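(* Let $n\ge 3$ and $\mathfrak g=B_n$. For every dominant integral weight $\lambda$ of $\mathfrak g$, the assignment $Y\mapsto T_Y$ defines a map $\varphi: Y(\lambda)\to T(\lambda)$ which is an isomorphism of $U_q(B_n)$-crystals. That is, $\varphi$ is a bijection from the set $Y(\lambda)$ of Young walls onto the set $T(\lambda)$ of reverse-shape tableaux, which (with the convention $\varphi(0)=0$) commutes with the Kashiwara operators $\tilde e_i,\tilde f_i$ $(i=1,\dots,n)$ and preserves $\mathrm{wt}$, $\varepsilon_i$ and $\varphi_i$.
   Context: **Weights.** Let $\epsilon_1,\dots,\epsilon_n$ be the standard orthonormal basis of $\mathfrak h^*$ for $B_n$, and let $\lambda_1,\dots,\lambda_n$ be the fundamental weights. Put $\omega_i=\lambda_i$ for $i<n$ and $\omega_n=2\lambda_n$, so $\omega_i=\epsilon_1+\dots+\epsilon_i$ and $\lambda_n=\frac12(\epsilon_1+\dots+\epsilon_n)$. Every dominant integral $\lambda$ is uniquely $\lambda=\omega_{i_1}+\dots+\omega_{i_t}+b\lambda_n$ with $1\le i_1\le\dots\le i_t\le n$ and $b\in\{0,1\}$. Put $N=i_1+\dots+i_t$. **Tensor product rule (signature rule).** In a tensor product $b_1\otimes\dots\otimes b_N$ of crystal elements, write for each $b_j$ (in order) $\varepsilon_i(b_j)$ signs $-$ followed by $\varphi_i(b_j)$ signs $+$. Cancel successively all pairs $(+,-)$ to get $(-,\dots,-,+,\dots,+)$, the $i$-signature. $\tilde e_i$ acts on the factor of the right-most remaining $-$, and $\tilde f_i$ on the factor of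 the left-most remaining $+$; the result is $0$ if there is no such sign. $\varepsilon_i$ and $\varphi_i$ are the numbers of remaining $-$ and $+$. **Vector and spin crystals.** $\mathbf B$ is the crystal $1\xrightarrow{1}2\xrightarrow{2}\cdots\xrightarrow{n-1}n\xrightarrow{n}0\xrightarrow{n}\overline n\xrightarrow{n-1}\cdots\xrightarrow{2}\overline 2\xrightarrow{1}\overline1$, with $\mathrm{wt}(j)=\epsilon_j$, $\mathrm{wt}(\overline j)=-\epsilon_j$, $\mathrm{wt}(0)=0$. $B_{sp}$ is the set of half-columns of length $n$: strictly increasing (downwards) columns with entries in $\{1,\dots,n,\overline n,\dots,\overline1\}$ containing exactly one of $j,\overline j$ for each $j$. The weight of a half-column is half the sum of the weights of its entries. For $i<n$, $\tilde f_i$ replaces the pair of entries $i,\overline{i+1}$ by $i+1,\overline i$ if both are present, and is $0$ otherwise; $\tilde f_n$ replaces $n$ by $\overline n$ if $n$ is present, and is $0$ otherwise; $\tilde e_i$ is the inverse partial map. **Tableaux $T(\lambda)$.** Order: $1\prec2\prec\dots\prec n\prec0\prec\overline n\prec\dots\prec\overline1$. The shape has, from left to right, columns of lengths $i_1\le\dots\le i_t$ and, if $b=1$, one further half-column of length $n$ at the right end; all columns are bottom-justified. Rows are numbered from bottom to top. (If row $j$ from the bottom has length $l_j$, a half-column box counting $\frac12$, then $\lambda=\sum_j l_j\epsilon_j$.) $T(\lambda)$ is the set of fillings with entries in $\{i,\overline i: 1\le i\le n\}\cup\{0\}$ such that: 1. entries weakly increase along rows from left to right, but $0$ occurs at most once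 in a row; 2. entries strictly increase down columns, except that $0$ may be repeated in a column; 3. the half-column (if any) is an element of $B_{sp}$; in particular $i$ and $\overline i$ do not both appear in it; 4. (1CC) if a column of length $M$ has $a$ in row $p$ and $\overline a$ in row $q$, with $p>q$ and $1\le a\le n$, then $p-q-1\ge M-a$; 5. for adjacent columns $C$ (left) and $C'$ (right), where $C'$ may be the half-column, the following two conditions hold. - (2CC-1) If $a$ $(1\le a\le n)$ is in row $p$ of $C$ and $\overline a$ is in row $q$ of $C'$ with $p>q$, then $p-q\le n-a$. - (2CC-2) If $a$ is in row $p$ of $C$ and $\overline a$ is in row $q$ of $C'$ with $p>q$, and if $b$ and $\overline b$ both lie in $C$, or both lie in $C'$, in rows $r$ and $s$ respectively with $p\ge r>s\ge q$, then $(p-r)+(s-q)<b-a$. A tableau $T$ is identified with an element of $\mathbf B^{\otimes N}$ (if $b=0$) or $B_{sp}\otimes\mathbf B^{\otimes N}$ (if $b=1$) by reading columns from right to left, each from top to bottom; the half-column is the first factor. The crystal structure of $T(\lambda)$ is that induced from the tensor product. **Young walls of type $B_n^{(1)}$.** Columns are numbered $1,2,3,\dots$ from right to left. Each column is a stack of colored blocks. Going upwards the layers repeat with period $$(0|1),\ 2,\ 3,\dots,n-1,\ n,\ n,\ n-1,\dots,3,\ 2 .$$ The blocks $2,\dots,n-1$ have unit height and unit thickness. The two successive $n$-blocks have half-unit height and unit thickness. A $(0|1)$ layer has unit height and consists of one $0$-block and one $1$-block, each of half-unit thickness, one in the front half and one in the back half. In every $(0|1)$ layer of a given column the front color is the same,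 and the front color alternates between $0$ and $1$ in consecutive columns. A layer can be started only when the layer below is complete; the two blocks of a $(0|1)$ layer may be added in either order. Ground-state walls: - If $b=1$: $Y_{\Lambda_n}$, in which every column consists of a single $n$-block of half-unit height. The layers above it are $n,n-1,\dots,2,(0|1),2,\dots$. - If $b=0$: $Y_{\Lambda_0}$ if $N$ is even, $Y_{\Lambda_1}$ if $N$ is odd, in which every column consists of the front block of one $(0|1)$ layer at the bottom. This front block has color $0$ in column $N$ and colors alternate. (Thus the vacant slot of the bottom layer of column 1 has color $0$ for $Y_{\Lambda_0}$ and $1$ for $Y_{\Lambda_1}$.) For $N=0$ use $Y_{\Lambda_0}$. A Young wall is obtained by adding finitely many blocks to the ground-state wall so that there is no free space immediately to the right of any block, except in the right-most column (separately for front and back halves). A column is full if its height is an integer multiple of the unit length and its top is of unit thickness. A wall is proper if no two full columns have the same height. It is reduced if there is no column that can be lowered by one complete period (removing one $0$-block, one $1$-block, and two blocks of each color $2,\dots,n$ from its top part, and not removing ground-state blocks) so that the result is still a proper Young wall. **Kashiwara operators on proper walls.** A block of color $i$ at the top of a column is a removable $i$-block if its removal leaves a proper wall. A place on top of a column is an $i$-admissible slot if adding an $i$-block there gives a proper wall. To each column assign: - $--$ if it is twice $i$-removable; - $-$ if it is once $i$-removable and not $i$-admissible; - $-+$ if it is once $i$-removable and once $i$-admissible; - $+$ if it is once $i$-admissible and not $i$-removable; - $++$ if it is twice $i$-admissible; - nothing otherwise. Read the columns from left to right and cancel all $(+,-)$ pairs. $\tilde e_i$ removes the $i$-block of the right-most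 remaining $-$, and $\tilde f_i$ adds an $i$-block at the left-most remaining $+$ (the result is $0$ if there is none). $\varepsilon_i,\varphi_i$ are the numbers of remaining $-$, $+$. Here $\mathrm{wt}(Y)=\Lambda-\sum_i k_i\alpha_i$, where $\Lambda$ is the weight of the ground-state wall and $k_i$ is the number of added $i$-blocks, viewed as a weight of $B_n$ through its values on $h_1,\dots,h_n$. **Entry of a column.** To a column with given top assign a letter as follows. - The top layer is $(0|1)$ with only its $0$-block: letter $1$; with only its $1$-block: letter $\overline1$; with both: letter $2$. - The top block has color $j-1$ ($3\le j\le n$) and lies between a $(0|1)$ layer below and the next $n,n$ pair above: letter $j$. - The top block is the lower $n$-block of a pair: letter $0$; it is the upper $n$-block of a pair: letter $\overline n$. - The top block has color $j$ ($2\le j\le n-1$) and lies between an $n,n$ pair below and the next $(0|1)$ layer above: letter $\overline j$. **The set $Y(\lambda)$.** Number the periods so that period $1$ begins with the lowest $(0|1)$ layer, period $2$ with the next $(0|1)$ layer, and so on. The highest weight wall $H_\lambda$ is the wall in which, for $1\le k\le t$ and $1\le a\le i_k$, column number $i_1+\dots+i_{k-1}+a$ has letter $i_k+1-a$ with its top in period $t-k+1$, and all columns with number $>N$ are as in the ground-state wall. $Y(\lambda)$ is the connected component containing $H_\lambda$ of the crystal of reduced proper Young walls with respect to $\tilde e_i,\tilde f_i$, $i=1,\dots,n$ (the $0$-arrows being deleted). Its crystal structure is the restricted one. **The tableau $T_Y$.** Let $Y\in Y(\lambda)$. For $1\le k\le t$ and $1\le a\le i_k$, the box of $T_Y$ in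 the $k$-th column from the left and $a$-th row from the bottom contains the letter of column number $i_1+\dots+i_{k-1}+a$ of $Y$. If $b=1$, consider columns $N+1,\dots,N+n$ of $Y$: each of these having added blocks above the ground-state wall contributes its letter, which lies in $\{\overline n,\dots,\overline1\}$. If these letters are $\overline{j_1},\dots,\overline{j_m}$, the right-most half-column of $T_Y$ consists of $\overline{j_1},\dots,\overline{j_m}$ and the elements of $\{1,\dots,n\}\setminus\{j_1,\dots,j_m\}$, arranged strictly increasing downwards. *)

theory Defs
  imports Complex_Main "HOL-Library.Multiset"
begin

section \<open>Crystals of type \<open>B\<^sub>n\<close>\<close>

text \<open>
  A weight of \<open>B\<^sub>n\<close> is given either by its coordinates with respect to \<open>\<epsilon>\<^sub>1, \<dots>, \<epsilon>\<^sub>n\<close> or by its values on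
  \<open>h\<^sub>1, \<dots>, h\<^sub>n\<close>; \<open>coroot_value\<close> passes from the former to the latter. Only indices in \<open>{1..n}\<close>
  are ever relevant. The element \<open>0\<close> of a crystal is rendered as \<^const>\<open>None\<close>.
\<close>

definition coroot_value :: "nat \<Rightarrow> (nat \<Rightarrow> rat) \<Rightarrow> nat \<Rightarrow> rat" where
  "coroot_value n x j = (if j < n then x j - x (j + 1) else 2 * x n)"

record 'a crystal =
  elems :: "'a set"
  weight :: "'a \<Rightarrow> nat \<Rightarrow> rat"  \<comment> \<open>\<open>weight B x j = \<langle>h\<^sub>j, wt x\<rangle>\<close>\<close>
  op_e :: "nat \<Rightarrow> 'a \<Rightarrow> 'a option"
  op_f :: "nat \<Rightarrow> 'a \<Rightarrow> 'a option"
  eps :: "nat \<Rightarrow> 'a \<Rightarrow> nat"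
  phi :: "nat \<Rightarrow> 'a \<Rightarrow> nat"

text \<open>The Kashiwara operators are maps from the crystal into the crystal together with \<open>0\<close>.\<close>

definition closed_under_ops :: "nat \<Rightarrow> 'a crystal \<Rightarrow> bool" where
  "closed_under_ops n B \<longleftrightarrow>
     (\<forall>i\<in>{1..n}. \<forall>x\<in>elems B. set_option (op_e B i x) \<subseteq> elems B \<and> set_option (op_f B i x) \<subseteq> elems B)"

definition crystal_iso :: "nat \<Rightarrow> 'a crystal \<Rightarrow> 'b crystal \<Rightarrow> ('a \<Rightarrow> 'b) \<Rightarrow> bool" where
  "crystal_iso n B B' \<psi> \<longleftrightarrow>
     closed_under_ops n B \<and> closed_under_ops n B' \<and>
     bij_betw \<psi> (elems B) (elems B') \<and>
     (\<forall>x\<in>elems B. \<forall>i\<in>{1..n}.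
        op_e B' i (\<psi> x) = map_option \<psi> (op_e B i x) \<and>
        op_f B' i (\<psi> x) = map_option \<psi> (op_f B i x) \<and>
        weight B' (\<psi> x) i = weight B x i \<and>
        eps B' i (\<psi> x) = eps B i x \<and>
        phi B' i (\<psi> x) = phi B i x)"


section \<open>Dominant integral weights\<close>

definition dominant_integral :: "nat \<Rightarrow> (nat \<Rightarrow> rat) \<Rightarrow> bool" where
  "dominant_integral n lam \<longleftrightarrow> (\<forall>j\<in>{1..n}. coroot_value n lam j \<in> \<nat>)"

definition omega :: "nat \<Rightarrow> nat \<Rightarrow> rat" where
  "omega i m = (if 1 \<le> m \<and> m \<le> i then 1 else 0)"

definition spin_weight :: "nat \<Rightarrow> nat \<Rightarrow> rat" where
  "spin_weight n m = (if 1 \<le> m \<and> m \<le> n then 1/2 else 0)"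

text \<open>\<open>lam = \<omega>\<^bsub>i\<^sub>1\<^esub> + \<dots> + \<omega>\<^bsub>i\<^sub>t\<^esub> + b \<lambda>\<^sub>n\<close> with \<open>cs = [i\<^sub>1, \<dots>, i\<^sub>t]\<close>.\<close>

definition decomposes :: "nat \<Rightarrow> (nat \<Rightarrow> rat) \<Rightarrow> nat list \<Rightarrow> bool \<Rightarrow> bool" where
  "decomposes n lam cs b \<longleftrightarrow> sorted cs \<and> set cs \<subseteq> {1..n} \<and>
     (\<forall>m\<in>{1..n}. lam m = (\<Sum>i\<leftarrow>cs. omega i m) + (if b then spin_weight n m else 0))"

lemma coroot_value_eqD:
  assumes "\<And>j. j \<in> {1..n} \<Longrightarrow> coroot_value n x j = coroot_value n y j" "m \<in> {1..n}"
  shows "x m = y m"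
proof -
  have "1 \<le> m" "m \<le> n" using assms(2) by auto
  have "m \<ge> 1 \<longrightarrow> x m = y m" using \<open>m \<le> n\<close>
  proof (induction m rule: inc_induct)
    case base
    show ?case using assms(1)[of n] by (auto simp: coroot_value_def)
  next
    case (step k)
    then show ?case using assms(1)[of k] by (auto simp: coroot_value_def)
  qed
  with \<open>1 \<le> m\<close> show ?thesis by simp
qed

lemma coroot_value_sum:
  assumes "set cs \<subseteq> {1..n}" "j \<in> {1..n}"
  shows "coroot_value n (\<lambda>m. (\<Sum>i\<leftarrow>cs. omega i m) + (if b then spin_weight n m else 0)) j =
    of_nat (if j < n then count (mset cs) j else 2 * count (mset cs) n + (if b then 1 else 0))"
proof -
  have "(\<Sum>i\<leftarrow>cs. omega i j) =
    of_nat (count (mset cs) j) + (if j < n then \<Sum>i\<leftarrow>cs. omega i (j + 1) else 0)"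
    using assms by (induction cs) (auto simp: omega_def)
  with assms(2) show ?thesis
    by (auto simp: coroot_value_def spin_weight_def)
qed

lemma decomposes_iff:
  "decomposes n lam cs b \<longleftrightarrow> sorted cs \<and> set cs \<subseteq> {1..n} \<and> (\<forall>j\<in>{1..n}. coroot_value n lam j =
    of_nat (if j < n then count (mset cs) j else 2 * count (mset cs) n + (if b then 1 else 0)))"
proof -
  let ?y = "\<lambda>m. (\<Sum>i\<leftarrow>cs. omega i m) + (if b then spin_weight n m else 0)"
  have "(\<forall>m\<in>{1..n}. lam m = ?y m) \<longleftrightarrow> (\<forall>j\<in>{1..n}. coroot_value n lam j = coroot_value n ?y j)"
  proof
    assume a: "\<forall>m\<in>{1..n}. lam m = ?y m"
    show "\<forall>j\<in>{1..n}. coroot_value n lam j = coroot_value n ?y j"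
    proof
      fix j assume "j \<in> {1..n}"
      then have "lam j = ?y j" "j < n \<Longrightarrow> lam (j + 1) = ?y (j + 1)" "lam n = ?y n"
        using a by auto
      then show "coroot_value n lam j = coroot_value n ?y j"
        unfolding coroot_value_def by presburger
    qed
  next
    assume "\<forall>j\<in>{1..n}. coroot_value n lam j = coroot_value n ?y j"
    then show "\<forall>m\<in>{1..n}. lam m = ?y m" using coroot_value_eqD[of n lam ?y] by blast
  qed
  then show ?thesis
    unfolding decomposes_def using coroot_value_sum[of cs n _ b] by auto
qed

lemma decomposition_ex1:
  assumes "n \<ge> 1" "dominant_integral n lam"
  shows "\<exists>!d. decomposes n lam (fst d) (snd d)"
proof (rule ex_ex1I)
  obtain k where k: "\<And>j. j \<in> {1..n} \<Longrightarrow> coroot_value n lam j = of_nat (k j)"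
    using assms(2) unfolding dominant_integral_def Nats_def image_iff by metis
  define M where "M = (\<Sum>i\<in>{1..n}. replicate_mset (if i < n then k i else k n div 2) i)"
  have M: "count M j = (if j \<in> {1..n} then (if j < n then k j else k n div 2) else 0)" for j
    unfolding M_def by (simp add: count_sum)
  have sM: "set_mset M \<subseteq> {1..n}"
    using M by (metis count_eq_zero_iff subsetI)
  have "decomposes n lam (sorted_list_of_multiset M) (odd (k n))"
    unfolding decomposes_iff using k sM assms(1) by (auto simp: M elim: oddE)
  then show "\<exists>d. decomposes n lam (fst d) (snd d)" by fastforce
next
  fix d e
  assume d: "decomposes n lam (fst d) (snd d)" and e: "decomposes n lam (fst e) (snd e)"
  obtain cs b where [simp]: "d = (cs, b)" by fastforce
  obtain cs' b' where [simp]: "e = (cs', b')" by fastforce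
  have eq: "(if j < n then count (mset cs) j else 2 * count (mset cs) n + (if b then 1 else 0)) =
    (if j < n then count (mset cs') j else 2 * count (mset cs') n + (if b' then 1 else 0))"
    if "j \<in> {1..n}" for j
  proof -
    have "(of_nat (if j < n then count (mset cs) j else 2 * count (mset cs) n + (if b then 1 else 0)) :: rat) =
      of_nat (if j < n then count (mset cs') j else 2 * count (mset cs') n + (if b' then 1 else 0))"
      using d e that unfolding decomposes_iff fst_conv snd_conv \<open>d = _\<close> \<open>e = _\<close> by metis
    then show ?thesis by (simp only: of_nat_eq_iff)
  qed
  have n: "2 * count (mset cs) n + (if b then 1 else 0) = 2 * count (mset cs') n + (if b' then 1 else 0)"
    using eq[of n] assms(1) by simp
  then have b: "b = b'" "count (mset cs) n = count (mset cs') n"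
    by (auto split: if_splits; presburger)+
  have "count (mset cs) j = count (mset cs') j" for j
  proof (cases "j \<in> {1..n}")
    case True
    then show ?thesis using eq[of j] b by (cases "j < n") auto
  next
    case False
    then have "j \<notin> set cs" "j \<notin> set cs'" using d e by (auto simp: decomposes_def)
    then show ?thesis by (simp add: count_mset count_list_0_iff)
  qed
  then have "mset cs = mset cs'" by (rule multiset_eqI)
  moreover have "sorted cs" "sorted cs'" using d e by (simp_all add: decomposes_def)
  ultimately have "cs = cs'" by (metis properties_for_sort)
  with b show "d = e" by simp
qed

text \<open>The pair \<open>([i\<^sub>1, \<dots>, i\<^sub>t], b)\<close> attached to \<open>lam\<close>.\<close>

definition decomposition :: "nat \<Rightarrow> (nat \<Rightarrow> rat) \<Rightarrow> nat list \<times> bool" where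
  "decomposition n lam = (THE d. decomposes n lam (fst d) (snd d))"


section \<open>The signature rule\<close>

datatype sign = Minus | Plus

text \<open>
  Signs carry the place (tensor factor or column of a wall) they come from. The recursion cancels
  all pairs \<open>(Plus, Minus)\<close> starting from the right, so that \<open>cancel ss\<close> always has the form
  \<open>(Minus, \<dots>, Minus, Plus, \<dots>, Plus)\<close>.
\<close>

primrec cancel :: "(sign \<times> 'a) list \<Rightarrow> (sign \<times> 'a) list" where
  "cancel [] = []"
| "cancel (s # ss) =
     (case cancel ss of
        [] \<Rightarrow> [s]
      | s' # ss' \<Rightarrow> if fst s = Plus \<and> fst s' = Minus then ss' else s # s' # ss')"

definition remaining :: "sign \<Rightarrow> (sign \<times> 'a) list \<Rightarrow> 'a list" where
  "remaining s ss = map snd (filter (\<lambda>x. fst x = s) (cancel ss))"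


section \<open>Vector and spin crystals and their tensor products\<close>

text \<open>\<open>Pos j\<close> is the letter \<open>j\<close>, \<open>Neg j\<close> is the letter \<open>j\<close> with a bar.\<close>

datatype letter = Pos nat | Zero | Neg nat

instantiation letter :: linorder
begin

fun less_letter :: "letter \<Rightarrow> letter \<Rightarrow> bool" where
  "less_letter (Pos i) (Pos j) = (i < j)"
| "less_letter (Pos i) _ = True"
| "less_letter Zero (Neg j) = True"
| "less_letter (Neg i) (Neg j) = (j < i)"
| "less_letter _ _ = False"

definition less_eq_letter :: "letter \<Rightarrow> letter \<Rightarrow> bool" where
  "less_eq_letter x y \<longleftrightarrow> x = y \<or> x < y"

instance
proof
  fix x y z :: letter
  show "x < y \<longleftrightarrow> x \<le> y \<and> \<not> y \<le> x"
    by (cases x; cases y) (auto simp: less_eq_letter_def)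
  show "x \<le> x" by (simp add: less_eq_letter_def)
  show "x \<le> y \<Longrightarrow> y \<le> z \<Longrightarrow> x \<le> z"
    by (cases x; cases y; cases z) (auto simp: less_eq_letter_def)
  show "x \<le> y \<Longrightarrow> y \<le> x \<Longrightarrow> x = y"
    by (cases x; cases y) (auto simp: less_eq_letter_def)
  show "x \<le> y \<or> y \<le> x"
    by (cases x; cases y) (auto simp: less_eq_letter_def)
qed

end

definition letters :: "nat \<Rightarrow> letter set" where
  "letters n = Pos ` {1..n} \<union> {Zero} \<union> Neg ` {1..n}"

definition vec_f :: "nat \<Rightarrow> nat \<Rightarrow> letter \<Rightarrow> letter option" where
  "vec_f n i x =
     (if i < n then
        (if x = Pos i then Some (Pos (i + 1)) else if x = Neg (i + 1) then Some (Neg i) else None)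
      else
        (if x = Pos n then Some Zero else if x = Zero then Some (Neg n) else None))"

definition vec_e :: "nat \<Rightarrow> nat \<Rightarrow> letter \<Rightarrow> letter option" where
  "vec_e n i x =
     (if i < n then
        (if x = Pos (i + 1) then Some (Pos i) else if x = Neg i then Some (Neg (i + 1)) else None)
      else
        (if x = Zero then Some (Pos n) else if x = Neg n then Some Zero else None))"

text \<open>
  All columns, here and in tableaux below, are listed from bottom to top, so that row \<open>p\<close> of a
  column \<open>C\<close> is \<open>C ! (p - 1)\<close>; strictly increasing downwards thus means strictly decreasing as a list.
\<close>

definition half_columns :: "nat \<Rightarrow> letter list set" where
  "half_columns n = {c. length c = n \<and> set c \<subseteq> letters n - {Zero} \<and> sorted_wrt (>) c \<and>
     (\<forall>j\<in>{1..n}. (Pos j \<in> set c) \<noteq> (Neg j \<in> set c))}"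

text \<open>Replacing the entries in place keeps a half-column strictly increasing.\<close>

definition spin_f :: "nat \<Rightarrow> nat \<Rightarrow> letter list \<Rightarrow> letter list option" where
  "spin_f n i c =
     (if i < n then
        (if Pos i \<in> set c \<and> Neg (i + 1) \<in> set c
         then Some (map (id(Pos i := Pos (i + 1), Neg (i + 1) := Neg i)) c) else None)
      else
        (if Pos n \<in> set c then Some (map (id(Pos n := Neg n)) c) else None))"

definition spin_e :: "nat \<Rightarrow> nat \<Rightarrow> letter list \<Rightarrow> letter list option" where
  "spin_e n i c =
     (if i < n then
        (if Pos (i + 1) \<in> set c \<and> Neg i \<in> set c
         then Some (map (id(Pos (i + 1) := Pos i, Neg i := Neg (i + 1))) c) else None)
      else
        (if Neg n \<in> set c then Some (map (id(Neg n := Pos n)) c) else None))"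

datatype factor = Vec letter | Spin "letter list"

primrec factor_f :: "nat \<Rightarrow> nat \<Rightarrow> factor \<Rightarrow> factor option" where
  "factor_f n i (Vec x) = map_option Vec (vec_f n i x)"
| "factor_f n i (Spin c) = map_option Spin (spin_f n i c)"

primrec factor_e :: "nat \<Rightarrow> nat \<Rightarrow> factor \<Rightarrow> factor option" where
  "factor_e n i (Vec x) = map_option Vec (vec_e n i x)"
| "factor_e n i (Spin c) = map_option Spin (spin_e n i c)"

text \<open>The largest \<open>k\<close> such that the \<open>k\<close>-th iterate of the partial map \<open>g\<close> at \<open>x\<close> is not \<open>0\<close>.\<close>

definition string_length :: "('a \<Rightarrow> 'a option) \<Rightarrow> 'a \<Rightarrow> nat" where
  "string_length g x = (GREATEST k. ((\<lambda>y. Option.bind y g) ^^ k) (Some x) \<noteq> None)"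

definition word_signs :: "nat \<Rightarrow> nat \<Rightarrow> factor list \<Rightarrow> (sign \<times> nat) list" where
  "word_signs n i w = concat (map
     (\<lambda>p. replicate (string_length (factor_e n i) (w ! p)) (Minus, p) @
          replicate (string_length (factor_f n i) (w ! p)) (Plus, p)) [0..<length w])"

definition word_e :: "nat \<Rightarrow> nat \<Rightarrow> factor list \<Rightarrow> factor list option" where
  "word_e n i w =
     (let ps = remaining Minus (word_signs n i w)
      in if ps = [] then None else Some (w[last ps := the (factor_e n i (w ! last ps))]))"

definition word_f :: "nat \<Rightarrow> nat \<Rightarrow> factor list \<Rightarrow> factor list option" where
  "word_f n i w =
     (let ps = remaining Plus (word_signs n i w)
      in if ps = [] then None else Some (w[hd ps := the (factor_f n i (w ! hd ps))]))"

primrec letter_weight :: "letter \<Rightarrow> nat \<Rightarrow> rat" where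
  "letter_weight (Pos j) m = (if m = j then 1 else 0)"
| "letter_weight Zero m = 0"
| "letter_weight (Neg j) m = (if m = j then -1 else 0)"

primrec factor_weight :: "factor \<Rightarrow> nat \<Rightarrow> rat" where
  "factor_weight (Vec x) m = letter_weight x m"
| "factor_weight (Spin c) m = (\<Sum>x\<leftarrow>c. letter_weight x m) / 2"


section \<open>Reverse-shape tableaux\<close>

text \<open>
  A tableau is the list of its columns, from left to right; if \<open>b\<close> holds, its last column is the
  half-column.
\<close>

definition shape :: "nat \<Rightarrow> nat list \<Rightarrow> bool \<Rightarrow> nat list" where
  "shape n cs b = cs @ (if b then [n] else [])"

definition fillings :: "nat \<Rightarrow> nat list \<Rightarrow> bool \<Rightarrow> letter list list set" where
  "fillings n cs b = {T. map length T = shape n cs b \<and> (\<forall>C\<in>set T. set C \<subseteq> letters n)}"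

definition in_row :: "letter list \<Rightarrow> nat \<Rightarrow> letter \<Rightarrow> bool" where
  "in_row C p x \<longleftrightarrow> 1 \<le> p \<and> p \<le> length C \<and> C ! (p - 1) = x"

definition rows_ok :: "letter list list \<Rightarrow> bool" where
  "rows_ok T \<longleftrightarrow> (\<forall>k l p x y. k < l \<longrightarrow> l < length T \<longrightarrow> in_row (T ! k) p x \<longrightarrow> in_row (T ! l) p y \<longrightarrow>
     x \<le> y \<and> \<not> (x = Zero \<and> y = Zero))"

definition column_ok :: "letter list \<Rightarrow> bool" where
  "column_ok C \<longleftrightarrow> sorted_wrt (\<lambda>x y. x > y \<or> (x = Zero \<and> y = Zero)) C"

definition cc1 :: "letter list \<Rightarrow> bool" where
  "cc1 C \<longleftrightarrow> (\<forall>a p q. in_row C p (Pos a) \<longrightarrow> in_row C q (Neg a) \<longrightarrow> p > q \<longrightarrow>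
     int p - int q - 1 \<ge> int (length C) - int a)"

definition cc2_1 :: "nat \<Rightarrow> letter list \<Rightarrow> letter list \<Rightarrow> bool" where
  "cc2_1 n C C' \<longleftrightarrow> (\<forall>a p q. in_row C p (Pos a) \<longrightarrow> in_row C' q (Neg a) \<longrightarrow> p > q \<longrightarrow>
     int p - int q \<le> int n - int a)"

definition cc2_2 :: "letter list \<Rightarrow> letter list \<Rightarrow> bool" where
  "cc2_2 C C' \<longleftrightarrow> (\<forall>a p q d r s. in_row C p (Pos a) \<longrightarrow> in_row C' q (Neg a) \<longrightarrow> p > q \<longrightarrow>
     (in_row C r (Pos d) \<and> in_row C s (Neg d)) \<or> (in_row C' r (Pos d) \<and> in_row C' s (Neg d)) \<longrightarrow>
     p \<ge> r \<longrightarrow> r > s \<longrightarrow> s \<ge> q \<longrightarrow>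
     (int p - int r) + (int s - int q) < int d - int a)"

definition tableaux :: "nat \<Rightarrow> nat list \<Rightarrow> bool \<Rightarrow> letter list list set" where
  "tableaux n cs b = {T \<in> fillings n cs b.
     rows_ok T \<and> (\<forall>C\<in>set T. column_ok C) \<and> (b \<longrightarrow> last T \<in> half_columns n) \<and>
     (\<forall>C\<in>set T. cc1 C) \<and>
     (\<forall>k. k + 1 < length T \<longrightarrow> cc2_1 n (T ! k) (T ! (k + 1)) \<and> cc2_2 (T ! k) (T ! (k + 1)))}"

definition reading :: "bool \<Rightarrow> letter list list \<Rightarrow> factor list" where
  "reading b T =
     (if b then [Spin (last T)] else []) @
     map Vec (concat (map rev (rev (if b then butlast T else T))))"

definition unreading :: "nat \<Rightarrow> nat list \<Rightarrow> bool \<Rightarrow> factor list \<Rightarrow> letter list list" where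
  "unreading n cs b = inv_into (fillings n cs b) (reading b)"

definition tableau_crystal :: "nat \<Rightarrow> (nat \<Rightarrow> rat) \<Rightarrow> letter list list crystal" where
  "tableau_crystal n lam = (let (cs, b) = decomposition n lam in
     \<lparr> elems = tableaux n cs b,
       weight = (\<lambda>T. coroot_value n (\<lambda>m. \<Sum>x\<leftarrow>reading b T. factor_weight x m)),
       op_e = (\<lambda>i T. map_option (unreading n cs b) (word_e n i (reading b T))),
       op_f = (\<lambda>i T. map_option (unreading n cs b) (word_f n i (reading b T))),
       eps = (\<lambda>i T. length (remaining Minus (word_signs n i (reading b T)))),
       phi = (\<lambda>i T. length (remaining Plus (word_signs n i (reading b T)))) \<rparr>)"


section \<open>Young walls of type \<open>B\<^sub>n\<^sup>(\<^sup>1\<^sup>)\<close>\<close>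

text \<open>
  A block is a pair (layer, colour), and a wall assigns to each column \<open>j \<ge> 1\<close> (numbered from right to
  left) its set of blocks; column \<open>0\<close> is a dummy and empty. Layers are numbered in such a way that
  those with numbers \<open>m (2n - 1), \<dots>, (m + 1) (2n - 1) - 1\<close> form the \<open>m\<close>-th period, whose lowest
  layer is \<open>(0|1)\<close>. The bottom layer of every column is the \<open>(0|1)\<close> layer of period \<open>1\<close> if \<open>b\<close> is
  false, and the lower \<open>n\<close>-layer just before period \<open>1\<close> (i.e. of ``period \<open>0\<close>'') if \<open>b\<close> is true.
\<close>

type_synonym block = "nat \<times> nat"
type_synonym wall = "nat \<Rightarrow> block set"

definition layer_colours :: "nat \<Rightarrow> nat \<Rightarrow> nat set" where
  "layer_colours n L =
     (let r = L mod (2 * n - 1)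
      in if r = 0 then {0, 1} else if r < n then {r + 1} else {2 * n - r})"

definition bottom_layer :: "nat \<Rightarrow> bool \<Rightarrow> nat" where
  "bottom_layer n b = (if b then n - 1 else 2 * n - 1)"

text \<open>
  The front colour is \<open>0\<close> in column \<open>N\<close> and alternates. For \<open>b\<close> true the choice is immaterial:
  interchanging front and back in all columns yields the same walls.
\<close>

definition front_colour :: "nat \<Rightarrow> nat \<Rightarrow> nat" where
  "front_colour N j = (N + j) mod 2"

definition ground :: "nat \<Rightarrow> bool \<Rightarrow> nat \<Rightarrow> wall" where
  "ground n b N j =
     (if j = 0 then {} else if b then {(bottom_layer n b, n)}
      else {(bottom_layer n b, front_colour N j)})"

definition is_column :: "nat \<Rightarrow> bool \<Rightarrow> block set \<Rightarrow> bool" where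
  "is_column n b C \<longleftrightarrow> (\<forall>(L, c)\<in>C. bottom_layer n b \<le> L \<and> c \<in> layer_colours n L \<and>
     (bottom_layer n b < L \<longrightarrow> (\<forall>c'\<in>layer_colours n (L - 1). (L - 1, c') \<in> C)))"

text \<open>The blocks of colour \<open>0\<close> or \<open>1\<close> only occupy the front or the back half of their layer.\<close>

definition right_supported :: "nat \<Rightarrow> wall \<Rightarrow> bool" where
  "right_supported N Y \<longleftrightarrow> (\<forall>j\<ge>1. \<forall>(L, c)\<in>Y (j + 1).
     (if c \<ge> 2 then (L, c) \<in> Y j
      else \<exists>c'\<in>{0, 1}. (L, c') \<in> Y j \<and> (c' = front_colour N j \<longleftrightarrow> c = front_colour N (j + 1))))"

definition young_wall :: "nat \<Rightarrow> bool \<Rightarrow> nat \<Rightarrow> wall \<Rightarrow> bool" where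
  "young_wall n b N Y \<longleftrightarrow> Y 0 = {} \<and>
     (\<forall>j\<ge>1. ground n b N j \<subseteq> Y j \<and> is_column n b (Y j)) \<and>
     finite {(j, x). x \<in> Y j - ground n b N j} \<and>
     right_supported N Y"

definition top_layer :: "block set \<Rightarrow> nat" where
  "top_layer C = Max (fst ` C)"

definition top_complete :: "nat \<Rightarrow> block set \<Rightarrow> bool" where
  "top_complete n C \<longleftrightarrow> (\<forall>c\<in>layer_colours n (top_layer C). (top_layer C, c) \<in> C)"

definition column_height :: "nat \<Rightarrow> block set \<Rightarrow> rat" where
  "column_height n C = (\<Sum>L\<in>fst ` C. if n \<in> layer_colours n L then 1/2 else 1)"

definition full :: "nat \<Rightarrow> block set \<Rightarrow> bool" where
  "full n C \<longleftrightarrow> column_height n C \<in> \<int> \<and> top_complete n C"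

definition proper_wall :: "nat \<Rightarrow> bool \<Rightarrow> nat \<Rightarrow> wall \<Rightarrow> bool" where
  "proper_wall n b N Y \<longleftrightarrow> young_wall n b N Y \<and>
     (\<forall>j\<ge>1. \<forall>k\<ge>1. j \<noteq> k \<longrightarrow> full n (Y j) \<longrightarrow> full n (Y k) \<longrightarrow> column_height n (Y j) \<noteq> column_height n (Y k))"

text \<open>
  \<open>C\<close> below is column \<open>j\<close> lowered by one period. That the removed blocks come from the top of the column and
  do not belong to the ground-state wall is implied by the requirement that the result is a wall.
\<close>

definition reduced_wall :: "nat \<Rightarrow> bool \<Rightarrow> nat \<Rightarrow> wall \<Rightarrow> bool" where
  "reduced_wall n b N Y \<longleftrightarrow> proper_wall n b N Y \<and>
     \<not> (\<exists>j\<ge>1. \<exists>C\<subseteq>Y j. proper_wall n b N (Y(j := C)) \<and>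
         (\<forall>c\<in>{0, 1}. card {L. (L, c) \<in> Y j - C} = 1) \<and>
         (\<forall>c\<in>{2..n}. card {L. (L, c) \<in> Y j - C} = 2))"

definition remove_block :: "nat \<Rightarrow> nat \<Rightarrow> wall \<Rightarrow> wall" where
  "remove_block i j Y = Y(j := Y j - {(top_layer (Y j), i)})"

definition removable :: "nat \<Rightarrow> bool \<Rightarrow> nat \<Rightarrow> nat \<Rightarrow> nat \<Rightarrow> wall \<Rightarrow> bool" where
  "removable n b N i j Y \<longleftrightarrow>
     (top_layer (Y j), i) \<in> Y j \<and> proper_wall n b N (remove_block i j Y)"

definition slot_layer :: "nat \<Rightarrow> block set \<Rightarrow> nat" where
  "slot_layer n C = (if top_complete n C then top_layer C + 1 else top_layer C)"

definition add_block :: "nat \<Rightarrow> nat \<Rightarrow> nat \<Rightarrow> wall \<Rightarrow> wall" where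
  "add_block n i j Y = Y(j := insert (slot_layer n (Y j), i) (Y j))"

definition admissible :: "nat \<Rightarrow> bool \<Rightarrow> nat \<Rightarrow> nat \<Rightarrow> nat \<Rightarrow> wall \<Rightarrow> bool" where
  "admissible n b N i j Y \<longleftrightarrow>
     (slot_layer n (Y j), i) \<notin> Y j \<and> proper_wall n b N (add_block n i j Y)"

definition twice_removable :: "nat \<Rightarrow> bool \<Rightarrow> nat \<Rightarrow> nat \<Rightarrow> nat \<Rightarrow> wall \<Rightarrow> bool" where
  "twice_removable n b N i j Y \<longleftrightarrow>
     removable n b N i j Y \<and> removable n b N i j (remove_block i j Y)"

definition twice_admissible :: "nat \<Rightarrow> bool \<Rightarrow> nat \<Rightarrow> nat \<Rightarrow> nat \<Rightarrow> wall \<Rightarrow> bool" where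
  "twice_admissible n b N i j Y \<longleftrightarrow>
     admissible n b N i j Y \<and> admissible n b N i j (add_block n i j Y)"

definition column_signs :: "nat \<Rightarrow> bool \<Rightarrow> nat \<Rightarrow> nat \<Rightarrow> wall \<Rightarrow> nat \<Rightarrow> sign list" where
  "column_signs n b N i Y j =
     (if twice_removable n b N i j Y then [Minus, Minus]
      else if twice_admissible n b N i j Y then [Plus, Plus]
      else (if removable n b N i j Y then [Minus] else []) @
           (if admissible n b N i j Y then [Plus] else []))"

text \<open>For a Young wall only finitely many columns have a non-empty signature.\<close>

definition wall_signs :: "nat \<Rightarrow> bool \<Rightarrow> nat \<Rightarrow> nat \<Rightarrow> wall \<Rightarrow> (sign \<times> nat) list" where
  "wall_signs n b N i Y = concat (map (\<lambda>j. map (\<lambda>s. (s, j)) (column_signs n b N i Y j))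
     (rev (sorted_list_of_set {j. 1 \<le> j \<and> column_signs n b N i Y j \<noteq> []})))"

definition wall_e :: "nat \<Rightarrow> bool \<Rightarrow> nat \<Rightarrow> nat \<Rightarrow> wall \<Rightarrow> wall option" where
  "wall_e n b N i Y =
     (let js = remaining Minus (wall_signs n b N i Y)
      in if js = [] then None else Some (remove_block i (last js) Y))"

definition wall_f :: "nat \<Rightarrow> bool \<Rightarrow> nat \<Rightarrow> nat \<Rightarrow> wall \<Rightarrow> wall option" where
  "wall_f n b N i Y =
     (let js = remaining Plus (wall_signs n b N i Y)
      in if js = [] then None else Some (add_block n i (hd js) Y))"

text \<open>\<open>affine_cartan n j i = \<langle>h\<^sub>j, \<alpha>\<^sub>i\<rangle>\<close> for \<open>B\<^sub>n\<^sup>(\<^sup>1\<^sup>)\<close>, \<open>n \<ge> 3\<close>: the nodes \<open>0\<close> and \<open>1\<close> are both joined to \<open>2\<close>.\<close>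

definition affine_cartan :: "nat \<Rightarrow> nat \<Rightarrow> nat \<Rightarrow> int" where
  "affine_cartan n j i =
     (if i = j then 2
      else if {i, j} = {0, 1} then 0
      else if {i, j} = {0, 2} then -1
      else if i = 0 \<or> j = 0 then 0
      else if j = n \<and> i + 1 = n then -2
      else if i = j + 1 \<or> j = i + 1 then -1
      else 0)"

text \<open>The ground-state wall has weight \<open>\<Lambda>\<^sub>k\<close> with \<open>k = ground_index n b N\<close>.\<close>

definition ground_index :: "nat \<Rightarrow> bool \<Rightarrow> nat \<Rightarrow> nat" where
  "ground_index n b N = (if b then n else if even N then 0 else 1)"

definition wall_weight :: "nat \<Rightarrow> bool \<Rightarrow> nat \<Rightarrow> wall \<Rightarrow> nat \<Rightarrow> rat" where
  "wall_weight n b N Y j = (if j = ground_index n b N then 1 else 0) -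
     (\<Sum>i\<in>{0..n}. of_nat (card {(k, L). (L, i) \<in> Y k - ground n b N k}) * of_int (affine_cartan n j i))"

definition column_letter :: "nat \<Rightarrow> block set \<Rightarrow> letter" where
  "column_letter n C =
     (let L = top_layer C; r = L mod (2 * n - 1)
      in if r = 0 then (if (L, 0) \<in> C then if (L, 1) \<in> C then Pos 2 else Pos 1 else Neg 1)
         else if r < n - 1 then Pos (r + 2)
         else if r = n - 1 then Zero
         else Neg (2 * n - r))"

definition top_period :: "nat \<Rightarrow> block set \<Rightarrow> nat" where
  "top_period n C = top_layer C div (2 * n - 1)"

text \<open>
  With \<open>cs = [i\<^sub>1, \<dots>, i\<^sub>t]\<close> indexed from \<open>0\<close>, the number of column \<open>i\<^sub>1 + \<dots> + i\<^bsub>k-1\<^esub> + a\<close> is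
  \<open>column_number cs (k - 1) a\<close>, and the period \<open>t - k + 1\<close> is \<open>length cs - (k - 1)\<close>.
\<close>

definition column_number :: "nat list \<Rightarrow> nat \<Rightarrow> nat \<Rightarrow> nat" where
  "column_number cs k a = sum_list (take k cs) + a"

definition highest_weight_wall :: "nat \<Rightarrow> nat list \<Rightarrow> bool \<Rightarrow> wall" where
  "highest_weight_wall n cs b = (THE Y. young_wall n b (sum_list cs) Y \<and>
     (\<forall>k<length cs. \<forall>a\<in>{1..cs ! k}.
        column_letter n (Y (column_number cs k a)) = Pos (cs ! k + 1 - a) \<and>
        top_period n (Y (column_number cs k a)) = length cs - k) \<and>
     (\<forall>j>sum_list cs. Y j = ground n b (sum_list cs) j))"

definition wall_arrow :: "nat \<Rightarrow> bool \<Rightarrow> nat \<Rightarrow> (wall \<times> wall) set" where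
  "wall_arrow n b N = {(Y, Z). reduced_wall n b N Y \<and> reduced_wall n b N Z \<and>
     (\<exists>i\<in>{1..n}. wall_e n b N i Y = Some Z \<or> wall_f n b N i Y = Some Z)}"

definition walls :: "nat \<Rightarrow> nat list \<Rightarrow> bool \<Rightarrow> wall set" where
  "walls n cs b = {Y. (highest_weight_wall n cs b, Y) \<in>
     (wall_arrow n b (sum_list cs) \<union> (wall_arrow n b (sum_list cs))\<inverse>)\<^sup>*}"

definition wall_crystal :: "nat \<Rightarrow> (nat \<Rightarrow> rat) \<Rightarrow> wall crystal" where
  "wall_crystal n lam = (let (cs, b) = decomposition n lam; N = sum_list cs in
     \<lparr> elems = walls n cs b,
       weight = wall_weight n b N,
       op_e = wall_e n b N,
       op_f = wall_f n b N,
       eps = (\<lambda>i Y. length (remaining Minus (wall_signs n b N i Y))),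
       phi = (\<lambda>i Y. length (remaining Plus (wall_signs n b N i Y))) \<rparr>)"


section \<open>The tableau of a wall\<close>

text \<open>
  The half-column is formed as a list with multiplicities, so that coinciding or unexpected letters
  in columns \<open>N + 1, \<dots>, N + n\<close> would show up as a violation of \<open>half_columns\<close>.
\<close>

definition half_column_of :: "nat \<Rightarrow> bool \<Rightarrow> nat \<Rightarrow> wall \<Rightarrow> letter list" where
  "half_column_of n b N Y =
     (let xs = map (\<lambda>j. column_letter n (Y j)) (filter (\<lambda>j. Y j \<noteq> ground n b N j) [N + 1..<N + n + 1])
      in rev (sort (xs @ map Pos (filter (\<lambda>j. Neg j \<notin> set xs) [1..<n + 1]))))"

definition tableau_of_wall :: "nat \<Rightarrow> (nat \<Rightarrow> rat) \<Rightarrow> wall \<Rightarrow> letter list list" where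
  "tableau_of_wall n lam Y = (let (cs, b) = decomposition n lam in
     map (\<lambda>k. map (\<lambda>a. column_letter n (Y (column_number cs k a))) [1..<cs ! k + 1]) [0..<length cs] @
     (if b then [half_column_of n b (sum_list cs) Y] else []))"

end

theory Submission
  imports Defs
begin

text \<open>
  As no \<open>0\<close>-blocks are added or removed, the top of each column runs through the letters \<open>1, \<dots>, 1\<close>-bar
  above a layer that depends only on the number of the column, so that a wall in the component of
  \<open>H\<^sub>\<lambda>\<close> is determined by the letters of its columns. Such a wall is proper if and only if the letters
  satisfy the column condition of tableaux among the columns starting from the same period. A column
  whose block cannot be added or removed because of its neighbour lacks a sign, but the missing signs
  come in pairs \<open>(+, -)\<close> that would cancel. Hence the signature rules for walls and for readings
  of tableaux select the same column.

  On the side of tableaux, (1CC), (2CC) and the row conditions are rewritten as inequalities between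
  functions counting the entries up to \<open>a\<close> and those from \<open>a\<close>-bar on. They are preserved by the
  operators, and the only tableau annihilated by all \<open>e\<^sub>i\<close> is the one whose columns are \<open>1, \<dots>, M\<close>.
  Hence \<open>T(\<lambda>)\<close> is connected, and the walls obtained from tableaux form the component of \<open>H\<^sub>\<lambda>\<close>; they are
  reduced since the rows of a tableau increase.
\<close>

section \<open>The signature rule\<close>

text \<open>The conditions (2CC) speak about particular letters in particular rows, which the
  operators disturb. The inequalities for all a \<le> d in \<open>link\<close> have no such side
  conditions, and an operator changes the counting functions at a single index, so that stability
  becomes a comparison of neighbouring indices. The second obstacle is the half-column. In a word it
  is a single spin factor, but on the wall it is spread over the infinitely many columns beyond N,
  where only barred letters are visible: unbarred ones are coded by ground-state columns. That such
  a tail carries at most one sign, that of the spin factor, needs its own argument. Finally, the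
  component of the highest weight wall is formed with arrows in both directions. A wall might
  therefore enter it through an arrow that ends in a wall made from a tableau; since the two kinds
  of operators undo each other, its starting point is again made from a tableau.\<close>

lemma cancel_normal_form:
  "cancel ss = map (Pair Minus) (remaining Minus ss) @ map (Pair Plus) (remaining Plus ss)"
proof (induction ss)
  case (Cons s ss)
  obtain t a where s: "s = (t, a)" by fastforce
  show ?case
  proof (cases "cancel ss")
    case Nil
    then show ?thesis using s by (cases t) (auto simp: remaining_def)
  next
    case cs: (Cons s' ss')
    obtain t' a' where s': "s' = (t', a')" by fastforce
    have eq: "s' # ss' = map (Pair Minus) (remaining Minus ss) @ map (Pair Plus) (remaining Plus ss)"
      using cs Cons.IH by simp
    show ?thesis
    proof (cases "remaining Minus ss")
      case Nil
      with eq have "s' # ss' = map (Pair Plus) (remaining Plus ss)" by simp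
      then have *: "\<forall>x\<in>set (s' # ss'). fst x = Plus" by auto
      then have "filter (\<lambda>x. fst x = Minus) (s' # ss') = []" "filter (\<lambda>x. fst x = Plus) (s' # ss') = s' # ss'"
        by (auto simp: filter_empty_conv filter_id_conv)
      with * s cs show ?thesis
        by (cases t) (auto simp: remaining_def map_idI prod_eq_iff)
    next
      case (Cons m ms)
      obtain ps where "remaining Plus ss = ps" by blast
      with eq Cons cs have c: "cancel ss = (Minus, m) # map (Pair Minus) ms @ map (Pair Plus) ps"
        by simp
      have f: "filter (\<lambda>x. fst x = Minus) (map (Pair Minus) ms @ map (Pair Plus) ps) = map (Pair Minus) ms"
        "filter (\<lambda>x. fst x = Plus) (map (Pair Minus) ms @ map (Pair Plus) ps) = map (Pair Plus) ps"
        by (auto simp: filter_empty_conv filter_id_conv)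
      show ?thesis unfolding s
        by (cases t) (simp_all add: remaining_def c f comp_def)
    qed
  qed
qed (simp add: remaining_def)

lemma remaining_Nil [simp]: "remaining s [] = []"
  by (simp add: remaining_def)

lemma remaining_Minus_Cons [simp]:
  "remaining Minus ((Minus, a) # ss) = a # remaining Minus ss"
  "remaining Plus ((Minus, a) # ss) = remaining Plus ss"
  by (auto simp: remaining_def split: list.splits)

lemma remaining_Plus_Cons [simp]:
  "remaining Minus ((Plus, a) # ss) = tl (remaining Minus ss)"
  "remaining Plus ((Plus, a) # ss) =
     (if remaining Minus ss = [] then a # remaining Plus ss else remaining Plus ss)"
proof -
  have f: "filter (\<lambda>x. fst x = Minus) (map (Pair Plus) xs) = []"
    "filter (\<lambda>x. fst x = Plus) (map (Pair Minus) xs) = []"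
    "filter (\<lambda>x. fst x = Minus) (map (Pair Minus) xs) = map (Pair Minus) xs"
    "filter (\<lambda>x. fst x = Plus) (map (Pair Plus) xs) = map (Pair Plus) xs" for xs :: "'a list"
    by (auto simp: filter_empty_conv filter_id_conv)
  consider "remaining Minus ss = []" "remaining Plus ss = []"
    | p ps where "remaining Minus ss = []" "remaining Plus ss = p # ps"
    | m ms where "remaining Minus ss = m # ms"
    by (metis list.exhaust)
  then have "remaining Minus ((Plus, a) # ss) = tl (remaining Minus ss) \<and>
    remaining Plus ((Plus, a) # ss) =
     (if remaining Minus ss = [] then a # remaining Plus ss else remaining Plus ss)"
  proof cases
    case 1
    then have "cancel ss = []" using cancel_normal_form[of ss] by simp
    then show ?thesis by (simp add: remaining_def)
  next
    case 2
    then have "cancel ss = map (Pair Plus) (p # ps)" using cancel_normal_form[of ss] by simp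
    then show ?thesis using 2 f(1)[of ps] f(4)[of ps] by (simp add: remaining_def comp_def)
  next
    case 3
    then have "cancel ss = map (Pair Minus) (m # ms) @ map (Pair Plus) (remaining Plus ss)"
      using cancel_normal_form[of ss] by simp
    then show ?thesis using 3 f(2,3)[of ms] f(1,4)[of "remaining Plus ss"]
      by (simp add: remaining_def[of _ "(Plus, a) # ss"] comp_def)
  qed
  then show "remaining Minus ((Plus, a) # ss) = tl (remaining Minus ss)"
    "remaining Plus ((Plus, a) # ss) =
     (if remaining Minus ss = [] then a # remaining Plus ss else remaining Plus ss)" by auto
qed

text \<open>What survives in \<open>u\<close> ends with pluses and what survives in \<open>v\<close>
  begins with minuses. These meet and cancel one for one, at the expense of the last pluses of
  \<open>u\<close> and the first minuses of \<open>v\<close>.\<close>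

lemma remaining_append:
  "remaining Minus (u @ v) = remaining Minus u @ drop (length (remaining Plus u)) (remaining Minus v) \<and>
   remaining Plus (u @ v) =
     take (length (remaining Plus u) - length (remaining Minus v)) (remaining Plus u) @ remaining Plus v"
proof (induction u)
  case (Cons x u)
  obtain t a where x: "x = (t, a)" by fastforce
  show ?case
  proof (cases t)
    case Minus
    with Cons x show ?thesis by simp
  next
    case Plus
    show ?thesis
    proof (cases "remaining Minus u")
      case Nil
      then show ?thesis using Cons Plus x
        by (auto simp: tl_drop drop_Suc Suc_diff_le not_le)
    next
      case (Cons m ms)
      then show ?thesis using Cons.IH Plus x by simp
    qed
  qed
qed simp

lemmas remaining_Minus_append = remaining_append[THEN conjunct1]
lemmas remaining_Plus_append = remaining_append[THEN conjunct2]

text \<open>Cancellation looks at the signs only, so the places may be renamed, even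
  non-injectively. This is how positions of a reading are later turned into letters or into columns
  of a wall.\<close>

lemma remaining_map: "remaining s (map (\<lambda>(t, a). (t, g a)) ss) = map g (remaining s ss)"
proof -
  have "remaining Minus (map (\<lambda>(t, a). (t, g a)) ss) = map g (remaining Minus ss) \<and>
    remaining Plus (map (\<lambda>(t, a). (t, g a)) ss) = map g (remaining Plus ss)"
  proof (induction ss)
    case (Cons x ss)
    obtain t a where x: "x = (t, a)" by fastforce
    with Cons show ?case by (cases t) (auto simp: map_tl)
  qed simp
  then show ?thesis by (cases s) auto
qed

lemma remaining_replicate [simp]:
  "remaining Minus (replicate k (Minus, a)) = replicate k a"
  "remaining Plus (replicate k (Minus, a)) = []"
  "remaining Plus (replicate k (Plus, a)) = replicate k a"
  "remaining Minus (replicate k (Plus, a)) = []"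
  by (induction k) auto

lemma set_remaining: "x \<in> set (remaining s ss) \<Longrightarrow> (s, x) \<in> set ss"
proof -
  have "set (cancel ss) \<subseteq> set ss"
    by (induction ss) (auto split: list.splits if_splits)
  then show "x \<in> set (remaining s ss) \<Longrightarrow> (s, x) \<in> set ss"
    by (auto simp: remaining_def)
qed

lemma remaining_cong_middle:
  assumes "\<And>s. remaining s v = remaining s v'"
  shows "remaining s (u @ v @ w) = remaining s (u @ v' @ w)"
  using assms by (cases s) (simp_all add: remaining_Minus_append remaining_Plus_append)

lemma remaining_cancel_pairs:
  "remaining s (u @ replicate k (Plus, a) @ replicate k (Minus, b) @ w) = remaining s (u @ w)"
proof -
  have "remaining s (replicate k (Plus, a) @ replicate k (Minus, b)) = []" for s
    by (cases s) (simp_all add: remaining_Minus_append remaining_Plus_append)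
  then show ?thesis
    using remaining_cong_middle[of "replicate k (Plus, a) @ replicate k (Minus, b)" "[]" s u w] by simp
qed

text \<open>Telescoping: each \<open>m j\<close> counts pairs cancelled between neighbouring blocks \<open>Suc j\<close> and \<open>j\<close>.\<close>

lemma remaining_cancel_adjacent:
  fixes e f m :: "nat \<Rightarrow> nat"
  assumes "\<And>j. 1 \<le> j \<Longrightarrow> j < N \<Longrightarrow> m j \<le> e j \<and> m j \<le> f (Suc j)"
    and "m 0 = 0" "m N = 0"
  shows "remaining s (u @ concat (map (\<lambda>j. replicate (e j) (Minus, j) @ replicate (f j) (Plus, j)) (rev [1..<Suc N]))) =
    remaining s (u @ concat (map (\<lambda>j. replicate (e j - m j) (Minus, j) @ replicate (f j - m (j - 1)) (Plus, j)) (rev [1..<Suc N])))"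
proof -
  let ?F = "\<lambda>K. concat (map (\<lambda>j. replicate (e j) (Minus, j) @ replicate (f j) (Plus, j)) (rev [1..<Suc K]))"
  let ?G = "\<lambda>K. concat (map (\<lambda>j. replicate (e j - m j) (Minus, j) @ replicate (f j - m (j - 1)) (Plus, j)) (rev [1..<Suc K]))"
  \<comment> \<open>The \<open>m K\<close> minuses of column \<open>K\<close> that are due to cancel
    against column \<open>Suc K\<close> are kept in front until that column is processed; there is
    no column 0, hence the case distinction. The prefix \<open>v\<close> is arbitrary so that it can
    absorb column \<open>Suc K\<close> in the induction.\<close>
  have main: "remaining s (v @ ?F K) = remaining s (v @ (if K = 0 then [] else replicate (m K) (Minus, K)) @ ?G K)"
    if "K \<le> N" for K v using that
  proof (induction K arbitrary: v)
    case (Suc K)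
    let ?j = "Suc K"
    have mK: "m K \<le> f ?j \<and> (K \<noteq> 0 \<longrightarrow> m K \<le> e K)"
      using assms(1)[of K] assms(2) Suc.prems by (cases "K = 0") auto
    have "remaining s (v @ ?F ?j) = remaining s ((v @ replicate (e ?j) (Minus, ?j) @ replicate (f ?j) (Plus, ?j)) @ ?F K)"
      by simp
    also have "\<dots> = remaining s ((v @ replicate (e ?j) (Minus, ?j) @ replicate (f ?j) (Plus, ?j)) @
        (if K = 0 then [] else replicate (m K) (Minus, K)) @ ?G K)"
      using Suc.IH Suc.prems by (intro Suc.IH) simp
    also have "\<dots> = remaining s ((v @ replicate (e ?j) (Minus, ?j) @ replicate (f ?j - m K) (Plus, ?j)) @
        (replicate (m K) (Plus, ?j) @ replicate (m K) (Minus, K)) @ ?G K)"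
    proof (cases "K = 0")
      case True then show ?thesis using assms(2) by simp
    next
      case False
      have "replicate (f ?j) (Plus, ?j) = replicate (f ?j - m K) (Plus, ?j) @ replicate (m K) (Plus, ?j)"
        using mK by (simp flip: replicate_add)
      then show ?thesis using False by simp
    qed
    also have "\<dots> = remaining s (v @ replicate (e ?j) (Minus, ?j) @ replicate (f ?j - m K) (Plus, ?j) @ ?G K)"
      using remaining_cancel_pairs[of s "v @ replicate (e ?j) (Minus, ?j) @ replicate (f ?j - m K) (Plus, ?j)"]
      by simp
    also have "replicate (e ?j) (Minus, ?j) = replicate (m ?j) (Minus, ?j) @ replicate (e ?j - m ?j) (Minus, ?j)"
      using assms(1)[of ?j] assms(3) Suc.prems
      by (cases "?j = N") (simp_all flip: replicate_add)
    finally show ?case by simp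
  qed simp
  show ?thesis using main[of N u] assms(3) by (simp cong: if_cong)
qed

section \<open>Letters\<close>

definition letter_eps :: "nat \<Rightarrow> nat \<Rightarrow> letter \<Rightarrow> nat" where
  "letter_eps n i x = (if i < n then (if x = Pos (i + 1) \<or> x = Neg i then 1 else 0)
     else if x = Neg n then 2 else if x = Zero then 1 else 0)"

definition letter_phi :: "nat \<Rightarrow> nat \<Rightarrow> letter \<Rightarrow> nat" where
  "letter_phi n i x = (if i < n then (if x = Pos i \<or> x = Neg (i + 1) then 1 else 0)
     else if x = Pos n then 2 else if x = Zero then 1 else 0)"

lemma iterate_bind_None:
  fixes g :: "'a \<Rightarrow> 'a option"
  shows "((\<lambda>y. Option.bind y g) ^^ k) None = None"
  by (induction k) auto

lemma string_length_None: "g x = None \<Longrightarrow> string_length g x = 0"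
proof -
  assume a: "g x = None"
  have b: "((\<lambda>y. Option.bind y g) ^^ Suc k) (Some x) = None" for k
    by (simp only: funpow_Suc_right comp_def) (simp add: a iterate_bind_None)
  have "k \<le> 0" if "((\<lambda>y. Option.bind y g) ^^ k) (Some x) \<noteq> None" for k
  proof (rule ccontr)
    assume "\<not> k \<le> 0"
    then obtain l where "k = Suc l" by (metis le_zero_eq not0_implies_Suc)
    then show False using b that by metis
  qed
  then show ?thesis unfolding string_length_def
    by (intro Greatest_equality) auto
qed

lemma string_length_Some1: "g x = Some y \<Longrightarrow> g y = None \<Longrightarrow> string_length g x = 1"
proof -
  assume a: "g x = Some y" "g y = None"
  have b: "((\<lambda>y. Option.bind y g) ^^ Suc (Suc k)) (Some x) = None" for k
    by (simp only: funpow_Suc_right comp_def) (simp add: a iterate_bind_None)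
  have "k \<le> 1" if "((\<lambda>y. Option.bind y g) ^^ k) (Some x) \<noteq> None" for k
  proof (rule ccontr)
    assume "\<not> k \<le> 1"
    then obtain l where "k = Suc (Suc l)" by (metis One_nat_def less_natE not_le plus_1_eq_Suc)
    then show False using b that by metis
  qed
  then show ?thesis unfolding string_length_def
    by (intro Greatest_equality) (auto simp: a)
qed

lemma string_length_Some2: "g x = Some y \<Longrightarrow> g y = Some z \<Longrightarrow> g z = None \<Longrightarrow> string_length g x = 2"
proof -
  assume a: "g x = Some y" "g y = Some z" "g z = None"
  have b: "((\<lambda>y. Option.bind y g) ^^ Suc (Suc (Suc k))) (Some x) = None" for k
    by (simp only: funpow_Suc_right comp_def) (simp add: a iterate_bind_None)
  have "k \<le> 2" if "((\<lambda>y. Option.bind y g) ^^ k) (Some x) \<noteq> None" for k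
  proof (rule ccontr)
    assume "\<not> k \<le> 2"
    then obtain l where "k = Suc (Suc (Suc l))" by (metis add_2_eq_Suc less_natE not_le)
    then show False using b that by metis
  qed
  then show ?thesis unfolding string_length_def
    by (intro Greatest_equality) (auto simp: a numeral_2_eq_2)
qed

lemma string_length_factor_e_Vec [simp]:
  "string_length (factor_e n i) (Vec x) = letter_eps n i x"
proof (cases "vec_e n i x")
  case None
  then show ?thesis
    by (subst string_length_None) (auto simp: vec_e_def letter_eps_def split: if_splits)
next
  case (Some y)
  show ?thesis
  proof (cases "vec_e n i y")
    case None
    with Some show ?thesis
      by (subst string_length_Some1[of _ _ "Vec y"]) (auto simp: vec_e_def letter_eps_def split: if_splits)
  next
    case (Some z)
    with \<open>vec_e n i x = Some y\<close> show ?thesis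
      by (subst string_length_Some2[of _ _ "Vec y" "Vec z"]) (auto simp: vec_e_def letter_eps_def split: if_splits)
  qed
qed

lemma string_length_factor_f_Vec [simp]:
  "string_length (factor_f n i) (Vec x) = letter_phi n i x"
proof (cases "vec_f n i x")
  case None
  then show ?thesis
    by (subst string_length_None) (auto simp: vec_f_def letter_phi_def split: if_splits)
next
  case (Some y)
  show ?thesis
  proof (cases "vec_f n i y")
    case None
    with Some show ?thesis
      by (subst string_length_Some1[of _ _ "Vec y"]) (auto simp: vec_f_def letter_phi_def split: if_splits)
  next
    case (Some z)
    with \<open>vec_f n i x = Some y\<close> show ?thesis
      by (subst string_length_Some2[of _ _ "Vec y" "Vec z"]) (auto simp: vec_f_def letter_phi_def split: if_splits)
  qed
qed

lemma letter_eps_pos_iff: "letter_eps n i x > 0 \<longleftrightarrow> vec_e n i x \<noteq> None"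
  by (auto simp: letter_eps_def vec_e_def)

lemma letter_phi_pos_iff: "letter_phi n i x > 0 \<longleftrightarrow> vec_f n i x \<noteq> None"
  by (auto simp: letter_phi_def vec_f_def)

lemma vec_f_eps_phi:
  "vec_f n i x = Some y \<Longrightarrow> letter_eps n i y = Suc (letter_eps n i x) \<and> letter_phi n i x = Suc (letter_phi n i y)"
  by (auto simp: letter_eps_def letter_phi_def vec_f_def split: if_splits)

lemma vec_e_iff_vec_f: "vec_e n i x = Some y \<longleftrightarrow> vec_f n i y = Some x"
  by (auto simp: vec_e_def vec_f_def)

section \<open>Counting functions of columns\<close>

lemma letter_le_simps [simp]:
  "Pos a \<le> Pos b \<longleftrightarrow> a \<le> b" "Pos a \<le> Zero" "Pos a \<le> Neg b" "\<not> Zero \<le> Pos b" "Zero \<le> Zero"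
  "Zero \<le> Neg b" "\<not> Neg a \<le> Pos b" "\<not> Neg a \<le> Zero" "Neg a \<le> Neg b \<longleftrightarrow> b \<le> a"
  by (auto simp: less_eq_letter_def)

lemma letters_simps [simp]:
  "Pos a \<in> letters n \<longleftrightarrow> 1 \<le> a \<and> a \<le> n" "Zero \<in> letters n" "Neg a \<in> letters n \<longleftrightarrow> 1 \<le> a \<and> a \<le> n"
  by (auto simp: letters_def)

definition pos_count :: "letter list \<Rightarrow> nat \<Rightarrow> int" where
  "pos_count C a = int (length (filter (\<lambda>x. x \<le> Pos a) C))"

definition neg_count :: "letter list \<Rightarrow> nat \<Rightarrow> int" where
  "neg_count C a = int (length (filter (\<lambda>x. Neg a \<le> x) C))"

lemma le_Pos_Suc_iff: "x \<le> Pos (Suc a) \<longleftrightarrow> x \<le> Pos a \<or> x = Pos (Suc a)"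
  by (cases x) auto

lemma Neg_Suc_le_iff: "Neg (Suc a) \<le> x \<longleftrightarrow> Neg a \<le> x \<or> x = Neg (Suc a)"
  by (cases x) auto

lemma pos_count_Suc: "pos_count C (Suc a) = pos_count C a + int (count_list C (Pos (Suc a)))"
  by (induction C) (auto simp: pos_count_def le_Pos_Suc_iff)

lemma neg_count_Suc: "neg_count C (Suc a) = neg_count C a + int (count_list C (Neg (Suc a)))"
  by (induction C) (auto simp: neg_count_def Neg_Suc_le_iff)

lemma pos_count_0: "set C \<subseteq> letters n \<Longrightarrow> pos_count C 0 = 0"
proof -
  assume a: "set C \<subseteq> letters n"
  have "\<not> x \<le> Pos 0" if "x \<in> set C" for x using a that by (cases x) auto
  then show ?thesis by (auto simp: pos_count_def filter_empty_conv)
qed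

lemma neg_count_0: "set C \<subseteq> letters n \<Longrightarrow> neg_count C 0 = 0"
proof -
  assume a: "set C \<subseteq> letters n"
  have "\<not> Neg 0 \<le> x" if "x \<in> set C" for x using a that by (cases x) auto
  then show ?thesis by (auto simp: neg_count_def filter_empty_conv)
qed

lemma count_sum: "set C \<subseteq> letters n \<Longrightarrow>
  pos_count C n + neg_count C n + int (count_list C Zero) = int (length C)"
proof (induction C)
  case (Cons x C)
  then show ?case by (cases x) (auto simp: pos_count_def neg_count_def)
qed (simp add: pos_count_def neg_count_def)

lemma column_ok_count:
  "column_ok C \<Longrightarrow> x \<noteq> Zero \<Longrightarrow> count_list C x = (if x \<in> set C then 1 else 0)"
proof (induction C)
  case (Cons y C)
  then have "column_ok C" "\<forall>z\<in>set C. y > z \<or> (y = Zero \<and> z = Zero)" by (auto simp: column_ok_def)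
  with Cons show ?case by (auto simp: count_list_0_iff)
qed simp

lemma pos_count_step:
  "column_ok C \<Longrightarrow> pos_count C (Suc a) = pos_count C a + (if Pos (Suc a) \<in> set C then 1 else 0)"
  by (simp add: pos_count_Suc column_ok_count)

lemma neg_count_step:
  "column_ok C \<Longrightarrow> neg_count C (Suc a) = neg_count C a + (if Neg (Suc a) \<in> set C then 1 else 0)"
  by (simp add: neg_count_Suc column_ok_count)

text \<open>Columns are listed from bottom to top, hence weakly decreasing, so the entries with an
  upward closed property occupy an initial segment of the list.\<close>

lemma nth_up_closed_iff:
  assumes "sorted_wrt (\<ge>) C" "\<And>x y :: 'a :: linorder. x \<le> y \<Longrightarrow> R x \<Longrightarrow> R y" "p < length C"
  shows "R (C ! p) \<longleftrightarrow> p < length (filter R C)"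
  using assms(1,3)
proof (induction C arbitrary: p)
  case (Cons c C)
  show ?case
  proof (cases "R c")
    case True
    then show ?thesis using Cons by (cases p) auto
  next
    case False
    have "\<forall>x\<in>set (c # C). \<not> R x" using Cons.prems(1) False assms(2) by auto
    then have "filter R (c # C) = []" "\<not> R ((c # C) ! p)"
      using Cons.prems(2) nth_mem unfolding filter_empty_conv by blast+
    then show ?thesis by simp
  qed
qed simp

lemma column_ok_sorted: "column_ok C \<Longrightarrow> sorted_wrt (\<ge>) C"
  unfolding column_ok_def by (erule sorted_wrt_mono_rel[rotated]) auto

text \<open>Only \<open>Zero\<close> can be repeated in a column; any other entry has exactly the
  larger entries below it.\<close>

lemma filter_greater_length:
  assumes "column_ok C" "p < length C" "C ! p \<noteq> Zero"
  shows "length (filter (\<lambda>y. C ! p < y) C) = p"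
proof -
  let ?x = "C ! p"
  note s = column_ok_sorted[OF assms(1)]
  have "length (filter (\<lambda>y. ?x \<le> y) C) = length (filter (\<lambda>y. ?x < y) C) + count_list C ?x" for C x
    by (induction C) auto
  moreover have "count_list C ?x = 1" using assms by (simp add: column_ok_count)
  moreover have "p < length (filter (\<lambda>y. ?x \<le> y) C)"
    using nth_up_closed_iff[OF s _ assms(2), of "\<lambda>y. ?x \<le> y"] by auto
  moreover have "\<not> p < length (filter (\<lambda>y. ?x < y) C)"
    using nth_up_closed_iff[OF s _ assms(2), of "\<lambda>y. ?x < y"] by auto
  ultimately show ?thesis by simp
qed

lemma filter_not_le_length: "int (length (filter (\<lambda>x. \<not> x \<le> Pos a) C)) = int (length C) - pos_count C a"
  using sum_length_filter_compl[of "\<lambda>x. x \<le> Pos a" C] by (simp add: pos_count_def)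

text \<open>Below the letter \<open>a\<close> lie the entries that exceed it, which are those not
  counted by \<open>pos_count C a\<close>. This turns the rows in (1CC) and (2CC) into
  counts.\<close>

lemma in_row_PosD:
  assumes "column_ok C" "in_row C p (Pos a)"
  shows "int p = int (length C) - pos_count C a + 1" "Pos a \<in> set C"
proof -
  have p: "p - 1 < length C" "C ! (p - 1) = Pos a" "1 \<le> p" using assms(2) by (auto simp: in_row_def)
  have "length (filter (\<lambda>y. \<not> y \<le> Pos a) C) = p - 1"
    using filter_greater_length[OF assms(1) p(1)] p(2) by (simp add: not_le)
  then show "int p = int (length C) - pos_count C a + 1" using filter_not_le_length[of a C] p(3) by linarith
  show "Pos a \<in> set C" using p nth_mem by metis
qed

lemma in_row_NegD:
  assumes "column_ok C" "in_row C q (Neg a)"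
  shows "int q = neg_count C a" "Neg a \<in> set C"
proof -
  have p: "q - 1 < length C" "C ! (q - 1) = Neg a" "1 \<le> q" using assms(2) by (auto simp: in_row_def)
  show *: "Neg a \<in> set C" using p nth_mem by metis
  have "length (filter (\<lambda>y. Neg a \<le> y) C) = length (filter (\<lambda>y. Neg a < y) C) + count_list C (Neg a)" for C
    by (induction C) auto
  then show "int q = neg_count C a"
    using filter_greater_length[OF assms(1) p(1)] p(2,3) column_ok_count[OF assms(1), of "Neg a"] *
    by (simp add: neg_count_def)
qed

lemma in_rowE:
  assumes "x \<in> set C"
  obtains p where "in_row C p x"
proof -
  obtain q where "q < length C" "C ! q = x" using assms by (auto simp: in_set_conv_nth)
  then have "in_row C (Suc q) x" by (simp add: in_row_def)
  then show ?thesis using that by blast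
qed

lemma pos_count_mono: "a \<le> d \<Longrightarrow> pos_count C a \<le> pos_count C d"
  unfolding pos_count_def
  by (induction d rule: dec_induct) (auto simp: pos_count_Suc[unfolded pos_count_def])

lemma neg_count_mono: "a \<le> d \<Longrightarrow> neg_count C a \<le> neg_count C d"
  unfolding neg_count_def
  by (induction d rule: dec_induct) (auto simp: neg_count_Suc[unfolded neg_count_def])

lemma pos_count_le: "a \<le> d \<Longrightarrow> column_ok C \<Longrightarrow> pos_count C d \<le> pos_count C a + int (d - a)"
  by (induction d rule: dec_induct) (auto simp: pos_count_step)

lemma neg_count_le: "a \<le> d \<Longrightarrow> column_ok C \<Longrightarrow> neg_count C d \<le> neg_count C a + int (d - a)"
  by (induction d rule: dec_induct) (auto simp: neg_count_step)

text \<open>The admissible columns of Kashiwara and Nakashima in type B, with (1CC) in a form that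
  refers neither to rows nor to a pair of letters being present.\<close>

definition kn_column :: "nat \<Rightarrow> letter list \<Rightarrow> bool" where
  "kn_column n C \<longleftrightarrow> set C \<subseteq> letters n \<and> column_ok C \<and> length C \<le> n \<and>
     (\<forall>a\<le>n. pos_count C a + neg_count C a \<le> int a)"

lemma kn_columnD:
  assumes "kn_column n C"
  shows "set C \<subseteq> letters n" "column_ok C" "length C \<le> n"
    "\<And>a. a \<le> n \<Longrightarrow> pos_count C a + neg_count C a \<le> int a"
  using assms by (auto simp: kn_column_def)

text \<open>At the least \<open>a\<close> violating the count, both \<open>a\<close> and its barred copy must occur.\<close>

lemma kn_column_iff:
  "kn_column n C \<longleftrightarrow> set C \<subseteq> letters n \<and> column_ok C \<and> length C \<le> n \<and> cc1 C"
proof (cases "set C \<subseteq> letters n \<and> column_ok C \<and> length C \<le> n")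
  case True
  then have l: "set C \<subseteq> letters n" and c: "column_ok C" by auto
  have "(\<forall>a\<le>n. pos_count C a + neg_count C a \<le> int a) \<longleftrightarrow> cc1 C"
  proof
    assume a: "\<forall>a\<le>n. pos_count C a + neg_count C a \<le> int a"
    show "cc1 C" unfolding cc1_def
    proof (intro allI impI)
      fix a p q assume pq: "in_row C p (Pos a)" "in_row C q (Neg a)" "q < p"
      have "a \<le> n" using in_row_PosD(2)[OF c pq(1)] l by auto
      with a have "pos_count C a + neg_count C a \<le> int a" by blast
      then show "int (length C) - int a \<le> int p - int q - 1"
        using in_row_PosD(1)[OF c pq(1)] in_row_NegD(1)[OF c pq(2)] by linarith
    qed
  next
    assume cc: "cc1 C"
    show "\<forall>a\<le>n. pos_count C a + neg_count C a \<le> int a"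
    proof (intro allI impI)
      fix a show "a \<le> n \<Longrightarrow> pos_count C a + neg_count C a \<le> int a"
      proof (induction a)
        case 0
        then show ?case using pos_count_0[OF l] neg_count_0[OF l] by simp
      next
        case (Suc a)
        show ?case
        proof (cases "Pos (Suc a) \<in> set C \<and> Neg (Suc a) \<in> set C")
          case True
          then obtain p q where pq: "in_row C p (Pos (Suc a))" "in_row C q (Neg (Suc a))"
            by (metis in_rowE)
          have "q < p"
          proof (rule ccontr)
            assume "\<not> q < p"
            moreover have r: "1 \<le> p" "q \<le> length C" "C ! (p - 1) = Pos (Suc a)" "C ! (q - 1) = Neg (Suc a)"
              using pq by (auto simp: in_row_def)
            moreover from r have "p \<noteq> q" by auto
            ultimately have "p - 1 < q - 1" "q - 1 < length C" by linarith+
            then show False using sorted_wrt_nth_less[OF column_ok_sorted[OF c], of "p - 1" "q - 1"] r by simp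
          qed
          with cc pq have "int (length C) - int (Suc a) \<le> int p - int q - 1" unfolding cc1_def by blast
          then show ?thesis using in_row_PosD(1)[OF c pq(1)] in_row_NegD(1)[OF c pq(2)] by linarith
        next
          case False
          then show ?thesis using Suc by (auto simp: pos_count_step[OF c] neg_count_step[OF c])
        qed
      qed
    qed
  qed
  then show ?thesis using True by (auto simp: kn_column_def)
qed (auto simp: kn_column_def)

text \<open>
  The counting functions of two adjacent columns of lengths \<open>M \<le> M'\<close> enter here as \<open>P, Q\<close> and \<open>P', Q'\<close>.
  The first two inequalities express (2CC-2) with the pair \<open>d\<close> in the left and in the right column, the
  third one (2CC-1). For \<open>a = d\<close> and \<open>a = n\<close> they say that the rows are admissible.
\<close>

definition link :: "nat \<Rightarrow> int \<Rightarrow> int \<Rightarrow> (nat \<Rightarrow> int) \<Rightarrow> (nat \<Rightarrow> int) \<Rightarrow> (nat \<Rightarrow> int) \<Rightarrow> (nat \<Rightarrow> int) \<Rightarrow> bool" where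
  "link n M M' P Q P' Q' \<longleftrightarrow> (\<forall>a d. a \<le> d \<longrightarrow> d \<le> n \<longrightarrow>
     P d + Q d - int d \<le> P a + Q' a - int a \<and>
     P' d + Q' d - int d - (M' - M) \<le> P a + Q' a - int a \<and>
     M - int n \<le> P a + Q' a - int a)"

definition linked :: "nat \<Rightarrow> letter list \<Rightarrow> letter list \<Rightarrow> bool" where
  "linked n C C' \<longleftrightarrow> length C \<le> length C' \<and> link n (int (length C)) (int (length C'))
     (pos_count C) (neg_count C) (pos_count C') (neg_count C')"

definition row_le :: "letter list \<Rightarrow> letter list \<Rightarrow> bool" where
  "row_le C C' \<longleftrightarrow> length C \<le> length C' \<and>
     (\<forall>p<length C. C ! p \<le> C' ! p \<and> \<not> (C ! p = Zero \<and> C' ! p = Zero))"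

text \<open>Two decreasing lists are comparable row by row if and only if no up-set of letters has
  more entries in the left one. The up-sets starting at a bar give the inequalities for
  \<open>neg_count\<close>, those starting above \<open>Pos a\<close> the ones for
  \<open>pos_count\<close>. The last inequality says that every entry of \<open>C\<close> from
  \<open>Zero\<close> on meets a barred letter, so that zeros do not meet.\<close>

lemma row_le_iff:
  assumes "kn_column n C" "kn_column n C'" "length C \<le> length C'"
  shows "row_le C C' \<longleftrightarrow>
    (\<forall>a\<le>n. neg_count C a \<le> neg_count C' a \<and> pos_count C' a - pos_count C a \<le> int (length C') - int (length C)) \<and>
    int (length C) \<le> pos_count C n + neg_count C' n" (is "?L \<longleftrightarrow> ?R")
proof -
  note c = kn_columnD(2)[OF assms(1)] and c' = kn_columnD(2)[OF assms(2)]
  note s = column_ok_sorted[OF c] and s' = column_ok_sorted[OF c']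
  note l = kn_columnD(1)[OF assms(1)]
  have neg: "Neg a \<le> D ! p \<longleftrightarrow> int p < neg_count D a" if "sorted_wrt (\<ge>) D" "p < length D" for D p a
    unfolding neg_count_def using nth_up_closed_iff[OF that(1) _ that(2), of "\<lambda>x. Neg a \<le> x"]
    by auto
  have pos: "\<not> D ! p \<le> Pos a \<longleftrightarrow> int p < int (length D) - pos_count D a"
    if "sorted_wrt (\<ge>) D" "p < length D" for D p a
    unfolding filter_not_le_length[symmetric]
    using nth_up_closed_iff[OF that(1) _ that(2), of "\<lambda>x. \<not> x \<le> Pos a"]
    by (auto intro: order_trans)
  have nle: "neg_count D a \<le> int (length D)" "0 \<le> neg_count D a" "0 \<le> pos_count D a" "pos_count D a \<le> int (length D)" for D a
    by (simp_all add: neg_count_def pos_count_def)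
  show ?thesis
  proof
    assume L: ?L
    have 1: "neg_count C a \<le> neg_count C' a" for a
    proof (rule ccontr)
      assume *: "\<not> ?thesis"
      \<comment> \<open>Counting rows from 0, this is the first row in which the entry of
        \<open>C'\<close> lies below the bar of \<open>a\<close>, while that of \<open>C\<close>
        does not.\<close>
      define p where "p = nat (neg_count C' a)"
      have p: "int p = neg_count C' a" using nle by (simp add: p_def)
      then have pl: "p < length C" using * nle(1)[of C a] by linarith
      then have "Neg a \<le> C ! p" using neg[OF s] p * by simp
      moreover have "\<not> Neg a \<le> C' ! p" using neg[OF s', of p a] p pl assms(3) by simp
      moreover have "C ! p \<le> C' ! p" using L pl by (simp add: row_le_def)
      ultimately show False by simp
    qed
    have 2: "pos_count C' a - pos_count C a \<le> int (length C') - int (length C)" for a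
    proof (rule ccontr)
      assume *: "\<not> ?thesis"
      define p where "p = nat (int (length C') - pos_count C' a)"
      have p: "int p = int (length C') - pos_count C' a" using nle by (simp add: p_def)
      then have pl: "p < length C" using * nle(3)[of C a] by linarith
      then have "\<not> C ! p \<le> Pos a" using pos[OF s] p * by simp
      moreover have "C' ! p \<le> Pos a" using pos[OF s', of p a] p pl assms(3) by simp
      moreover have "C ! p \<le> C' ! p" using L pl by (simp add: row_le_def)
      ultimately show False by simp
    qed
    have "int (length C) \<le> pos_count C n + neg_count C' n"
    proof (rule ccontr)
      assume *: "\<not> ?thesis"
      define p where "p = nat (neg_count C' n)"
      have p: "int p = neg_count C' n" using nle by (simp add: p_def)
      then have pl: "p < length C" using * nle(3)[of C n] by linarith
      then have "\<not> C ! p \<le> Pos n" using pos[OF s] p * by simp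
      moreover have "\<not> Neg n \<le> C' ! p" using neg[OF s', of p n] p pl assms(3) by simp
      moreover have "C ! p \<le> C' ! p" "\<not> (C ! p = Zero \<and> C' ! p = Zero)" using L pl by (auto simp: row_le_def)
      moreover have "C' ! p \<in> letters n" "C ! p \<in> letters n"
        using kn_columnD(1)[OF assms(2)] l pl assms(3) nth_mem[of p] by (meson subsetD less_le_trans)+
      ultimately show False by (cases "C ! p"; cases "C' ! p") auto
    qed
    with 1 2 show ?R by blast
  next
    assume R: ?R
    show ?L unfolding row_le_def
    proof (intro conjI allI impI)
      fix p assume p: "p < length C"
      then have p': "p < length C'" using assms(3) by simp
      have lp: "C ! p \<in> letters n" using l p nth_mem by blast
      have "C ! p \<le> C' ! p \<and> \<not> (C ! p = Zero \<and> C' ! p = Zero)"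
      proof (cases "C ! p")
        case (Pos a)
        with lp have a: "1 \<le> a" "a \<le> n" by auto
        then have "\<not> C ! p \<le> Pos (a - 1)" using Pos by simp
        then have "int p < int (length C) - pos_count C (a - 1)" using pos[OF s p] by blast
        moreover have "pos_count C' (a - 1) - pos_count C (a - 1) \<le> int (length C') - int (length C)"
          using R a by (meson diff_le_self order_trans)
        ultimately have "\<not> C' ! p \<le> Pos (a - 1)" using pos[OF s' p', of "a - 1"] by linarith
        then show ?thesis using Pos a by (cases "C' ! p") auto
      next
        case Zero
        then have "\<not> C ! p \<le> Pos n" by simp
        then have "Neg n \<le> C' ! p" using pos[OF s p] neg[OF s' p'] R[THEN conjunct2] by auto
        then show ?thesis using Zero by (cases "C' ! p") auto
      next
        case (Neg a)
        with lp have a: "1 \<le> a" "a \<le> n" by auto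
        have "Neg a \<le> C ! p" using Neg by simp
        then have "Neg a \<le> C' ! p" using neg[OF s p] neg[OF s' p'] R[THEN conjunct1, rule_format, of a] a by auto
        then show ?thesis using Neg by simp
      qed
      then show "C ! p \<le> C' ! p" "\<not> (C ! p = Zero \<and> C' ! p = Zero)" by auto
    qed (use assms(3) in simp)
  qed
qed

text \<open>
  At an extremal violation of one of the inequalities of \<^const>\<open>link\<close>, both indices carry the letters
  to which the conditions (2CC) apply.
\<close>

lemma linked_iff:
  assumes "kn_column n C" "kn_column n C'" "length C \<le> length C'"
  shows "linked n C C' \<longleftrightarrow> row_le C C' \<and> cc2_1 n C C' \<and> cc2_2 C C'"
proof -
  note c = kn_columnD(2)[OF assms(1)] and c' = kn_columnD(2)[OF assms(2)]
  note l = kn_columnD(1)[OF assms(1)] and l' = kn_columnD(1)[OF assms(2)]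
  define P Q P' Q' M M' where defs: "P = pos_count C" "Q = neg_count C" "P' = pos_count C'" "Q' = neg_count C'"
    "M = int (length C)" "M' = int (length C')"
  note PS = pos_count_step[OF c, folded defs] neg_count_step[OF c, folded defs]
    pos_count_step[OF c', folded defs] neg_count_step[OF c', folded defs]
  have le: "M \<le> M'" using assms(3) by (simp add: defs)
  have rowC: "int p = M - P a + 1" "Pos a \<in> set C" if "in_row C p (Pos a)" for p a
    using in_row_PosD[OF c that] by (auto simp: defs)
  have rowC': "int p = M' - P' a + 1" "Pos a \<in> set C'" if "in_row C' p (Pos a)" for p a
    using in_row_PosD[OF c' that] by (auto simp: defs)
  have rowN: "int p = Q a" "Neg a \<in> set C" if "in_row C p (Neg a)" for p a
    using in_row_NegD[OF c that] by (auto simp: defs)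
  have rowN': "int p = Q' a" "Neg a \<in> set C'" if "in_row C' p (Neg a)" for p a
    using in_row_NegD[OF c' that] by (auto simp: defs)
  have row: "row_le C C' \<longleftrightarrow> (\<forall>a\<le>n. Q a \<le> Q' a \<and> P' a - P a \<le> M' - M) \<and> M \<le> P n + Q' n"
    using row_le_iff[OF assms] by (simp add: defs)
  have bounds: "1 \<le> a \<and> a \<le> n" if "Pos a \<in> set C \<or> Pos a \<in> set C' \<or> Neg a \<in> set C \<or> Neg a \<in> set C'" for a
    using that l l' by auto
  have linkdef: "linked n C C' \<longleftrightarrow> link n M M' P Q P' Q'" using assms(3) by (simp add: linked_def defs)
  show ?thesis
  proof
    assume "linked n C C'"
    then have L: "P d + Q d - int d \<le> P a + Q' a - int a"
      "P' d + Q' d - int d - (M' - M) \<le> P a + Q' a - int a" "M - int n \<le> P a + Q' a - int a"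
      if "a \<le> d" "d \<le> n" for a d
      using that unfolding linkdef link_def by blast+
    have "row_le C C'" unfolding row
    proof (intro conjI allI impI)
      fix a assume a: "a \<le> n"
      show "Q a \<le> Q' a" "P' a - P a \<le> M' - M" using L(1,2)[of a a] a by auto
    qed (use L(3)[of n n] in simp)
    moreover have "cc2_1 n C C'" unfolding cc2_1_def
    proof (intro allI impI)
      fix a p q assume pq: "in_row C p (Pos a)" "in_row C' q (Neg a)" "q < p"
      \<comment> \<open>The inequalities are used just below \<open>a\<close>, where both counts are
        smaller by one. This accounts for the shift by one in the rows and, for (2CC-2), for the
        strict inequality.\<close>
      obtain b where b: "a = Suc b" using bounds rowC(2)[OF pq(1)] by (cases a) auto
      then have "b \<le> n" using bounds[of a] rowC(2)[OF pq(1)] by auto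
      have "P b = P a - 1" "Q' b = Q' a - 1"
        using PS rowC(2)[OF pq(1)] rowN'(2)[OF pq(2)] by (auto simp: b)
      then show "int p - int q \<le> int n - int a"
        using L(3)[of b b] \<open>b \<le> n\<close> b rowC(1)[OF pq(1)] rowN'(1)[OF pq(2)] by simp
    qed
    moreover have "cc2_2 C C'" unfolding cc2_2_def
    proof (intro allI impI)
      fix a p q d r s
      assume pq: "in_row C p (Pos a)" "in_row C' q (Neg a)" "q < p"
        and rs: "in_row C r (Pos d) \<and> in_row C s (Neg d) \<or> in_row C' r (Pos d) \<and> in_row C' s (Neg d)"
        and ord: "r \<le> p" "s < r" "q \<le> s"
      obtain b where b: "a = Suc b" using bounds rowC(2)[OF pq(1)] by (cases a) auto
      have ab: "P b = P a - 1" "Q' b = Q' a - 1" "1 \<le> a" "a \<le> n"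
        using PS rowC(2)[OF pq(1)] rowN'(2)[OF pq(2)] bounds[of a] by (auto simp: b)
      show "int p - int r + (int s - int q) < int d - int a"
        using rs
      proof
        assume rs: "in_row C r (Pos d) \<and> in_row C s (Neg d)"
        then have d: "d \<le> n" "int r = M - P d + 1" "int s = Q d" using bounds rowC rowN by blast+
        have "a \<le> d"
        proof (rule ccontr)
          assume "\<not> a \<le> d"
          then have "d \<le> b" using b by simp
          then have "P d \<le> P b" unfolding defs by (rule pos_count_mono)
          then show False using ab d ord(1) rowC(1)[OF pq(1)] by simp
        qed
        then show ?thesis using L(1)[of b d] d ab b rowC(1)[OF pq(1)] rowN'(1)[OF pq(2)] by simp
      next
        assume rs: "in_row C' r (Pos d) \<and> in_row C' s (Neg d)"
        then have d: "d \<le> n" "int r = M' - P' d + 1" "int s = Q' d" using bounds rowC' rowN' by blast+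
        have "a \<le> d"
        proof (rule ccontr)
          assume "\<not> a \<le> d"
          then have "d \<le> b" using b by simp
          then have "Q' d \<le> Q' b" unfolding defs by (rule neg_count_mono)
          then show False using ab d ord(3) rowN'(1)[OF pq(2)] by simp
        qed
        then show ?thesis using L(2)[of b d] d ab b rowC(1)[OF pq(1)] rowN'(1)[OF pq(2)] by simp
      qed
    qed
    ultimately show "row_le C C' \<and> cc2_1 n C C' \<and> cc2_2 C C'" by blast
  next
    assume A: "row_le C C' \<and> cc2_1 n C C' \<and> cc2_2 C C'"
    then have R: "Q a \<le> Q' a" "P' a - P a \<le> M' - M" "M \<le> P n + Q' n" if "a \<le> n" for a
      using that row by auto
    \<comment> \<open>Downward induction from the row condition at \<open>n\<close>. The right side
      falls from \<open>Suc a\<close> to \<open>a\<close> only if \<open>Suc a\<close> lies in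
      \<open>C\<close> and its bar in \<open>C'\<close>. Then (2CC-1) is the bound wanted, unless
      the bar does not lie lower, when the bound is immediate.\<close>
    have L3: "M - int n \<le> P a + Q' a - int a" if "a \<le> n" for a using that
    proof (induction a rule: inc_induct)
      case base then show ?case using R(3)[of n] by simp
    next
      case (step a)
      show ?case
      proof (cases "Pos (Suc a) \<in> set C \<and> Neg (Suc a) \<in> set C'")
        case True
        then obtain p q where pq: "in_row C p (Pos (Suc a))" "in_row C' q (Neg (Suc a))" by (metis in_rowE)
        have "int p - int q \<le> int n - int (Suc a)"
        proof (cases "q < p")
          case True
          then show ?thesis using A pq unfolding cc2_1_def by blast
        qed (use step in simp)
        then show ?thesis
          using rowC(1)[OF pq(1)] rowN'(1)[OF pq(2)] True PS by simp
      next
        case False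
        then show ?thesis using step PS(1)[of a] PS(4)[of a] by (auto split: if_splits)
      qed
    qed
    have ineq: "M - P (Suc a) + 1 > Q' (Suc a) \<Longrightarrow> Pos (Suc a) \<in> set C \<Longrightarrow> Neg (Suc a) \<in> set C' \<Longrightarrow>
       (Pos d \<in> set C \<and> Neg d \<in> set C \<and> P (Suc a) \<le> P d \<and> Q' (Suc a) \<le> Q d \<and> Q d < M - P d + 1 \<longrightarrow>
         P d - P (Suc a) + (Q d - Q' (Suc a)) < int d - int (Suc a)) \<and>
       (Pos d \<in> set C' \<and> Neg d \<in> set C' \<and> M' - P' d \<le> M - P (Suc a) \<and> Q' (Suc a) \<le> Q' d \<and> Q' d < M' - P' d + 1 \<longrightarrow>
         M - P (Suc a) - (M' - P' d) + (Q' d - Q' (Suc a)) < int d - int (Suc a))" for a d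
    proof -
      assume a: "M - P (Suc a) + 1 > Q' (Suc a)" "Pos (Suc a) \<in> set C" "Neg (Suc a) \<in> set C'"
      then obtain p q where pq: "in_row C p (Pos (Suc a))" "in_row C' q (Neg (Suc a))" by (metis in_rowE)
      have pq': "int p = M - P (Suc a) + 1" "int q = Q' (Suc a)" using rowC[OF pq(1)] rowN'[OF pq(2)] by auto
      have cc: "in_row C r (Pos d) \<and> in_row C s (Neg d) \<or> in_row C' r (Pos d) \<and> in_row C' s (Neg d) \<Longrightarrow>
        r \<le> p \<Longrightarrow> s < r \<Longrightarrow> q \<le> s \<Longrightarrow> int p - int r + (int s - int q) < int d - int (Suc a)" for r s
        using A pq pq' a(1) unfolding cc2_2_def by (metis of_nat_less_iff)
      show ?thesis
      proof (intro conjI impI)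
        assume d: "Pos d \<in> set C \<and> Neg d \<in> set C \<and> P (Suc a) \<le> P d \<and> Q' (Suc a) \<le> Q d \<and> Q d < M - P d + 1"
        then obtain r s where rs: "in_row C r (Pos d)" "in_row C s (Neg d)" by (metis in_rowE)
        have "int r = M - P d + 1" "int s = Q d" using rs rowC rowN by blast+
        then show "P d - P (Suc a) + (Q d - Q' (Suc a)) < int d - int (Suc a)"
          using cc[of r s] rs d pq' by linarith
      next
        assume d: "Pos d \<in> set C' \<and> Neg d \<in> set C' \<and> M' - P' d \<le> M - P (Suc a) \<and> Q' (Suc a) \<le> Q' d \<and> Q' d < M' - P' d + 1"
        then obtain r s where rs: "in_row C' r (Pos d)" "in_row C' s (Neg d)" by (metis in_rowE)
        have "int r = M' - P' d + 1" "int s = Q' d" using rs rowC' rowN' by blast+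
        then show "M - P (Suc a) - (M' - P' d) + (Q' d - Q' (Suc a)) < int d - int (Suc a)"
          using cc[of r s] rs d pq' by linarith
      qed
    qed
    have tot: "P d + Q d \<le> M" "P' d + Q' d \<le> M'" if "d \<le> n" for d
      using pos_count_mono[OF that, of C] neg_count_mono[OF that, of C] count_sum[OF l]
        pos_count_mono[OF that, of C'] neg_count_mono[OF that, of C'] count_sum[OF l'] by (auto simp: defs)
    have L1: "P d + Q d - int d \<le> P a + Q' a - int a" if "a \<le> d" "d \<le> n" for a d using that
    proof (induction "d - a" arbitrary: a d rule: less_induct)
      case less
      show ?case
      proof (cases "a = d")
        case True then show ?thesis using R(1)[of a] less by simp
      next
        case False
        then obtain e where e: "d = Suc e" "a \<le> e" using less by (cases d) auto
        have IH: "P d + Q d - int d \<le> P (Suc a) + Q' (Suc a) - int (Suc a)"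
          "P e + Q e - int e \<le> P a + Q' a - int a" using less.hyps[of d "Suc a"] less.hyps[of e a] less.prems e by auto
        show ?thesis
        proof (rule ccontr)
          assume neg: "\<not> ?thesis"
          have a: "Pos (Suc a) \<in> set C" "Neg (Suc a) \<in> set C'"
            using neg IH(1) PS(1)[of a] PS(4)[of a] by (auto split: if_splits)
          have d: "Pos d \<in> set C" "Neg d \<in> set C"
            using neg IH(2) PS(1)[of e] PS(2)[of e] e by (auto split: if_splits)
          have eq: "P d + Q d - int d = P (Suc a) + Q' (Suc a) - int (Suc a)"
            using neg IH(1) a PS(1)[of a] PS(4)[of a] by auto
          \<comment> \<open>A column gains at most one entry per index, so the violation forces
            \<open>Q d\<close> to exceed \<open>Q' a\<close>: the bar of \<open>d\<close> is not
            lower than that of \<open>Suc a\<close>, as (2CC-2) requires of its rows.\<close>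
          have "P d \<le> P a + int (d - a)" unfolding defs by (rule pos_count_le) (use less c in auto)
          then have "\<not> Q d \<le> Q' a" using neg less.prems by (auto simp: of_nat_diff)
          then have "Q' (Suc a) \<le> Q d" using PS(4)[of a] by (auto split: if_splits)
          moreover have "P (Suc a) \<le> P d" unfolding defs by (rule pos_count_mono) (use e in simp)
          ultimately show False using ineq[OF _ a, of d] d eq tot[of d] less.prems by simp
        qed
      qed
    qed
    have L2: "P' d + Q' d - int d - (M' - M) \<le> P a + Q' a - int a" if "a \<le> d" "d \<le> n" for a d using that
    proof (induction "d - a" arbitrary: a d rule: less_induct)
      case less
      show ?case
      proof (cases "a = d")
        case True then show ?thesis using R(2)[of a] less by simp
      next
        case False
        then obtain e where e: "d = Suc e" "a \<le> e" using less by (cases d) auto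
        have IH: "P' d + Q' d - int d - (M' - M) \<le> P (Suc a) + Q' (Suc a) - int (Suc a)"
          "P' e + Q' e - int e - (M' - M) \<le> P a + Q' a - int a" using less.hyps[of d "Suc a"] less.hyps[of e a] less.prems e by auto
        show ?thesis
        proof (rule ccontr)
          assume neg: "\<not> ?thesis"
          have a: "Pos (Suc a) \<in> set C" "Neg (Suc a) \<in> set C'"
            using neg IH(1) PS(1)[of a] PS(4)[of a] by (auto split: if_splits)
          have d: "Pos d \<in> set C'" "Neg d \<in> set C'"
            using neg IH(2) PS(3)[of e] PS(4)[of e] e by (auto split: if_splits)
          have eq: "P' d + Q' d - int d - (M' - M) = P (Suc a) + Q' (Suc a) - int (Suc a)"
            using neg IH(1) a PS(1)[of a] PS(4)[of a] by auto
          have "Q' d \<le> Q' a + int (d - a)" unfolding defs by (rule neg_count_le) (use less c' in auto)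
          then have "\<not> P' d - (M' - M) \<le> P a" using neg less.prems by (auto simp: of_nat_diff)
          then have "M' - P' d \<le> M - P (Suc a)" using PS(1)[of a] by (auto split: if_splits)
          moreover have "Q' (Suc a) \<le> Q' d" unfolding defs by (rule neg_count_mono) (use e in simp)
          ultimately show False using ineq[OF _ a, of d] d eq tot[of d] less.prems by simp
        qed
      qed
    qed
    show "linked n C C'" unfolding linkdef link_def using L1 L2 L3 by (meson order_trans)
  qed
qed

section \<open>Preservation of the inequalities between two adjacent columns\<close>

definition unit_steps :: "nat \<Rightarrow> (nat \<Rightarrow> int) \<Rightarrow> bool" where
  "unit_steps n P \<longleftrightarrow> (\<forall>a<n. P a \<le> P (Suc a) \<and> P (Suc a) \<le> P a + 1)"

lemma linkD:
  assumes "link n M M' P Q P' Q'" "a \<le> d" "d \<le> n"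
  shows "P d + Q d - int d \<le> P a + Q' a - int a"
    "P' d + Q' d - int d - (M' - M) \<le> P a + Q' a - int a" "M - int n \<le> P a + Q' a - int a"
  using assms unfolding link_def by blast+

lemma linkI:
  assumes "\<And>a d. a \<le> d \<Longrightarrow> d \<le> n \<Longrightarrow>
     P d + Q d - int d \<le> P a + Q' a - int a \<and>
     P' d + Q' d - int d - (M' - M) \<le> P a + Q' a - int a \<and>
     M - int n \<le> P a + Q' a - int a"
  shows "link n M M' P Q P' Q'"
  using assms unfolding link_def by blast

lemma link_cong:
  assumes "\<And>a. a \<le> n \<Longrightarrow> P a = R a" "\<And>a. a \<le> n \<Longrightarrow> Q a = S a" "\<And>a. a \<le> n \<Longrightarrow> P' a = R' a" "\<And>a. a \<le> n \<Longrightarrow> Q' a = S' a"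
  shows "link n M M' P Q P' Q' \<longleftrightarrow> link n M M' R S R' S'"
  unfolding link_def by (simp add: assms cong: imp_cong conj_cong)

lemma link_mono:
  assumes L: "link n M M' P Q P' Q'"
    and "\<And>a. a \<le> n \<Longrightarrow> P a + Q' a \<le> R a + S' a" "\<And>a. a \<le> n \<Longrightarrow> R a + S a \<le> P a + Q a"
      "\<And>a. a \<le> n \<Longrightarrow> R' a + S' a \<le> P' a + Q' a"
  shows "link n M M' R S R' S'"
proof (rule linkI)
  fix a d :: nat assume ad: "a \<le> d" "d \<le> n"
  show "R d + S d - int d \<le> R a + S' a - int a \<and>
     R' d + S' d - int d - (M' - M) \<le> R a + S' a - int a \<and> M - int n \<le> R a + S' a - int a"
    using linkD[OF L ad] assms(2)[of a] assms(3)[of d] assms(4)[of d] ad by auto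
qed

text \<open>
  In the lemmas \<open>link_f_\<dots>\<close> and \<open>link_e_\<dots>\<close> below, \<open>i = Suc k\<close> is the index of the operator. The
  hypotheses on counting functions say which of the letters \<open>i, i + 1\<close> and their barred copies occur.
\<close>

lemma link_f_pos_left:
  assumes L: "link n M M' P Q P' Q'" and i: "i = Suc k" "i < n" and S: "unit_steps n P'" "unit_steps n Q'"
    and C: "P i = P k + 1" "P (Suc i) = P i"
    and C': "\<not> (Q' (Suc i) = Q' i + 1 \<and> Q' i = Q' k)" "P' i = P' k + 1 \<Longrightarrow> P' (Suc i) = P' i \<Longrightarrow> Q' i = Q' k + 1"
  shows "link n M M' (P(i := P i - 1)) Q P' Q'"
proof (rule linkI)
  fix a d :: nat assume ad: "a \<le> d" "d \<le> n"
  have S': "Q' k \<le> Q' i" "Q' i \<le> Q' (Suc i)" "Q' (Suc i) \<le> Q' i + 1" "Q' i \<le> Q' k + 1"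
    "P' k \<le> P' i" "P' i \<le> P' (Suc i)" "P' (Suc i) \<le> P' i + 1" "P' i \<le> P' k + 1"
    using S i unfolding unit_steps_def by auto
  let ?P = "P(i := P i - 1)"
  show "?P d + Q d - int d \<le> ?P a + Q' a - int a \<and>
     P' d + Q' d - int d - (M' - M) \<le> ?P a + Q' a - int a \<and> M - int n \<le> ?P a + Q' a - int a"
  proof (cases "a = i")
    case False
    then show ?thesis using linkD[OF L ad] by auto
  next
    case [simp]: True
    \<comment> \<open>If the bound were attained at \<open>i\<close>, the bounds at \<open>k\<close>
      and at \<open>Suc i\<close> would make \<open>Q'\<close> constant before \<open>i\<close> and
      increasing after it: the right column would contain the bar of \<open>Suc i\<close> without
      that of \<open>i\<close>, which \<open>C'\<close> excludes.\<close>
    have str: "X < P i + Q' i - int i"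
      if "X \<le> P k + Q' k - int k" "X \<le> P (Suc i) + Q' (Suc i) - int (Suc i)" "X \<le> P i + Q' i - int i" for X
      using that S' C C'(1) i(1) by linarith
    \<comment> \<open>For \<open>d = i\<close> there is no bound with \<open>a = Suc i\<close>, so
      \<open>str\<close> does not apply; the second assumption \<open>C'\<close> on the right column
      takes its place.\<close>
    have R2: "P' i + Q' i - (M' - M) \<le> P i + Q' i - 1"
    proof (rule ccontr)
      assume neg: "\<not> ?thesis"
      then have "P' i = P' k + 1" "P' (Suc i) = P' i"
        using linkD(2)[OF L, of k k] linkD(2)[OF L, of "Suc i" "Suc i"] linkD(2)[OF L, of i i] i S' C by auto
      then show False using C'(2) C linkD(2)[OF L, of k i] i neg by simp
    qed
    show ?thesis
    proof (cases "d = i")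
      case True
      then show ?thesis using R2 linkD(1)[OF L, of i i] i str[OF linkD(3)[OF L, of k i] linkD(3)[OF L, of "Suc i" "Suc i"] linkD(3)[OF L, of i i]]
        by simp
    next
      case False
      with ad have d: "Suc i \<le> d" "i \<le> d" "k \<le> d" using i by auto
      show ?thesis using d ad False
        str[OF linkD(1)[OF L d(3) ad(2)] linkD(1)[OF L d(1) ad(2)] linkD(1)[OF L d(2) ad(2)]]
        str[OF linkD(2)[OF L d(3) ad(2)] linkD(2)[OF L d(1) ad(2)] linkD(2)[OF L d(2) ad(2)]]
        str[OF linkD(3)[OF L d(3) ad(2)] linkD(3)[OF L d(1) ad(2)] linkD(3)[OF L d(2) ad(2)]]
        by simp
    qed
  qed
qed

text \<open>Only the first inequality with \<open>d = i\<close> becomes sharper, so it has to be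
  strict beforehand. Were it an equality, the bound for \<open>d = Suc i\<close> would exclude
  \<open>Suc i\<close> from the left column, and with it \<open>i\<close>. Then the bound for
  \<open>d = k\<close> is violated if \<open>a < i\<close>, and \<open>a = i\<close> leads to the
  pattern that \<open>C'\<close> excludes.\<close>

lemma link_f_neg_left:
  assumes L: "link n M M' P Q P' Q'" and i: "i = Suc k" "i < n"
    and S: "unit_steps n P" "unit_steps n Q'"
    and C: "Q (Suc i) = Q i + 1" "Q i = Q k" "P i = P k + 1 \<Longrightarrow> P (Suc i) = P i + 1"
    and C': "P (Suc i) = P i \<Longrightarrow> \<not> (Q' (Suc i) = Q' i + 1 \<and> Q' i = Q' k)"
  shows "link n M M' P (Q(i := Q i + 1)) P' Q'"
proof (rule linkI)
  fix a d :: nat assume ad: "a \<le> d" "d \<le> n"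
  have S': "Q' k \<le> Q' i" "Q' i \<le> Q' (Suc i)" "Q' (Suc i) \<le> Q' i + 1" "Q' i \<le> Q' k + 1"
    "P k \<le> P i" "P i \<le> P (Suc i)" "P (Suc i) \<le> P i + 1" "P i \<le> P k + 1"
    using S i unfolding unit_steps_def by auto
  let ?Q = "Q(i := Q i + 1)"
  show "P d + ?Q d - int d \<le> P a + Q' a - int a \<and>
     P' d + Q' d - int d - (M' - M) \<le> P a + Q' a - int a \<and> M - int n \<le> P a + Q' a - int a"
  proof (cases "d = i")
    case False
    then show ?thesis using linkD[OF L ad] by simp
  next
    case [simp]: True
    have "P i + Q i - int i < P a + Q' a - int a"
    proof (rule ccontr)
      assume neg: "\<not> ?thesis"
      have 1: "P (Suc i) = P i" using neg linkD(1)[OF L, of a "Suc i"] ad i C S' by simp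
      then have 2: "P i = P k" using C S' by linarith
      show False
      proof (cases "a = i")
        case True
        then have "Q' i = Q i" using neg linkD(1)[OF L, of i i] i by simp
        then show False using 1 C'[OF 1] C S' i linkD(1)[OF L, of k k] linkD(1)[OF L, of "Suc i" "Suc i"] by simp
      next
        case False
        then show False using 2 C neg linkD(1)[OF L, of a k] ad i by simp
      qed
    qed
    then show ?thesis using linkD[OF L ad] by simp
  qed
qed

text \<open>For \<open>a = i\<close> the right sides grow as well. At stake is only the second
  inequality with \<open>a < i\<close> and \<open>d = i\<close>, which is strict by comparison with
  \<open>d = Suc i\<close> and \<open>d = k\<close>.\<close>

lemma link_f_neg_right:
  assumes L: "link n M M' P Q P' Q'" and i: "i = Suc k" "i < n"
    and S: "unit_steps n P'"
    and C': "Q' (Suc i) = Q' i + 1" "Q' i = Q' k" "P' i = P' k + 1 \<Longrightarrow> P' (Suc i) = P' i + 1"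
  shows "link n M M' P Q P' (Q'(i := Q' i + 1))"
proof (rule linkI)
  fix a d :: nat assume ad: "a \<le> d" "d \<le> n"
  have S': "P' k \<le> P' i" "P' i \<le> P' (Suc i)" "P' (Suc i) \<le> P' i + 1" "P' i \<le> P' k + 1"
    using S i unfolding unit_steps_def by auto
  let ?Q = "Q'(i := Q' i + 1)"
  have "P' i + Q' i - int i - (M' - M) < P a + Q' a - int a" if "a < i"
  proof (rule ccontr)
    assume neg: "\<not> ?thesis"
    have 1: "P' (Suc i) = P' i" using neg linkD(2)[OF L, of a "Suc i"] that i C' S' by simp
    then have 2: "P' i = P' k" using C' S' by linarith
    then show False using 2 C' neg linkD(2)[OF L, of a k] that i by simp
  qed
  then show "P d + Q d - int d \<le> P a + ?Q a - int a \<and>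
     P' d + ?Q d - int d - (M' - M) \<le> P a + ?Q a - int a \<and> M - int n \<le> P a + ?Q a - int a"
    using linkD[OF L ad] ad by (cases "a = i"; cases "d = i") auto
qed

lemma link_e_pos_left:
  assumes L: "link n M M' P Q P' Q'" and i: "i = Suc k" "i < n"
    and S: "unit_steps n Q"
    and C: "P (Suc i) = P i + 1" "P i = P k" "Q i = Q k + 1 \<Longrightarrow> Q (Suc i) = Q i + 1"
  shows "link n M M' (P(i := P i + 1)) Q P' Q'"
proof (rule linkI)
  fix a d :: nat assume ad: "a \<le> d" "d \<le> n"
  have S': "Q k \<le> Q i" "Q i \<le> Q (Suc i)" "Q (Suc i) \<le> Q i + 1" "Q i \<le> Q k + 1"
    using S i unfolding unit_steps_def by auto
  let ?P = "P(i := P i + 1)"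
  have "P i + Q i - int i < P a + Q' a - int a" if "a < i"
  proof (rule ccontr)
    assume neg: "\<not> ?thesis"
    have 1: "Q (Suc i) = Q i" using neg linkD(1)[OF L, of a "Suc i"] that i C S' by simp
    then have 2: "Q i = Q k" using C S' by linarith
    then show False using 2 C neg linkD(1)[OF L, of a k] that i by simp
  qed
  then show "?P d + Q d - int d \<le> ?P a + Q' a - int a \<and>
     P' d + Q' d - int d - (M' - M) \<le> ?P a + Q' a - int a \<and> M - int n \<le> ?P a + Q' a - int a"
    using linkD[OF L ad] ad by (cases "a = i"; cases "d = i") auto
qed

text \<open>Mirror image of \<open>link_f_neg_left\<close>: the two columns and the two counting
  functions exchange their roles.\<close>

lemma link_e_pos_right:
  assumes L: "link n M M' P Q P' Q'" and i: "i = Suc k" "i < n"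
    and S: "unit_steps n P" "unit_steps n Q'"
    and C': "P' (Suc i) = P' i + 1" "P' i = P' k" "Q' i = Q' k + 1 \<Longrightarrow> Q' (Suc i) = Q' i + 1"
    and C: "Q' (Suc i) = Q' i \<Longrightarrow> \<not> (P (Suc i) = P i + 1 \<and> P i = P k)"
  shows "link n M M' P Q (P'(i := P' i + 1)) Q'"
proof (rule linkI)
  fix a d :: nat assume ad: "a \<le> d" "d \<le> n"
  have S': "Q' k \<le> Q' i" "Q' i \<le> Q' (Suc i)" "Q' (Suc i) \<le> Q' i + 1" "Q' i \<le> Q' k + 1"
    "P k \<le> P i" "P i \<le> P (Suc i)" "P (Suc i) \<le> P i + 1" "P i \<le> P k + 1"
    using S i unfolding unit_steps_def by auto
  let ?P = "P'(i := P' i + 1)"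
  show "P d + Q d - int d \<le> P a + Q' a - int a \<and>
     ?P d + Q' d - int d - (M' - M) \<le> P a + Q' a - int a \<and> M - int n \<le> P a + Q' a - int a"
  proof (cases "d = i")
    case False
    then show ?thesis using linkD[OF L ad] by simp
  next
    case [simp]: True
    have "P' i + Q' i - int i - (M' - M) < P a + Q' a - int a"
    proof (rule ccontr)
      assume neg: "\<not> ?thesis"
      have 1: "Q' (Suc i) = Q' i" using neg linkD(2)[OF L, of a "Suc i"] ad i C' S' by simp
      then have 2: "Q' i = Q' k" using C' S' by linarith
      show False
      proof (cases "a = i")
        case True
        then have "P i = P' i - (M' - M)" using neg linkD(2)[OF L, of i i] i by simp
        then show False using 1 C[OF 1] C' S' i linkD(2)[OF L, of k k] linkD(2)[OF L, of "Suc i" "Suc i"] by simp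
      next
        case False
        then show False using 2 C' neg linkD(2)[OF L, of a k] ad i by simp
      qed
    qed
    then show ?thesis using linkD[OF L ad] by simp
  qed
qed

text \<open>Mirror image of \<open>link_f_pos_left\<close>, except for \<open>R\<close>, which
  provides for a half-column on the right. There the unbarred count changes at \<open>i\<close> as
  well, but its sum with the new barred count is \<open>i\<close>. As the length is
  \<open>n\<close>, the second inequality with \<open>d = i\<close> then reduces to the
  third.\<close>

lemma link_e_neg_right:
  assumes L: "link n M M' P Q P' Q'" and i: "i = Suc k" "i < n"
    and S: "unit_steps n P" "unit_steps n Q" "unit_steps n Q'"
    and C': "Q' i = Q' k + 1" "Q' (Suc i) = Q' i"
    and C: "\<not> (P (Suc i) = P i + 1 \<and> P i = P k)" "Q i = Q k + 1 \<Longrightarrow> Q (Suc i) = Q i \<Longrightarrow> P i = P k + 1"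
    and R: "R = P' \<or> M' = int n \<and> R i + Q' i - 1 = int i \<and> (\<forall>a. a \<noteq> i \<longrightarrow> R a = P' a)"
  shows "link n M M' P Q R (Q'(i := Q' i - 1))"
proof (rule linkI)
  fix a d :: nat assume ad: "a \<le> d" "d \<le> n"
  have S': "Q' k \<le> Q' i" "Q' i \<le> Q' (Suc i)" "Q' (Suc i) \<le> Q' i + 1" "Q' i \<le> Q' k + 1"
    "P k \<le> P i" "P i \<le> P (Suc i)" "P (Suc i) \<le> P i + 1" "P i \<le> P k + 1"
    "Q k \<le> Q i" "Q i \<le> Q (Suc i)" "Q (Suc i) \<le> Q i + 1" "Q i \<le> Q k + 1"
    using S i unfolding unit_steps_def by auto
  let ?Q = "Q'(i := Q' i - 1)"
  have str: "X < P i + Q' i - int i"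
    if "X \<le> P k + Q' k - int k" "X \<le> P (Suc i) + Q' (Suc i) - int (Suc i)" "X \<le> P i + Q' i - int i" for X
    using that S' C(1) C' i(1) by linarith
  have str3: "M - int n < P i + Q' i - int i"
    using str[OF linkD(3)[OF L, of k i] linkD(3)[OF L, of "Suc i" "Suc i"] linkD(3)[OF L, of i i]] i by simp
  have R1: "Q i < Q' i"
  proof (rule ccontr)
    assume neg: "\<not> ?thesis"
    then have "Q i = Q k + 1" "Q (Suc i) = Q i"
      using linkD(1)[OF L, of k k] linkD(1)[OF L, of "Suc i" "Suc i"] linkD(1)[OF L, of i i] i S' C' by auto
    then show False using C(2) C' linkD(1)[OF L, of k i] i neg by simp
  qed
  have "P d + Q d - int d \<le> P a + ?Q a - int a \<and>
     P' d + ?Q d - int d - (M' - M) \<le> P a + ?Q a - int a \<and> M - int n \<le> P a + ?Q a - int a"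
  proof (cases "a = i")
    case False
    then show ?thesis using linkD[OF L ad] by auto
  next
    case [simp]: True
    show ?thesis
    proof (cases "d = i")
      case True
      then show ?thesis using R1 linkD(2)[OF L, of i i] i str3 by simp
    next
      case False
      with ad have d: "Suc i \<le> d" "i \<le> d" "k \<le> d" using i by auto
      show ?thesis using d ad False
        str[OF linkD(1)[OF L d(3) ad(2)] linkD(1)[OF L d(1) ad(2)] linkD(1)[OF L d(2) ad(2)]]
        str[OF linkD(2)[OF L d(3) ad(2)] linkD(2)[OF L d(1) ad(2)] linkD(2)[OF L d(2) ad(2)]]
        str3 by simp
    qed
  qed
  then show "P d + Q d - int d \<le> P a + ?Q a - int a \<and>
     R d + ?Q d - int d - (M' - M) \<le> P a + ?Q a - int a \<and> M - int n \<le> P a + ?Q a - int a"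
    using R by (cases "d = i") auto
qed

text \<open>For \<open>a = n\<close> only \<open>d = n\<close> is left, where the totals are at most
  the lengths. Hence the single strict inequality \<open>M + 1 \<le> P n + Q' n\<close> gives
  everything; it comes from the bounds at \<open>n\<close> and at \<open>k\<close>.\<close>

lemma link_f_pos_left_top:
  assumes L: "link n M M' P Q P' Q'" and n: "n = Suc k"
    and M: "P n + Q n \<le> M" "P' n + Q' n \<le> M'"
    and C: "P n = P k + 1"
    and C': "Q' n = Q' k + 1 \<or> Q' n = Q' k \<and> P' n = P' k \<and> M' = P' n + Q' n"
  shows "link n M M' (P(n := P n - 1)) Q P' Q'"
proof (rule linkI)
  fix a d :: nat assume ad: "a \<le> d" "d \<le> n"
  have "M + 1 \<le> P n + Q' n"
  proof (rule ccontr)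
    assume "\<not> ?thesis"
    then show False using C C' linkD(3)[OF L, of n n] linkD(3)[OF L, of k k] linkD(2)[OF L, of k k] n by auto
  qed
  then show "(P(n := P n - 1)) d + Q d - int d \<le> (P(n := P n - 1)) a + Q' a - int a \<and>
     P' d + Q' d - int d - (M' - M) \<le> (P(n := P n - 1)) a + Q' a - int a \<and> M - int n \<le> (P(n := P n - 1)) a + Q' a - int a"
    using linkD[OF L ad] ad M by (cases "a = n"; cases "d = n") auto
qed

text \<open>The assumption holds when the column contains \<open>Zero\<close>: replacing it keeps
  the total at \<open>n\<close> within the length, and the new inequality for \<open>d = n\<close>
  follows from the third one. The next three lemmas rest on the same remark.\<close>

lemma link_neg_left_top:
  assumes L: "link n M M' P Q P' Q'" and "P n + Q n + 1 \<le> M"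
  shows "link n M M' P (Q(n := Q n + 1)) P' Q'"
proof (rule linkI)
  fix a d :: nat assume ad: "a \<le> d" "d \<le> n"
  show "P d + (Q(n := Q n + 1)) d - int d \<le> P a + Q' a - int a \<and>
     P' d + Q' d - int d - (M' - M) \<le> P a + Q' a - int a \<and> M - int n \<le> P a + Q' a - int a"
    using linkD[OF L ad] ad assms(2) by (cases "d = n") auto
qed

lemma link_neg_right_top:
  assumes L: "link n M M' P Q P' Q'" and "P' n + Q' n + 1 \<le> M'"
  shows "link n M M' P Q P' (Q'(n := Q' n + 1))"
proof (rule linkI)
  fix a d :: nat assume ad: "a \<le> d" "d \<le> n"
  show "P d + Q d - int d \<le> P a + (Q'(n := Q' n + 1)) a - int a \<and>
     P' d + (Q'(n := Q' n + 1)) d - int d - (M' - M) \<le> P a + (Q'(n := Q' n + 1)) a - int a \<and>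
     M - int n \<le> P a + (Q'(n := Q' n + 1)) a - int a"
    using linkD[OF L ad] ad assms(2) by (cases "d = n"; cases "a = n") auto
qed

lemma link_pos_left_top:
  assumes L: "link n M M' P Q P' Q'" and "P n + Q n + 1 \<le> M"
  shows "link n M M' (P(n := P n + 1)) Q P' Q'"
proof (rule linkI)
  fix a d :: nat assume ad: "a \<le> d" "d \<le> n"
  show "(P(n := P n + 1)) d + Q d - int d \<le> (P(n := P n + 1)) a + Q' a - int a \<and>
     P' d + Q' d - int d - (M' - M) \<le> (P(n := P n + 1)) a + Q' a - int a \<and>
     M - int n \<le> (P(n := P n + 1)) a + Q' a - int a"
    using linkD[OF L ad] ad assms(2) by (cases "d = n"; cases "a = n") auto
qed

lemma link_pos_right_top:
  assumes L: "link n M M' P Q P' Q'" and "P' n + Q' n + 1 \<le> M'"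
  shows "link n M M' P Q (P'(n := P' n + 1)) Q'"
proof (rule linkI)
  fix a d :: nat assume ad: "a \<le> d" "d \<le> n"
  show "P d + Q d - int d \<le> P a + Q' a - int a \<and>
     (P'(n := P' n + 1)) d + Q' d - int d - (M' - M) \<le> P a + Q' a - int a \<and>
     M - int n \<le> P a + Q' a - int a"
    using linkD[OF L ad] ad assms(2) by (cases "d = n"; cases "a = n") auto
qed

text \<open>Mirror image of \<open>link_f_pos_left_top\<close>. The function \<open>R\<close> again
  provides for a half-column, where \<open>n\<close> itself replaces its bar, so that the unbarred
  count changes at \<open>n\<close>.\<close>

lemma link_e_neg_right_top:
  assumes L: "link n M M' P Q P' Q'" and n: "n = Suc k"
    and S: "unit_steps n P"
    and M: "P n + Q n \<le> M" "R n + Q' n - 1 \<le> M'"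
    and C': "Q' n = Q' k + 1"
    and C: "P n = P k \<Longrightarrow> M = P n + Q n \<and> Q n = Q k"
    and R: "\<And>a. a \<noteq> n \<Longrightarrow> R a = P' a"
  shows "link n M M' P Q R (Q'(n := Q' n - 1))"
proof (rule linkI)
  fix a d :: nat assume ad: "a \<le> d" "d \<le> n"
  have S': "P k \<le> P n" "P n \<le> P k + 1" using S n unfolding unit_steps_def by auto
  have "M + 1 \<le> P n + Q' n"
  proof (rule ccontr)
    assume "\<not> ?thesis"
    then show False using C C' S' linkD(3)[OF L, of n n] linkD(3)[OF L, of k k] linkD(1)[OF L, of k k] n by auto
  qed
  then show "P d + Q d - int d \<le> P a + (Q'(n := Q' n - 1)) a - int a \<and>
     R d + (Q'(n := Q' n - 1)) d - int d - (M' - M) \<le> P a + (Q'(n := Q' n - 1)) a - int a \<and>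
     M - int n \<le> P a + (Q'(n := Q' n - 1)) a - int a"
    using linkD[OF L ad] ad M R[of d] by (cases "a = n"; cases "d = n") auto
qed

section \<open>Signatures of words and columns\<close>

definition factor_signs :: "nat \<Rightarrow> nat \<Rightarrow> factor \<Rightarrow> sign list" where
  "factor_signs n i x = replicate (string_length (factor_e n i) x) Minus @ replicate (string_length (factor_f n i) x) Plus"

lemma word_signs_alt:
  "word_signs n i w = concat (map (\<lambda>p. map (\<lambda>s. (s, p)) (factor_signs n i (w ! p))) [0..<length w])"
  by (simp add: word_signs_def factor_signs_def map_replicate_const)

lemma word_signs_append:
  "word_signs n i (u @ v) = word_signs n i u @ map (\<lambda>(s, p). (s, length u + p)) (word_signs n i v)"
proof -
  have "concat (map (\<lambda>p. map (\<lambda>s. (s, p)) (factor_signs n i ((u @ v) ! p))) [length u..<length u + length v]) =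
    map (\<lambda>(s, p). (s, length u + p)) (word_signs n i v)"
    unfolding word_signs_alt map_concat
    by (rule arg_cong[where f = concat], rule nth_equalityI) (auto simp: nth_append)
  moreover have "concat (map (\<lambda>p. map (\<lambda>s. (s, p)) (factor_signs n i ((u @ v) ! p))) [0..<length u]) = word_signs n i u"
    unfolding word_signs_alt by (rule arg_cong[where f = concat]) (auto simp: nth_append)
  ultimately show ?thesis
    unfolding word_signs_alt[of n i "u @ v"] using upt_add_eq_append[of 0 "length u" "length v"] by simp
qed

lemma word_signs_bound: "(s, p) \<in> set (word_signs n i w) \<Longrightarrow> p < length w"
  by (auto simp: word_signs_alt)

definition word_eps :: "nat \<Rightarrow> nat \<Rightarrow> factor list \<Rightarrow> nat" where
  "word_eps n i w = length (remaining Minus (word_signs n i w))"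

definition word_phi :: "nat \<Rightarrow> nat \<Rightarrow> factor list \<Rightarrow> nat" where
  "word_phi n i w = length (remaining Plus (word_signs n i w))"

text \<open>\<open>acts Plus\<close> and \<open>acts Minus\<close> locate the factor that \<open>f\<^sub>i\<close> and \<open>e\<^sub>i\<close> change.\<close>

fun acts :: "sign \<Rightarrow> nat \<Rightarrow> nat \<Rightarrow> factor list \<Rightarrow> nat \<Rightarrow> bool" where
  "acts Plus n i w p \<longleftrightarrow> remaining Plus (word_signs n i w) \<noteq> [] \<and> hd (remaining Plus (word_signs n i w)) = p"
| "acts Minus n i w p \<longleftrightarrow> remaining Minus (word_signs n i w) \<noteq> [] \<and> last (remaining Minus (word_signs n i w)) = p"

lemma remaining_shift:
  "remaining s (map (\<lambda>(t, p). (t, k + p)) ss) = map ((+) k) (remaining s (ss :: (sign \<times> nat) list))"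
  using remaining_map[of s "(+) k" ss] by simp

text \<open>If \<open>f\<close> acts in \<open>v\<close>, all pluses of \<open>u\<close> have been
  absorbed by \<open>v\<close>; if \<open>e\<close> acts in \<open>u\<close>, all minuses of
  \<open>v\<close> have been absorbed by \<open>u\<close>. The resulting comparisons carry
  information about the neighbouring column into the stability proofs.\<close>

lemma acts_append:
  "acts Plus n i (u @ v) p \<Longrightarrow> p < length u \<Longrightarrow> acts Plus n i u p"
  "acts Plus n i (u @ v) p \<Longrightarrow> \<not> p < length u \<Longrightarrow> acts Plus n i v (p - length u) \<and> word_phi n i u \<le> word_eps n i v"
  "acts Minus n i (u @ v) p \<Longrightarrow> p < length u \<Longrightarrow> acts Minus n i u p \<and> word_eps n i v \<le> word_phi n i u"
  "acts Minus n i (u @ v) p \<Longrightarrow> \<not> p < length u \<Longrightarrow> acts Minus n i v (p - length u)"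
proof -
  define Pu Mu Pv Mv where defs: "Pu = remaining Plus (word_signs n i u)" "Mu = remaining Minus (word_signs n i u)"
    "Pv = remaining Plus (word_signs n i v)" "Mv = remaining Minus (word_signs n i v)"
  have Plus: "remaining Plus (word_signs n i (u @ v)) = take (length Pu - length Mv) Pu @ map ((+) (length u)) Pv"
    by (simp add: word_signs_append remaining_Plus_append remaining_shift defs)
  have Minus: "remaining Minus (word_signs n i (u @ v)) = Mu @ map ((+) (length u)) (drop (length Pu) Mv)"
    by (simp add: word_signs_append remaining_Minus_append remaining_shift defs drop_map)
  have b: "\<And>p. p \<in> set Pu \<Longrightarrow> p < length u" "\<And>p. p \<in> set Mu \<Longrightarrow> p < length u"
    unfolding defs by (auto dest!: set_remaining word_signs_bound)
  show "acts Plus n i u p" if "acts Plus n i (u @ v) p" "p < length u"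
  proof (cases "take (length Pu - length Mv) Pu")
    case Nil
    then have "remaining Plus (word_signs n i (u @ v)) = map ((+) (length u)) Pv" using Plus by simp
    then show ?thesis using that by (cases Pv) auto
  next
    case (Cons q qs)
    then have "Pu \<noteq> []" "hd Pu = q" by (metis take_Nil list.distinct(1), metis hd_take list.sel(1) take_eq_Nil2 list.distinct(1) gr0I)
    then show ?thesis using that Cons Plus by (simp flip: defs)
  qed
  show "acts Plus n i v (p - length u) \<and> word_phi n i u \<le> word_eps n i v" if "acts Plus n i (u @ v) p" "\<not> p < length u"
  proof (cases "take (length Pu - length Mv) Pu")
    case Nil
    then have "remaining Plus (word_signs n i (u @ v)) = map ((+) (length u)) Pv" using Plus by simp
    then show ?thesis using that Nil by (cases Pv) (auto simp: word_phi_def word_eps_def simp flip: defs)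
  next
    case (Cons q qs)
    then have "q \<in> set Pu" by (metis in_set_takeD list.set_intros(1))
    then show ?thesis using that Cons Plus b by auto
  qed
  show "acts Minus n i u p \<and> word_eps n i v \<le> word_phi n i u" if "acts Minus n i (u @ v) p" "p < length u"
  proof (cases "drop (length Pu) Mv")
    case Nil
    then show ?thesis using that Minus by (auto simp: word_phi_def word_eps_def simp flip: defs)
  next
    case (Cons q qs)
    then have "last (remaining Minus (word_signs n i (u @ v))) \<ge> length u"
      unfolding Minus by (auto simp: last_map)
    then show ?thesis using that by simp
  qed
  show "acts Minus n i v (p - length u)" if "acts Minus n i (u @ v) p" "\<not> p < length u"
  proof (cases "drop (length Pu) Mv")
    case Nil
    then have "p \<in> set Mu" using that Minus by auto
    then show ?thesis using b that by auto
  next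
    case (Cons q qs)
    then have *: "last (remaining Minus (word_signs n i (u @ v))) = length u + last (drop (length Pu) Mv)"
      unfolding Minus by (simp add: last_map)
    have "length Pu < length Mv" using Cons by (metis drop_all list.distinct(1) not_le)
    then have "Mv \<noteq> []" "last (drop (length Pu) Mv) = last Mv" by (auto simp: last_drop)
    then show ?thesis using that * by (auto simp flip: defs)
  qed
qed

lemma acts_middle:
  assumes "acts s n i (u @ v @ w) p" "length u \<le> p" "p < length u + length v"
  shows "acts s n i v (p - length u)"
proof (cases s)
  case Plus
  then show ?thesis using acts_append(2)[of n i u "v @ w" p] acts_append(1)[of n i v w "p - length u"] assms by auto
next
  case Minus
  then show ?thesis using acts_append(4)[of n i u "v @ w" p] acts_append(3)[of n i v w "p - length u"] assms by auto
qed

lemma acts_bound: "acts s n i w p \<Longrightarrow> p < length w"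
proof (cases s)
  case Plus
  then show "acts s n i w p \<Longrightarrow> p < length w" by (auto dest!: hd_in_set set_remaining word_signs_bound)
next
  case Minus
  then show "acts s n i w p \<Longrightarrow> p < length w" by (auto dest!: last_in_set set_remaining word_signs_bound)
qed

section \<open>Signatures of single columns\<close>

definition letter_signs :: "nat \<Rightarrow> nat \<Rightarrow> letter list \<Rightarrow> (sign \<times> letter) list" where
  "letter_signs n i D = concat (map (\<lambda>x. replicate (letter_eps n i x) (Minus, x) @ replicate (letter_phi n i x) (Plus, x)) D)"

lemma letter_signs_word:
  "letter_signs n i D = map (\<lambda>(s, p). (s, D ! p)) (word_signs n i (map Vec D))"
proof -
  have "map (\<lambda>x. replicate (letter_eps n i x) (Minus, x) @ replicate (letter_phi n i x) (Plus, x)) D =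
    map (map (\<lambda>(s, p). (s, D ! p))) (map (\<lambda>p. map (\<lambda>s. (s, p)) (factor_signs n i (map Vec D ! p))) [0..<length (map Vec D)])"
    by (rule nth_equalityI) (auto simp: factor_signs_def)
  then show ?thesis unfolding letter_signs_def word_signs_alt map_concat by simp
qed

lemma remaining_letter_signs:
  "remaining s (letter_signs n i D) = map ((!) D) (remaining s (word_signs n i (map Vec D)))"
  unfolding letter_signs_word by (rule remaining_map)

lemma word_eps_Vec: "word_eps n i (map Vec D) = length (remaining Minus (letter_signs n i D))"
  by (simp add: word_eps_def remaining_letter_signs)

lemma word_phi_Vec: "word_phi n i (map Vec D) = length (remaining Plus (letter_signs n i D))"
  by (simp add: word_phi_def remaining_letter_signs)

lemma acts_Vec:
  "acts Plus n i (map Vec D) p \<Longrightarrow> remaining Plus (letter_signs n i D) \<noteq> [] \<and> hd (remaining Plus (letter_signs n i D)) = D ! p"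
  "acts Minus n i (map Vec D) p \<Longrightarrow> remaining Minus (letter_signs n i D) \<noteq> [] \<and> last (remaining Minus (letter_signs n i D)) = D ! p"
  by (auto simp: remaining_letter_signs hd_map last_map)

lemma letter_signs_filter:
  assumes "\<And>x. x \<in> set D \<Longrightarrow> \<not> R x \<Longrightarrow> letter_eps n i x = 0 \<and> letter_phi n i x = 0"
  shows "letter_signs n i D = letter_signs n i (filter R D)"
  using assms by (induction D) (auto simp: letter_signs_def)

lemma sorted_count_list_unique:
  assumes "sorted xs" "sorted ys" "\<And>x. count_list xs x = count_list ys (x :: 'a :: linorder)"
  shows "xs = ys"
  using assms properties_for_sort[of ys xs] properties_for_sort[of xs xs]
  by (metis count_mset multiset_eqI)

lemma count_list_filter: "count_list (filter R D) x = (if R x then count_list D x else 0)"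
  by (induction D) auto

lemma sorted_rev_column: "column_ok C \<Longrightarrow> sorted (rev C)"
  using column_ok_sorted by (simp add: sorted_wrt_rev)

lemma letter_signs_column:
  assumes "column_ok C" "i < n"
  shows "letter_signs n i (rev C) =
    (if Pos i \<in> set C then [(Plus, Pos i)] else []) @ (if Pos (i + 1) \<in> set C then [(Minus, Pos (i + 1))] else []) @
    (if Neg (i + 1) \<in> set C then [(Plus, Neg (i + 1))] else []) @ (if Neg i \<in> set C then [(Minus, Neg i)] else [])"
proof -
  let ?R = "\<lambda>x. x = Pos i \<or> x = Pos (i + 1) \<or> x = Neg (i + 1) \<or> x = Neg i"
  let ?E = "(if Pos i \<in> set C then [Pos i] else []) @ (if Pos (i + 1) \<in> set C then [Pos (i + 1)] else []) @
    (if Neg (i + 1) \<in> set C then [Neg (i + 1)] else []) @ (if Neg i \<in> set C then [Neg i] else [])"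
  have "filter ?R (rev C) = ?E"
  proof (rule sorted_count_list_unique)
    show "sorted (filter ?R (rev C))" by (rule sorted_wrt_filter) (rule sorted_rev_column[OF assms(1)])
    show "count_list (filter ?R (rev C)) x = count_list ?E x" for x
      by (cases x) (auto simp: count_list_filter column_ok_count[OF assms(1)] count_list_0_iff)
  qed auto
  moreover have "letter_signs n i (rev C) = letter_signs n i (filter ?R (rev C))"
    by (rule letter_signs_filter) (use assms(2) in \<open>auto simp: letter_eps_def letter_phi_def\<close>)
  ultimately show ?thesis using assms(2)
    by (simp add: letter_signs_def letter_eps_def letter_phi_def)
qed

lemma letter_signs_column_top:
  assumes "column_ok C"
  shows "letter_signs n n (rev C) =
    (if Pos n \<in> set C then [(Plus, Pos n), (Plus, Pos n)] else []) @
    concat (replicate (count_list C Zero) [(Minus, Zero), (Plus, Zero)]) @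
    (if Neg n \<in> set C then [(Minus, Neg n), (Minus, Neg n)] else [])"
proof -
  let ?R = "\<lambda>x. x = Pos n \<or> x = Zero \<or> x = Neg n"
  let ?E = "(if Pos n \<in> set C then [Pos n] else []) @ replicate (count_list C Zero) Zero @
    (if Neg n \<in> set C then [Neg n] else [])"
  have rep: "count_list (replicate k Zero) x = (if x = Zero then k else 0)" for k x
    by (induction k) auto
  have "filter ?R (rev C) = ?E"
  proof (rule sorted_count_list_unique)
    show "sorted (filter ?R (rev C))" by (rule sorted_wrt_filter) (rule sorted_rev_column[OF assms(1)])
    show "count_list (filter ?R (rev C)) x = count_list ?E x" for x
      by (cases x) (auto simp: count_list_filter column_ok_count[OF assms(1)] count_list_0_iff rep)
  qed (auto simp: sorted_append)
  moreover have "letter_signs n n (rev C) = letter_signs n n (filter ?R (rev C))"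
    by (rule letter_signs_filter) (auto simp: letter_eps_def letter_phi_def)
  ultimately show ?thesis
    by (simp add: letter_signs_def letter_eps_def letter_phi_def numeral_2_eq_2)
qed

text \<open>The plus of each zero cancels against the minus of the next one, so a run of zeros
  behaves like a single zero.\<close>

lemma remaining_zeros:
  "remaining Minus (concat (replicate k [(Minus, x), (Plus, x)])) = (if k = 0 then [] else [x])"
  "remaining Plus (concat (replicate k [(Minus, x), (Plus, x)])) = (if k = 0 then [] else [x])"
proof -
  have "remaining Minus (concat (replicate k [(Minus, x), (Plus, x)])) = (if k = 0 then [] else [x]) \<and>
    remaining Plus (concat (replicate k [(Minus, x), (Plus, x)])) = (if k = 0 then [] else [x])"
    by (induction k) auto
  then show "remaining Minus (concat (replicate k [(Minus, x), (Plus, x)])) = (if k = 0 then [] else [x])"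
    "remaining Plus (concat (replicate k [(Minus, x), (Plus, x)])) = (if k = 0 then [] else [x])" by auto
qed

text \<open>The clauses on \<open>word_eps\<close> are recorded for the sake of
  \<open>acts_append\<close>: where it vanishes, a column read before this one cannot have a
  remaining plus.\<close>

lemma acts_Plus_column:
  assumes "column_ok C" "i < n" "acts Plus n i (map Vec (rev C)) p"
  defines "x \<equiv> rev C ! p"
  shows "x = Pos i \<and> Pos i \<in> set C \<and> Pos (Suc i) \<notin> set C \<and> word_eps n i (map Vec (rev C)) = 0 \<or>
    x = Neg (Suc i) \<and> Neg (Suc i) \<in> set C \<and> Neg i \<notin> set C \<and> (Pos i \<in> set C \<longrightarrow> Pos (Suc i) \<in> set C) \<and>
      (Pos (Suc i) \<notin> set C \<longrightarrow> word_eps n i (map Vec (rev C)) = 0)"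
  using acts_Vec(1)[OF assms(3)] unfolding x_def[symmetric] word_eps_Vec letter_signs_column[OF assms(1,2)]
  by (auto split: if_splits)

lemma acts_Minus_column:
  assumes "column_ok C" "i < n" "acts Minus n i (map Vec (rev C)) p"
  defines "x \<equiv> rev C ! p"
  shows "x = Neg i \<and> Neg i \<in> set C \<and> Neg (Suc i) \<notin> set C \<and> word_phi n i (map Vec (rev C)) = 0 \<or>
    x = Pos (Suc i) \<and> Pos (Suc i) \<in> set C \<and> Pos i \<notin> set C \<and> (Neg i \<in> set C \<longrightarrow> Neg (Suc i) \<in> set C) \<and>
      (Neg (Suc i) \<notin> set C \<longrightarrow> word_phi n i (map Vec (rev C)) = 0)"
  using acts_Vec(2)[OF assms(3)] unfolding x_def[symmetric] word_phi_Vec letter_signs_column[OF assms(1,2)]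
  by (auto split: if_splits)

lemma word_phi_column_0:
  assumes "column_ok C" "i < n" "word_phi n i (map Vec (rev C)) = 0"
  shows "\<not> (Neg (Suc i) \<in> set C \<and> Neg i \<notin> set C)" "Pos i \<in> set C \<Longrightarrow> Pos (Suc i) \<notin> set C \<Longrightarrow> Neg i \<in> set C"
  using assms(3) unfolding word_phi_Vec letter_signs_column[OF assms(1,2)] by (auto split: if_splits)

lemma word_eps_column_0:
  assumes "column_ok C" "i < n" "word_eps n i (map Vec (rev C)) = 0"
  shows "\<not> (Pos (Suc i) \<in> set C \<and> Pos i \<notin> set C)" "Neg i \<in> set C \<Longrightarrow> Neg (Suc i) \<notin> set C \<Longrightarrow> Pos i \<in> set C"
  using assms(3) unfolding word_eps_Vec letter_signs_column[OF assms(1,2)] by (auto split: if_splits)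

lemma count_list_pos_iff: "0 < count_list C x \<longleftrightarrow> x \<in> set C"
  by (induction C) auto

lemma acts_Plus_column_top:
  assumes "column_ok C" "acts Plus n n (map Vec (rev C)) p"
  defines "x \<equiv> rev C ! p"
  shows "x = Pos n \<and> Pos n \<in> set C \<and> word_eps n n (map Vec (rev C)) = 0 \<or> x = Zero \<and> Zero \<in> set C"
  using acts_Vec(1)[OF assms(2)] count_list_pos_iff[of C Zero]
  unfolding x_def[symmetric] word_eps_Vec letter_signs_column_top[OF assms(1)]
  by (auto split: if_splits simp: remaining_Plus_append remaining_Minus_append remaining_zeros)

lemma acts_Minus_column_top:
  assumes "column_ok C" "acts Minus n n (map Vec (rev C)) p"
  defines "x \<equiv> rev C ! p"
  shows "x = Neg n \<and> Neg n \<in> set C \<and> word_phi n n (map Vec (rev C)) = 0 \<or> x = Zero \<and> Zero \<in> set C"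
  using acts_Vec(2)[OF assms(2)] count_list_pos_iff[of C Zero]
  unfolding x_def[symmetric] word_phi_Vec letter_signs_column_top[OF assms(1)]
  by (auto split: if_splits simp: remaining_Plus_append remaining_Minus_append remaining_zeros)

lemma word_phi_column_top_0:
  assumes "column_ok C" "word_phi n n (map Vec (rev C)) = 0"
  shows "Neg n \<in> set C \<or> Pos n \<notin> set C \<and> Zero \<notin> set C"
  using assms(2) count_list_pos_iff[of C Zero]
  unfolding word_phi_Vec letter_signs_column_top[OF assms(1)]
  by (auto split: if_splits simp: remaining_Plus_append remaining_Minus_append remaining_zeros)

lemma word_eps_column_top_0:
  assumes "column_ok C" "word_eps n n (map Vec (rev C)) = 0"
  shows "Pos n \<in> set C \<or> Neg n \<notin> set C \<and> Zero \<notin> set C"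
  using assms(2) count_list_pos_iff[of C Zero]
  unfolding word_eps_Vec letter_signs_column_top[OF assms(1)]
  by (auto split: if_splits simp: remaining_Plus_append remaining_Minus_append remaining_zeros)

section \<open>Stability of columns and of adjacent pairs\<close>

lemma vec_f_succ:
  assumes "vec_f n i x = Some y" "1 \<le> i" "i \<le> n" "x \<in> letters n"
  shows "x < y" "y \<in> letters n" "\<And>z. z \<in> letters n \<Longrightarrow> x < z \<Longrightarrow> y \<le> z"
proof -
  show "x < y" "y \<in> letters n" using assms by (auto simp: vec_f_def split: if_splits)
  show "\<And>z. z \<in> letters n \<Longrightarrow> x < z \<Longrightarrow> y \<le> z"
    using assms by (cases "i < n") (case_tac z; auto simp: vec_f_def split: if_splits)+
qed

lemma vec_f_cases:
  assumes "vec_f n i x = Some y" "i \<le> n"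
  obtains "i < n" "x = Pos i" "y = Pos (Suc i)" | "i < n" "x = Neg (Suc i)" "y = Neg i"
    | "i = n" "x = Pos n" "y = Zero" | "i = n" "x = Zero" "y = Neg n"
  using assms by (auto simp: vec_f_def split: if_splits)

text \<open>A transitive relation; later it also expresses properness of neighbouring columns of a
  wall.\<close>

definition col_gt :: "letter \<Rightarrow> letter \<Rightarrow> bool" where
  "col_gt x y \<longleftrightarrow> y < x \<or> x = Zero \<and> y = Zero"

lemma column_ok_iff: "column_ok C \<longleftrightarrow> (\<forall>r. Suc r < length C \<longrightarrow> col_gt (C ! r) (C ! Suc r))"
proof -
  have "transp col_gt" by (auto simp: transp_def col_gt_def)
  moreover have "column_ok C \<longleftrightarrow> sorted_wrt col_gt C"
    unfolding column_ok_def by (rule arg_cong2[where f = sorted_wrt]) (auto simp: col_gt_def fun_eq_iff)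
  ultimately show ?thesis by (simp add: sorted_wrt_iff_nth_Suc_transp)
qed

text \<open>If the order were destroyed, \<open>w\<close> would be \<open>y\<close> or a second
  zero, and its minus would cancel the only plus of \<open>x\<close>.\<close>

lemma acts_Plus_two_letters:
  assumes "acts Plus n i [Vec x, Vec w] 0" "vec_f n i x = Some y" "col_gt w x" "1 \<le> i" "i \<le> n"
    "x \<in> letters n" "w \<in> letters n"
  shows "col_gt w y"
proof (rule ccontr)
  assume neg: "\<not> col_gt w y"
  then have "w = y \<or> x = Zero \<and> w = Zero"
    using vec_f_succ(3)[OF assms(2,4-6), of w] vec_f_succ(1)[OF assms(2,4-6)] assms(3,7) by (auto simp: col_gt_def)
  moreover have "w = Zero \<longrightarrow> y \<noteq> Zero" using neg by (auto simp: col_gt_def)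
  ultimately have w: "w = y \<or> x = Zero \<and> w = Zero" "w = Zero \<longrightarrow> y \<noteq> Zero" by blast+
  have "hd (remaining Plus (word_signs n i (map Vec [x, w]))) \<noteq> 0 \<or> remaining Plus (word_signs n i (map Vec [x, w])) = []"
    by (rule vec_f_cases[OF assms(2,5)])
      (use w assms(4) in \<open>auto simp: word_signs_def letter_eps_def letter_phi_def numeral_2_eq_2\<close>)
  then show False using assms(1) by simp
qed

lemma acts_Minus_two_letters:
  assumes "acts Minus n i [Vec w, Vec y] 1" "vec_f n i x = Some y" "col_gt y w" "1 \<le> i" "i \<le> n"
    "x \<in> letters n" "w \<in> letters n"
  shows "col_gt x w"
proof (rule ccontr)
  assume neg: "\<not> col_gt x w"
  then have "w = x \<or> y = Zero \<and> w = Zero"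
    using vec_f_succ(3)[OF assms(2,4-6), of w] vec_f_succ(1)[OF assms(2,4-6)] assms(3,7)
    unfolding col_gt_def by (metis leD linorder_neqE)
  moreover have "w = Zero \<longrightarrow> x \<noteq> Zero" using neg by (auto simp: col_gt_def)
  ultimately have w: "w = x \<or> y = Zero \<and> w = Zero" "w = Zero \<longrightarrow> x \<noteq> Zero" by blast+
  have "last (remaining Minus (word_signs n i (map Vec [w, y]))) \<noteq> 1 \<or> remaining Minus (word_signs n i (map Vec [w, y])) = []"
    by (rule vec_f_cases[OF assms(2,5)])
      (use w assms(4) in \<open>auto simp: word_signs_def letter_eps_def letter_phi_def numeral_2_eq_2\<close>)
  then show False using assms(1) by simp
qed

lemma split_two: "Suc p < length D \<Longrightarrow> D = take p D @ [D ! p, D ! Suc p] @ drop (Suc (Suc p)) D"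
  by (simp add: Cons_nth_drop_Suc)

text \<open>A raised entry can conflict only with the entry in the row below, which is read
  immediately after it. \<open>acts_middle\<close> isolates these two letters.\<close>

lemma column_ok_f:
  assumes "column_ok C" "set C \<subseteq> letters n" "acts Plus n i (map Vec (rev C)) p" "1 \<le> i" "i \<le> n"
    "r = length C - Suc p" "p < length C" "vec_f n i (C ! r) = Some y"
  shows "column_ok (C[r := y])"
  unfolding column_ok_iff
proof (intro allI impI)
  fix t assume t: "Suc t < length (C[r := y])"
  have l: "C ! q \<in> letters n" if "q < length C" for q using that assms(2) nth_mem by blast
  have r: "r < length C" using assms(6,7) by simp
  have g: "col_gt (C ! t) (C ! Suc t)" using assms(1) t by (simp add: column_ok_iff)
  consider "t = r" | "Suc t = r" | "t \<noteq> r" "Suc t \<noteq> r" by blast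
  then show "col_gt (C[r := y] ! t) (C[r := y] ! Suc t)"
  proof cases
    case 1
    then show ?thesis using g vec_f_succ(1)[OF assms(8,4,5) l[OF r]] t by (auto simp: col_gt_def)
  next
    case 2
    then have "t = length C - Suc (Suc p)" using assms(6) by linarith
    with 2 have p: "Suc p < length (rev C)" "rev C ! p = C ! r" "rev C ! Suc p = C ! t"
      using assms(6,7) t by (auto simp: rev_nth)
    have "map Vec (rev C) = map Vec (take p (rev C)) @ [Vec (C ! r), Vec (C ! t)] @ map Vec (drop (Suc (Suc p)) (rev C))"
      using arg_cong[OF split_two[OF p(1)], of "map Vec"] p by simp
    with assms(3) have "acts Plus n i (map Vec (take p (rev C)) @ [Vec (C ! r), Vec (C ! t)] @ map Vec (drop (Suc (Suc p)) (rev C))) p"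
      by simp
    then have "acts Plus n i [Vec (C ! r), Vec (C ! t)] (p - length (map Vec (take p (rev C))))"
      by (rule acts_middle) (use p(1) in auto)
    then have "acts Plus n i [Vec (C ! r), Vec (C ! t)] 0" using p(1) by simp
    then show ?thesis using acts_Plus_two_letters[OF _ assms(8) _ assms(4,5)] g 2 t l by simp
  next
    case 3
    then show ?thesis using g by simp
  qed
qed

lemma column_ok_e:
  assumes "column_ok C" "set C \<subseteq> letters n" "acts Minus n i (map Vec (rev C)) p" "1 \<le> i" "i \<le> n"
    "r = length C - Suc p" "p < length C" "vec_e n i (C ! r) = Some y"
  shows "column_ok (C[r := y])"
  unfolding column_ok_iff
proof (intro allI impI)
  fix t assume t: "Suc t < length (C[r := y])"
  have f: "vec_f n i y = Some (C ! r)" using assms(8) by (simp add: vec_e_iff_vec_f)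
  have l: "C ! q \<in> letters n" if "q < length C" for q using that assms(2) nth_mem by blast
  have r: "r < length C" using assms(6,7) by simp
  have y: "y \<in> letters n"
    by (rule vec_f_cases[OF f assms(5)]) (use assms(4) in auto)
  have g: "col_gt (C ! t) (C ! Suc t)" using assms(1) t by (simp add: column_ok_iff)
  consider "t = r" | "Suc t = r" | "t \<noteq> r" "Suc t \<noteq> r" by blast
  then show "col_gt (C[r := y] ! t) (C[r := y] ! Suc t)"
  proof cases
    case 2
    then show ?thesis using g vec_f_succ(1)[OF f assms(4,5) y] t by (auto simp: col_gt_def)
  next
    case 1
    define q where "q = p - 1"
    have p: "p = Suc q" "Suc q < length (rev C)" "rev C ! q = C ! Suc r" "rev C ! Suc q = C ! r"
      using assms(6,7) t 1 by (auto simp: rev_nth q_def Suc_diff_Suc)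
    have "map Vec (rev C) = map Vec (take q (rev C)) @ [Vec (C ! Suc r), Vec (C ! r)] @ map Vec (drop (Suc (Suc q)) (rev C))"
      using arg_cong[OF split_two[OF p(2)], of "map Vec"] p by simp
    with assms(3) have "acts Minus n i (map Vec (take q (rev C)) @ [Vec (C ! Suc r), Vec (C ! r)] @ map Vec (drop (Suc (Suc q)) (rev C))) p"
      by simp
    then have "acts Minus n i [Vec (C ! Suc r), Vec (C ! r)] (p - length (map Vec (take q (rev C))))"
      by (rule acts_middle) (use p(1,2) in auto)
    then have "acts Minus n i [Vec (C ! Suc r), Vec (C ! r)] 1" using p(1,2) by simp
    then show ?thesis using acts_Minus_two_letters[OF _ f _ assms(4,5) y] g 1 t l by simp
  next
    case 3
    then show ?thesis using g by simp
  qed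
qed

lemma length_filter_update:
  "r < length C \<Longrightarrow> int (length (filter R (C[r := y]))) =
    int (length (filter R C)) - of_bool (R (C ! r)) + of_bool (R y)"
proof (induction C arbitrary: r)
  case (Cons c C)
  then show ?case using Cons.IH[of "r - 1"] by (cases r) auto
qed simp

text \<open>A step either leaves the letter \<open>i\<close>, lowering only the count of entries up
  to \<open>i\<close>, or produces the bar of \<open>i\<close>, raising only the count from that bar
  on. For \<open>i = n\<close> the intermediate letter \<open>Zero\<close> is counted by neither
  function.\<close>

lemma counts_f:
  assumes "vec_f n i (C ! r) = Some y" "1 \<le> i" "i \<le> n" "r < length C" "a \<le> n"
  shows "pos_count (C[r := y]) a = (if C ! r = Pos i then ((pos_count C)(i := pos_count C i - 1)) a else pos_count C a)"
    "neg_count (C[r := y]) a = (if C ! r = Pos i then neg_count C a else ((neg_count C)(i := neg_count C i + 1)) a)"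
  by (rule vec_f_cases[OF assms(1,3)];
      use assms(2-) in \<open>auto simp: pos_count_def neg_count_def length_filter_update\<close>)+

lemma counts_e:
  assumes "vec_e n i (C ! r) = Some y" "1 \<le> i" "i \<le> n" "r < length C" "a \<le> n"
  shows "pos_count (C[r := y]) a = (if y = Pos i then ((pos_count C)(i := pos_count C i + 1)) a else pos_count C a)"
    "neg_count (C[r := y]) a = (if y = Pos i then neg_count C a else ((neg_count C)(i := neg_count C i - 1)) a)"
  by (rule vec_f_cases[OF assms(1)[unfolded vec_e_iff_vec_f] assms(3)];
      use assms(2-) in \<open>auto simp: pos_count_def neg_count_def length_filter_update\<close>)+

lemma unit_steps_counts: "column_ok C \<Longrightarrow> unit_steps n (pos_count C)" "column_ok C \<Longrightarrow> unit_steps n (neg_count C)"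
  by (auto simp: unit_steps_def pos_count_step neg_count_step)

lemma counts_le_length:
  assumes "set C \<subseteq> letters n" 
  shows "pos_count C n + neg_count C n \<le> int (length C)"
    "Zero \<in> set C \<Longrightarrow> pos_count C n + neg_count C n + 1 \<le> int (length C)"
    "Zero \<notin> set C \<Longrightarrow> pos_count C n + neg_count C n = int (length C)"
  using count_sum[OF assms] count_list_pos_iff[of C Zero] by (auto simp: count_list_0_iff)

lemma kn_column_f:
  assumes "kn_column n C" "acts Plus n i (map Vec (rev C)) p" "1 \<le> i" "i \<le> n"
    "r = length C - Suc p" "p < length C" "vec_f n i (C ! r) = Some y"
  shows "kn_column n (C[r := y])"
proof -
  note c = kn_columnD[OF assms(1)]
  have r: "r < length C" using assms by simp
  have x: "rev C ! p = C ! r" using assms by (simp add: rev_nth)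
  have "C ! r \<in> letters n" using r c(1) nth_mem by blast
  then have "set (C[r := y]) \<subseteq> letters n"
    using vec_f_succ(2)[OF assms(7,3,4)] c(1) set_update_subset_insert[of C r y] by blast
  moreover have "column_ok (C[r := y])" by (rule column_ok_f) (use assms c in auto)
  moreover have "pos_count (C[r := y]) a + neg_count (C[r := y]) a \<le> int a" if "a \<le> n" for a
  proof (cases "C ! r = Pos i")
    case True
    then show ?thesis using c(4)[OF that] counts_f[OF assms(7,3,4) r that] by auto
  next
    case False
    show ?thesis
    proof (cases "a = i")
      case ai: True
      \<comment> \<open>For \<open>i = n\<close> a zero leaves room. For \<open>i < n\<close>, if
        \<open>i\<close> occurs then so does \<open>Suc i\<close>, and the total grows by two up to
        the bound at \<open>Suc i\<close>; otherwise the total at \<open>i\<close> equals that at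
        \<open>k\<close>.\<close>
      have "pos_count C i + neg_count C i + 1 \<le> int i"
      proof (cases "i = n")
        case True
        then have "Zero \<in> set C" using acts_Plus_column_top[OF c(2), of n p] assms(2) x False by auto
        then show ?thesis using counts_le_length(2)[OF c(1)] c(3) unfolding True by linarith
      next
        case i: False
        then have i: "i < n" using assms by simp
        have m: "Neg (Suc i) \<in> set C" "Neg i \<notin> set C" "Pos i \<in> set C \<longrightarrow> Pos (Suc i) \<in> set C"
          using acts_Plus_column[OF c(2) i assms(2)] x False by auto
        obtain k where k: "i = Suc k" using assms(3) by (cases i) auto
        show ?thesis
          using m c(4)[of k] c(4)[of "Suc i"] i k pos_count_step[OF c(2), of k] pos_count_step[OF c(2), of i]
            neg_count_step[OF c(2), of k] neg_count_step[OF c(2), of i] by (auto split: if_splits)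
      qed
      then show ?thesis using counts_f[OF assms(7,3,4) r that] False ai by simp
    next
      case ai: False
      then show ?thesis using c(4)[OF that] counts_f[OF assms(7,3,4) r that] False by auto
    qed
  qed
  ultimately show ?thesis using c(3) by (simp add: kn_column_def)
qed

lemma kn_column_e:
  assumes "kn_column n C" "acts Minus n i (map Vec (rev C)) p" "1 \<le> i" "i \<le> n"
    "r = length C - Suc p" "p < length C" "vec_e n i (C ! r) = Some y"
  shows "kn_column n (C[r := y])"
proof -
  note c = kn_columnD[OF assms(1)]
  have r: "r < length C" using assms by simp
  have x: "rev C ! p = C ! r" using assms by (simp add: rev_nth)
  have f: "vec_f n i y = Some (C ! r)" using assms(7) by (simp add: vec_e_iff_vec_f)
  have "y \<in> letters n" by (rule vec_f_cases[OF f assms(4)]) (use assms(3) in auto)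
  then have "set (C[r := y]) \<subseteq> letters n"
    using c(1) set_update_subset_insert[of C r y] by blast
  moreover have "column_ok (C[r := y])" by (rule column_ok_e) (use assms c in auto)
  moreover have "pos_count (C[r := y]) a + neg_count (C[r := y]) a \<le> int a" if "a \<le> n" for a
  proof (cases "y = Pos i")
    case False
    then show ?thesis using c(4)[OF that] counts_e[OF assms(7,3,4) r that] by auto
  next
    case True
    show ?thesis
    proof (cases "a = i")
      case ai: True
      have "pos_count C i + neg_count C i + 1 \<le> int i"
      proof (cases "i = n")
        case n: True
        then have "C ! r = Zero" using f True by (simp add: vec_f_def)
        then have "Zero \<in> set C" using r nth_mem by metis
        then show ?thesis using counts_le_length(2)[OF c(1)] c(3) unfolding n by linarith
      next
        case i: False
        then have i: "i < n" using assms by simp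
        have m: "Pos (Suc i) \<in> set C" "Pos i \<notin> set C" "Neg i \<in> set C \<longrightarrow> Neg (Suc i) \<in> set C"
          using acts_Minus_column[OF c(2) i assms(2)] x f True i by (auto simp: vec_f_def)
        obtain k where k: "i = Suc k" using assms(3) by (cases i) auto
        show ?thesis
          using m c(4)[of k] c(4)[of "Suc i"] i k pos_count_step[OF c(2), of k] pos_count_step[OF c(2), of i]
            neg_count_step[OF c(2), of k] neg_count_step[OF c(2), of i] by (auto split: if_splits)
      qed
      then show ?thesis using counts_e[OF assms(7,3,4) r that] True ai by simp
    next
      case ai: False
      then show ?thesis using c(4)[OF that] counts_e[OF assms(7,3,4) r that] True by auto
    qed
  qed
  ultimately show ?thesis using c(3) by (simp add: kn_column_def)
qed

section \<open>Half-columns and the spin operators\<close>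

lemma half_columnD:
  assumes "c \<in> half_columns n"
  shows "length c = n" "set c \<subseteq> letters n" "Zero \<notin> set c" "sorted_wrt (>) c" "column_ok c"
    "\<And>j. 1 \<le> j \<Longrightarrow> j \<le> n \<Longrightarrow> Neg j \<in> set c \<longleftrightarrow> Pos j \<notin> set c"
proof -
  show s: "sorted_wrt (>) c" using assms by (simp add: half_columns_def)
  show "column_ok c" unfolding column_ok_def using s by (rule sorted_wrt_mono_rel[rotated]) auto
  fix j assume "1 \<le> j" "j \<le> n"
  then show "Neg j \<in> set c \<longleftrightarrow> Pos j \<notin> set c"
    using assms by (force simp: half_columns_def)
qed (use assms in \<open>auto simp: half_columns_def\<close>)

lemma half_column_counts:
  assumes "c \<in> half_columns n" "a \<le> n"
  shows "pos_count c a + neg_count c a = int a"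
  using assms(2)
proof (induction a)
  case 0
  then show ?case using pos_count_0 neg_count_0 half_columnD[OF assms(1)] by simp
next
  case (Suc a)
  then show ?case using half_columnD(5,6)[OF assms(1)] by (simp add: pos_count_step neg_count_step)
qed

lemma half_column_kn: "c \<in> half_columns n \<Longrightarrow> kn_column n c"
  using half_columnD half_column_counts by (fastforce simp: kn_column_def)

lemma half_columnI:
  assumes "length c = n" "set c \<subseteq> letters n" "Zero \<notin> set c" "sorted_wrt (>) c"
    "\<And>j. 1 \<le> j \<Longrightarrow> j \<le> n \<Longrightarrow> Neg j \<in> set c \<longleftrightarrow> Pos j \<notin> set c"
  shows "c \<in> half_columns n"
  using assms unfolding half_columns_def by force

lemma half_column_f:
  assumes "c \<in> half_columns n" "spin_f n i c = Some c'" "1 \<le> i" "i \<le> n"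
  shows "c' \<in> half_columns n" "\<And>a. a \<le> n \<Longrightarrow> pos_count c' a = pos_count c a - of_bool (a = i)"
proof -
  note c = half_columnD[OF assms(1)]
  define g where "g = (if i < n then id(Pos i := Pos (i + 1), Neg (i + 1) := Neg i) else id(Pos n := Neg n))"
  have c': "c' = map g c" using assms(2) by (auto simp: spin_f_def g_def split: if_splits)
  have in_c: "Pos i \<in> set c" "Neg i \<notin> set c" "i < n \<Longrightarrow> Neg (Suc i) \<in> set c \<and> Pos (Suc i) \<notin> set c"
    using assms c(6)[of i] c(6)[of "Suc i"] by (auto simp: spin_f_def split: if_splits)
  \<comment> \<open>The targets of \<open>g\<close> do not occur in the half-column, and each of
    them is adjacent in the alphabet of half-columns to the letter it replaces; this makes
    \<open>g\<close> strictly increasing on the entries.\<close>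
  have bnd: "case x of Pos b \<Rightarrow> b \<le> n \<and> (i < n \<longrightarrow> b \<noteq> Suc i) | Zero \<Rightarrow> False | Neg b \<Rightarrow> b \<le> n \<and> b \<noteq> i" if "x \<in> set c" for x
    by (rule letter.exhaust[of x]; use that c(2,3) in_c in auto)
  have lt: "g y < g x" if "y < x" "x \<in> set c" "y \<in> set c" for x y
    using that(1) bnd[OF that(2)] bnd[OF that(3)] assms(4)
    by (cases x; cases y) (auto simp: g_def split: if_splits)
  have P: "Pos b \<in> set c' \<longleftrightarrow> b = Suc i \<and> i < n \<or> b \<noteq> i \<and> b \<noteq> Suc i \<and> Pos b \<in> set c" if "b \<le> n" for b
  proof
    assume "Pos b \<in> set c'"
    then obtain x where "x \<in> set c" "g x = Pos b" by (auto simp: c')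
    then show "b = Suc i \<and> i < n \<or> b \<noteq> i \<and> b \<noteq> Suc i \<and> Pos b \<in> set c"
      using assms(4) that in_c by (auto simp: g_def split: if_splits)
  next
    assume "b = Suc i \<and> i < n \<or> b \<noteq> i \<and> b \<noteq> Suc i \<and> Pos b \<in> set c"
    then have "\<exists>x\<in>set c. g x = Pos b"
    proof
      assume "b = Suc i \<and> i < n"
      then show ?thesis using in_c(1) by (intro bexI[of _ "Pos i"]) (auto simp: g_def)
    next
      assume "b \<noteq> i \<and> b \<noteq> Suc i \<and> Pos b \<in> set c"
      then show ?thesis using assms(4) by (intro bexI[of _ "Pos b"]) (auto simp: g_def)
    qed
    then show "Pos b \<in> set c'" by (force simp: c')
  qed
  have N: "Neg b \<in> set c' \<longleftrightarrow> b = i \<or> b \<noteq> Suc i \<and> Neg b \<in> set c" if "b \<le> n" for b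
  proof
    assume "Neg b \<in> set c'"
    then obtain x where "x \<in> set c" "g x = Neg b" by (auto simp: c')
    then show "b = i \<or> b \<noteq> Suc i \<and> Neg b \<in> set c"
      using assms(4) that by (auto simp: g_def split: if_splits)
  next
    assume "b = i \<or> b \<noteq> Suc i \<and> Neg b \<in> set c"
    then have "\<exists>x\<in>set c. g x = Neg b"
    proof
      assume "b = i"
      then show ?thesis using in_c assms(4)
        by (intro bexI[of _ "if i < n then Neg (Suc i) else Pos n"]) (auto simp: g_def)
    next
      assume "b \<noteq> Suc i \<and> Neg b \<in> set c"
      then show ?thesis using assms(4) by (intro bexI[of _ "Neg b"]) (auto simp: g_def)
    qed
    then show "Neg b \<in> set c'" by (force simp: c')
  qed
  show half: "c' \<in> half_columns n"
  proof (rule half_columnI)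
    show "sorted_wrt (>) c'" unfolding c' sorted_wrt_map
      by (rule sorted_wrt_mono_rel[OF _ c(4)]) (use lt in blast)
    show "set c' \<subseteq> letters n" "Zero \<notin> set c'"
      using c(2,3) assms(3,4) by (auto simp: c' g_def)
    show "Neg j \<in> set c' \<longleftrightarrow> Pos j \<notin> set c'" if "1 \<le> j" "j \<le> n" for j
      using N[of j] P[of j] c(6)[OF that] that in_c assms(4) by auto
  qed (use c c' in simp)
  note h = half_columnD[OF half]
  show "pos_count c' a = pos_count c a - of_bool (a = i)" if "a \<le> n" for a using that
  proof (induction a)
    case 0
    then show ?case using assms(3) pos_count_0[OF c(2)] pos_count_0[OF h(2)] by simp
  next
    case (Suc a)
    then show ?case using P[of "Suc a"] in_c by (auto simp: pos_count_step[OF c(5)] pos_count_step[OF h(5)])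
  qed
qed

text \<open>Being stated as an inverse of \<open>spin_f\<close>, it lets the effect of
  \<open>spin_e\<close> on the counts be read off from \<open>half_column_f\<close>.\<close>

lemma half_column_e:
  assumes "c \<in> half_columns n" "spin_e n i c = Some c'" "1 \<le> i" "i \<le> n"
  shows "c' \<in> half_columns n" "spin_f n i c' = Some c"
proof -
  note c = half_columnD[OF assms(1)]
  define g where "g = (if i < n then id(Pos (i + 1) := Pos i, Neg i := Neg (i + 1)) else id(Neg n := Pos n))"
  have c': "c' = map g c" using assms(2) by (auto simp: spin_e_def g_def split: if_splits)
  have in_c: "Neg i \<in> set c" "Pos i \<notin> set c" "i < n \<Longrightarrow> Pos (Suc i) \<in> set c \<and> Neg (Suc i) \<notin> set c"
    using assms c(6)[of i] c(6)[of "Suc i"] by (auto simp: spin_e_def split: if_splits)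
  have bnd: "case x of Pos b \<Rightarrow> b \<le> n \<and> b \<noteq> i | Zero \<Rightarrow> False | Neg b \<Rightarrow> b \<le> n \<and> (i < n \<longrightarrow> b \<noteq> Suc i)" if "x \<in> set c" for x
    by (rule letter.exhaust[of x]; use that c(2,3) in_c in auto)
  have lt: "g y < g x" if "y < x" "x \<in> set c" "y \<in> set c" for x y
    using that(1) bnd[OF that(2)] bnd[OF that(3)] assms(4)
    by (cases x; cases y) (auto simp: g_def split: if_splits)
  have P: "Pos b \<in> set c' \<longleftrightarrow> b = i \<or> b \<noteq> Suc i \<and> Pos b \<in> set c" if "b \<le> n" for b
  proof
    assume "Pos b \<in> set c'"
    then obtain x where "x \<in> set c" "g x = Pos b" by (auto simp: c')
    then show "b = i \<or> b \<noteq> Suc i \<and> Pos b \<in> set c"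
      using assms(4) that by (auto simp: g_def split: if_splits)
  next
    assume "b = i \<or> b \<noteq> Suc i \<and> Pos b \<in> set c"
    then have "\<exists>x\<in>set c. g x = Pos b"
    proof
      assume "b = i"
      then show ?thesis using in_c assms(4)
        by (intro bexI[of _ "if i < n then Pos (Suc i) else Neg n"]) (auto simp: g_def)
    next
      assume "b \<noteq> Suc i \<and> Pos b \<in> set c"
      then show ?thesis using assms(4) by (intro bexI[of _ "Pos b"]) (auto simp: g_def)
    qed
    then show "Pos b \<in> set c'" by (force simp: c')
  qed
  have N: "Neg b \<in> set c' \<longleftrightarrow> b = Suc i \<and> i < n \<or> b \<noteq> i \<and> b \<noteq> Suc i \<and> Neg b \<in> set c" if "b \<le> n" for b
  proof
    assume "Neg b \<in> set c'"
    then obtain x where "x \<in> set c" "g x = Neg b" by (auto simp: c')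
    then show "b = Suc i \<and> i < n \<or> b \<noteq> i \<and> b \<noteq> Suc i \<and> Neg b \<in> set c"
      using assms(4) that in_c by (auto simp: g_def split: if_splits)
  next
    assume "b = Suc i \<and> i < n \<or> b \<noteq> i \<and> b \<noteq> Suc i \<and> Neg b \<in> set c"
    then have "\<exists>x\<in>set c. g x = Neg b"
    proof
      assume "b = Suc i \<and> i < n"
      then show ?thesis using in_c(1) by (intro bexI[of _ "Neg i"]) (auto simp: g_def)
    next
      assume "b \<noteq> i \<and> b \<noteq> Suc i \<and> Neg b \<in> set c"
      then show ?thesis using assms(4) by (intro bexI[of _ "Neg b"]) (auto simp: g_def)
    qed
    then show "Neg b \<in> set c'" by (force simp: c')
  qed
  show half: "c' \<in> half_columns n"
  proof (rule half_columnI)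
    show "sorted_wrt (>) c'" unfolding c' sorted_wrt_map
      by (rule sorted_wrt_mono_rel[OF _ c(4)]) (use lt in blast)
    show "set c' \<subseteq> letters n" "Zero \<notin> set c'"
      using c(2,3) assms(3,4) by (auto simp: c' g_def)
    show "Neg j \<in> set c' \<longleftrightarrow> Pos j \<notin> set c'" if "1 \<le> j" "j \<le> n" for j
      using N[of j] P[of j] c(6)[OF that] that in_c assms(4) by auto
  qed (use c c' in simp)
  have "map (if i < n then id(Pos i := Pos (i + 1), Neg (i + 1) := Neg i) else id(Pos n := Neg n)) c' = c"
    unfolding c' map_map by (rule map_idI) (cases "i = n"; use in_c assms(4) in \<open>auto simp: g_def\<close>)
  then show "spin_f n i c' = Some c" using P[of i] N[of "Suc i"] assms(4) by (auto simp: spin_f_def)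
qed

lemma string_length_spin:
  "1 \<le> i \<Longrightarrow> string_length (factor_e n i) (Spin c) = (if spin_e n i c = None then 0 else 1)"
  "1 \<le> i \<Longrightarrow> string_length (factor_f n i) (Spin c) = (if spin_f n i c = None then 0 else 1)"
proof -
  assume i: "1 \<le> i"
  show "string_length (factor_e n i) (Spin c) = (if spin_e n i c = None then 0 else 1)"
  proof (cases "spin_e n i c")
    case (Some d)
    then have "spin_e n i d = None" using i by (auto simp: spin_e_def split: if_splits)
    then show ?thesis using Some by (simp add: string_length_Some1[of _ _ "Spin d"])
  qed (simp add: string_length_None)
  show "string_length (factor_f n i) (Spin c) = (if spin_f n i c = None then 0 else 1)"
  proof (cases "spin_f n i c")
    case (Some d)
    then have "spin_f n i d = None" using i by (auto simp: spin_f_def split: if_splits)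
    then show ?thesis using Some by (simp add: string_length_Some1[of _ _ "Spin d"])
  qed (simp add: string_length_None)
qed

lemma spin_not_both: "c \<in> half_columns n \<Longrightarrow> 1 \<le> i \<Longrightarrow> i \<le> n \<Longrightarrow> spin_f n i c \<noteq> None \<Longrightarrow> spin_e n i c = None"
  using half_columnD(6)[of c n i] by (auto simp: spin_f_def spin_e_def split: if_splits)

lemma word_signs_Spin:
  "1 \<le> i \<Longrightarrow> word_signs n i [Spin c] = (if spin_e n i c = None then [] else [(Minus, 0)]) @ (if spin_f n i c = None then [] else [(Plus, 0)])"
  by (auto simp: word_signs_def string_length_spin)

text \<open>Lets an ordinary column and the half-column be treated alike as right neighbours of a
  column.\<close>

definition right_word :: "nat \<Rightarrow> letter list \<Rightarrow> factor list \<Rightarrow> bool" where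
  "right_word n C u \<longleftrightarrow> u = map Vec (rev C) \<or> C \<in> half_columns n \<and> u = [Spin C]"

lemma right_word_phi_0:
  assumes "right_word n C u" "column_ok C" "1 \<le> i" "i < n" "word_phi n i u = 0"
  shows "\<not> (Neg (Suc i) \<in> set C \<and> Neg i \<notin> set C)" "Pos i \<in> set C \<Longrightarrow> Pos (Suc i) \<notin> set C \<Longrightarrow> Neg i \<in> set C"
proof -
  have "\<not> (Neg (Suc i) \<in> set C \<and> Neg i \<notin> set C) \<and> (Pos i \<in> set C \<longrightarrow> Pos (Suc i) \<notin> set C \<longrightarrow> Neg i \<in> set C)"
  proof (cases "u = map Vec (rev C)")
    case True
    then show ?thesis using word_phi_column_0[OF assms(2,4)] assms(5) by blast
  next
    case False
    then have h: "C \<in> half_columns n" "u = [Spin C]" using assms(1) by (auto simp: right_word_def)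
    have "spin_f n i C = None"
      using assms(5) spin_not_both[OF h(1), of i] assms(3,4)
      unfolding h(2) word_phi_def word_signs_Spin[OF assms(3)] by (auto split: if_splits)
    then show ?thesis using half_columnD(6)[OF h(1), of i] half_columnD(6)[OF h(1), of "Suc i"] assms(3,4)
      by (auto simp: spin_f_def split: if_splits)
  qed
  then show "\<not> (Neg (Suc i) \<in> set C \<and> Neg i \<notin> set C)" "Pos i \<in> set C \<Longrightarrow> Pos (Suc i) \<notin> set C \<Longrightarrow> Neg i \<in> set C"
    by auto
qed

lemma right_word_phi_top_0:
  assumes "right_word n C u" "column_ok C" "1 \<le> n" "word_phi n n u = 0"
  shows "Neg n \<in> set C \<or> Pos n \<notin> set C \<and> Zero \<notin> set C"
proof (cases "u = map Vec (rev C)")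
  case True
  then show ?thesis using word_phi_column_top_0[OF assms(2)] assms(4) by blast
next
  case False
  then have h: "C \<in> half_columns n" "u = [Spin C]" using assms(1) by (auto simp: right_word_def)
  have "spin_f n n C = None"
    using assms(4) spin_not_both[OF h(1), of n] assms(3)
    unfolding h(2) word_phi_def word_signs_Spin[OF assms(3)] by (auto split: if_splits)
  then show ?thesis using half_columnD(6)[OF h(1), of n] assms(3)
    by (auto simp: spin_f_def split: if_splits)
qed

section \<open>Stability of linked pairs under the operators\<close>

lemma linkedD: "linked n C C' \<Longrightarrow> link n (int (length C)) (int (length C')) (pos_count C) (neg_count C) (pos_count C') (neg_count C')"
  "linked n C C' \<Longrightarrow> length C \<le> length C'"
  by (auto simp: linked_def)

text \<open>The right neighbour is read first, so an action in \<open>C\<close> shows by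
  \<open>acts_append\<close> that \<open>word_phi n i u\<close> is at most \<open>word_eps\<close>
  of \<open>C\<close>. Where the latter vanishes, the letters of \<open>C'\<close> are restricted
  just as \<open>link_f_pos_left\<close>, \<open>link_f_neg_left\<close> and
  \<open>link_f_pos_left_top\<close> demand.\<close>

lemma linked_f_left:
  assumes kn: "kn_column n C" "kn_column n C'" and L: "linked n C C'" and u: "right_word n C' u"
    and acts: "acts Plus n i (u @ map Vec (rev C)) (length u + p)" and i: "1 \<le> i" "i \<le> n"
    and r: "r = length C - Suc p" "p < length C" and y: "vec_f n i (C ! r) = Some y"
  shows "linked n (C[r := y]) C'"
proof -
  note c = kn_columnD[OF kn(1)] and c' = kn_columnD[OF kn(2)]
  have a: "acts Plus n i (map Vec (rev C)) p" "word_phi n i u \<le> word_eps n i (map Vec (rev C))"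
    using acts_append(2)[OF acts] by auto
  have x: "rev C ! p = C ! r" "r < length C" using r by (auto simp: rev_nth)
  obtain k where k: "i = Suc k" using i by (cases i) auto
  note st = pos_count_step[OF c(2)] neg_count_step[OF c(2)] pos_count_step[OF c'(2)] neg_count_step[OF c'(2)]
  note us = unit_steps_counts[OF c(2)] unit_steps_counts[OF c'(2)]
  note cnt = counts_f[OF y i x(2)]
  show ?thesis
  proof (cases "C ! r = Pos i")
    case True
    have "link n (int (length C)) (int (length C')) ((pos_count C)(i := pos_count C i - 1)) (neg_count C) (pos_count C') (neg_count C')"
    proof (cases "i < n")
      case il: True
      have m: "Pos i \<in> set C" "Pos (Suc i) \<notin> set C" "word_phi n i u = 0"
        using acts_Plus_column[OF c(2) il a(1)] x True a(2) by auto
      show ?thesis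
        by (rule link_f_pos_left[OF linkedD(1)[OF L] k il us(3,4)])
          (use m right_word_phi_0[OF u c'(2) i(1) il] in \<open>auto simp: st k split: if_splits\<close>)
    next
      case False
      then have n: "i = n" using i by simp
      have m: "Pos n \<in> set C" "word_phi n n u = 0"
        using acts_Plus_column_top[OF c(2), of n p] x True a unfolding n by auto
      have "Neg n \<in> set C' \<or> Neg n \<notin> set C' \<and> Pos n \<notin> set C' \<and> pos_count C' n + neg_count C' n = int (length C')"
        using right_word_phi_top_0[OF u c'(2) _ m(2)] i n counts_le_length(3)[OF c'(1)] by auto
      then show ?thesis unfolding n
        by (intro link_f_pos_left_top[OF linkedD(1)[OF L] k[unfolded n] counts_le_length(1)[OF c(1)] counts_le_length(1)[OF c'(1)]])
          (use m k n in \<open>auto simp: st split: if_splits\<close>)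
    qed
    then have "link n (int (length C)) (int (length C')) (pos_count (C[r := y])) (neg_count (C[r := y])) (pos_count C') (neg_count C')"
      by (rule link_cong[THEN iffD1, rotated -1]) (use True cnt in auto)
    then show ?thesis using linkedD(2)[OF L] by (simp add: linked_def)
  next
    case False
    have "link n (int (length C)) (int (length C')) (pos_count C) ((neg_count C)(i := neg_count C i + 1)) (pos_count C') (neg_count C')"
    proof (cases "i < n")
      case il: True
      have m: "Neg (Suc i) \<in> set C" "Neg i \<notin> set C" "Pos i \<in> set C \<longrightarrow> Pos (Suc i) \<in> set C"
         "Pos (Suc i) \<notin> set C \<longrightarrow> word_phi n i u = 0"
        using acts_Plus_column[OF c(2) il a(1)] x False a(2) by auto
      show ?thesis
        by (rule link_f_neg_left[OF linkedD(1)[OF L] k il us(1,4)])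
          (use m right_word_phi_0[OF u c'(2) i(1) il] in \<open>auto simp: st k split: if_splits\<close>)
    next
      case nl: False
      then have n: "i = n" using i by simp
      have "Zero \<in> set C"
        using acts_Plus_column_top[OF c(2), of n p] x False a unfolding n by auto
      then show ?thesis unfolding n
        by (intro link_neg_left_top[OF linkedD(1)[OF L]] counts_le_length(2)[OF c(1)])
    qed
    then have "link n (int (length C)) (int (length C')) (pos_count (C[r := y])) (neg_count (C[r := y])) (pos_count C') (neg_count C')"
      by (rule link_cong[THEN iffD1, rotated -1]) (use False cnt in auto)
    then show ?thesis using linkedD(2)[OF L] by (simp add: linked_def)
  qed
qed

lemma linked_f_right:
  assumes kn: "kn_column n C" "kn_column n C'" and L: "linked n C C'"
    and a: "acts Plus n i (map Vec (rev C')) p" and i: "1 \<le> i" "i \<le> n"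
    and r: "r = length C' - Suc p" "p < length C'" and y: "vec_f n i (C' ! r) = Some y"
  shows "linked n C (C'[r := y])"
proof -
  note c = kn_columnD[OF kn(1)] and c' = kn_columnD[OF kn(2)]
  have x: "rev C' ! p = C' ! r" "r < length C'" using r by (auto simp: rev_nth)
  obtain k where k: "i = Suc k" using i by (cases i) auto
  note st = pos_count_step[OF c(2)] neg_count_step[OF c(2)] pos_count_step[OF c'(2)] neg_count_step[OF c'(2)]
  note us = unit_steps_counts[OF c(2)] unit_steps_counts[OF c'(2)]
  note cnt = counts_f[OF y i x(2)]
  show ?thesis
  proof (cases "C' ! r = Pos i")
    case True
    have "link n (int (length C)) (int (length C')) (pos_count C) (neg_count C) (pos_count (C'[r := y])) (neg_count (C'[r := y]))"
      by (rule link_mono[OF linkedD(1)[OF L]]) (use True cnt in auto)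
    then show ?thesis using linkedD(2)[OF L] by (simp add: linked_def)
  next
    case False
    have "link n (int (length C)) (int (length C')) (pos_count C) (neg_count C) (pos_count C') ((neg_count C')(i := neg_count C' i + 1))"
    proof (cases "i < n")
      case il: True
      have m: "Neg (Suc i) \<in> set C'" "Neg i \<notin> set C'" "Pos i \<in> set C' \<longrightarrow> Pos (Suc i) \<in> set C'"
        using acts_Plus_column[OF c'(2) il a] x False by auto
      show ?thesis
        by (rule link_f_neg_right[OF linkedD(1)[OF L] k il us(3)])
          (use m in \<open>auto simp: st k split: if_splits\<close>)
    next
      case nl: False
      then have n: "i = n" using i by simp
      have "Zero \<in> set C'"
        using acts_Plus_column_top[OF c'(2), of n p] x False a unfolding n by auto
      then show ?thesis unfolding n
        by (intro link_neg_right_top[OF linkedD(1)[OF L]] counts_le_length(2)[OF c'(1)])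
    qed
    then have "link n (int (length C)) (int (length C')) (pos_count C) (neg_count C) (pos_count (C'[r := y])) (neg_count (C'[r := y]))"
      by (rule link_cong[THEN iffD1, rotated -1]) (use False cnt in auto)
    then show ?thesis using linkedD(2)[OF L] by (simp add: linked_def)
  qed
qed

text \<open>The two counts of a half-column add up to the index before and after the step, while the
  barred count does not decrease; so \<open>link_mono\<close> applies.\<close>

lemma linked_f_right_spin:
  assumes "linked n C c" "c \<in> half_columns n" "spin_f n i c = Some c'" "1 \<le> i" "i \<le> n"
  shows "linked n C c'"
proof -
  note h = half_column_f[OF assms(2-5)]
  have "link n (int (length C)) (int (length c)) (pos_count C) (neg_count C) (pos_count c') (neg_count c')"
  proof (rule link_mono[OF linkedD(1)[OF assms(1)]])
    fix a assume a: "a \<le> n"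
    show "pos_count C a + neg_count c a \<le> pos_count C a + neg_count c' a" "pos_count c' a + neg_count c' a \<le> pos_count c a + neg_count c a"
      using half_column_counts[OF assms(2) a] half_column_counts[OF h(1) a] h(2)[OF a] by (cases "a = i"; simp)+
  qed simp
  then show ?thesis using linkedD(2)[OF assms(1)] half_columnD(1)[OF h(1)] half_columnD(1)[OF assms(2)]
    by (simp add: linked_def)
qed

lemma linked_e_left:
  assumes kn: "kn_column n C" "kn_column n C'" and L: "linked n C C'"
    and a: "acts Minus n i (map Vec (rev C)) p" and i: "1 \<le> i" "i \<le> n"
    and r: "r = length C - Suc p" "p < length C" and y: "vec_e n i (C ! r) = Some y"
  shows "linked n (C[r := y]) C'"
proof -
  note c = kn_columnD[OF kn(1)] and c' = kn_columnD[OF kn(2)]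
  have x: "rev C ! p = C ! r" "r < length C" using r by (auto simp: rev_nth)
  obtain k where k: "i = Suc k" using i by (cases i) auto
  note st = pos_count_step[OF c(2)] neg_count_step[OF c(2)] pos_count_step[OF c'(2)] neg_count_step[OF c'(2)]
  note us = unit_steps_counts[OF c(2)] unit_steps_counts[OF c'(2)]
  note cnt = counts_e[OF y i x(2)]
  have f: "vec_f n i y = Some (C ! r)" using y by (simp add: vec_e_iff_vec_f)
  show ?thesis
  proof (cases "y = Pos i")
    case False
    have "link n (int (length C)) (int (length C')) (pos_count (C[r := y])) (neg_count (C[r := y])) (pos_count C') (neg_count C')"
      by (rule link_mono[OF linkedD(1)[OF L]]) (use False cnt in auto)
    then show ?thesis using linkedD(2)[OF L] by (simp add: linked_def)
  next
    case True
    have "link n (int (length C)) (int (length C')) ((pos_count C)(i := pos_count C i + 1)) (neg_count C) (pos_count C') (neg_count C')"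
    proof (cases "i < n")
      case il: True
      have m: "Pos (Suc i) \<in> set C" "Pos i \<notin> set C" "Neg i \<in> set C \<longrightarrow> Neg (Suc i) \<in> set C"
        using acts_Minus_column[OF c(2) il a] x True f il by (auto simp: vec_f_def)
      show ?thesis
        by (rule link_e_pos_left[OF linkedD(1)[OF L] k il us(2)])
          (use m in \<open>auto simp: st k split: if_splits\<close>)
    next
      case nl: False
      then have n: "i = n" using i by simp
      have "C ! r = Zero" using f True n by (simp add: vec_f_def)
      then have "Zero \<in> set C" using x(2) nth_mem by metis
      then show ?thesis unfolding n
        by (intro link_pos_left_top[OF linkedD(1)[OF L]] counts_le_length(2)[OF c(1)])
    qed
    then have "link n (int (length C)) (int (length C')) (pos_count (C[r := y])) (neg_count (C[r := y])) (pos_count C') (neg_count C')"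
      by (rule link_cong[THEN iffD1, rotated -1]) (use True cnt in auto)
    then show ?thesis using linkedD(2)[OF L] by (simp add: linked_def)
  qed
qed

lemma linked_e_right:
  assumes kn: "kn_column n C" "kn_column n C'" and L: "linked n C C'"
    and acts: "acts Minus n i (map Vec (rev C') @ map Vec (rev C)) p" and i: "1 \<le> i" "i \<le> n"
    and r: "r = length C' - Suc p" "p < length C'" and y: "vec_e n i (C' ! r) = Some y"
  shows "linked n C (C'[r := y])"
proof -
  note c = kn_columnD[OF kn(1)] and c' = kn_columnD[OF kn(2)]
  have a: "acts Minus n i (map Vec (rev C')) p" "word_eps n i (map Vec (rev C)) \<le> word_phi n i (map Vec (rev C'))"
    using acts_append(3)[OF acts] r by auto
  have x: "rev C' ! p = C' ! r" "r < length C'" using r by (auto simp: rev_nth)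
  obtain k where k: "i = Suc k" using i by (cases i) auto
  note st = pos_count_step[OF c(2)] neg_count_step[OF c(2)] pos_count_step[OF c'(2)] neg_count_step[OF c'(2)]
  note us = unit_steps_counts[OF c(2)] unit_steps_counts[OF c'(2)]
  note cnt = counts_e[OF y i x(2)]
  have f: "vec_f n i y = Some (C' ! r)" using y by (simp add: vec_e_iff_vec_f)
  show ?thesis
  proof (cases "y = Pos i")
    case False
    have "link n (int (length C)) (int (length C')) (pos_count C) (neg_count C) (pos_count C') ((neg_count C')(i := neg_count C' i - 1))"
    proof (cases "i < n")
      case il: True
      have m: "Neg i \<in> set C'" "Neg (Suc i) \<notin> set C'" "word_eps n i (map Vec (rev C)) = 0"
        using acts_Minus_column[OF c'(2) il a(1)] x False f il a(2) by (auto simp: vec_f_def split: if_splits)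
      show ?thesis
        by (rule link_e_neg_right[OF linkedD(1)[OF L] k il us(1,2,4)])
          (use m word_eps_column_0[OF c(2) il m(3)] in \<open>auto simp: st k split: if_splits\<close>)
    next
      case nl: False
      then have n: "i = n" using i by simp
      have m: "Neg n \<in> set C'" "word_eps n n (map Vec (rev C)) = 0"
        using acts_Minus_column_top[OF c'(2), of n p] x False f a unfolding n by (auto simp: vec_f_def split: if_splits)
      have "Pos n \<in> set C \<or> Pos n \<notin> set C \<and> Neg n \<notin> set C \<and> pos_count C n + neg_count C n = int (length C)"
        using word_eps_column_top_0[OF c(2) m(2)] counts_le_length(3)[OF c(1)] by auto
      then show ?thesis unfolding n
        by (intro link_e_neg_right_top[OF linkedD(1)[OF L] k[unfolded n] us(1) counts_le_length(1)[OF c(1)]])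
          (use m k n counts_le_length(1)[OF c'(1)] in \<open>auto simp: st split: if_splits\<close>)
    qed
    then have "link n (int (length C)) (int (length C')) (pos_count C) (neg_count C) (pos_count (C'[r := y])) (neg_count (C'[r := y]))"
      by (rule link_cong[THEN iffD1, rotated -1]) (use False cnt in auto)
    then show ?thesis using linkedD(2)[OF L] by (simp add: linked_def)
  next
    case True
    have "link n (int (length C)) (int (length C')) (pos_count C) (neg_count C) ((pos_count C')(i := pos_count C' i + 1)) (neg_count C')"
    proof (cases "i < n")
      case il: True
      have m: "Pos (Suc i) \<in> set C'" "Pos i \<notin> set C'" "Neg i \<in> set C' \<longrightarrow> Neg (Suc i) \<in> set C'"
          "Neg (Suc i) \<notin> set C' \<longrightarrow> word_eps n i (map Vec (rev C)) = 0"
        using acts_Minus_column[OF c'(2) il a(1)] x True f il a(2) by (auto simp: vec_f_def split: if_splits)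
      show ?thesis
        by (rule link_e_pos_right[OF linkedD(1)[OF L] k il us(1,4)])
          (use m word_eps_column_0[OF c(2) il] in \<open>auto simp: st k split: if_splits\<close>)
    next
      case nl: False
      then have n: "i = n" using i by simp
      have "C' ! r = Zero" using f True n by (simp add: vec_f_def)
      then have "Zero \<in> set C'" using x(2) nth_mem by metis
      then show ?thesis unfolding n
        by (intro link_pos_right_top[OF linkedD(1)[OF L]] counts_le_length(2)[OF c'(1)])
    qed
    then have "link n (int (length C)) (int (length C')) (pos_count C) (neg_count C) (pos_count (C'[r := y])) (neg_count (C'[r := y]))"
      by (rule link_cong[THEN iffD1, rotated -1]) (use True cnt in auto)
    then show ?thesis using linkedD(2)[OF L] by (simp add: linked_def)
  qed
qed

text \<open>\<open>spin_e\<close> and \<open>spin_f\<close> never apply to the same half-column.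
  Hence it has no plus, and by \<open>acts_append\<close> the left column has no remaining minus. At
  \<open>i\<close> the operator lowers the barred count and raises the unbarred one, which is what
  \<open>R\<close> in \<open>link_e_neg_right\<close> and \<open>link_e_neg_right_top\<close>
  provides for.\<close>

lemma linked_e_right_spin:
  assumes kn: "kn_column n C" and L: "linked n C c" and h: "c \<in> half_columns n" and e: "spin_e n i c = Some c'"
    and acts: "acts Minus n i ([Spin c] @ map Vec (rev C)) 0" and i: "1 \<le> i" "i \<le> n"
  shows "linked n C c'"
proof -
  note co = kn_columnD[OF kn(1)] and hc = half_columnD[OF h]
  note h' = half_column_e[OF h e i]
  have "word_phi n i [Spin c] = 0"
    using spin_not_both[OF h i] e unfolding word_phi_def word_signs_Spin[OF i(1)] by (cases "spin_f n i c") auto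
  then have z: "word_eps n i (map Vec (rev C)) = 0"
    using acts_append(3)[OF acts] by simp
  obtain k where k: "i = Suc k" using i by (cases i) auto
  have pos: "pos_count c' a = pos_count c a + of_bool (a = i)" if "a \<le> n" for a
    using half_column_f(2)[OF h'(1,2) i that] by simp
  have neg: "neg_count c' a = ((neg_count c)(i := neg_count c i - 1)) a" if "a \<le> n" for a
    using pos[OF that] half_column_counts[OF h that] half_column_counts[OF h'(1) that] by (auto split: if_splits)
  define R where "R = (pos_count c)(i := pos_count c i + 1)"
  note st = pos_count_step[OF co(2)] neg_count_step[OF co(2)] neg_count_step[OF hc(5)]
  note us = unit_steps_counts[OF co(2)] unit_steps_counts[OF hc(5)]
  have "link n (int (length C)) (int (length c)) (pos_count C) (neg_count C) R ((neg_count c)(i := neg_count c i - 1))"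
  proof (cases "i < n")
    case il: True
    have m: "Neg i \<in> set c" "Neg (Suc i) \<notin> set c"
      using e hc(6)[of "Suc i"] il by (auto simp: spin_e_def split: if_splits)
    have "R i + neg_count c i - 1 = int i" using half_column_counts[OF h i(2)] by (simp add: R_def)
    then show ?thesis
      by (intro link_e_neg_right[OF linkedD(1)[OF L] k il us(1,2,4)])
        (use m word_eps_column_0[OF co(2) il z] hc(1) in \<open>auto simp: st k R_def split: if_splits\<close>)
  next
    case nl: False
    then have n: "i = n" using i by simp
    have m: "Neg n \<in> set c" using e n by (auto simp: spin_e_def split: if_splits)
    have "Pos n \<in> set C \<or> Pos n \<notin> set C \<and> Neg n \<notin> set C \<and> pos_count C n + neg_count C n = int (length C)"
      using word_eps_column_top_0[OF co(2) z[unfolded n]] counts_le_length(3)[OF co(1)] by auto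
    then show ?thesis unfolding n
      by (intro link_e_neg_right_top[OF linkedD(1)[OF L] k[unfolded n] us(1) counts_le_length(1)[OF co(1)]])
        (use m k n half_column_counts[OF h, of n] hc(1) in \<open>auto simp: st R_def split: if_splits\<close>)
  qed
  then have "link n (int (length C)) (int (length c')) (pos_count C) (neg_count C) (pos_count c') (neg_count c')"
    unfolding hc(1) half_columnD(1)[OF h'(1)]
    by (rule link_cong[THEN iffD1, rotated -1]) (use pos neg in \<open>auto simp: R_def\<close>)
  then show ?thesis using linkedD(2)[OF L] half_columnD(1)[OF h'(1)] hc(1) by (simp add: linked_def)
qed

section \<open>Tableaux as chains of linked columns\<close>

definition tab :: "nat \<Rightarrow> nat list \<Rightarrow> bool \<Rightarrow> letter list list \<Rightarrow> bool" where
  "tab n cs b T \<longleftrightarrow> map length T = shape n cs b \<and> (\<forall>C\<in>set T. kn_column n C) \<and>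
     successively (linked n) T \<and> (b \<longrightarrow> last T \<in> half_columns n)"

lemma sorted_shape: "sorted cs \<Longrightarrow> set cs \<subseteq> {1..n} \<Longrightarrow> sorted (shape n cs b)"
  by (auto simp: shape_def sorted_append)

text \<open>If zeros met in the outer columns, the entry between them would be squeezed to zero
  too.\<close>

lemma row_le_trans: "row_le C D \<Longrightarrow> row_le D E \<Longrightarrow> row_le C E"
  unfolding row_le_def by (metis order_trans order_antisym_conv less_le_trans)

text \<open>The row condition compares all pairs of columns, but by transitivity of
  \<open>row_le\<close> adjacent pairs suffice, and to these \<open>linked_iff\<close>
  applies.\<close>

lemma tableaux_iff_tab:
  assumes "sorted cs" "set cs \<subseteq> {1..n}"
  shows "T \<in> tableaux n cs b \<longleftrightarrow> tab n cs b T"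
proof (cases "map length T = shape n cs b")
  case False
  then show ?thesis by (simp add: tableaux_def fillings_def tab_def)
next
  case True
  have len: "length (T ! k) \<le> length (T ! l)" if "k \<le> l" "l < length T" for k l
    using sorted_nth_mono[OF sorted_shape[OF assms, of b, folded True], of k l] that by simp
  have len_n: "length C \<le> n" if "C \<in> set T" for C
  proof -
    have "length C \<in> set (shape n cs b)" using that True by (metis image_eqI list.set_map)
    then show ?thesis using assms(2) by (auto simp: shape_def split: if_splits)
  qed
  have rows: "rows_ok T \<longleftrightarrow> successively row_le T"
  proof -
    have "rows_ok T \<longleftrightarrow> (\<forall>k l. k < l \<longrightarrow> l < length T \<longrightarrow> row_le (T ! k) (T ! l))"
    proof
      assume R: "rows_ok T"
      show "\<forall>k l. k < l \<longrightarrow> l < length T \<longrightarrow> row_le (T ! k) (T ! l)"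
        unfolding row_le_def
      proof (intro allI impI conjI)
        fix k l p assume kl: "k < l" "l < length T" and p: "p < length (T ! k)"
        have "in_row (T ! k) (Suc p) (T ! k ! p)" "in_row (T ! l) (Suc p) (T ! l ! p)"
          using p len[of k l] kl by (auto simp: in_row_def)
        then show "T ! k ! p \<le> T ! l ! p" "\<not> (T ! k ! p = Zero \<and> T ! l ! p = Zero)"
          using R kl unfolding rows_ok_def by blast+
      qed (use len in simp)
    next
      assume R: "\<forall>k l. k < l \<longrightarrow> l < length T \<longrightarrow> row_le (T ! k) (T ! l)"
      show "rows_ok T" unfolding rows_ok_def
      proof (intro allI impI)
        fix k l p x y assume kl: "k < l" "l < length T" and xy: "in_row (T ! k) p x" "in_row (T ! l) p y"
        then have "p - 1 < length (T ! k)" "x = T ! k ! (p - 1)" "y = T ! l ! (p - 1)" by (auto simp: in_row_def)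
        moreover have "row_le (T ! k) (T ! l)" using R kl by blast
        ultimately show "x \<le> y \<and> \<not> (x = Zero \<and> y = Zero)" by (simp add: row_le_def)
      qed
    qed
    also have "\<dots> \<longleftrightarrow> sorted_wrt row_le T" unfolding sorted_wrt_iff_nth_less by blast
    also have "\<dots> \<longleftrightarrow> successively row_le T"
      by (rule successively_conv_sorted_wrt[symmetric]) (blast intro: transpI row_le_trans)
    finally show ?thesis .
  qed
  have lnk: "successively (linked n) T \<longleftrightarrow> successively row_le T \<and>
      (\<forall>k. k + 1 < length T \<longrightarrow> cc2_1 n (T ! k) (T ! (k + 1)) \<and> cc2_2 (T ! k) (T ! (k + 1)))"
    if kn: "\<forall>C\<in>set T. kn_column n C"
  proof -
    have "linked n (T ! k) (T ! Suc k) \<longleftrightarrow> row_le (T ! k) (T ! Suc k) \<and> cc2_1 n (T ! k) (T ! Suc k) \<and> cc2_2 (T ! k) (T ! Suc k)"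
      if "Suc k < length T" for k
      by (rule linked_iff) (use that kn len in auto)
    then show ?thesis by (auto simp: successively_conv_nth)
  qed
  have kn: "(\<forall>C\<in>set T. kn_column n C) \<longleftrightarrow> T \<in> fillings n cs b \<and> (\<forall>C\<in>set T. column_ok C) \<and> (\<forall>C\<in>set T. cc1 C)"
    using len_n True unfolding kn_column_iff fillings_def by blast
  show ?thesis
  proof (cases "\<forall>C\<in>set T. kn_column n C")
    case kt: True
    then show ?thesis using kn lnk[OF kt] rows True unfolding tableaux_def tab_def by auto
  next
    case False
    then show ?thesis using kn unfolding tableaux_def tab_def by auto
  qed
qed

lemma tab_replace:
  assumes "tab n cs b (A @ C # R)" "kn_column n C2" "length C2 = length C"
    "A \<noteq> [] \<Longrightarrow> linked n (last A) C2" "R \<noteq> [] \<Longrightarrow> linked n C2 (hd R)"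
    "b \<Longrightarrow> R = [] \<Longrightarrow> C2 \<in> half_columns n"
  shows "tab n cs b (A @ C2 # R)"
proof -
  have "successively (linked n) (A @ C # R)" using assms(1) by (simp add: tab_def)
  then have "successively (linked n) A" "successively (linked n) R"
    by (auto simp: successively_append_iff successively_Cons)
  then have "successively (linked n) (A @ C2 # R)"
    using assms(4,5) by (auto simp: successively_append_iff successively_Cons)
  then show ?thesis using assms by (auto simp: tab_def)
qed

definition spin_part :: "bool \<Rightarrow> letter list list \<Rightarrow> factor list" where
  "spin_part b T = (if b then [Spin (last T)] else [])"

lemma reading_alt: "reading b T = spin_part b T @ map Vec (rev (concat (if b then butlast T else T)))"
  by (simp add: reading_def spin_part_def rev_concat rev_map)

lemma reading_Cons: "(b \<Longrightarrow> T \<noteq> []) \<Longrightarrow> reading b (C # T) = reading b T @ map Vec (rev C)"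
  by (auto simp: reading_alt spin_part_def)

lemma reading_append: "(b \<Longrightarrow> R \<noteq> []) \<Longrightarrow> reading b (A @ R) = reading b R @ map Vec (rev (concat A))"
  by (auto simp: reading_alt spin_part_def butlast_append)

text \<open>Exposes the end of a reading that stems from its leftmost column. When \<open>f\<close>
  acts in the column further to the left, this is the word that \<open>linked_f_left\<close> asks
  for.\<close>

lemma reading_right_word:
  assumes "b \<Longrightarrow> R \<noteq> []" "b \<Longrightarrow> last R \<in> half_columns n"
  obtains pre u where "reading b R = pre @ u" "R = [] \<and> u = [] \<or> R \<noteq> [] \<and> right_word n (hd R) u"
proof (cases R)
  case Nil
  then show ?thesis using that[of "reading b R" "[]"] by simp
next
  case (Cons E R1)
  show ?thesis
  proof (cases "b \<and> R1 = []")
    case True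
    then have "reading b R = [] @ [Spin E]" using Cons by (simp add: reading_def)
    moreover have "right_word n (hd R) [Spin E]" using True Cons assms(2) by (simp add: right_word_def)
    ultimately show ?thesis using that Cons by blast
  next
    case False
    then have "reading b R = reading b R1 @ map Vec (rev E)" unfolding Cons by (intro reading_Cons) auto
    moreover have "right_word n (hd R) (map Vec (rev E))" using Cons by (simp add: right_word_def)
    ultimately show ?thesis using that Cons by blast
  qed
qed

lemma acts_PlusD: "acts Plus n i w p \<Longrightarrow> string_length (factor_f n i) (w ! p) > 0"
  using acts_bound[of Plus n i w p] set_remaining[of p Plus "word_signs n i w"]
  by (auto simp: word_signs_alt factor_signs_def dest: hd_in_set)

lemma acts_MinusD: "acts Minus n i w p \<Longrightarrow> string_length (factor_e n i) (w ! p) > 0"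
  using acts_bound[of Minus n i w p] set_remaining[of p Minus "word_signs n i w"]
  by (auto simp: word_signs_alt factor_signs_def dest: last_in_set)

lemma concat_position:
  assumes "q < length (concat L)"
  obtains A C B t where "L = A @ C # B" "q = length (concat B) + t" "t < length C"
  using assms
proof (induction L arbitrary: q thesis rule: list.induct)
  case (Cons C L)
  show ?case
  proof (cases "q < length (concat L)")
    case True
    with Cons.IH obtain A D B t where "L = A @ D # B" "q = length (concat B) + t" "t < length D" by blast
    then show ?thesis using Cons.prems(1)[of "C # A" D B t] by simp
  next
    case False
    then show ?thesis using Cons.prems(1)[of "[]" C L "q - length (concat L)"] Cons.prems(2) by simp
  qed
qed simp

text \<open>The factor that changes is the half-column or lies in one column \<open>C\<close>. By
  \<open>tab_replace\<close> only this column and its links to both neighbours have to be checked,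
  and \<open>acts_middle\<close> restricts the action to the word of \<open>C\<close>, or of
  \<open>C\<close> and its right neighbour.\<close>

lemma tab_f:
  assumes T: "tab n cs b T" and i: "1 \<le> i" "i \<le> n" and a: "acts Plus n i (reading b T) p"
  shows "\<exists>T' z. tab n cs b T' \<and> factor_f n i (reading b T ! p) = Some z \<and> reading b T' = (reading b T)[p := z]"
proof -
  define T0 where "T0 = (if b then butlast T else T)"
  have Tne: "T \<noteq> []" if b using T that by (auto simp: tab_def shape_def)
  have T0: "T = T0 @ (if b then [last T] else [])" using Tne by (simp add: T0_def)
  have kn: "kn_column n C" if "C \<in> set T" for C using T that by (simp add: tab_def)
  have half: "last T \<in> half_columns n" if b using T that by (simp add: tab_def)
  have suc: "successively (linked n) T" using T by (simp add: tab_def)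
  have pl: "p < length (reading b T)" using acts_bound[OF a] .
  have rd: "reading b T = spin_part b T @ map Vec (rev (concat T0))" by (simp add: reading_alt T0_def)
  show ?thesis
  proof (cases "p < length (spin_part b T)")
    case True
    then have b: b and p: "p = 0" by (auto simp: spin_part_def split: if_splits)
    have r0: "reading b T ! p = Spin (last T)" using b p by (simp add: reading_def)
    then obtain c' where c': "spin_f n i (last T) = Some c'"
      using acts_PlusD[OF a] string_length_spin(2)[OF i(1), of n "last T"] by (auto split: if_splits)
    have T': "tab n cs b (T0 @ c' # [])"
    proof (rule tab_replace[of n cs b T0 "last T" "[]"])
      show "tab n cs b (T0 @ [last T])" using T T0 b by simp
      note h = half_column_f[OF half[OF b] c' i]
      show "kn_column n c'" using half_column_kn[OF h(1)] .
      show "length c' = length (last T)" using half_columnD(1)[OF h(1)] half_columnD(1)[OF half[OF b]] by simp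
      show "linked n (last T0) c'" if "T0 \<noteq> []"
      proof (rule linked_f_right_spin[OF _ half[OF b] c' i])
        have "successively (linked n) (T0 @ [last T])" using suc T0 b by simp
        then show "linked n (last T0) (last T)" using that by (simp add: successively_append_iff)
      qed
      show "c' \<in> half_columns n" using h(1) .
    qed simp
    have "reading b (T0 @ [c']) = (reading b T)[p := Spin c']"
      using b p by (simp add: reading_def T0_def)
    then show ?thesis using T' r0 c' by auto
  next
    case False
    define q where "q = p - length (spin_part b T)"
    have q: "p = length (spin_part b T) + q" "q < length (concat T0)" using False pl rd by (auto simp: q_def)
    \<comment> \<open>The reading runs through the columns from right to left, so \<open>q\<close>
      counts past the columns \<open>B\<close> to the right of \<open>C\<close>.\<close>
    obtain A C B t where ACB: "T0 = A @ C # B" "q = length (concat B) + t" "t < length C"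
      using concat_position[OF q(2)] by blast
    define R where "R = B @ (if b then [last T] else [])"
    have TR: "T = A @ C # R" using T0 ACB by (simp add: R_def)
    have Rb: "b \<Longrightarrow> R \<noteq> []" "b \<Longrightarrow> last R \<in> half_columns n" using half by (auto simp: R_def)
    obtain pre u where u: "reading b R = pre @ u" "R = [] \<and> u = [] \<or> R \<noteq> [] \<and> right_word n (hd R) u"
      using reading_right_word[OF Rb] by blast
    have w: "reading b T = pre @ u @ map Vec (rev C) @ map Vec (rev (concat A))"
      using reading_append[of b "C # R" A] reading_Cons[of b R C] Rb u unfolding TR by simp
    have "length (reading b R) = length (spin_part b T) + length (concat B)"
      by (auto simp: reading_alt R_def spin_part_def)
    then have p: "p = length pre + length u + t" using q ACB u(1) by simp
    \<comment> \<open>A column is read from the top but listed from the bottom.\<close>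
    define r where "r = length C - Suc t"
    have r: "r < length C" "t < length C" "rev C ! t = C ! r" using ACB(3) by (auto simp: r_def rev_nth)
    have a1: "acts Plus n i (u @ map Vec (rev C)) (length u + t)"
      using acts_middle[of Plus n i pre "u @ map Vec (rev C)" "map Vec (rev (concat A))" p] a w p r by simp
    have a2: "acts Plus n i (map Vec (rev C)) t"
      using acts_append(2)[OF a1] by simp
    have wp: "reading b T ! p = Vec (C ! r)" using r unfolding w p by (simp add: nth_append)
    obtain y where y: "vec_f n i (C ! r) = Some y"
      using acts_PlusD[OF a] unfolding wp by (auto simp: letter_phi_pos_iff simp del: neq0_conv)
    have sucs: "A \<noteq> [] \<Longrightarrow> linked n (last A) C" "R \<noteq> [] \<Longrightarrow> linked n C (hd R)"
      using suc unfolding TR by (auto simp: successively_append_iff successively_Cons)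
    have T': "tab n cs b (A @ C[r := y] # R)"
    proof (rule tab_replace)
      show "tab n cs b (A @ C # R)" using T TR by simp
      show "kn_column n (C[r := y])" by (rule kn_column_f[OF _ a2 i r_def r(2) y]) (use kn TR in simp)
      show "linked n (last A) (C[r := y])" if "A \<noteq> []"
        by (rule linked_f_right[OF _ _ sucs(1)[OF that] a2 i r_def r(2) y]) (use kn TR that in auto)
      show "linked n (C[r := y]) (hd R)" if "R \<noteq> []"
        by (rule linked_f_left[OF _ _ sucs(2)[OF that] _ a1 i r_def r(2) y]) (use kn TR that u in auto)
    qed (use Rb in auto)
    have "rev (C[r := y]) = (rev C)[t := y]" using r by (simp add: rev_update r_def)
    then have "reading b (A @ C[r := y] # R) = (reading b T)[p := Vec y]"
      using reading_append[of b "C[r := y] # R" A] reading_Cons[of b R "C[r := y]"] Rb u r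
      unfolding w p by (simp add: list_update_append map_update)
    then show ?thesis using T' wp y by auto
  qed
qed

lemma tab_e:
  assumes T: "tab n cs b T" and i: "1 \<le> i" "i \<le> n" and a: "acts Minus n i (reading b T) p"
  shows "\<exists>T' z. tab n cs b T' \<and> factor_e n i (reading b T ! p) = Some z \<and> reading b T' = (reading b T)[p := z]"
proof -
  define T0 where "T0 = (if b then butlast T else T)"
  have Tne: "T \<noteq> []" if b using T that by (auto simp: tab_def shape_def)
  have T0: "T = T0 @ (if b then [last T] else [])" using Tne by (simp add: T0_def)
  have kn: "kn_column n C" if "C \<in> set T" for C using T that by (simp add: tab_def)
  have half: "last T \<in> half_columns n" if b using T that by (simp add: tab_def)
  have suc: "successively (linked n) T" using T by (simp add: tab_def)
  have pl: "p < length (reading b T)" using acts_bound[OF a] .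
  have rd: "reading b T = spin_part b T @ map Vec (rev (concat T0))" by (simp add: reading_alt T0_def)
  show ?thesis
  proof (cases "p < length (spin_part b T)")
    case True
    then have b: b and p: "p = 0" by (auto simp: spin_part_def split: if_splits)
    have r0: "reading b T ! p = Spin (last T)" using b p by (simp add: reading_def)
    then obtain c' where c': "spin_e n i (last T) = Some c'"
      using acts_MinusD[OF a] string_length_spin(1)[OF i(1), of n "last T"] by (auto split: if_splits)
    have T': "tab n cs b (T0 @ c' # [])"
    proof (rule tab_replace[of n cs b T0 "last T" "[]"])
      show "tab n cs b (T0 @ [last T])" using T T0 b by simp
      note h = half_column_e[OF half[OF b] c' i]
      show "kn_column n c'" using half_column_kn[OF h(1)] .
      show "length c' = length (last T)" using half_columnD(1)[OF h(1)] half_columnD(1)[OF half[OF b]] by simp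
      show "linked n (last T0) c'" if ne: "T0 \<noteq> []"
      proof (rule linked_e_right_spin[OF _ _ half[OF b] c' _ i])
        have "successively (linked n) (T0 @ [last T])" using suc T0 b by simp
        then show "linked n (last T0) (last T)" using that by (simp add: successively_append_iff)
        have "last T0 \<in> set T" using that T0 by (metis Un_iff last_in_set set_append)
        then show "kn_column n (last T0)" by (rule kn)
        have "concat T0 = concat (butlast T0) @ last T0"
          using arg_cong[OF append_butlast_last_id[OF ne], of concat] by simp
        then have "reading b T = [] @ ([Spin (last T)] @ map Vec (rev (last T0))) @ map Vec (rev (concat (butlast T0)))"
          using rd b by (simp add: spin_part_def)
        then show "acts Minus n i ([Spin (last T)] @ map Vec (rev (last T0))) 0"
          using a p acts_middle[of Minus n i "[]" "[Spin (last T)] @ map Vec (rev (last T0))" "map Vec (rev (concat (butlast T0)))" 0]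
          by simp
      qed
      show "c' \<in> half_columns n" using h(1) .
    qed simp
    have "reading b (T0 @ [c']) = (reading b T)[p := Spin c']"
      using b p by (simp add: reading_def T0_def)
    then show ?thesis using T' r0 c' by auto
  next
    case False
    define q where "q = p - length (spin_part b T)"
    have q: "p = length (spin_part b T) + q" "q < length (concat T0)" using False pl rd by (auto simp: q_def)
    obtain A C B t where ACB: "T0 = A @ C # B" "q = length (concat B) + t" "t < length C"
      using concat_position[OF q(2)] by blast
    define R where "R = B @ (if b then [last T] else [])"
    have TR: "T = A @ C # R" using T0 ACB by (simp add: R_def)
    have Rb: "b \<Longrightarrow> R \<noteq> []" "b \<Longrightarrow> last R \<in> half_columns n" using half by (auto simp: R_def)
    have w: "reading b T = reading b R @ map Vec (rev C) @ map Vec (rev (concat A))"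
      using reading_append[of b "C # R" A] reading_Cons[of b R C] Rb unfolding TR by simp
    have "length (reading b R) = length (spin_part b T) + length (concat B)"
      by (auto simp: reading_alt R_def spin_part_def)
    then have p: "p = length (reading b R) + t" using q ACB by simp
    define r where "r = length C - Suc t"
    have r: "r < length C" "t < length C" "rev C ! t = C ! r" using ACB(3) by (auto simp: r_def rev_nth)
    have a2: "acts Minus n i (map Vec (rev C)) t"
      using acts_middle[of Minus n i "reading b R" "map Vec (rev C)" "map Vec (rev (concat A))" p] a w p r by simp
    \<comment> \<open>For \<open>e\<close> it is the left neighbour, read after \<open>C\<close>,
      whose minuses have to be absorbed by \<open>C\<close>.\<close>
    have a3: "acts Minus n i (map Vec (rev C) @ map Vec (rev (last A))) t" if "A \<noteq> []"
    proof -
      have "concat A = concat (butlast A) @ last A"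
        using arg_cong[OF append_butlast_last_id[OF that], of concat] by simp
      then have "reading b T = reading b R @ (map Vec (rev C) @ map Vec (rev (last A))) @ map Vec (rev (concat (butlast A)))"
        using w by simp
      then show ?thesis
        using acts_middle[of Minus n i "reading b R" "map Vec (rev C) @ map Vec (rev (last A))" "map Vec (rev (concat (butlast A)))" p] a p r
        by simp
    qed
    have wp: "reading b T ! p = Vec (C ! r)" using r unfolding w p by (simp add: nth_append)
    obtain y where y: "vec_e n i (C ! r) = Some y"
      using acts_MinusD[OF a] unfolding wp by (auto simp: letter_eps_pos_iff simp del: neq0_conv)
    have sucs: "A \<noteq> [] \<Longrightarrow> linked n (last A) C" "R \<noteq> [] \<Longrightarrow> linked n C (hd R)"
      using suc unfolding TR by (auto simp: successively_append_iff successively_Cons)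
    have T': "tab n cs b (A @ C[r := y] # R)"
    proof (rule tab_replace)
      show "tab n cs b (A @ C # R)" using T TR by simp
      show "kn_column n (C[r := y])" by (rule kn_column_e[OF _ a2 i r_def r(2) y]) (use kn TR in simp)
      show "linked n (last A) (C[r := y])" if "A \<noteq> []"
        by (rule linked_e_right[OF _ _ sucs(1)[OF that] a3[OF that] i r_def r(2) y]) (use kn TR that in auto)
      show "linked n (C[r := y]) (hd R)" if "R \<noteq> []"
        by (rule linked_e_left[OF _ _ sucs(2)[OF that] a2 i r_def r(2) y]) (use kn TR that in auto)
    qed (use Rb in auto)
    have "rev (C[r := y]) = (rev C)[t := y]" using r by (simp add: rev_update r_def)
    then have "reading b (A @ C[r := y] # R) = (reading b T)[p := Vec y]"
      using reading_append[of b "C[r := y] # R" A] reading_Cons[of b R "C[r := y]"] Rb r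
      unfolding w p by (simp add: list_update_append map_update)
    then show ?thesis using T' wp y by auto
  qed
qed

section \<open>The highest weight tableau\<close>

definition std_column :: "nat \<Rightarrow> letter list" where
  "std_column M = rev (map Pos [1..<Suc M])"

lemma std_column_simps [simp]: "length (std_column M) = M" "set (std_column M) = Pos ` {1..M}"
  by (auto simp: std_column_def)

lemma std_column_nth: "p < M \<Longrightarrow> std_column M ! p = Pos (M - p)"
  by (simp add: std_column_def rev_nth del: upt_Suc)

lemma column_ok_std: "column_ok (std_column M)"
  unfolding column_ok_iff by (auto simp: std_column_nth col_gt_def)

lemma std_column_letters: "set (std_column M) \<subseteq> letters M"
  by auto

lemma pos_count_std: "pos_count (std_column M) a = int (min a M)"
  by (induction a) (auto simp: pos_count_step[OF column_ok_std] pos_count_0[OF std_column_letters])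

lemma neg_count_std: "neg_count (std_column M) a = 0"
  by (induction a) (auto simp: neg_count_step[OF column_ok_std] neg_count_0[OF std_column_letters])

lemma std_column_unique:
  assumes "column_ok C" "set C = Pos ` {1..M}"
  shows "C = std_column M"
proof -
  have "rev C = rev (std_column M)"
  proof (rule sorted_count_list_unique)
    show "count_list (rev C) x = count_list (rev (std_column M)) x" for x
      using column_ok_count[OF assms(1)] column_ok_count[OF column_ok_std, of x M] assms(2)
      by (cases "x = Zero") (auto simp: count_list_0_iff)
  qed (use assms(1) column_ok_std sorted_rev_column in auto)
  then show ?thesis by simp
qed

lemma kn_column_std: "M \<le> n \<Longrightarrow> kn_column n (std_column M)"
  using column_ok_std by (auto simp: kn_column_def pos_count_std neg_count_std)

lemma linked_std: "M \<le> M' \<Longrightarrow> M' \<le> n \<Longrightarrow> linked n (std_column M) (std_column M')"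
  by (auto simp: linked_def link_def pos_count_std neg_count_std)

lemma half_column_std: "std_column n \<in> half_columns n"
proof (rule half_columnI)
  show "sorted_wrt (>) (std_column n)" unfolding sorted_wrt_iff_nth_less by (auto simp: std_column_nth)
qed auto

definition std_tab :: "nat \<Rightarrow> nat list \<Rightarrow> bool \<Rightarrow> letter list list" where
  "std_tab n cs b = map std_column (shape n cs b)"

lemma tab_std:
  assumes "sorted cs" "set cs \<subseteq> {1..n}"
  shows "tab n cs b (std_tab n cs b)"
proof -
  have le: "\<forall>M\<in>set (shape n cs b). M \<le> n" using assms by (auto simp: shape_def split: if_splits)
  have "successively (linked n) (map std_column (shape n cs b))"
    unfolding successively_conv_nth
    using sorted_nth_mono[OF sorted_shape[OF assms, of b]] le by (auto intro!: linked_std)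
  moreover have "\<forall>C\<in>set (std_tab n cs b). kn_column n C" using le by (auto simp: std_tab_def intro: kn_column_std)
  moreover have "b \<longrightarrow> last (std_tab n cs b) \<in> half_columns n" by (simp add: std_tab_def shape_def half_column_std)
  ultimately show ?thesis by (simp add: tab_def std_tab_def comp_def)
qed

lemma word_phi_append_0: "word_phi n i u = 0 \<Longrightarrow> word_phi n i v = 0 \<Longrightarrow> word_phi n i (u @ v) = 0"
  by (simp add: word_phi_def word_signs_append remaining_Plus_append remaining_shift)

lemma word_eps_append_0:
  "word_eps n i (u @ v) = 0 \<Longrightarrow> word_eps n i u = 0"
  "word_eps n i (u @ v) = 0 \<Longrightarrow> word_phi n i u = 0 \<Longrightarrow> word_eps n i v = 0"
  by (auto simp: word_eps_def word_phi_def word_signs_append remaining_Minus_append remaining_shift)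

text \<open>In a standard column longer than \<open>i\<close> the plus of \<open>i\<close> cancels
  against the minus of \<open>Suc i\<close>, which is read next.\<close>

lemma word_phi_std:
  assumes "\<forall>M\<in>set Ms. i < M \<and> M \<le> n" "b \<longrightarrow> Ms \<noteq> [] \<and> last Ms = n" "1 \<le> i"
  shows "word_phi n i (reading b (map std_column Ms)) = 0"
  using assms
proof (induction Ms)
  case Nil
  then show ?case by (simp add: reading_def word_phi_def word_signs_def)
next
  case (Cons M Ms)
  show ?case
  proof (cases "b \<and> Ms = []")
    case True
    then have "spin_f n i (std_column M) = None" using Cons.prems by (auto simp: spin_f_def)
    then show ?thesis using True Cons.prems(3) by (simp add: reading_def word_phi_def word_signs_Spin)
  next
    case False
    then have rd: "reading b (map std_column (M # Ms)) = reading b (map std_column Ms) @ map Vec (rev (std_column M))"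
      using reading_Cons[of b "map std_column Ms" "std_column M"] by simp
    have "word_phi n i (map Vec (rev (std_column M))) = 0"
      unfolding word_phi_Vec using Cons.prems
      by (subst letter_signs_column[OF column_ok_std]) auto
    then show ?thesis unfolding rd using False Cons by (intro word_phi_append_0 Cons.IH) auto
  qed
qed

lemma down_closed_interval:
  fixes S :: "nat set"
  assumes "finite S" "0 \<notin> S" "\<And>i. 1 \<le> i \<Longrightarrow> Suc i \<in> S \<Longrightarrow> i \<in> S"
  shows "\<exists>k. S = {1..k}"
proof (cases "S = {}")
  case False
  have "a \<in> S" if "1 \<le> a" "a \<le> Max S" for a
    using that(2,1)
  proof (induction a rule: inc_induct)
    case base
    then show ?case using Max_in[OF assms(1) False] by blast
  next
    case (step a)
    then have "Suc a \<in> S" by simp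
    then show ?case by (rule assms(3)[OF step.prems])
  qed
  then have "{1..Max S} \<subseteq> S" by (meson atLeastAtMost_iff subsetI)
  moreover have "1 \<le> a" if "a \<in> S" for a using that assms(2) by (metis not_one_le_zero gr0I less_one not_le)
  then have "S \<subseteq> {1..Max S}" using Max_ge[OF assms(1)] by (meson atLeastAtMost_iff subsetI)
  ultimately have "S = {1..Max S}" by blast
  then show ?thesis by blast
qed (auto intro: exI[of _ 0])

text \<open>Without remaining minuses the unbarred letters are closed downwards, hence form an
  interval from 1. The largest barred letter, say the bar of \<open>J\<close>, would need the plus
  of \<open>J\<close> in front of it; then the letters up to \<open>J\<close> already exhaust the
  bound on the total at \<open>J\<close>. A zero would likewise need \<open>n\<close>, and there
  would be no room for it.\<close>

lemma highest_single_column: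
  assumes "kn_column n C" "n \<ge> 1" "\<And>i. 1 \<le> i \<Longrightarrow> i \<le> n \<Longrightarrow> word_eps n i (map Vec (rev C)) = 0"
  shows "C = std_column (length C)"
proof -
  note c = kn_columnD[OF assms(1)]
  have "\<exists>k. {a. Pos a \<in> set C} = {1..k}"
  proof (rule down_closed_interval)
    show "finite {a. Pos a \<in> set C}" by (rule finite_subset[OF _ finite_atMost[of n]]) (use c(1) in auto)
    show "0 \<notin> {a. Pos a \<in> set C}" using c(1) by auto
    fix i assume i: "1 \<le> i" "Suc i \<in> {a. Pos a \<in> set C}"
    then have "i < n" using c(1) by auto
    then show "i \<in> {a. Pos a \<in> set C}"
      using word_eps_column_0(1)[OF c(2) _ assms(3)] i by auto
  qed
  then obtain k where "{a. Pos a \<in> set C} = {1..k}" by blast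
  then have k: "Pos a \<in> set C \<longleftrightarrow> 1 \<le> a \<and> a \<le> k" for a by (auto simp: set_eq_iff)
  have pc: "pos_count C a = int a" if "a \<le> k" for a
    using that by (induction a) (auto simp: pos_count_0[OF c(1)] pos_count_step[OF c(2)] k)
  have noneg: "Neg j \<notin> set C" for j
  proof
    assume "Neg j \<in> set C"
    define J where "J = Max {j. Neg j \<in> set C}"
    have fin: "finite {j. Neg j \<in> set C}" by (rule finite_subset[OF _ finite_atMost[of n]]) (use c(1) in auto)
    then have J: "Neg J \<in> set C" "\<And>a. Neg a \<in> set C \<Longrightarrow> a \<le> J"
      using Max_in[OF fin] Max_ge[OF fin] \<open>Neg j \<in> set C\<close> unfolding J_def by blast+
    have Jn: "1 \<le> J" "J \<le> n" using J(1) c(1) by auto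
    have "Pos J \<in> set C"
    proof (cases "J = n")
      case True
      then show ?thesis using word_eps_column_top_0[OF c(2) assms(3)] J(1) Jn by auto
    next
      case False
      then show ?thesis using word_eps_column_0(2)[OF c(2) _ assms(3)[OF Jn]] J Jn by force
    qed
    then have "pos_count C J = int J" using k pc by blast
    moreover have "neg_count C J \<ge> 1"
      using neg_count_step[OF c(2), of "J - 1"] neg_count_mono[of 0 "J - 1" C] neg_count_0[OF c(1)] J(1) Jn by simp
    ultimately show False using c(4)[OF Jn(2)] by simp
  qed
  have nozero: "Zero \<notin> set C"
  proof
    assume z: "Zero \<in> set C"
    then have "Pos n \<in> set C" using word_eps_column_top_0[OF c(2) assms(3)] assms(2) by auto
    then have "pos_count C n = int n" using k pc by blast
    moreover have "neg_count C n \<ge> 0" by (simp add: neg_count_def)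
    ultimately show False using counts_le_length(2)[OF c(1) z] c(3) by simp
  qed
  have "x \<in> set C \<longleftrightarrow> x \<in> Pos ` {1..k}" for x
    using noneg nozero k by (cases x) auto
  then have "set C = Pos ` {1..k}" by blast
  then have "C = std_column k" by (rule std_column_unique[OF c(2)])
  then show ?thesis by simp
qed

text \<open>The columns to the right of \<open>C\<close> are read before it, hence are annihilated
  by all \<open>e\<close> as well and are standard by induction. Let \<open>m\<close> be the length
  of the next column. For \<open>i < m\<close> these columns leave no plus, so \<open>C\<close>
  itself can have no remaining minus. The comparison of rows shows that all letters of
  \<open>C\<close> are among 1, ..., \<open>m\<close>, so these indices suffice.\<close>

lemma highest_weight_aux:
  assumes "n \<ge> 1" "\<forall>C\<in>set T. kn_column n C" "successively (linked n) T"
    "b \<longrightarrow> T \<noteq> [] \<and> last T \<in> half_columns n"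
    "\<And>i. 1 \<le> i \<Longrightarrow> i \<le> n \<Longrightarrow> word_eps n i (reading b T) = 0"
  shows "T = map std_column (map length T)"
  using assms(2-)
proof (induction T)
  case (Cons C T)
  have kn: "kn_column n C" using Cons.prems by simp
  note c = kn_columnD[OF kn]
  show ?case
  proof (cases "T = []")
    case T: True
    show ?thesis
    proof (cases b)
      case True
      then have h: "C \<in> half_columns n" and rd: "reading b (C # T) = [Spin C]" using Cons.prems T by (auto simp: reading_def)
      have e: "spin_e n i C = None" if "1 \<le> i" "i \<le> n" for i
        using Cons.prems(4)[OF that] unfolding rd word_eps_def word_signs_Spin[OF that(1)] by (auto split: if_splits)
      have "Pos a \<in> set C" if "1 \<le> a" "a \<le> n" for a
        using that(2,1)
      proof (induction a rule: inc_induct)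
        case base
        then show ?case using e[of n] half_columnD(6)[OF h, of n] assms(1) by (auto simp: spin_e_def split: if_splits)
      next
        case (step a)
        then show ?case using e[of a] half_columnD(6)[OF h, of a] by (auto simp: spin_e_def split: if_splits)
      qed
      then have "x \<in> set C \<longleftrightarrow> x \<in> Pos ` {1..n}" for x
        using half_columnD(2,3)[OF h] half_columnD(6)[OF h] by (cases x) fastforce+
      then have "C = std_column n" by (intro std_column_unique c(2)) blast
      then show ?thesis using T by simp
    next
      case False
      then have "reading b (C # T) = map Vec (rev C)" using T by (simp add: reading_def)
      then have "C = std_column (length C)"
        using highest_single_column[OF kn assms(1)] Cons.prems(4) by simp
      then show ?thesis using T by simp
    qed
  next
    case False
    have rd: "reading b (C # T) = reading b T @ map Vec (rev C)" by (rule reading_Cons) (use False in simp)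
    have eT: "word_eps n i (reading b T) = 0" if "1 \<le> i" "i \<le> n" for i
      using Cons.prems(4)[OF that] word_eps_append_0(1) unfolding rd by blast
    have IH: "T = map std_column (map length T)"
      by (rule Cons.IH) (use Cons.prems False eT in \<open>auto simp: successively_Cons\<close>)
    define m where "m = length (hd T)"
    have hdT: "hd T = std_column m" using False IH unfolding m_def
      by (metis list.map_sel(1) map_is_Nil_conv)
    have lnk: "linked n C (hd T)" using Cons.prems(2) False by (cases T) auto
    have sT: "successively (linked n) T" using Cons.prems(2) by (cases T) auto
    have knT: "\<forall>D\<in>set T. kn_column n D" using Cons.prems by simp
    have mn: "m \<le> n" using knT False kn_columnD(3)[of n "hd T"] by (simp add: m_def)
    have rl: "row_le C (hd T)"
      using linked_iff[OF kn, of "hd T"] lnk linkedD(2)[OF lnk] knT False by auto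
    have len_T: "m \<le> length D" if "D \<in> set T" for D
    proof -
      have "successively (\<lambda>x y. length x \<le> length y) T"
        using sT by (rule successively_mono) (auto dest: linkedD(2))
      then have "sorted_wrt (\<lambda>x y. length x \<le> length y) T"
        by (subst successively_conv_sorted_wrt[symmetric]) (auto intro!: transpI)
      then show ?thesis using that False unfolding m_def by (cases T) auto
    qed
    have phi: "word_phi n i (reading b T) = 0" if "1 \<le> i" "i < m" for i
    proof -
      have "word_phi n i (reading b (map std_column (map length T))) = 0"
      proof (rule word_phi_std)
        show "\<forall>M\<in>set (map length T). i < M \<and> M \<le> n" using len_T that knT kn_columnD(3) by force
        show "b \<longrightarrow> map length T \<noteq> [] \<and> last (map length T) = n"
          using Cons.prems(3) False half_columnD(1) by (auto simp: last_map)
      qed (use that in simp)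
      then show ?thesis using IH by simp
    qed
    have epsC: "word_eps n i (map Vec (rev C)) = 0" if "1 \<le> i" "i < m" for i
      using word_eps_append_0(2)[OF Cons.prems(4)[unfolded rd] phi] that mn by simp
    have pos: "\<exists>a. x = Pos a \<and> 1 \<le> a \<and> a \<le> m" if x: "x \<in> set C" for x
    proof -
      obtain p where p: "p < length C" "C ! p = x" using x by (auto simp: in_set_conv_nth)
      then have "x \<le> std_column m ! p" "p < m" using rl hdT by (auto simp: row_le_def)
      then have "x \<le> Pos (m - p)" by (simp add: std_column_nth)
      moreover have "x \<in> letters n" using c(1) x by blast
      ultimately show ?thesis by (cases x) auto
    qed
    have "\<exists>k. {a. Pos a \<in> set C} = {1..k}"
    proof (rule down_closed_interval)
      show "finite {a. Pos a \<in> set C}" by (rule finite_subset[OF _ finite_atMost[of n]]) (use c(1) in auto)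
      show "0 \<notin> {a. Pos a \<in> set C}" using c(1) by auto
      fix i assume i: "1 \<le> i" "Suc i \<in> {a. Pos a \<in> set C}"
      then have "i < m" using pos by fastforce
      then show "i \<in> {a. Pos a \<in> set C}"
        using word_eps_column_0(1)[OF c(2) _ epsC] i mn by auto
    qed
    then obtain k where "{a. Pos a \<in> set C} = {1..k}" by blast
    then have "Pos a \<in> set C \<longleftrightarrow> 1 \<le> a \<and> a \<le> k" for a by (auto simp: set_eq_iff)
    then have "x \<in> set C \<longleftrightarrow> x \<in> Pos ` {1..k}" for x
      using pos by (cases x) fastforce+
    then have "set C = Pos ` {1..k}" by blast
    then have "C = std_column k" by (rule std_column_unique[OF c(2)])
    then show ?thesis using IH by simp
  qed
qed simp

lemma highest_weight_tab:
  assumes "n \<ge> 1" "tab n cs b T" "\<And>i. 1 \<le> i \<Longrightarrow> i \<le> n \<Longrightarrow> word_eps n i (reading b T) = 0"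
  shows "T = std_tab n cs b"
proof -
  have "T = map std_column (map length T)"
    by (rule highest_weight_aux[OF assms(1) _ _ _ assms(3)]) (use assms(2) in \<open>auto simp: tab_def shape_def\<close>)
  then show ?thesis using assms(2) unfolding tab_def std_tab_def by metis
qed

text \<open>Position of a letter in the chain formed by the vector crystal; the sum over a reading
  serves as a measure that every \<open>e\<close> decreases.\<close>

fun letter_rank :: "nat \<Rightarrow> letter \<Rightarrow> nat" where
  "letter_rank n (Pos a) = a"
| "letter_rank n Zero = n + 1"
| "letter_rank n (Neg a) = 2 * n + 2 - a"

fun factor_rank :: "nat \<Rightarrow> factor \<Rightarrow> nat" where
  "factor_rank n (Vec x) = letter_rank n x"
| "factor_rank n (Spin c) = sum_list (map (letter_rank n) c)"

lemma factor_rank_e: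
  assumes "factor_e n i x = Some y" "1 \<le> i" "i \<le> n"
  shows "factor_rank n y < factor_rank n x"
proof (cases x)
  case (Vec l)
  then show ?thesis using assms by (auto simp: vec_e_def split: if_splits)
next
  case (Spin c)
  then obtain d where d: "spin_e n i c = Some d" "y = Spin d" using assms(1) by auto
  define g where "g = (if i < n then id(Pos (i + 1) := Pos i, Neg i := Neg (i + 1)) else id(Neg n := Pos n))"
  have g: "d = map g c" "Neg i \<in> set c" using d assms(3) by (auto simp: spin_e_def g_def split: if_splits)
  have le: "letter_rank n (g x) \<le> letter_rank n x" for x using assms(2,3) by (cases x) (auto simp: g_def)
  have lt: "letter_rank n (g (Neg i)) < letter_rank n (Neg i)" using assms(2,3) by (auto simp: g_def)
  have "sum_list (map (\<lambda>x. letter_rank n (g x)) c) < sum_list (map (letter_rank n) c)"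
    using g(2)
  proof (induction c)
    case (Cons x c)
    have "sum_list (map (\<lambda>x. letter_rank n (g x)) c) \<le> sum_list (map (letter_rank n) c)"
      by (rule sum_list_mono) (rule le)
    then show ?case using Cons le[of x] lt by auto
  qed simp
  then show ?thesis using d g Spin by (simp add: comp_def)
qed

text \<open>Connectedness of the tableau crystal as an induction rule: apply operators
  \<open>e\<close>, each of which lowers the rank, until all of them vanish.\<close>

lemma tab_induct [consumes 2, case_names std step]:
  assumes "n \<ge> 1" "tab n cs b T"
    and "P (std_tab n cs b)"
    and "\<And>T T' i p z. tab n cs b T \<Longrightarrow> tab n cs b T' \<Longrightarrow> 1 \<le> i \<Longrightarrow> i \<le> n \<Longrightarrow> acts Minus n i (reading b T) p \<Longrightarrow>
      factor_e n i (reading b T ! p) = Some z \<Longrightarrow> reading b T' = (reading b T)[p := z] \<Longrightarrow> P T' \<Longrightarrow> P T"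
  shows "P T"
  using assms(2)
proof (induction "sum_list (map (factor_rank n) (reading b T))" arbitrary: T rule: less_induct)
  case less
  show ?case
  proof (cases "\<forall>i. 1 \<le> i \<longrightarrow> i \<le> n \<longrightarrow> word_eps n i (reading b T) = 0")
    case True
    then show ?thesis using highest_weight_tab[OF assms(1) less.prems] assms(3) by auto
  next
    case False
    then obtain i where i: "1 \<le> i" "i \<le> n" "word_eps n i (reading b T) \<noteq> 0" by blast
    then obtain p where p: "acts Minus n i (reading b T) p" by (auto simp: word_eps_def)
    obtain T' z where T': "tab n cs b T'" "factor_e n i (reading b T ! p) = Some z" "reading b T' = (reading b T)[p := z]"
      using tab_e[OF less.prems i(1,2) p] by blast
    have "sum_list (map (factor_rank n) (reading b T')) < sum_list (map (factor_rank n) (reading b T))"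
      using factor_rank_e[OF T'(2) i(1,2)] acts_bound[OF p]
        elem_le_sum_list[of p "map (factor_rank n) (reading b T)"]
      unfolding T'(3) by (simp add: map_update sum_list_update)
    then show ?thesis using less.hyps[OF _ T'(1)] assms(4)[OF less.prems T'(1) i(1,2) p T'(2,3)] by blast
  qed
qed

text \<open>The prescribed lengths of the columns allow the concatenation to be undone.\<close>

lemma reading_inj: "inj_on (reading b) (fillings n cs b)"
proof
  fix S T assume S: "S \<in> fillings n cs b" and T: "T \<in> fillings n cs b" and eq: "reading b S = reading b T"
  have len: "map length S = map length T" using S T by (simp add: fillings_def)
  have concat_inj: "xs = ys" if "map length xs = map length ys" "concat xs = concat ys" for xs ys :: "letter list list"
    using that by (induction xs arbitrary: ys) (auto simp: Cons_eq_map_conv)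
  have inj: "inj (map Vec)" by (simp add: inj_def)
  show "S = T"
  proof (cases b)
    case False
    then have "concat S = concat T" using eq injD[OF inj] by (auto simp: reading_alt spin_part_def)
    then show ?thesis using concat_inj len by blast
  next
    case True
    then have ne: "S \<noteq> []" "T \<noteq> []" using S T by (auto simp: fillings_def shape_def)
    have "last S = last T" "concat (butlast S) = concat (butlast T)"
      using True eq injD[OF inj] by (auto simp: reading_alt spin_part_def)
    moreover have "map length (butlast S) = map length (butlast T)" using len by (metis map_butlast)
    ultimately show ?thesis using concat_inj ne by (metis append_butlast_last_id)
  qed
qed

lemma tab_fillings: "tab n cs b T \<Longrightarrow> T \<in> fillings n cs b"
  by (auto simp: tab_def fillings_def kn_column_def)

lemma unreading_reading: "tab n cs b T \<Longrightarrow> unreading n cs b (reading b T) = T"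
  unfolding unreading_def by (rule inv_into_f_f[OF reading_inj tab_fillings])

section \<open>Columns of Young walls\<close>

text \<open>The top layer of a column with letter \<open>x\<close> whose letters start in period
  \<open>p\<close>. Truncated subtraction puts 1 and 2 into the same (0|1) layer, where
  \<open>tops\<close> tells them apart. The bar of 1 has offset \<open>2 * n - 1\<close>: it lies in
  the (0|1) layer of the next period, of which only the 1-block is present.\<close>

fun lay :: "nat \<Rightarrow> nat \<Rightarrow> letter \<Rightarrow> nat" where
  "lay n p (Pos j) = p * (2 * n - 1) + (j - 2)"
| "lay n p Zero = p * (2 * n - 1) + (n - 1)"
| "lay n p (Neg j) = p * (2 * n - 1) + (2 * n - j)"

fun tops :: "nat \<Rightarrow> letter \<Rightarrow> nat set" where
  "tops n (Pos j) = (if j = 1 then {0} else if j = 2 then {0, 1} else {j - 1})"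
| "tops n Zero = {n}"
| "tops n (Neg j) = (if j = 1 then {1} else {j})"

definition stack :: "nat \<Rightarrow> bool \<Rightarrow> nat \<Rightarrow> nat set \<Rightarrow> block set" where
  "stack n b L S = {(l, c). bottom_layer n b \<le> l \<and> l < L \<and> c \<in> layer_colours n l} \<union> {L} \<times> S"

definition proper_top :: "nat \<Rightarrow> bool \<Rightarrow> nat \<Rightarrow> nat set \<Rightarrow> bool" where
  "proper_top n b L S \<longleftrightarrow> bottom_layer n b \<le> L \<and> S \<noteq> {} \<and> S \<subseteq> layer_colours n L"

text \<open>The primed data belong to the right column. The front colours alternate, so in a (0|1)
  layer a block of colour \<open>c\<close> leans on the block of the other colour in the column to
  its right.\<close>

definition supports :: "nat \<Rightarrow> nat set \<Rightarrow> nat \<Rightarrow> nat set \<Rightarrow> bool" where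
  "supports L' S' L S \<longleftrightarrow> L < L' \<or> L = L' \<and> (\<forall>c\<in>S. if c \<ge> 2 then c \<in> S' else 1 - c \<in> S')"

lemma in_stack: "(l, c) \<in> stack n b L S \<longleftrightarrow> bottom_layer n b \<le> l \<and> l < L \<and> c \<in> layer_colours n l \<or> l = L \<and> c \<in> S"
  by (auto simp: stack_def)

lemma layer_colours_eq:
  "k < 2 * n - 1 \<Longrightarrow> layer_colours n (p * (2 * n - 1) + k) = (if k = 0 then {0, 1} else if k < n then {k + 1} else {2 * n - k})"
  by (simp add: layer_colours_def)

locale wall_rank =
  fixes n :: nat
  assumes n3: "3 \<le> n"
begin

lemma finite_layer_colours [simp]: "finite (layer_colours n L)"
  by (simp add: layer_colours_def Let_def)

lemma layer_colours_nonempty: "layer_colours n L \<noteq> {}"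
  by (simp add: layer_colours_def Let_def)

lemma layer_colours_small:
  assumes "c \<in> layer_colours n L" "c < 2" shows "layer_colours n L = {0, 1}" "L mod (2 * n - 1) = 0"
proof -
  have "L mod (2 * n - 1) < 2 * n - 1" using n3 by simp
  then show "layer_colours n L = {0, 1}" "L mod (2 * n - 1) = 0"
    using assms by (auto simp: layer_colours_def Let_def split: if_splits)
qed

lemma layer_colours_le: "c \<in> layer_colours n L \<Longrightarrow> c \<le> n"
  using n3 by (auto simp: layer_colours_def Let_def split: if_splits)

lemma colours_lay:
  "x \<in> letters n \<Longrightarrow> layer_colours n (lay n p x) =
    (case x of Pos j \<Rightarrow> if j \<le> 2 then {0, 1} else {j - 1} | Zero \<Rightarrow> {n} | Neg j \<Rightarrow> if j = 1 then {0, 1} else {j})"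
proof (cases x)
  case (Neg j)
  assume x: "x \<in> letters n"
  show ?thesis
  proof (cases "j = 1")
    case True
    have "p * (2 * n - 1) + (2 * n - 1) = (p + 1) * (2 * n - 1) + 0" by simp
    then show ?thesis using Neg True layer_colours_eq[of 0 n "p + 1"] n3 by simp
  next
    case False
    then have "2 * n - j < 2 * n - 1" "n \<le> 2 * n - j" "2 * n - j \<noteq> 0" "2 * n - (2 * n - j) = j" using x Neg n3 by auto
    then show ?thesis using Neg False layer_colours_eq[of "2 * n - j" n p] by (simp del: Nat.add_diff_assoc)
  qed
next
  case (Pos j)
  assume x: "x \<in> letters n"
  show ?thesis
  proof (cases "j \<le> 2")
    case True
    then show ?thesis using Pos n3 layer_colours_eq[of 0 n p] by simp
  next
    case False
    then have "j - 2 < 2 * n - 1" "j - 2 \<noteq> 0" "j - 2 < n" "j - 2 + 1 = j - 1" using x Pos by auto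
    then show ?thesis using Pos False layer_colours_eq[of "j - 2" n p] by (simp del: Nat.add_diff_assoc)
  qed
next
  case Zero
  then show ?thesis using n3 layer_colours_eq[of "n - 1" n p] by (auto simp del: Nat.add_diff_assoc)
qed

lemma tops_lay: "x \<in> letters n \<Longrightarrow> tops n x \<noteq> {} \<and> tops n x \<subseteq> layer_colours n (lay n p x)"
  by (cases x) (auto simp: colours_lay simp del: lay.simps)

lemma tops_complete: "x \<in> letters n \<Longrightarrow> tops n x = layer_colours n (lay n p x) \<longleftrightarrow> x \<noteq> Pos 1 \<and> x \<noteq> Neg 1"
  by (cases x) (auto simp: colours_lay simp del: lay.simps)

lemma lay_mod:
  assumes "x \<in> letters n"
  shows "lay n p x mod (2 * n - 1) = (case x of Pos j \<Rightarrow> j - 2 | Zero \<Rightarrow> n - 1 | Neg j \<Rightarrow> if j = 1 then 0 else 2 * n - j)"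
  using assms n3 by (cases x) (auto simp: mod_mult_self3 simp del: Nat.add_diff_assoc)

context
  fixes b L S assumes t: "proper_top n b L S"
begin

lemma bottom_le: "bottom_layer n b \<le> L" and top_nonempty: "S \<noteq> {}" and top_subset: "S \<subseteq> layer_colours n L"
  using t by (auto simp: proper_top_def)

lemma fst_stack: "fst ` stack n b L S = {bottom_layer n b..L}"
proof
  show "{bottom_layer n b..L} \<subseteq> fst ` stack n b L S"
  proof
    fix l assume l: "l \<in> {bottom_layer n b..L}"
    obtain c where c: "l < L \<longrightarrow> c \<in> layer_colours n l" "l = L \<longrightarrow> c \<in> S"
      using layer_colours_nonempty[of l] top_nonempty by (cases "l = L") auto
    then have "(l, c) \<in> stack n b L S" using l by (auto simp: in_stack)
    then show "l \<in> fst ` stack n b L S" by force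
  qed
qed (use bottom_le in \<open>auto simp: stack_def\<close>)

lemma finite_stack: "finite (stack n b L S)"
proof -
  have "stack n b L S \<subseteq> {..L} \<times> {..n}" using top_subset by (auto simp: stack_def dest: layer_colours_le)
  then show ?thesis by (rule finite_subset) simp
qed

lemma is_column_stack: "is_column n b (stack n b L S)"
  using top_subset bottom_le unfolding is_column_def by (auto simp: in_stack)

lemma top_layer_stack: "top_layer (stack n b L S) = L"
  unfolding top_layer_def fst_stack using bottom_le by (intro Max_eqI) auto

lemma top_complete_stack: "top_complete n (stack n b L S) \<longleftrightarrow> S = layer_colours n L"
  using top_subset by (auto simp: top_complete_def top_layer_stack in_stack)

end

section \<open>Heights, full columns and the shape of arbitrary columns\<close>

definition height :: "bool \<Rightarrow> nat \<Rightarrow> rat" where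
  "height b L = (\<Sum>l\<in>{bottom_layer n b..L}. if n \<in> layer_colours n l then 1/2 else 1)"

lemma column_height_stack: "proper_top n b L S \<Longrightarrow> column_height n (stack n b L S) = height b L"
  by (simp add: column_height_def fst_stack height_def)

lemma top_in_colours: "n \<in> layer_colours n L \<longleftrightarrow> L mod (2 * n - 1) = n - 1 \<or> L mod (2 * n - 1) = n"
  using n3 by (auto simp: layer_colours_def Let_def)

lemma height_less:
  assumes "bottom_layer n b \<le> L" "L < L'" shows "height b L < height b L'"
  unfolding height_def by (rule sum_strict_mono2[where b = L']) (use assms in auto)

lemma height_inj:
  assumes "bottom_layer n b \<le> L" "bottom_layer n b \<le> L'" "height b L = height b L'" shows "L = L'"
  using height_less[OF assms(1), of L'] height_less[OF assms(2), of L] assms(3) by (cases L L' rule: linorder_cases) auto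

text \<open>The two \<open>n\<close>-layers of a period have half height and together make up one
  unit, so the height is an integer unless the top is the lower one of them. If \<open>b\<close>
  holds, the bottom layer is itself a lower \<open>n\<close>-layer, and the same rule
  results.\<close>

lemma height_Ints:
  assumes "bottom_layer n b \<le> L"
  shows "height b L + (if L mod (2 * n - 1) = n - 1 then 1/2 else 0) \<in> \<int>"
  using assms
proof (induction L rule: dec_induct)
  case base
  show ?case
  proof (cases b)
    case True
    then have "bottom_layer n b mod (2 * n - 1) = n - 1" using n3 by (simp add: bottom_layer_def)
    moreover have "n \<in> layer_colours n (bottom_layer n b)" using calculation by (simp add: top_in_colours)
    ultimately show ?thesis by (simp add: height_def)
  next
    case False
    then have "bottom_layer n b mod (2 * n - 1) = 0" by (simp add: bottom_layer_def)
    moreover have "n \<notin> layer_colours n (bottom_layer n b)" using calculation n3 by (simp add: top_in_colours)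
    ultimately show ?thesis using n3 by (simp add: height_def)
  qed
next
  case (step L)
  define w :: rat where "w = (if n \<in> layer_colours n (Suc L) then 1/2 else 1)"
  define r where "r = L mod (2 * n - 1)"
  have r: "r < 2 * n - 1" "Suc L mod (2 * n - 1) = (if Suc r = 2 * n - 1 then 0 else Suc r)"
    using n3 by (auto simp: r_def mod_Suc)
  have "height b (Suc L) = height b L + w"
    using step.hyps by (simp add: height_def w_def)
  moreover have "w = (if Suc L mod (2 * n - 1) = n - 1 \<or> Suc L mod (2 * n - 1) = n then 1/2 else 1)"
    by (simp add: w_def top_in_colours)
  moreover have IH: "height b L + (if r = n - 1 then 1/2 else 0) \<in> \<int>" using step.IH by (simp add: r_def)
  ultimately have *: "height b (Suc L) = height b L + w" "w = (if (if Suc r = 2 * n - 1 then 0 else Suc r) = n - 1 \<or>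
      (if Suc r = 2 * n - 1 then 0 else Suc r) = n then 1/2 else 1)"
    "height b L + (if r = n - 1 then 1/2 else 0) \<in> \<int>" using r(2) by simp_all
  consider "r = n - 1" | "Suc r = n - 1" | "r \<noteq> n - 1" "Suc r \<noteq> n - 1" "Suc r \<noteq> n" using n3 by linarith
  then show ?case
  proof cases
    case 1
    then have "Suc r \<noteq> 2 * n - 1" "Suc r = n" using n3 by auto
    then have "Suc L mod (2 * n - 1) \<noteq> n - 1" and w: "w = 1/2" using * r n3 by auto
    then show ?thesis unfolding *(1) w using *(3) 1 by simp
  next
    case 2
    then have "Suc r \<noteq> 2 * n - 1" "r \<noteq> n - 1" using n3 by auto
    then have "Suc L mod (2 * n - 1) = n - 1" "height b L \<in> \<int>" and w: "w = 1/2" using * r n3 2 by auto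
    moreover have "height b L + 1/2 + 1/2 = height b L + 1" by simp
    ultimately show ?thesis unfolding *(1) w by (simp add: Ints_add)
  next
    case 3
    then have "w = 1" "Suc L mod (2 * n - 1) \<noteq> n - 1" "height b L \<in> \<int>" using * r n3 by auto
    then show ?thesis using *(1) by (simp add: Ints_add)
  qed
qed

lemma full_stack:
  assumes "proper_top n b L S"
  shows "full n (stack n b L S) \<longleftrightarrow> S = layer_colours n L \<and> L mod (2 * n - 1) \<noteq> n - 1"
proof -
  have "height b L \<in> \<int> \<longleftrightarrow> L mod (2 * n - 1) \<noteq> n - 1"
  proof (cases "L mod (2 * n - 1) = n - 1")
    case True
    then have "height b L + 1/2 \<in> \<int>" using height_Ints[OF bottom_le[OF assms]] by simp
    moreover have "(1/2 :: rat) \<notin> \<int>"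
    proof
      assume "(1/2 :: rat) \<in> \<int>"
      then obtain k :: int where "(1/2 :: rat) = of_int k" by (elim Ints_cases)
      then have "(of_int 1 :: rat) = of_int (2 * k)" by simp
      then have "1 = 2 * k" by (simp only: of_int_eq_iff)
      then show False by presburger
    qed
    ultimately have "height b L \<notin> \<int>" by (metis Ints_diff add_diff_cancel_left')
    then show ?thesis using True by simp
  next
    case False
    then show ?thesis using height_Ints[OF bottom_le[OF assms]] by simp
  qed
  then show ?thesis unfolding full_def column_height_stack[OF assms] top_complete_stack[OF assms] by auto
qed

text \<open>\<open>is_column\<close> only asks for the layer directly below each block; descending
  from the top layer shows that all lower layers are complete.\<close>

lemma column_form:
  assumes "is_column n b C" "finite C" "C \<noteq> {}"
  shows "proper_top n b (top_layer C) {c. (top_layer C, c) \<in> C}" "C = stack n b (top_layer C) {c. (top_layer C, c) \<in> C}"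
proof -
  let ?L = "top_layer C"
  have Lin: "?L \<in> fst ` C" unfolding top_layer_def by (rule Max_in) (use assms in auto)
  have le: "l \<le> ?L" if "(l, c) \<in> C" for l c
    unfolding top_layer_def using that assms(2) by (intro Max_ge) force+
  have col: "bottom_layer n b \<le> l" "c \<in> layer_colours n l"
    "bottom_layer n b < l \<Longrightarrow> c' \<in> layer_colours n (l - 1) \<Longrightarrow> (l - 1, c') \<in> C" if "(l, c) \<in> C" for l c c'
    using that assms(1) unfolding is_column_def by blast+
  obtain c0 where c0: "(?L, c0) \<in> C" using Lin by auto
  have below: "\<forall>c\<in>layer_colours n l. (l, c) \<in> C" if "l < ?L" "bottom_layer n b \<le> l" for l
    using less_imp_le[OF that(1)] that
  proof (induction l rule: inc_induct)
    case (step l)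
    have "\<exists>c. (Suc l, c) \<in> C"
    proof (cases "Suc l = ?L")
      case True
      then show ?thesis using c0 by auto
    next
      case False
      then show ?thesis using step layer_colours_nonempty[of "Suc l"] by auto
    qed
    then show ?case using col(3)[of "Suc l"] step.prems by force
  qed simp
  show "proper_top n b ?L {c. (?L, c) \<in> C}" using c0 col unfolding proper_top_def by blast
  show "C = stack n b ?L {c. (?L, c) \<in> C}"
  proof (rule set_eqI)
    fix x :: "nat \<times> nat"
    obtain l c where x: "x = (l, c)" by fastforce
    have "(l, c) \<in> C \<longleftrightarrow> (l, c) \<in> stack n b ?L {c. (?L, c) \<in> C}"
      unfolding in_stack using le[of l c] col[of l c] below[of l] by (cases "l = ?L") auto
    then show "x \<in> C \<longleftrightarrow> x \<in> stack n b ?L {c. (?L, c) \<in> C}" using x by simp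
  qed
qed

lemma supports_iff:
  assumes t: "proper_top n b L S" and t': "proper_top n b L' S'"
  shows "(\<forall>(l, c)\<in>stack n b L S. if c \<ge> 2 then (l, c) \<in> stack n b L' S'
      else \<exists>c'\<in>{0, 1}. (l, c') \<in> stack n b L' S' \<and> (c' = front_colour N j \<longleftrightarrow> c = front_colour N (j + 1)))
    \<longleftrightarrow> supports L' S' L S" (is "?A \<longleftrightarrow> _")
proof -
  have fc: "front_colour N (j + 1) = 1 - front_colour N j" "front_colour N j = 0 \<or> front_colour N j = 1"
    unfolding front_colour_def by presburger+
  have eq: "(\<exists>c'\<in>{0, 1}. (l, c') \<in> A \<and> (c' = front_colour N j \<longleftrightarrow> c = front_colour N (j + 1))) \<longleftrightarrow> (l, 1 - c) \<in> A"
    if "c < 2" for l c and A :: "block set"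
    using that fc by (cases "front_colour N j = 0"; cases "c = 0") auto
  have "?A \<longleftrightarrow> (\<forall>(l, c)\<in>stack n b L S. if c \<ge> 2 then (l, c) \<in> stack n b L' S' else (l, 1 - c) \<in> stack n b L' S')"
    using eq by (intro ball_cong) auto
  also have "\<dots> \<longleftrightarrow> supports L' S' L S"
  proof
    assume A: "\<forall>(l, c)\<in>stack n b L S. if c \<ge> 2 then (l, c) \<in> stack n b L' S' else (l, 1 - c) \<in> stack n b L' S'"
    have S: "c \<ge> 2 \<Longrightarrow> (L, c) \<in> stack n b L' S'" "c < 2 \<Longrightarrow> (L, 1 - c) \<in> stack n b L' S'" if "c \<in> S" for c
      using A that by (force simp: in_stack)+
    obtain c where "c \<in> S" using top_nonempty[OF t] by blast
    then have "L \<le> L'" using S[of c] by (cases "c \<ge> 2") (auto simp: in_stack)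
    then show "supports L' S' L S" using S by (auto simp: supports_def in_stack)
  next
    assume sup: "supports L' S' L S"
    have comp: "1 - c \<in> layer_colours n l" if "c \<in> layer_colours n l" "c < 2" for c l
      using layer_colours_small[OF that] that by (cases "c = 0") auto
    show "\<forall>(l, c)\<in>stack n b L S. if c \<ge> 2 then (l, c) \<in> stack n b L' S' else (l, 1 - c) \<in> stack n b L' S'"
    proof (clarify)
      fix l c assume lc: "(l, c) \<in> stack n b L S"
      then have c: "c \<in> layer_colours n l" "bottom_layer n b \<le> l" "l \<le> L"
        using top_subset[OF t] bottom_le[OF t] by (auto simp: in_stack)
      show "if c \<ge> 2 then (l, c) \<in> stack n b L' S' else (l, 1 - c) \<in> stack n b L' S'"
      proof (cases "l < L'")
        case True
        then show ?thesis using c comp[of c l] by (auto simp: in_stack)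
      next
        case False
        then have "l = L" "L = L'" "c \<in> S" using sup c lc by (auto simp: supports_def in_stack)
        then show ?thesis using sup by (auto simp: supports_def in_stack split: if_splits)
      qed
    qed
  qed
  finally show ?thesis .
qed

lemma proper_stack_wall:
  assumes "Y 0 = {}" "\<And>j. 1 \<le> j \<Longrightarrow> Y j = stack n b (L j) (S j)" "\<And>j. 1 \<le> j \<Longrightarrow> proper_top n b (L j) (S j)"
  shows "proper_wall n b N Y \<longleftrightarrow> (\<forall>j\<ge>1. ground n b N j \<subseteq> Y j) \<and> finite {(j, x). x \<in> Y j - ground n b N j} \<and>
    (\<forall>j\<ge>1. supports (L j) (S j) (L (j + 1)) (S (j + 1))) \<and>
    (\<forall>j\<ge>1. \<forall>k\<ge>1. j \<noteq> k \<longrightarrow> full n (Y j) \<longrightarrow> full n (Y k) \<longrightarrow> L j \<noteq> L k)"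
proof -
  have "(\<forall>(l, c)\<in>Y (j + 1). if c \<ge> 2 then (l, c) \<in> Y j
      else \<exists>c'\<in>{0, 1}. (l, c') \<in> Y j \<and> (c' = front_colour N j \<longleftrightarrow> c = front_colour N (j + 1)))
    \<longleftrightarrow> supports (L j) (S j) (L (j + 1)) (S (j + 1))" if "1 \<le> j" for j
    unfolding assms(2)[OF that] assms(2)[OF le_add2[of 1 j]]
    by (rule supports_iff) (use assms(3) that in auto)
  then have "right_supported N Y \<longleftrightarrow> (\<forall>j\<ge>1. supports (L j) (S j) (L (j + 1)) (S (j + 1)))"
    unfolding right_supported_def by meson
  moreover have "column_height n (Y j) = column_height n (Y k) \<longleftrightarrow> L j = L k" if "1 \<le> j" "1 \<le> k" for j k
    using height_inj bottom_le assms that by (metis column_height_stack)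
  ultimately show ?thesis
    unfolding proper_wall_def young_wall_def using assms is_column_stack by (auto; blast)
qed

end

definition letter_layer :: "nat \<Rightarrow> letter \<Rightarrow> nat" where
  "letter_layer n x = (case x of Pos j \<Rightarrow> j - 2 | Zero \<Rightarrow> n - 1 | Neg j \<Rightarrow> 2 * n - j)"

lemma lay_eq: "lay n p x = p * (2 * n - 1) + letter_layer n x"
  by (cases x) (auto simp: letter_layer_def)

lemma supports_add: "supports (q + L') S' (q + L) S \<longleftrightarrow> supports L' S' L S"
  by (auto simp: supports_def)

text \<open>The excluded equality is that of two full columns. Tops with the letter 1 or its bar are
  incomplete and a top with \<open>Zero\<close> is at half height, so these columns are not full.
  This is why zeros, and only zeros, may be repeated.\<close>

lemma supports_same_base:
  assumes "3 \<le> n" "x \<in> letters n" "y \<in> letters n"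
  shows "supports (lay n p x) (tops n x) (lay n p y) (tops n y) \<and>
    \<not> (lay n p x = lay n p y \<and> x \<notin> {Pos 1, Neg 1, Zero} \<and> y \<notin> {Pos 1, Neg 1, Zero}) \<longleftrightarrow> col_gt x y"
  unfolding lay_eq supports_add add_left_cancel
  using assms by (cases x; cases y) (auto simp: supports_def col_gt_def letter_layer_def)

text \<open>The extreme case is the letter 1 on the right and the bar of 1 on the left: both tops
  lie in the same layer, and the 1-block on the left leans on the 0-block on the right.\<close>

lemma supports_next_base:
  assumes "3 \<le> n" "x \<in> letters n" "y \<in> letters n"
  shows "supports (lay n (Suc p) x) (tops n x) (lay n p y) (tops n y)"
proof -
  have eq: "lay n (Suc p) x = p * (2 * n - 1) + (2 * n - 1 + letter_layer n x)" by (simp add: lay_eq)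
  show ?thesis unfolding eq lay_eq[of n p y] supports_add
    using assms by (cases x; cases y) (auto simp: supports_def letter_layer_def)
qed

lemma lay_inj:
  assumes "3 \<le> n" "x \<in> letters n" "y \<in> letters n" "x \<notin> {Pos 1, Neg 1}" "y \<notin> {Pos 1, Neg 1}"
    and "lay n p x = lay n q y"
  shows "p = q \<and> x = y"
proof -
  define r where "r = (\<lambda>x. case x of Pos j \<Rightarrow> j - 2 | Zero \<Rightarrow> n - 1 | Neg j \<Rightarrow> 2 * n - j)"
  have lay: "lay n p x = p * (2 * n - 1) + r x" for p x by (cases x) (auto simp: r_def)
  have r: "r x < 2 * n - 1" if "x \<in> letters n" "x \<notin> {Pos 1, Neg 1}" for x
    using that assms(1) by (cases x) (auto simp: r_def)
  have "(p * (2 * n - 1) + r x) div (2 * n - 1) = (q * (2 * n - 1) + r y) div (2 * n - 1)"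
    "(p * (2 * n - 1) + r x) mod (2 * n - 1) = (q * (2 * n - 1) + r y) mod (2 * n - 1)"
    using assms(6) lay by simp_all
  then have "p = q" "r x = r y" using r[OF assms(2,4)] r[OF assms(3,5)] by simp_all
  moreover have "x = y" using \<open>r x = r y\<close> assms(1-5) by (cases x; cases y) (auto simp: r_def)
  ultimately show ?thesis by simp
qed

section \<open>Walls described by letters\<close>

text \<open>\<open>base_period cs j\<close> is the period in which the top of column \<open>j\<close> lies in the highest weight wall.\<close>

fun base_period :: "nat list \<Rightarrow> nat \<Rightarrow> nat" where
  "base_period [] j = 0"
| "base_period (c # cs) j = (if j \<le> c then Suc (length cs) else base_period cs (j - c))"

lemma base_period_gt: "sum_list cs < j \<Longrightarrow> base_period cs j = 0"
  by (induction cs arbitrary: j) auto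

lemma base_period_pos: "1 \<le> j \<Longrightarrow> j \<le> sum_list cs \<Longrightarrow> 1 \<le> base_period cs j"
  by (induction cs arbitrary: j) auto

lemma base_period_1: "0 \<notin> set cs \<Longrightarrow> base_period cs 1 = length cs"
  by (cases cs) (auto simp: Suc_le_eq)

lemma base_period_Suc:
  "0 \<notin> set cs \<Longrightarrow> 1 \<le> j \<Longrightarrow> base_period cs (Suc j) = base_period cs j \<or> base_period cs j = Suc (base_period cs (Suc j))"
proof (induction cs arbitrary: j)
  case (Cons c cs)
  consider "Suc j \<le> c" | "j = c" | "c < j" by linarith
  then show ?case
  proof cases
    case 2
    then show ?thesis using Cons.prems base_period_1[of cs] by simp
  next
    case 3
    then have "Suc j - c = Suc (j - c)" by simp
    then show ?thesis using Cons.IH[of "j - c"] Cons.prems 3 by simp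
  qed simp
qed simp

lemma base_period_mono: "0 \<notin> set cs \<Longrightarrow> 1 \<le> j \<Longrightarrow> j \<le> k \<Longrightarrow> base_period cs k \<le> base_period cs j"
proof (induction k)
  case (Suc k)
  show ?case
  proof (cases "j = Suc k")
    case False
    then have "base_period cs k \<le> base_period cs j" "1 \<le> k" using Suc by auto
    then show ?thesis using base_period_Suc[OF Suc.prems(1), of k] by auto
  qed simp
qed simp

definition valid_letters :: "nat \<Rightarrow> nat list \<Rightarrow> bool \<Rightarrow> (nat \<Rightarrow> letter) \<Rightarrow> bool" where
  "valid_letters n cs b \<xi> \<longleftrightarrow> (\<forall>j\<ge>1. \<xi> j \<in> letters n) \<and>
     (b \<longrightarrow> (\<forall>j>sum_list cs. Zero \<le> \<xi> j) \<and> finite {j. sum_list cs < j \<and> \<xi> j \<noteq> Zero})"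

text \<open>By \<open>supports_next_base\<close> and \<open>lay_inj\<close>, neighbouring columns
  with different base periods impose no condition on each other.\<close>

definition nice_letters :: "nat list \<Rightarrow> bool \<Rightarrow> (nat \<Rightarrow> letter) \<Rightarrow> bool" where
  "nice_letters cs b \<xi> \<longleftrightarrow> (\<forall>j\<ge>1. Suc j \<le> sum_list cs \<or> b \<longrightarrow> base_period cs j = base_period cs (Suc j) \<longrightarrow>
     col_gt (\<xi> j) (\<xi> (Suc j)))"

text \<open>
  If \<open>b\<close> holds, the columns to the left of column \<open>N = sum_list cs\<close> carry letters, too; the letter
  \<open>Zero\<close> with base period \<open>0\<close> then stands for a column of the ground-state wall.
\<close>

definition top_at :: "nat \<Rightarrow> nat list \<Rightarrow> bool \<Rightarrow> (nat \<Rightarrow> letter) \<Rightarrow> nat \<Rightarrow> nat" where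
  "top_at n cs b \<xi> j = (if j \<le> sum_list cs \<or> b then lay n (base_period cs j) (\<xi> j) else bottom_layer n b)"

definition colours_at :: "nat \<Rightarrow> nat list \<Rightarrow> bool \<Rightarrow> (nat \<Rightarrow> letter) \<Rightarrow> nat \<Rightarrow> nat set" where
  "colours_at n cs b \<xi> j = (if j \<le> sum_list cs \<or> b then tops n (\<xi> j) else {front_colour (sum_list cs) j})"

definition letter_wall :: "nat \<Rightarrow> nat list \<Rightarrow> bool \<Rightarrow> (nat \<Rightarrow> letter) \<Rightarrow> wall" where
  "letter_wall n cs b \<xi> j = (if j = 0 then {} else stack n b (top_at n cs b \<xi> j) (colours_at n cs b \<xi> j))"

lemma col_gt_trans: "col_gt x y \<Longrightarrow> col_gt y z \<Longrightarrow> col_gt x z"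
  by (auto simp: col_gt_def)

locale wall_data = wall_rank +
  fixes cs :: "nat list" and b :: bool
  assumes cs: "set cs \<subseteq> {1..n}"
begin

abbreviation "N \<equiv> sum_list cs"
abbreviation "beta \<equiv> base_period cs"
abbreviation "Psi \<equiv> letter_wall n cs b"
abbreviation "valid \<equiv> valid_letters n cs b"
abbreviation "nice \<equiv> nice_letters cs b"

lemma cs0: "0 \<notin> set cs" using cs by auto

lemma validD:
  assumes "valid \<xi>"
  shows "1 \<le> j \<Longrightarrow> \<xi> j \<in> letters n" "b \<Longrightarrow> N < j \<Longrightarrow> Zero \<le> \<xi> j" "b \<Longrightarrow> finite {j. N < j \<and> \<xi> j \<noteq> Zero}"
  using assms by (auto simp: valid_letters_def)

lemma valid_update:
  assumes "valid \<xi>" "y \<in> letters n" "b \<Longrightarrow> N < j \<Longrightarrow> Zero \<le> y"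
  shows "valid (\<xi>(j := y))"
proof -
  have "finite {k. N < k \<and> (\<xi>(j := y)) k \<noteq> Zero}" if b
    by (rule finite_subset[of _ "insert j {k. N < k \<and> \<xi> k \<noteq> Zero}"]) (use validD(3)[OF assms(1) that] in auto)
  then show ?thesis using assms by (auto simp: valid_letters_def)
qed

lemma bottom_ground: "\<not> b \<Longrightarrow> layer_colours n (bottom_layer n b) = {0, 1}" "b \<Longrightarrow> layer_colours n (bottom_layer n b) = {n}"
  using n3 by (auto simp: bottom_layer_def layer_colours_def)

lemma front_colour_cases: "front_colour M j = 0 \<or> front_colour M j = 1"
  unfolding front_colour_def by presburger

lemma bottom_le_lay:
  assumes "x \<in> letters n" "1 \<le> p \<or> b \<and> Zero \<le> x"
  shows "bottom_layer n b \<le> lay n p x"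
proof (cases "1 \<le> p")
  case True
  have "bottom_layer n b \<le> 2 * n - 1" by (auto simp: bottom_layer_def)
  moreover have "1 * (2 * n - 1) \<le> p * (2 * n - 1)" by (rule mult_le_mono1[OF True])
  ultimately show ?thesis unfolding lay_eq by linarith
next
  case False
  then show ?thesis using assms unfolding lay_eq by (cases x) (auto simp: bottom_layer_def letter_layer_def)
qed

lemma bottom_le_top_at: "valid \<xi> \<Longrightarrow> 1 \<le> j \<Longrightarrow> bottom_layer n b \<le> top_at n cs b \<xi> j"
proof -
  assume v: "valid \<xi>" and j: "1 \<le> j"
  show ?thesis
  proof (cases "j \<le> N \<or> b")
    case True
    then have "1 \<le> beta j \<or> b \<and> Zero \<le> \<xi> j" using base_period_pos[OF j] validD(2)[OF v] by (cases "j \<le> N") auto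
    then show ?thesis using bottom_le_lay validD(1)[OF v j] True by (simp add: top_at_def)
  qed (simp add: top_at_def)
qed

lemma proper_top_at: "valid \<xi> \<Longrightarrow> 1 \<le> j \<Longrightarrow> proper_top n b (top_at n cs b \<xi> j) (colours_at n cs b \<xi> j)"
  using bottom_le_top_at[of \<xi> j] tops_lay[of "\<xi> j" "beta j"] validD(1)[of \<xi> j] bottom_ground front_colour_cases[of N j]
  by (auto simp: proper_top_def top_at_def colours_at_def)

lemma Psi_0: "Psi \<xi> 0 = {}" by (simp add: letter_wall_def)

lemma Psi_stack: "1 \<le> j \<Longrightarrow> Psi \<xi> j = stack n b (top_at n cs b \<xi> j) (colours_at n cs b \<xi> j)"
  by (simp add: letter_wall_def)

lemma stack_bottom: "stack n b' (bottom_layer n b') S = {bottom_layer n b'} \<times> S"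
  by (auto simp: stack_def)

lemma Psi_ground: "\<not> (j \<le> N \<or> b) \<Longrightarrow> Psi \<xi> j = ground n b N j"
  by (auto simp: letter_wall_def top_at_def colours_at_def stack_bottom ground_def)

lemma Psi_ground_tail: "b \<Longrightarrow> N < j \<Longrightarrow> \<xi> j = Zero \<Longrightarrow> Psi \<xi> j = ground n b N j"
  using n3 by (auto simp: letter_wall_def top_at_def colours_at_def ground_def base_period_gt bottom_layer_def stack_def)

lemma full_Psi:
  assumes "valid \<xi>" "1 \<le> j"
  shows "full n (Psi \<xi> j) \<longleftrightarrow> (j \<le> N \<or> b) \<and> \<xi> j \<notin> {Pos 1, Neg 1, Zero}"
proof (cases "j \<le> N \<or> b")
  case True
  have x: "\<xi> j \<in> letters n" using validD(1)[OF assms] .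
  have "lay n (beta j) (\<xi> j) mod (2 * n - 1) = n - 1 \<longleftrightarrow> \<xi> j = Zero"
    unfolding lay_mod[OF x] using x n3 by (cases "\<xi> j") auto
  moreover have T: "top_at n cs b \<xi> j = lay n (beta j) (\<xi> j)" "colours_at n cs b \<xi> j = tops n (\<xi> j)"
    using True by (simp_all add: top_at_def colours_at_def)
  moreover have F: "full n (Psi \<xi> j) \<longleftrightarrow> colours_at n cs b \<xi> j = layer_colours n (top_at n cs b \<xi> j) \<and>
      top_at n cs b \<xi> j mod (2 * n - 1) \<noteq> n - 1"
    unfolding Psi_stack[OF assms(2)] by (rule full_stack[OF proper_top_at[OF assms]])
  ultimately have "full n (Psi \<xi> j) \<longleftrightarrow> (\<xi> j \<noteq> Pos 1 \<and> \<xi> j \<noteq> Neg 1) \<and> \<xi> j \<noteq> Zero"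
    unfolding F T tops_complete[OF x] by blast
  then show ?thesis using True by blast
next
  case False
  then have e: "colours_at n cs b \<xi> j = {front_colour N j}" "top_at n cs b \<xi> j = bottom_layer n b"
    by (simp_all add: colours_at_def top_at_def)
  have "layer_colours n (bottom_layer n b) = {0, 1}" using bottom_ground(1) False by blast
  moreover have "{front_colour N j} \<noteq> {0, 1}" by auto
  ultimately have "colours_at n cs b \<xi> j \<noteq> layer_colours n (top_at n cs b \<xi> j)"
    unfolding e by metis
  then show ?thesis
    unfolding Psi_stack[OF assms(2)] full_stack[OF proper_top_at[OF assms]] using False by simp
qed

lemma nice_chain:
  assumes "nice \<xi>" "1 \<le> j" "j < k" "k \<le> N \<or> b" "beta j = beta k"
  shows "col_gt (\<xi> j) (\<xi> k)"
  using assms(3-)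
proof (induction k)
  case (Suc k)
  have k: "1 \<le> k" using Suc.prems assms(2) by simp
  have "beta (Suc k) \<le> beta k" "beta k \<le> beta j" 
    using base_period_mono[OF cs0 k, of "Suc k"] base_period_mono[OF cs0 assms(2), of k] Suc.prems by auto
  then have e: "beta j = beta k" "beta k = beta (Suc k)" using Suc.prems by auto
  have "col_gt (\<xi> k) (\<xi> (Suc k))" using assms(1) k e Suc.prems by (auto simp: nice_letters_def)
  then show ?case using Suc e by (cases "j = k") (auto intro: col_gt_trans)
qed simp

lemma Psi_support:
  assumes "valid \<xi>" "1 \<le> j" "Suc j \<le> N \<or> b"
  shows "supports (top_at n cs b \<xi> j) (colours_at n cs b \<xi> j) (top_at n cs b \<xi> (Suc j)) (colours_at n cs b \<xi> (Suc j)) \<and>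
    \<not> (top_at n cs b \<xi> j = top_at n cs b \<xi> (Suc j) \<and> full n (Psi \<xi> j) \<and> full n (Psi \<xi> (Suc j))) \<longleftrightarrow>
    (beta j = beta (Suc j) \<longrightarrow> col_gt (\<xi> j) (\<xi> (Suc j)))"
proof -
  have x: "\<xi> j \<in> letters n" "\<xi> (Suc j) \<in> letters n" using validD(1)[OF assms(1)] assms(2) by auto
  have act: "j \<le> N \<or> b" "Suc j \<le> N \<or> b" using assms by auto
  have F: "full n (Psi \<xi> j) \<longleftrightarrow> \<xi> j \<notin> {Pos 1, Neg 1, Zero}" "full n (Psi \<xi> (Suc j)) \<longleftrightarrow> \<xi> (Suc j) \<notin> {Pos 1, Neg 1, Zero}"
    using full_Psi[OF assms(1)] act assms(2) by auto
  show ?thesis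
  proof (cases "beta j = beta (Suc j)")
    case True
    then show ?thesis using supports_same_base[OF n3 x, of "beta j"] act F by (simp add: top_at_def colours_at_def)
  next
    case False
    then have s: "beta j = Suc (beta (Suc j))" using base_period_Suc[OF cs0 assms(2)] by auto
    have "top_at n cs b \<xi> j \<noteq> top_at n cs b \<xi> (Suc j)" if "full n (Psi \<xi> j)" "full n (Psi \<xi> (Suc j))"
      using lay_inj[OF n3 x, of "beta j" "beta (Suc j)"] that F act False by (auto simp: top_at_def)
    then show ?thesis using supports_next_base[OF n3 x, of "beta (Suc j)"] False s act
      by (auto simp: top_at_def colours_at_def)
  qed
qed

lemma front_colour_Suc: "front_colour M (Suc j) = 1 - front_colour M j"
  unfolding front_colour_def by presburger

text \<open>If \<open>b\<close> is false, the critical columns are those whose top is still in the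
  bottom layer. Their letter is 1 or 2. The letter 1, which shows only a 0-block, is possible in
  column \<open>N\<close> alone, since no letter is smaller; there the front colour is 0 by the
  choice of the ground-state wall.\<close>

lemma ground_subset:
  assumes "valid \<xi>" "nice \<xi>" "1 \<le> j"
  shows "ground n b N j \<subseteq> Psi \<xi> j"
proof (cases "j \<le> N \<or> b")
  case False
  then show ?thesis using Psi_ground by simp
next
  case True
  have x: "\<xi> j \<in> letters n" using validD(1)[OF assms(1,3)] .
  show ?thesis
  proof (cases "bottom_layer n b < top_at n cs b \<xi> j")
    case True
    obtain c where g: "ground n b N j = {(bottom_layer n b, c)}" "c \<in> layer_colours n (bottom_layer n b)"
      using bottom_ground front_colour_cases[of N j] assms(3) by (cases b) (auto simp: ground_def)
    show ?thesis unfolding g Psi_stack[OF assms(3)] using True g by (simp add: in_stack)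
  next
    case False
    then have top: "top_at n cs b \<xi> j = bottom_layer n b" using bottom_le_top_at[OF assms(1,3)] by simp
    show ?thesis
    proof (cases b)
      case True
      then have l: "lay n (beta j) (\<xi> j) = n - 1" using top by (simp add: top_at_def bottom_layer_def)
      then have "lay n (beta j) (\<xi> j) mod (2 * n - 1) = n - 1" using n3 by simp
      then have "\<xi> j = Zero" unfolding lay_mod[OF x] using x n3 by (cases "\<xi> j") (auto split: if_splits)
      then have "(bottom_layer n b, n) \<in> Psi \<xi> j"
        using True unfolding Psi_stack[OF assms(3)] in_stack top by (simp add: colours_at_def)
      then show ?thesis using True assms(3) by (simp add: ground_def)
    next
      case nb: False
      then have jN: "j \<le> N" using True by simp
      have p: "1 \<le> beta j" using base_period_pos[OF assms(3) jN] .
      have l: "beta j * (2 * n - 1) + letter_layer n (\<xi> j) = 2 * n - 1"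
        using top nb jN by (simp add: top_at_def bottom_layer_def lay_eq)
      have "beta j < 2"
      proof (rule ccontr)
        assume "\<not> beta j < 2"
        then have "2 * (2 * n - 1) \<le> beta j * (2 * n - 1)" by (intro mult_right_mono) auto
        moreover obtain M where "M = 2 * n - 1" by blast
        ultimately show False using l n3 by linarith
      qed
      then have b1: "beta j = 1" using p by simp
      then have "letter_layer n (\<xi> j) = 0" using l by simp
      then have x12: "\<xi> j = Pos 1 \<or> \<xi> j = Pos 2" using x n3 by (cases "\<xi> j") (auto simp: letter_layer_def)
      have "\<xi> j = Pos 1 \<Longrightarrow> j = N"
      proof (rule ccontr)
        assume "\<xi> j = Pos 1" "j \<noteq> N"
        then have sj: "Suc j \<le> N" using jN by simp
        then have "beta (Suc j) = beta j" using b1 base_period_pos[of "Suc j" cs] base_period_mono[OF cs0 assms(3), of "Suc j"] by simp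
        then have "col_gt (Pos 1) (\<xi> (Suc j))" using assms(2,3) sj \<open>\<xi> j = Pos 1\<close> unfolding nice_letters_def by metis
        then show False using validD(1)[OF assms(1), of "Suc j"] by (cases "\<xi> (Suc j)") (auto simp: col_gt_def)
      qed
      moreover have "front_colour N N = 0" by (simp add: front_colour_def)
      ultimately have "front_colour N j \<in> tops n (\<xi> j)" using x12 front_colour_cases[of N j] by auto
      then have "(bottom_layer n b, front_colour N j) \<in> Psi \<xi> j"
        using jN unfolding Psi_stack[OF assms(3)] in_stack top by (simp add: colours_at_def)
      then show ?thesis using nb assms(3) by (simp add: ground_def)
    qed
  qed
qed

lemma finite_added:
  assumes "valid \<xi>"
  shows "finite {(j, x). x \<in> Psi \<xi> j - ground n b N j}"
proof -
  define J where "J = {1..N} \<union> (if b then {j. N < j \<and> \<xi> j \<noteq> Zero} else {})"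
  have "finite J" using validD(3)[OF assms] by (simp add: J_def)
  moreover have "finite (Psi \<xi> j)" for j
    using finite_stack[OF proper_top_at[OF assms, of j]] by (cases "j = 0") (auto simp: letter_wall_def)
  ultimately have "finite (Sigma J (\<lambda>j. Psi \<xi> j))" by blast
  moreover have "{(j, x). x \<in> Psi \<xi> j - ground n b N j} \<subseteq> Sigma J (\<lambda>j. Psi \<xi> j)"
  proof
    fix z assume "z \<in> {(j, x). x \<in> Psi \<xi> j - ground n b N j}"
    then obtain j l c where z: "z = (j, l, c)" and lc: "(l, c) \<in> Psi \<xi> j" "(l, c) \<notin> ground n b N j" by auto
    have "j \<in> J"
    proof (rule ccontr)
      assume nJ: "j \<notin> J"
      have "j \<noteq> 0" using lc Psi_0 by (cases j) auto
      then have "\<not> (j \<le> N \<or> b) \<or> b \<and> N < j \<and> \<xi> j = Zero" using nJ by (auto simp: J_def split: if_splits)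
      then show False using lc Psi_ground Psi_ground_tail by metis
    qed
    then show "z \<in> Sigma J (\<lambda>j. Psi \<xi> j)" using lc z by simp
  qed
  ultimately show ?thesis by (rule finite_subset[rotated])
qed

lemma proper_Psi_iff:
  assumes "valid \<xi>"
  shows "proper_wall n b N (Psi \<xi>) \<longleftrightarrow> nice \<xi>"
proof -
  have iff: "proper_wall n b N (Psi \<xi>) \<longleftrightarrow> (\<forall>j\<ge>1. ground n b N j \<subseteq> Psi \<xi> j) \<and>
      finite {(j, x). x \<in> Psi \<xi> j - ground n b N j} \<and>
      (\<forall>j\<ge>1. supports (top_at n cs b \<xi> j) (colours_at n cs b \<xi> j) (top_at n cs b \<xi> (j + 1)) (colours_at n cs b \<xi> (j + 1))) \<and>
      (\<forall>j\<ge>1. \<forall>k\<ge>1. j \<noteq> k \<longrightarrow> full n (Psi \<xi> j) \<longrightarrow> full n (Psi \<xi> k) \<longrightarrow> top_at n cs b \<xi> j \<noteq> top_at n cs b \<xi> k)"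
    by (rule proper_stack_wall[where L = "top_at n cs b \<xi>" and S = "colours_at n cs b \<xi>"])
      (use Psi_0 Psi_stack proper_top_at[OF assms] in blast)+
  show ?thesis
  proof
    assume P: "proper_wall n b N (Psi \<xi>)"
    show "nice \<xi>" unfolding nice_letters_def
    proof (intro allI impI)
      fix j assume j: "1 \<le> j" "Suc j \<le> N \<or> b" "beta j = beta (Suc j)"
      have "supports (top_at n cs b \<xi> j) (colours_at n cs b \<xi> j) (top_at n cs b \<xi> (j + 1)) (colours_at n cs b \<xi> (j + 1))"
        using P j(1) unfolding iff by blast
      moreover have "\<not> (top_at n cs b \<xi> j = top_at n cs b \<xi> (Suc j) \<and> full n (Psi \<xi> j) \<and> full n (Psi \<xi> (Suc j)))"
        using P j(1) unfolding iff by (metis le_SucI n_not_Suc_n)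
      ultimately show "col_gt (\<xi> j) (\<xi> (Suc j))" using Psi_support[OF assms j(1,2)] j(3) by simp
    qed
  next
    assume nc: "nice \<xi>"
    show "proper_wall n b N (Psi \<xi>)" unfolding iff
    proof (intro conjI allI impI)
      fix j :: nat assume j: "1 \<le> j"
      show "ground n b N j \<subseteq> Psi \<xi> j" by (rule ground_subset[OF assms nc j])
      show "supports (top_at n cs b \<xi> j) (colours_at n cs b \<xi> j) (top_at n cs b \<xi> (j + 1)) (colours_at n cs b \<xi> (j + 1))"
      proof (cases "Suc j \<le> N \<or> b")
        case True
        then show ?thesis using Psi_support[OF assms j] nc j unfolding nice_letters_def by auto
      next
        case False
        \<comment> \<open>Column \<open>j + 1\<close> is a ground-state column; since the front
          colours alternate, its block leans on the front block in the bottom layer of column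
          \<open>j\<close>.\<close>
        have top1: "top_at n cs b \<xi> (j + 1) = bottom_layer n b" "colours_at n cs b \<xi> (j + 1) = {1 - front_colour N j}"
          using False by (auto simp: top_at_def colours_at_def front_colour_Suc)
        have "(bottom_layer n b, front_colour N j) \<in> Psi \<xi> j"
          using ground_subset[OF assms nc j] False j by (auto simp: ground_def)
        then have "bottom_layer n b < top_at n cs b \<xi> j \<or> bottom_layer n b = top_at n cs b \<xi> j \<and> front_colour N j \<in> colours_at n cs b \<xi> j"
          unfolding Psi_stack[OF j] in_stack by auto
        then show ?thesis using front_colour_cases[of N j] unfolding top1 supports_def by auto
      qed
    next
      show "finite {(j, x). x \<in> Psi \<xi> j - ground n b N j}" by (rule finite_added[OF assms])
    next
      \<comment> \<open>By \<open>lay_inj\<close>, full columns with the same top have the same base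
        period and letter. All columns between them then share the base period, and the chain of
        \<open>col_gt\<close> excludes equal letters also for columns far apart.\<close>
      have main: "top_at n cs b \<xi> j \<noteq> top_at n cs b \<xi> k"
        if "1 \<le> j" "j < k" "full n (Psi \<xi> j)" "full n (Psi \<xi> k)" for j k
      proof
        assume eq: "top_at n cs b \<xi> j = top_at n cs b \<xi> k"
        have k: "1 \<le> k" using that by simp
        have f: "j \<le> N \<or> b" "k \<le> N \<or> b" "\<xi> j \<notin> {Pos 1, Neg 1, Zero}" "\<xi> k \<notin> {Pos 1, Neg 1, Zero}"
          using that full_Psi[OF assms] k by auto
        then have "lay n (beta j) (\<xi> j) = lay n (beta k) (\<xi> k)" using eq by (simp add: top_at_def)
        then have "beta j = beta k \<and> \<xi> j = \<xi> k"
          using lay_inj[OF n3 validD(1)[OF assms that(1)] validD(1)[OF assms k]] f by blast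
        then show False using nice_chain[OF nc that(1,2) f(2)] f(3) by (auto simp: col_gt_def)
      qed
      fix j k :: nat assume "1 \<le> j" "1 \<le> k" "j \<noteq> k" "full n (Psi \<xi> j)" "full n (Psi \<xi> k)"
      then show "top_at n cs b \<xi> j \<noteq> top_at n cs b \<xi> k"
        using main[of j k] main[of k j] by (cases "j < k") auto
    qed
  qed
qed

end

section \<open>Signatures of walls\<close>

text \<open>Letters of neighbouring columns, \<open>l\<close> on the left, that block each other: a
  plus of the left column and a minus of the right one are missing. For \<open>i = n\<close> one
  sign of each is concerned, even if the letter has two.\<close>

definition adjacent_pair :: "nat \<Rightarrow> nat \<Rightarrow> letter \<Rightarrow> letter \<Rightarrow> bool" where
  "adjacent_pair n i l x \<longleftrightarrow> (if i < n then vec_f n i l = Some x else letter_phi n i l > 0 \<and> letter_eps n i x > 0)"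

definition letter_column_signs :: "nat \<Rightarrow> nat \<Rightarrow> (letter \<Rightarrow> bool) \<Rightarrow> (letter \<Rightarrow> bool) \<Rightarrow> letter \<Rightarrow> sign list" where
  "letter_column_signs n i OL OR x =
     (if \<exists>y z. vec_e n i x = Some y \<and> OL y \<and> vec_e n i y = Some z \<and> OL z then [Minus, Minus]
      else if \<exists>y z. vec_f n i x = Some y \<and> OR y \<and> vec_f n i y = Some z \<and> OR z then [Plus, Plus]
      else (if \<exists>y. vec_e n i x = Some y \<and> OL y then [Minus] else []) @ (if \<exists>y. vec_f n i x = Some y \<and> OR y then [Plus] else []))"

lemma vec_f_Suc_cases: "vec_f n i x = Some y \<longleftrightarrow> i < n \<and> (x = Pos i \<and> y = Pos (Suc i) \<or> x = Neg (Suc i) \<and> y = Neg i) \<or>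
    \<not> i < n \<and> (x = Pos n \<and> y = Zero \<or> x = Zero \<and> y = Neg n)"
  by (auto simp: vec_f_def)

lemma vec_e_Suc_cases: "vec_e n i y = Some x \<longleftrightarrow> i < n \<and> (x = Pos i \<and> y = Pos (Suc i) \<or> x = Neg (Suc i) \<and> y = Neg i) \<or>
    \<not> i < n \<and> (x = Pos n \<and> y = Zero \<or> x = Zero \<and> y = Neg n)"
  by (auto simp: vec_e_def)

text \<open>The letters of the neighbours lie strictly beyond \<open>x\<close>, up to repeated
  zeros, so a step can only be blocked by a neighbour next to it in the crystal. Of the two steps
  for \<open>i = n\<close> it is the one starting from \<open>Zero\<close> that can be
  blocked.\<close>

lemma letter_column_signs_eq:
  assumes "1 \<le> i" "i \<le> n" "x \<in> letters n" "hl \<Longrightarrow> l \<in> letters n \<and> col_gt x l" "hr \<Longrightarrow> r \<in> letters n \<and> col_gt r x"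
  shows "letter_column_signs n i (\<lambda>y. hl \<longrightarrow> col_gt y l) (\<lambda>y. hr \<longrightarrow> col_gt r y) x =
    replicate (letter_eps n i x - (if hl \<and> adjacent_pair n i l x then 1 else 0)) Minus @
    replicate (letter_phi n i x - (if hr \<and> adjacent_pair n i x r then 1 else 0)) Plus"
proof (cases "i < n")
  case True
  have L: "hl \<Longrightarrow> x = Pos (Suc i) \<Longrightarrow> col_gt (Pos i) l \<longleftrightarrow> l \<noteq> Pos i"
    "hl \<Longrightarrow> x = Neg i \<Longrightarrow> col_gt (Neg (Suc i)) l \<longleftrightarrow> l \<noteq> Neg (Suc i)"
    using assms(4) True by (cases l; auto simp: col_gt_def)+
  have R: "hr \<Longrightarrow> x = Pos i \<Longrightarrow> col_gt r (Pos (Suc i)) \<longleftrightarrow> r \<noteq> Pos (Suc i)"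
    "hr \<Longrightarrow> x = Neg (Suc i) \<Longrightarrow> col_gt r (Neg i) \<longleftrightarrow> r \<noteq> Neg i"
    using assms(5) True by (cases r; auto simp: col_gt_def)+
  consider "x = Pos i" | "x = Pos (Suc i)" | "x = Neg (Suc i)" | "x = Neg i" | "x \<notin> {Pos i, Pos (Suc i), Neg (Suc i), Neg i}" by blast
  then show ?thesis
    by cases (use True L R in \<open>auto simp: letter_column_signs_def vec_f_Suc_cases vec_e_Suc_cases letter_eps_def letter_phi_def adjacent_pair_def\<close>)
next
  case False
  then have n: "i = n" using assms by simp
  have L: "hl \<Longrightarrow> x = Neg n \<Longrightarrow> col_gt Zero l" "hl \<Longrightarrow> x = Neg n \<or> x = Zero \<Longrightarrow> col_gt (Pos n) l \<longleftrightarrow> l \<noteq> Pos n \<and> l \<noteq> Zero"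
     "hl \<Longrightarrow> x = Zero \<Longrightarrow> l \<noteq> Neg n" "hl \<Longrightarrow> x = Neg n \<Longrightarrow> l \<noteq> Neg n"
    using assms(4) by (cases l; auto simp: col_gt_def)+
  have R: "hr \<Longrightarrow> x = Pos n \<Longrightarrow> col_gt r Zero" "hr \<Longrightarrow> x = Pos n \<or> x = Zero \<Longrightarrow> col_gt r (Neg n) \<longleftrightarrow> r \<noteq> Neg n \<and> r \<noteq> Zero"
    using assms(5) by (cases r; auto simp: col_gt_def)+
  consider "x = Pos n" | "x = Zero" | "x = Neg n" | "x \<notin> {Pos n, Zero, Neg n}" by blast
  then show ?thesis
    by cases (use n L R in \<open>auto simp: letter_column_signs_def vec_f_Suc_cases vec_e_Suc_cases letter_eps_def letter_phi_def adjacent_pair_def numeral_2_eq_2\<close>)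
qed

lemma adjacent_pair_le: "adjacent_pair n i l x \<Longrightarrow> 1 \<le> letter_phi n i l \<and> 1 \<le> letter_eps n i x"
  by (auto simp: adjacent_pair_def vec_f_Suc_cases letter_eps_def letter_phi_def split: if_splits)

section \<open>Adding and removing blocks as steps between letters\<close>

context wall_rank
begin

lemma slot_stack: "proper_top n b L S \<Longrightarrow> slot_layer n (stack n b L S) = (if S = layer_colours n L then Suc L else L)"
  unfolding slot_layer_def by (simp only: top_complete_stack top_layer_stack) simp

lemma proper_top_lay: "x \<in> letters n \<Longrightarrow> bottom_layer n b \<le> lay n p x \<Longrightarrow> proper_top n b (lay n p x) (tops n x)"
  using tops_lay by (simp add: proper_top_def)

lemma stack_Suc: "bottom_layer n b \<le> L \<Longrightarrow> insert (Suc L, i) (stack n b L (layer_colours n L)) = stack n b (Suc L) {i}"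
  by (auto simp: stack_def less_Suc_eq)

text \<open>Every step opens a new layer, except the one from 1 to 2, which completes the (0|1)
  layer.\<close>

lemma insert_f:
  assumes "vec_f n i x = Some y" "1 \<le> i" "i \<le> n" "x \<in> letters n" "bottom_layer n b \<le> lay n p x"
  shows "slot_layer n (stack n b (lay n p x) (tops n x)) = lay n p y"
    "(lay n p y, i) \<notin> stack n b (lay n p x) (tops n x)"
    "insert (lay n p y, i) (stack n b (lay n p x) (tops n x)) = stack n b (lay n p y) (tops n y)"
proof -
  note P = proper_top_lay[OF assms(4,5)]
  have "slot_layer n (stack n b (lay n p x) (tops n x)) = lay n p y \<and>
    (lay n p y, i) \<notin> stack n b (lay n p x) (tops n x) \<and>
    insert (lay n p y, i) (stack n b (lay n p x) (tops n x)) = stack n b (lay n p y) (tops n y)"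
  proof (cases "x = Pos 1")
    case True
    then have i: "i = 1" "y = Pos 2" using assms n3 by (auto simp: vec_f_Suc_cases)
    have ne: "tops n x \<noteq> layer_colours n (lay n p x)" using tops_complete[OF assms(4)] True by simp
    show ?thesis unfolding slot_stack[OF P] using ne True i by (auto simp: stack_def)
  next
    case False
    have x1: "x \<noteq> Neg 1" using assms by (auto simp: vec_f_Suc_cases)
    have eq: "tops n x = layer_colours n (lay n p x)" using tops_complete[OF assms(4)] False x1 by simp
    have y: "lay n p y = Suc (lay n p x)" "tops n y = {i}"
      using assms(1-4) False n3 unfolding lay_eq by (auto simp: vec_f_Suc_cases letter_layer_def split: if_splits)
    show ?thesis unfolding slot_stack[OF P] unfolding y eq stack_Suc[OF assms(5)] by (simp add: in_stack)
  qed
  then show "slot_layer n (stack n b (lay n p x) (tops n x)) = lay n p y"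
    "(lay n p y, i) \<notin> stack n b (lay n p x) (tops n x)"
    "insert (lay n p y, i) (stack n b (lay n p x) (tops n x)) = stack n b (lay n p y) (tops n y)" by auto
qed

text \<open>An incomplete (0|1) layer takes only its missing block. Above a complete layer the
  fitting blocks have the colours of the next layer. In neither case is \<open>i\<close>
  available.\<close>

lemma no_slot:
  assumes "vec_f n i x = None" "1 \<le> i" "i \<le> n" "x \<in> letters n" "bottom_layer n b \<le> lay n p x"
  defines "C \<equiv> stack n b (lay n p x) (tops n x)"
  shows "(slot_layer n C, i) \<in> C \<or> i \<notin> layer_colours n (slot_layer n C)"
proof -
  note P = proper_top_lay[OF assms(4,5)]
  note slot = slot_stack[OF P]
  show ?thesis
  proof (cases "x = Pos 1 \<or> x = Neg 1")
    case True
    then have "tops n x \<noteq> layer_colours n (lay n p x)" using tops_complete[OF assms(4)] by simp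
    then have s: "slot_layer n C = lay n p x" unfolding C_def slot by simp
    have l: "layer_colours n (lay n p x) = {0, 1}" using True colours_lay[OF assms(4)] by auto
    show ?thesis
    proof (cases "i = 1")
      case i: True
      then have "x = Neg 1" using True assms(1) n3 by (auto simp: vec_f_def split: if_splits)
      then have "(lay n p x, i) \<in> C" unfolding C_def in_stack i by simp
      then show ?thesis unfolding s ..
    next
      case False
      then have "i \<notin> {0, 1}" using assms(2) by simp
      then show ?thesis unfolding s l ..
    qed
  next
    case False
    then have "tops n x = layer_colours n (lay n p x)" using tops_complete[OF assms(4)] by simp
    then have s: "slot_layer n C = Suc (lay n p x)" unfolding C_def slot by simp
    define y where "y = (case x of Pos j \<Rightarrow> if j < n then Pos (Suc j) else Zero | Zero \<Rightarrow> Neg n | Neg j \<Rightarrow> Neg (j - 1))"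
    have "Suc (letter_layer n x) = letter_layer n y"
      using assms(4) False n3 by (cases x) (auto simp: letter_layer_def y_def)
    moreover have "y \<in> letters n" using assms(4) False n3 by (cases x) (auto simp: y_def)
    ultimately have y: "Suc (lay n p x) = lay n p y" "y \<in> letters n" by (simp_all add: lay_eq)
    have "i \<notin> layer_colours n (lay n p y)"
      using assms(1-4) False n3 unfolding colours_lay[OF y(2)]
      by (cases x) (auto simp: y_def vec_f_def split: if_splits)
    then show ?thesis unfolding s y(1) by blast
  qed
qed

lemma tops_vec_e: "x \<in> letters n \<Longrightarrow> 1 \<le> i \<Longrightarrow> i \<le> n \<Longrightarrow> i \<in> tops n x \<longleftrightarrow> vec_e n i x \<noteq> None"
  using n3 by (cases x) (auto simp: vec_e_def)

end

context wall_data
begin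

definition active :: "nat \<Rightarrow> bool" where
  "active j \<longleftrightarrow> 1 \<le> j \<and> (j \<le> N \<or> b)"

lemma active_lay:
  assumes "valid \<xi>" "active j"
  shows "Psi \<xi> j = stack n b (lay n (beta j) (\<xi> j)) (tops n (\<xi> j))" "bottom_layer n b \<le> lay n (beta j) (\<xi> j)" "\<xi> j \<in> letters n"
  using assms bottom_le_top_at[OF assms(1), of j] validD(1)[OF assms(1), of j]
  by (auto simp: active_def letter_wall_def top_at_def colours_at_def)

lemma Psi_update: "active j \<Longrightarrow> Psi (\<xi>(j := y)) = (Psi \<xi>)(j := stack n b (lay n (beta j) y) (tops n y))"
  by (auto simp: active_def letter_wall_def top_at_def colours_at_def fun_eq_iff)

lemma vec_letters:
  "vec_f n i x = Some y \<Longrightarrow> 1 \<le> i \<Longrightarrow> i \<le> n \<Longrightarrow> x \<in> letters n \<longleftrightarrow> y \<in> letters n"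
  by (auto simp: vec_f_Suc_cases)

lemma valid_f:
  assumes "valid \<xi>" "1 \<le> j" "vec_f n i (\<xi> j) = Some y" "1 \<le> i" "i \<le> n"
  shows "valid (\<xi>(j := y))"
proof (rule valid_update[OF assms(1)])
  show "y \<in> letters n" using vec_letters[OF assms(3-5)] validD(1)[OF assms(1,2)] by simp
  show "Zero \<le> y" if b "N < j"
    using vec_f_succ(1)[OF assms(3-5) validD(1)[OF assms(1,2)]] validD(2)[OF assms(1) that] by simp
qed

lemma valid_e:
  assumes "valid \<xi>" "1 \<le> j" "vec_e n i (\<xi> j) = Some y" "1 \<le> i" "i \<le> n" "N < j \<Longrightarrow> Zero \<le> y"
  shows "valid (\<xi>(j := y))"
  using assms vec_letters[of i y "\<xi> j"] validD(1)[OF assms(1,2)] by (intro valid_update) (auto simp: vec_e_iff_vec_f)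

lemma add_block_f:
  assumes "valid \<xi>" "active j" "vec_f n i (\<xi> j) = Some y" "1 \<le> i" "i \<le> n"
  shows "add_block n i j (Psi \<xi>) = Psi (\<xi>(j := y))" "(slot_layer n (Psi \<xi> j), i) \<notin> Psi \<xi> j"
proof -
  note a = active_lay[OF assms(1,2)]
  note I = insert_f[OF assms(3-5) a(3,2)]
  show "add_block n i j (Psi \<xi>) = Psi (\<xi>(j := y))"
    unfolding add_block_def Psi_update[OF assms(2)] a(1) I(1) I(3) ..
  show "(slot_layer n (Psi \<xi> j), i) \<notin> Psi \<xi> j" unfolding a(1) I(1) by (rule I(2))
qed

lemma remove_block_e:
  assumes "valid \<xi>" "active j" "vec_e n i (\<xi> j) = Some y" "1 \<le> i" "i \<le> n" "N < j \<Longrightarrow> Zero \<le> y"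
  shows "remove_block i j (Psi \<xi>) = Psi (\<xi>(j := y))"
proof -
  have j: "1 \<le> j" using assms(2) by (simp add: active_def)
  define \<xi>' where "\<xi>' = \<xi>(j := y)"
  have v: "valid \<xi>'" unfolding \<xi>'_def by (rule valid_e[OF assms(1) j assms(3-6)])
  have f: "vec_f n i (\<xi>' j) = Some (\<xi> j)" using assms(3) by (simp add: \<xi>'_def vec_e_iff_vec_f)
  note a = active_lay[OF v assms(2)]
  note I = insert_f[OF f assms(4,5) a(3,2)]
  have top: "top_layer (Psi \<xi> j) = lay n (beta j) (\<xi> j)"
    unfolding active_lay(1)[OF assms(1,2)]
    by (rule top_layer_stack[OF proper_top_lay[OF active_lay(3,2)[OF assms(1,2)]]])
  have "Psi \<xi> j = insert (lay n (beta j) (\<xi> j), i) (Psi \<xi>' j)"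
    unfolding active_lay(1)[OF assms(1,2)] a(1) I(3) ..
  then have "Psi \<xi> j - {(lay n (beta j) (\<xi> j), i)} = Psi \<xi>' j" using I(2) a(1) by auto
  then show ?thesis unfolding remove_block_def top \<xi>'_def[symmetric]
    using Psi_update[OF assms(2), of \<xi> y] a(1) by (auto simp: \<xi>'_def)
qed

lemma proper_wallD:
  assumes "proper_wall n b N Y" "1 \<le> j"
  shows "ground n b N j \<subseteq> Y j" "is_column n b (Y j)" "right_supported N Y"
  using assms by (auto simp: proper_wall_def young_wall_def)

lemma ground_not_removable:
  assumes "1 \<le> j" "Y j = ground n b N j" shows "\<not> removable n b N i j Y"
proof
  assume r: "removable n b N i j Y"
  have "\<exists>g. ground n b N j = {g}" using assms(1) by (cases b) (simp_all add: ground_def)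
  then obtain g where g: "ground n b N j = {g}" by blast
  then have "(top_layer (Y j), i) = g" using r assms by (auto simp: removable_def)
  then have "remove_block i j Y j = {}" using assms g by (simp add: remove_block_def)
  then show False using proper_wallD(1)[of "remove_block i j Y" j] r assms(1) g by (auto simp: removable_def)
qed

text \<open>For an inactive column the only colour in question is \<open>i = 1\<close>. If it is
  free, the front colour is 0, so by parity the column is not \<open>Suc N\<close>. Hence its right
  neighbour is a ground-state column as well, and a block in the back half would have free space to
  its right.\<close>

lemma admissible_iff:
  assumes "valid \<xi>" "1 \<le> i" "i \<le> n" "1 \<le> j"
  shows "admissible n b N i j (Psi \<xi>) \<longleftrightarrow> active j \<and> (\<exists>y. vec_f n i (\<xi> j) = Some y \<and> nice (\<xi>(j := y)))"
proof (cases "active j")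
  case True
  show ?thesis
  proof (cases "vec_f n i (\<xi> j)")
    case None
    note a = active_lay[OF assms(1) True]
    have "(slot_layer n (Psi \<xi> j), i) \<in> Psi \<xi> j \<or> i \<notin> layer_colours n (slot_layer n (Psi \<xi> j))"
      using no_slot[OF None assms(2,3) a(3,2)] unfolding a(1) .
    moreover have "i \<in> layer_colours n (slot_layer n (Psi \<xi> j))" if "proper_wall n b N (add_block n i j (Psi \<xi>))"
      using proper_wallD(2)[OF that assms(4)] unfolding is_column_def add_block_def by force
    ultimately have "\<not> admissible n b N i j (Psi \<xi>)" by (auto simp: admissible_def)
    then show ?thesis using None by simp
  next
    case (Some y)
    note v = valid_f[OF assms(1,4) Some assms(2,3)]
    show ?thesis unfolding admissible_def using add_block_f[OF assms(1) True Some assms(2,3)] True Some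
      proper_Psi_iff[OF v] by simp
  qed
next
  case False
  then have nb: "\<not> b" "N < j" using assms(4) by (auto simp: active_def)
  have "\<not> admissible n b N i j (Psi \<xi>)"
  proof
    assume ad: "admissible n b N i j (Psi \<xi>)"
    define Y where "Y = add_block n i j (Psi \<xi>)"
    have P: "proper_wall n b N Y" using ad by (simp add: admissible_def Y_def)
    have pt: "proper_top n b (bottom_layer n b) {front_colour N j}"
      using proper_top_at[OF assms(1,4)] nb by (simp add: top_at_def colours_at_def)
    have Pj: "Psi \<xi> j = stack n b (bottom_layer n b) {front_colour N j}"
      using nb assms(4) by (simp add: letter_wall_def top_at_def colours_at_def)
    have col: "layer_colours n (bottom_layer n b) = {0, 1}" using bottom_ground(1) nb by blast
    have "{front_colour N j} \<noteq> {0, 1}" by auto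
    then have slot: "slot_layer n (Psi \<xi> j) = bottom_layer n b"
      unfolding Pj slot_stack[OF pt] col by metis
    have "i \<in> layer_colours n (slot_layer n (Psi \<xi> j))"
      using proper_wallD(2)[OF P assms(4)] unfolding is_column_def add_block_def Y_def by force
    then have i: "i = 1" unfolding slot col using assms(2) by simp
    have "(bottom_layer n b, 1) \<notin> Psi \<xi> j" using ad i slot by (simp add: admissible_def)
    then have "front_colour N j \<noteq> 1" unfolding Pj stack_bottom by auto
    then have fj: "front_colour N j = 0" using front_colour_cases[of N j] by simp
    have "front_colour N (Suc N) = 1" unfolding front_colour_def by presburger
    then have jN: "j \<noteq> Suc N" using fj by auto
    define k where "k = j - 1"
    have k: "j = k + 1" "1 \<le> k" "N < k" using nb jN by (auto simp: k_def)
    have "(bottom_layer n b, 1) \<in> Y (k + 1)" using i slot by (simp add: Y_def add_block_def k(1))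
    then obtain c' where c': "(bottom_layer n b, c') \<in> Y k" "c' = front_colour N k \<longleftrightarrow> 1 = front_colour N (k + 1)"
      using proper_wallD(3)[OF P assms(4)] k(2) unfolding right_supported_def by fastforce
    have "Y k = ground n b N k" using Psi_ground[of k \<xi>] nb k by (simp add: Y_def add_block_def)
    then have "c' = front_colour N k" using c'(1) nb k(2) by (simp add: ground_def)
    then show False using c'(2) fj k(1) by (metis zero_neq_one)
  qed
  then show ?thesis using False by simp
qed

text \<open>Beyond column \<open>N\<close> a letter must not fall below \<open>Zero\<close>, for
  this would take away the ground-state block itself.\<close>

lemma removable_iff:
  assumes "valid \<xi>" "1 \<le> i" "i \<le> n" "1 \<le> j"
  shows "removable n b N i j (Psi \<xi>) \<longleftrightarrow>
    active j \<and> (\<exists>y. vec_e n i (\<xi> j) = Some y \<and> (N < j \<longrightarrow> Zero \<le> y) \<and> nice (\<xi>(j := y)))"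
proof (cases "active j")
  case True
  note a = active_lay[OF assms(1) True]
  have top: "top_layer (Psi \<xi> j) = lay n (beta j) (\<xi> j)"
    unfolding a(1) by (rule top_layer_stack[OF proper_top_lay[OF a(3,2)]])
  have mem: "(top_layer (Psi \<xi> j), i) \<in> Psi \<xi> j \<longleftrightarrow> vec_e n i (\<xi> j) \<noteq> None"
    unfolding top unfolding a(1) in_stack using tops_vec_e[OF a(3) assms(2,3)] by simp
  show ?thesis
  proof (cases "vec_e n i (\<xi> j)")
    case None
    then show ?thesis using mem by (simp add: removable_def)
  next
    case (Some y)
    show ?thesis
    proof (cases "N < j \<longrightarrow> Zero \<le> y")
      case t: True
      note v = valid_e[OF assms(1,4) Some assms(2,3)]
      have "remove_block i j (Psi \<xi>) = Psi (\<xi>(j := y))"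
        by (rule remove_block_e[OF assms(1) True Some assms(2,3)]) (use t in blast)
      then show ?thesis unfolding removable_def mem using Some t True proper_Psi_iff[OF v] by simp
    next
      case False
      then have tb: "N < j" "b" "\<not> Zero \<le> y" using True by (auto simp: active_def)
      have "Zero \<le> \<xi> j" using validD(2)[OF assms(1)] tb by blast
      then have "\<xi> j = Zero" using Some tb(3) assms(2) by (auto simp: vec_e_Suc_cases)
      then have "\<not> removable n b N i j (Psi \<xi>)"
        using ground_not_removable[OF assms(4)] Psi_ground_tail[OF tb(2,1)] by blast
      then show ?thesis using Some tb by simp
    qed
  qed
next
  case False
  then have "\<not> removable n b N i j (Psi \<xi>)"
    using ground_not_removable[OF assms(4)] Psi_ground[of j \<xi>] assms(4) by (auto simp: active_def)
  then show ?thesis using False by simp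
qed

definition left_ok :: "(nat \<Rightarrow> letter) \<Rightarrow> nat \<Rightarrow> letter \<Rightarrow> bool" where
  "left_ok \<xi> j y \<longleftrightarrow> (Suc j \<le> N \<or> b) \<and> beta j = beta (Suc j) \<longrightarrow> col_gt y (\<xi> (Suc j))"

definition right_ok :: "(nat \<Rightarrow> letter) \<Rightarrow> nat \<Rightarrow> letter \<Rightarrow> bool" where
  "right_ok \<xi> j y \<longleftrightarrow> 2 \<le> j \<and> beta (j - 1) = beta j \<longrightarrow> col_gt (\<xi> (j - 1)) y"

lemma nice_local: "nice \<xi> \<Longrightarrow> active j \<Longrightarrow> left_ok \<xi> j (\<xi> j) \<and> right_ok \<xi> j (\<xi> j)"
proof -
  assume nc: "nice \<xi>" and j: "active j"
  have "right_ok \<xi> j (\<xi> j)" unfolding right_ok_def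
  proof
    assume a: "2 \<le> j \<and> beta (j - 1) = beta j"
    then have "Suc (j - 1) = j" "1 \<le> j - 1" by auto
    then show "col_gt (\<xi> (j - 1)) (\<xi> j)" using nc a j unfolding nice_letters_def active_def by metis
  qed
  then show ?thesis using nc j by (auto simp: left_ok_def nice_letters_def active_def)
qed

lemma nice_update_iff:
  assumes "nice \<xi>" "active j"
  shows "nice (\<xi>(j := y)) \<longleftrightarrow> left_ok \<xi> j y \<and> right_ok \<xi> j y"
proof
  assume "nice (\<xi>(j := y))"
  then have "left_ok (\<xi>(j := y)) j ((\<xi>(j := y)) j) \<and> right_ok (\<xi>(j := y)) j ((\<xi>(j := y)) j)"
    using nice_local assms(2) by blast
  moreover have "2 \<le> j \<Longrightarrow> j - 1 \<noteq> j" by simp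
  ultimately show "left_ok \<xi> j y \<and> right_ok \<xi> j y" by (auto simp: left_ok_def right_ok_def)
next
  assume a: "left_ok \<xi> j y \<and> right_ok \<xi> j y"
  show "nice (\<xi>(j := y))" unfolding nice_letters_def
  proof (intro allI impI)
    fix k assume k: "1 \<le> k" "Suc k \<le> N \<or> b" "beta k = beta (Suc k)"
    have g: "col_gt (\<xi> k) (\<xi> (Suc k))" using assms(1) k unfolding nice_letters_def by blast
    consider "k = j" | "Suc k = j" | "k \<noteq> j" "Suc k \<noteq> j" by blast
    then show "col_gt ((\<xi>(j := y)) k) ((\<xi>(j := y)) (Suc k))"
    proof cases
      case 1 then show ?thesis using a k by (simp add: left_ok_def)
    next
      case 2 then show ?thesis using a k by (auto simp: right_ok_def)
    next
      case 3 then show ?thesis using g by simp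
    qed
  qed
qed

text \<open>\<open>f\<close> raises a letter, so only the right neighbour can obstruct it; in
  \<open>nice_e_iff\<close>, where it is lowered, only the left one can.\<close>

lemma nice_f_iff:
  assumes "valid \<xi>" "nice \<xi>" "active j" "vec_f n i (\<xi> j) = Some y" "1 \<le> i" "i \<le> n"
  shows "nice (\<xi>(j := y)) \<longleftrightarrow> right_ok \<xi> j y"
proof -
  have "\<xi> j < y" using vec_f_succ(1)[OF assms(4-6)] active_lay(3)[OF assms(1,3)] by blast
  then have "left_ok \<xi> j y" using nice_local[OF assms(2,3)] by (auto simp: left_ok_def col_gt_def)
  then show ?thesis using nice_update_iff[OF assms(2,3)] by simp
qed

lemma nice_e_iff:
  assumes "valid \<xi>" "nice \<xi>" "active j" "vec_e n i (\<xi> j) = Some y" "1 \<le> i" "i \<le> n"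
  shows "nice (\<xi>(j := y)) \<longleftrightarrow> left_ok \<xi> j y"
proof -
  have f: "vec_f n i y = Some (\<xi> j)" using assms(4) by (simp add: vec_e_iff_vec_f)
  then have "y < \<xi> j" using vec_f_succ(1)[OF f assms(5,6)] vec_letters[OF f assms(5,6)] active_lay(3)[OF assms(1,3)] by blast
  then have "right_ok \<xi> j y" using nice_local[OF assms(2,3)] by (auto simp: right_ok_def col_gt_def)
  then show ?thesis using nice_update_iff[OF assms(2,3)] by simp
qed

lemma column_signs_inactive:
  "valid \<xi> \<Longrightarrow> 1 \<le> i \<Longrightarrow> i \<le> n \<Longrightarrow> 1 \<le> j \<Longrightarrow> \<not> active j \<Longrightarrow> column_signs n b N i (Psi \<xi>) j = []"
  by (simp add: column_signs_def twice_removable_def twice_admissible_def removable_iff admissible_iff)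

lemma column_signs_active:
  assumes "valid \<xi>" "nice \<xi>" "1 \<le> i" "i \<le> n" "active j"
  shows "column_signs n b N i (Psi \<xi>) j =
    letter_column_signs n i (\<lambda>y. (N < j \<longrightarrow> Zero \<le> y) \<and> left_ok \<xi> j y) (right_ok \<xi> j) (\<xi> j)"
proof -
  have j: "1 \<le> j" using assms(5) by (simp add: active_def)
  have upd: "left_ok (\<xi>(j := y)) j = left_ok \<xi> j" "right_ok (\<xi>(j := y)) j = right_ok \<xi> j" for y
    by (auto simp: left_ok_def right_ok_def fun_eq_iff)
  have R1: "removable n b N i j (Psi \<xi>) \<longleftrightarrow> (\<exists>y. vec_e n i (\<xi> j) = Some y \<and> (N < j \<longrightarrow> Zero \<le> y) \<and> left_ok \<xi> j y)"
    if "valid \<xi>" "nice \<xi>" for \<xi>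
    using removable_iff[OF that(1) assms(3,4) j] nice_e_iff[OF that assms(5) _ assms(3,4)] assms(5) by blast
  have A1: "admissible n b N i j (Psi \<xi>) \<longleftrightarrow> (\<exists>y. vec_f n i (\<xi> j) = Some y \<and> right_ok \<xi> j y)"
    if "valid \<xi>" "nice \<xi>" for \<xi>
    using admissible_iff[OF that(1) assms(3,4) j] nice_f_iff[OF that assms(5) _ assms(3,4)] assms(5) by blast
  have R2: "twice_removable n b N i j (Psi \<xi>) \<longleftrightarrow> (\<exists>y z. vec_e n i (\<xi> j) = Some y \<and> ((N < j \<longrightarrow> Zero \<le> y) \<and> left_ok \<xi> j y) \<and>
      vec_e n i y = Some z \<and> (N < j \<longrightarrow> Zero \<le> z) \<and> left_ok \<xi> j z)"
  proof (cases "\<exists>y. vec_e n i (\<xi> j) = Some y \<and> (N < j \<longrightarrow> Zero \<le> y) \<and> left_ok \<xi> j y")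
    case True
    then obtain y where y: "vec_e n i (\<xi> j) = Some y" "N < j \<Longrightarrow> Zero \<le> y" "left_ok \<xi> j y" by blast
    have rb: "remove_block i j (Psi \<xi>) = Psi (\<xi>(j := y))" by (rule remove_block_e[OF assms(1,5) y(1) assms(3,4) y(2)])
    have v: "valid (\<xi>(j := y))" by (rule valid_e[OF assms(1) j y(1) assms(3,4) y(2)])
    have nn: "nice (\<xi>(j := y))" using nice_e_iff[OF assms(1,2,5) y(1) assms(3,4)] y(3) by blast
    show ?thesis unfolding twice_removable_def rb R1[OF assms(1,2)] R1[OF v nn] upd using y by auto
  next
    case False
    then show ?thesis unfolding twice_removable_def R1[OF assms(1,2)] by blast
  qed
  have A2: "twice_admissible n b N i j (Psi \<xi>) \<longleftrightarrow> (\<exists>y z. vec_f n i (\<xi> j) = Some y \<and> right_ok \<xi> j y \<and>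
      vec_f n i y = Some z \<and> right_ok \<xi> j z)"
  proof (cases "\<exists>y. vec_f n i (\<xi> j) = Some y \<and> right_ok \<xi> j y")
    case True
    then obtain y where y: "vec_f n i (\<xi> j) = Some y" "right_ok \<xi> j y" by blast
    have ab: "add_block n i j (Psi \<xi>) = Psi (\<xi>(j := y))" by (rule add_block_f(1)[OF assms(1,5) y(1) assms(3,4)])
    have v: "valid (\<xi>(j := y))" by (rule valid_f[OF assms(1) j y(1) assms(3,4)])
    have nn: "nice (\<xi>(j := y))" using nice_f_iff[OF assms(1,2,5) y(1) assms(3,4)] y(2) by blast
    show ?thesis unfolding twice_admissible_def ab A1[OF assms(1,2)] A1[OF v nn] upd using y by auto
  next
    case False
    then show ?thesis unfolding twice_admissible_def A1[OF assms(1,2)] by blast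
  qed
  show ?thesis unfolding column_signs_def letter_column_signs_def R2 A2 R1[OF assms(1,2)] A1[OF assms(1,2)] ..
qed

end

lemma concat_map_single:
  assumes "distinct xs" "j \<in> set xs" "\<And>k. k \<in> set xs \<Longrightarrow> k \<noteq> j \<Longrightarrow> g k = []"
  shows "concat (map g xs) = g j"
proof -
  obtain us vs where xs: "xs = us @ j # vs" using split_list[OF assms(2)] by blast
  then have "\<forall>k\<in>set us \<union> set vs. g k = []" using assms by auto
  then have e: "concat (map g us) = []" "concat (map g vs) = []" by auto
  show ?thesis unfolding xs map_append concat_append list.map(2) concat.simps(2) e by simp
qed

lemma wall_signs_upto:
  assumes "\<And>j. K \<le> j \<Longrightarrow> column_signs n b N i Y j = []"
  shows "wall_signs n b N i Y = concat (map (\<lambda>j. map (\<lambda>s. (s, j)) (column_signs n b N i Y j)) (rev [1..<K]))"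
proof -
  let ?g = "column_signs n b N i Y"
  have "{j. 1 \<le> j \<and> ?g j \<noteq> []} = {j \<in> set [1..<K]. ?g j \<noteq> []}"
    using assms by (auto simp: not_less[symmetric])
  also have "\<dots> = set (filter (\<lambda>j. ?g j \<noteq> []) [1..<K])" by simp
  finally have "sorted_list_of_set {j. 1 \<le> j \<and> ?g j \<noteq> []} = filter (\<lambda>j. ?g j \<noteq> []) [1..<K]"
    by (simp only:) (rule sorted_list_of_set.idem_if_sorted_distinct, rule sorted_wrt_filter, simp_all)
  moreover have "concat (map (\<lambda>j. map (\<lambda>s. (s, j)) (?g j)) (rev (filter (\<lambda>j. ?g j \<noteq> []) xs))) =
    concat (map (\<lambda>j. map (\<lambda>s. (s, j)) (?g j)) (rev xs))" for xs
    by (induction xs) auto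
  ultimately show ?thesis by (simp add: wall_signs_def)
qed

section \<open>Effect of a single step on the signature, and the signature of the tail\<close>

lemma remaining_append3:
  "remaining Minus (u @ w @ v) = remaining Minus u @ drop (length (remaining Plus u))
     (remaining Minus w @ drop (length (remaining Plus w)) (remaining Minus v))"
  "remaining Plus (u @ w @ v) = take (length (remaining Plus u) - length (remaining Minus w @ drop (length (remaining Plus w)) (remaining Minus v)))
     (remaining Plus u) @ take (length (remaining Plus w) - length (remaining Minus v)) (remaining Plus w) @ remaining Plus v"
  by (simp_all add: remaining_Minus_append remaining_Plus_append)

text \<open>That the last remaining minus belongs to \<open>j\<close> means that the pluses of
  \<open>j\<close> absorb all minuses of \<open>v\<close>, and that \<open>u\<close> leaves fewer
  than \<open>Suc e\<close> pluses. Turning this minus into a plus keeps the other cancellations, so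
  it becomes the first remaining plus. This makes \<open>f\<close> undo \<open>e\<close>.\<close>

lemma remaining_step_e:
  assumes "last (remaining Minus (u @ (replicate (Suc e) (Minus, j) @ replicate f (Plus, j)) @ v)) = j"
    "remaining Minus (u @ (replicate (Suc e) (Minus, j) @ replicate f (Plus, j)) @ v) \<noteq> []"
    "j \<notin> snd ` set u" "j \<notin> snd ` set v"
  shows "remaining Plus (u @ (replicate e (Minus, j) @ replicate (Suc f) (Plus, j)) @ v) \<noteq> [] \<and>
    hd (remaining Plus (u @ (replicate e (Minus, j) @ replicate (Suc f) (Plus, j)) @ v)) = j"
proof -
  let ?Pu = "remaining Plus u" and ?Mu = "remaining Minus u" and ?Mv = "remaining Minus v" and ?Pv = "remaining Plus v"
  have u: "j \<notin> set ?Mu" and v: "j \<notin> set ?Mv"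
    using assms(3,4) set_remaining[of j Minus u] set_remaining[of j Minus v] by force+
  have mid: "remaining Minus (replicate a (Minus, j) @ replicate c (Plus, j)) = replicate a j"
    "remaining Plus (replicate a (Minus, j) @ replicate c (Plus, j)) = replicate c j" for a c
    by (simp_all add: remaining_Minus_append remaining_Plus_append)
  have eq: "remaining Minus (u @ (replicate (Suc e) (Minus, j) @ replicate f (Plus, j)) @ v) =
    ?Mu @ drop (length ?Pu) (replicate (Suc e) j @ drop f ?Mv)"
    unfolding remaining_append3 mid length_replicate ..
  have dv: "drop f ?Mv = []"
  proof (rule ccontr)
    assume ne: "drop f ?Mv \<noteq> []"
    have "last (remaining Minus (u @ (replicate (Suc e) (Minus, j) @ replicate f (Plus, j)) @ v)) \<in> set ?Mu \<union> set ?Mv"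
    proof (cases "length ?Pu < Suc e + length (drop f ?Mv)")
      case True
      then have "drop (length ?Pu) (replicate (Suc e) j @ drop f ?Mv) \<noteq> []" by simp
      moreover have "last (drop (length ?Pu) (replicate (Suc e) j @ drop f ?Mv)) = last (drop f ?Mv)"
        using True ne by (subst last_drop) (auto simp del: length_drop)
      ultimately have "last (remaining Minus (u @ (replicate (Suc e) (Minus, j) @ replicate f (Plus, j)) @ v)) = last (drop f ?Mv)"
        unfolding eq by simp
      then show ?thesis using ne last_in_set in_set_dropD by (metis UnI2)
    next
      case False
      then have "drop (length ?Pu) (replicate (Suc e) j @ drop f ?Mv) = []" by simp
      then show ?thesis using assms(2) unfolding eq by auto
    qed
    then show False using assms(1) u v by auto
  qed
  have pu: "length ?Pu < Suc e"
  proof (rule ccontr)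
    assume "\<not> length ?Pu < Suc e"
    then have "remaining Minus (u @ (replicate (Suc e) (Minus, j) @ replicate f (Plus, j)) @ v) = ?Mu"
      unfolding eq dv by simp
    then show False using assms(1,2) u last_in_set by metis
  qed
  have "remaining Plus (u @ (replicate e (Minus, j) @ replicate (Suc f) (Plus, j)) @ v) =
    take (length ?Pu - length (replicate e j @ drop (Suc f) ?Mv)) ?Pu @ take (Suc f - length ?Mv) (replicate (Suc f) j) @ ?Pv"
    unfolding remaining_append3 mid length_replicate ..
  moreover have "length ?Pu - length (replicate e j @ drop (Suc f) ?Mv) = 0" using pu by simp
  moreover have "Suc f - length ?Mv = Suc (f - length ?Mv)" using dv by simp
  ultimately show ?thesis by simp
qed

lemma remaining_step_f:
  assumes "hd (remaining Plus (u @ (replicate e (Minus, j) @ replicate (Suc f) (Plus, j)) @ v)) = j"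
    "remaining Plus (u @ (replicate e (Minus, j) @ replicate (Suc f) (Plus, j)) @ v) \<noteq> []"
    "j \<notin> snd ` set u" "j \<notin> snd ` set v"
  shows "remaining Minus (u @ (replicate (Suc e) (Minus, j) @ replicate f (Plus, j)) @ v) \<noteq> [] \<and>
    last (remaining Minus (u @ (replicate (Suc e) (Minus, j) @ replicate f (Plus, j)) @ v)) = j"
proof -
  let ?Pu = "remaining Plus u" and ?Mu = "remaining Minus u" and ?Mv = "remaining Minus v" and ?Pv = "remaining Plus v"
  have u: "j \<notin> set ?Pu" and v: "j \<notin> set ?Pv"
    using assms(3,4) set_remaining[of j Plus u] set_remaining[of j Plus v] by force+
  have mid: "remaining Minus (replicate a (Minus, j) @ replicate c (Plus, j)) = replicate a j"
    "remaining Plus (replicate a (Minus, j) @ replicate c (Plus, j)) = replicate c j" for a c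
    by (simp_all add: remaining_Minus_append remaining_Plus_append)
  have eq: "remaining Plus (u @ (replicate e (Minus, j) @ replicate (Suc f) (Plus, j)) @ v) =
    take (length ?Pu - length (replicate e j @ drop (Suc f) ?Mv)) ?Pu @ take (Suc f - length ?Mv) (replicate (Suc f) j) @ ?Pv"
    unfolding remaining_append3 mid length_replicate ..
  have pu: "take (length ?Pu - length (replicate e j @ drop (Suc f) ?Mv)) ?Pu = []"
  proof (rule ccontr)
    assume ne: "take (length ?Pu - length (replicate e j @ drop (Suc f) ?Mv)) ?Pu \<noteq> []"
    then have "j \<in> set (take (length ?Pu - length (replicate e j @ drop (Suc f) ?Mv)) ?Pu)"
      using assms(1) unfolding eq by (metis hd_append2 hd_in_set)
    then show False using u in_set_takeD by metis
  qed
  have mv: "length ?Mv < Suc f"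
  proof (rule ccontr)
    assume "\<not> length ?Mv < Suc f"
    then have "remaining Plus (u @ (replicate e (Minus, j) @ replicate (Suc f) (Plus, j)) @ v) = ?Pv"
      unfolding eq pu by simp
    then show False using assms(1,2) v hd_in_set by metis
  qed
  have lp: "length ?Pu < Suc e"
  proof (cases "?Pu = []")
    case False
    then have "length ?Pu \<le> e + length (drop (Suc f) ?Mv)" using pu by simp
    then show ?thesis using mv by simp
  qed simp
  have "remaining Minus (u @ (replicate (Suc e) (Minus, j) @ replicate f (Plus, j)) @ v) =
    ?Mu @ drop (length ?Pu) (replicate (Suc e) j @ drop f ?Mv)"
    unfolding remaining_append3 mid length_replicate ..
  also have "\<dots> = ?Mu @ replicate (Suc e - length ?Pu) j" using mv by (simp del: replicate_Suc)
  also have "Suc e - length ?Pu = Suc (e - length ?Pu)" using lp by simp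
  finally show ?thesis by simp
qed

text \<open>The least choice matters for \<open>Zero\<close>, which fills all columns far to the
  left: it selects the rightmost ground-state column beyond \<open>N\<close>. A barred letter occurs
  there at most once, by \<open>tail_unique\<close>.\<close>

definition tail_pos :: "nat \<Rightarrow> (nat \<Rightarrow> letter) \<Rightarrow> letter \<Rightarrow> nat" where
  "tail_pos N \<xi> x = (LEAST j. N < j \<and> \<xi> j = x)"

definition in_tail :: "nat \<Rightarrow> (nat \<Rightarrow> letter) \<Rightarrow> letter \<Rightarrow> bool" where
  "in_tail N \<xi> x \<longleftrightarrow> (\<exists>j>N. \<xi> j = x)"

text \<open>The signature of a half-column in which the letter \<open>a\<close> is present when its
  bar is absent, with the sign placed at the column of the wall that would change.\<close>

definition tail_signs :: "nat \<Rightarrow> bool \<Rightarrow> nat \<Rightarrow> nat \<Rightarrow> (nat \<Rightarrow> letter) \<Rightarrow> (sign \<times> nat) list" where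
  "tail_signs n b N i \<xi> =
     (if \<not> b then []
      else if i < n then
        (if in_tail N \<xi> (Neg (Suc i)) \<and> \<not> in_tail N \<xi> (Neg i) then [(Plus, tail_pos N \<xi> (Neg (Suc i)))]
         else if in_tail N \<xi> (Neg i) \<and> \<not> in_tail N \<xi> (Neg (Suc i)) then [(Minus, tail_pos N \<xi> (Neg i))] else [])
      else if in_tail N \<xi> (Neg n) then [(Minus, tail_pos N \<xi> (Neg n))] else [(Plus, tail_pos N \<xi> Zero)])"

definition row_signs :: "nat \<Rightarrow> nat \<Rightarrow> nat \<Rightarrow> (nat \<Rightarrow> letter) \<Rightarrow> (sign \<times> nat) list" where
  "row_signs n N i \<xi> = concat (map (\<lambda>j. replicate (letter_eps n i (\<xi> j)) (Minus, j) @ replicate (letter_phi n i (\<xi> j)) (Plus, j)) (rev [1..<Suc N]))"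

definition full_signs :: "nat \<Rightarrow> bool \<Rightarrow> nat \<Rightarrow> nat \<Rightarrow> (nat \<Rightarrow> letter) \<Rightarrow> (sign \<times> nat) list" where
  "full_signs n b N i \<xi> = tail_signs n b N i \<xi> @ row_signs n N i \<xi>"

lemma tail_pos: "in_tail N \<xi> x \<Longrightarrow> N < tail_pos N \<xi> x \<and> \<xi> (tail_pos N \<xi> x) = x"
  unfolding in_tail_def tail_pos_def by (rule LeastI_ex) blast

lemma tail_pos_least: "N < j \<Longrightarrow> \<xi> j = x \<Longrightarrow> tail_pos N \<xi> x \<le> j"
  unfolding tail_pos_def by (rule Least_le) blast

context wall_data
begin

lemma row_signs_eq:
  assumes "valid \<xi>" "nice \<xi>" "1 \<le> i" "i \<le> n"
  shows "remaining s (u @ concat (map (\<lambda>j. map (\<lambda>s. (s, j)) (column_signs n b N i (Psi \<xi>) j)) (rev [1..<Suc N]))) =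
    remaining s (u @ row_signs n N i \<xi>)"
proof -
  \<comment> \<open>Counts the plus of column \<open>Suc j\<close> and the minus of column
    \<open>j\<close> that are missing because the two columns block each other.\<close>
  define m where "m j = (if 1 \<le> j \<and> Suc j \<le> N \<and> beta j = beta (Suc j) \<and> adjacent_pair n i (\<xi> (Suc j)) (\<xi> j) then 1 else 0 :: nat)" for j
  have col: "map (\<lambda>s. (s, j)) (column_signs n b N i (Psi \<xi>) j) =
    replicate (letter_eps n i (\<xi> j) - m j) (Minus, j) @ replicate (letter_phi n i (\<xi> j) - m (j - 1)) (Plus, j)"
    if j: "j \<in> set (rev [1..<Suc N])" for j
  proof -
    have jN: "1 \<le> j" "j \<le> N" using j by auto
    have act: "active j" using jN by (simp add: active_def)
    define hl where "hl \<longleftrightarrow> (Suc j \<le> N \<or> b) \<and> beta j = beta (Suc j)"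
    define hr where "hr \<longleftrightarrow> 2 \<le> j \<and> beta (j - 1) = beta j"
    \<comment> \<open>The base period changes between column \<open>N\<close> and the tail, so these
      never block each other, and only pairs among the first \<open>N\<close> columns count.\<close>
    have hl: "hl \<longleftrightarrow> Suc j \<le> N \<and> beta j = beta (Suc j)"
      using base_period_pos[OF jN] base_period_gt[of cs "Suc j"] by (cases "Suc j \<le> N") (auto simp: hl_def)
    have L: "hl \<Longrightarrow> \<xi> (Suc j) \<in> letters n \<and> col_gt (\<xi> j) (\<xi> (Suc j))"
      using nice_local[OF assms(2) act] validD(1)[OF assms(1), of "Suc j"] by (simp add: left_ok_def hl_def)
    have R: "\<xi> (j - 1) \<in> letters n \<and> col_gt (\<xi> (j - 1)) (\<xi> j)" if hr
    proof -
      have "1 \<le> j - 1" using that by (auto simp: hr_def)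
      then show ?thesis using that nice_local[OF assms(2) act] validD(1)[OF assms(1), of "j - 1"]
        unfolding right_ok_def hr_def by blast
    qed
    have lo: "(\<lambda>y. (N < j \<longrightarrow> Zero \<le> y) \<and> left_ok \<xi> j y) = (\<lambda>y. hl \<longrightarrow> col_gt y (\<xi> (Suc j)))"
      using jN by (auto simp: left_ok_def hl_def fun_eq_iff)
    have ro: "right_ok \<xi> j = (\<lambda>y. hr \<longrightarrow> col_gt (\<xi> (j - 1)) y)"
      by (auto simp: right_ok_def hr_def fun_eq_iff)
    have m: "m j = (if hl \<and> adjacent_pair n i (\<xi> (Suc j)) (\<xi> j) then 1 else 0)"
      "m (j - 1) = (if hr \<and> adjacent_pair n i (\<xi> j) (\<xi> (j - 1)) then 1 else 0)"
      using jN hl by (auto simp: m_def hr_def)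
    have "letter_column_signs n i (\<lambda>y. hl \<longrightarrow> col_gt y (\<xi> (Suc j))) (\<lambda>y. hr \<longrightarrow> col_gt (\<xi> (j - 1)) y) (\<xi> j) =
        replicate (letter_eps n i (\<xi> j) - m j) Minus @ replicate (letter_phi n i (\<xi> j) - m (j - 1)) Plus"
      unfolding m
      by (rule letter_column_signs_eq[OF assms(3,4) active_lay(3)[OF assms(1) act]]) (use L R in blast)+
    then show ?thesis
      unfolding column_signs_active[OF assms act] lo ro by (simp only: map_append map_replicate)
  qed
  have "concat (map (\<lambda>j. map (\<lambda>s. (s, j)) (column_signs n b N i (Psi \<xi>) j)) (rev [1..<Suc N])) =
    concat (map (\<lambda>j. replicate (letter_eps n i (\<xi> j) - m j) (Minus, j) @ replicate (letter_phi n i (\<xi> j) - m (j - 1)) (Plus, j)) (rev [1..<Suc N]))"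
    by (intro arg_cong[where f = concat] map_cong refl col)
  moreover have "m j \<le> letter_eps n i (\<xi> j) \<and> m j \<le> letter_phi n i (\<xi> (Suc j))" for j
    using adjacent_pair_le[of n i "\<xi> (Suc j)" "\<xi> j"] by (auto simp: m_def)
  moreover have "m 0 = 0" "m N = 0" by (auto simp: m_def)
  ultimately show ?thesis
    unfolding row_signs_def
    using remaining_cancel_adjacent[of N m "\<lambda>j. letter_eps n i (\<xi> j)" "\<lambda>j. letter_phi n i (\<xi> j)" s u] by simp
qed

lemma tail_gt:
  assumes "nice \<xi>" b "N < j" "j < k" shows "col_gt (\<xi> j) (\<xi> k)"
  by (rule nice_chain[OF assms(1)]) (use assms base_period_gt in auto)

lemma tail_letter:
  assumes "valid \<xi>" b "N < j" shows "\<xi> j = Zero \<or> (\<exists>a. \<xi> j = Neg a \<and> 1 \<le> a \<and> a \<le> n)"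
  using validD(1,2)[OF assms(1), of j] assms(2,3) by (cases "\<xi> j") auto

lemma tail_unique:
  assumes "nice \<xi>" b "N < j" "N < k" "\<xi> j = Neg a" "\<xi> k = Neg a" shows "j = k"
  using tail_gt[OF assms(1,2,3), of k] tail_gt[OF assms(1,2,4), of j] assms(5,6)
  by (cases j k rule: linorder_cases) (auto simp: col_gt_def)

lemma tail_order:
  assumes "nice \<xi>" b "N < j" "N < k" "\<xi> j < \<xi> k" shows "k < j"
  using tail_gt[OF assms(1,2,3), of k] assms(4,5) by (cases j k rule: linorder_cases) (auto simp: col_gt_def)

lemma tail_zero: "valid \<xi> \<Longrightarrow> nice \<xi> \<Longrightarrow> b \<Longrightarrow> N < j \<Longrightarrow> j \<le> k \<Longrightarrow> \<xi> j = Zero \<Longrightarrow> \<xi> k = Zero"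
  using tail_gt[of \<xi> j k] tail_letter[of \<xi> k] by (cases "j = k") (auto simp: col_gt_def)

lemma tail_bound:
  assumes "valid \<xi>" b shows "\<exists>K\<ge>N. \<forall>j>K. \<xi> j = Zero"
proof -
  have "finite {j. N < j \<and> \<xi> j \<noteq> Zero}" using validD(3)[OF assms] .
  then obtain K where "\<forall>j\<in>{j. N < j \<and> \<xi> j \<noteq> Zero}. j \<le> K" using finite_nat_set_iff_bounded_le by blast
  then have "\<forall>j>max N K. \<xi> j = Zero" by (metis (mono_tags, lifting) max_less_iff_conj mem_Collect_eq not_le)
  then show ?thesis by (intro exI[of _ "max N K"]) simp
qed

text \<open>All base periods beyond \<open>N\<close> are 0. Column \<open>Suc N\<close> is special,
  because its right neighbour has another base period and cannot block it; hence the clauses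
  \<open>Suc N < j\<close>.\<close>

lemma column_signs_tail:
  assumes "valid \<xi>" "nice \<xi>" b "1 \<le> i" "i \<le> n" "N < j"
  shows "column_signs n b N i (Psi \<xi>) j =
    (if i < n then (if \<xi> j = Neg (Suc i) \<and> \<not> (Suc N < j \<and> \<xi> (j - 1) = Neg i) then [Plus]
       else if \<xi> j = Neg i \<and> \<xi> (Suc j) \<noteq> Neg (Suc i) then [Minus] else [])
     else (if \<xi> j = Neg n then [Minus]
       else if \<xi> j = Zero \<and> \<not> (Suc N < j \<and> \<xi> (j - 1) \<in> {Zero, Neg n}) then [Plus] else []))"
proof -
  have act: "active j" unfolding active_def using assms by auto
  have b0: "beta k = 0" if "N < k" for k using base_period_gt that by blast
  have lo: "left_ok \<xi> j y \<longleftrightarrow> col_gt y (\<xi> (Suc j))" for y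
    unfolding left_ok_def using assms b0 by simp
  have ro: "right_ok \<xi> j y \<longleftrightarrow> (Suc N < j \<longrightarrow> col_gt (\<xi> (j - 1)) y)" for y
  proof (cases "Suc N < j")
    case True
    then show ?thesis using b0[of j] b0[of "j - 1"] by (auto simp: right_ok_def)
  next
    case False
    then have "j = Suc N" using assms(6) by simp
    then have "\<not> (2 \<le> j \<and> beta (j - 1) = beta j)" using base_period_pos[of N cs] b0[of j] by auto
    then show ?thesis unfolding right_ok_def using False by blast
  qed
  have L: "col_gt (\<xi> j) (\<xi> (Suc j))" using tail_gt[OF assms(2,3,6)] by simp
  have R: "Suc N < j \<Longrightarrow> col_gt (\<xi> (j - 1)) (\<xi> j)" using tail_gt[OF assms(2,3), of "j - 1" j] by auto
  have l: "\<xi> (Suc j) = Zero \<or> (\<exists>a. \<xi> (Suc j) = Neg a \<and> 1 \<le> a \<and> a \<le> n)" using tail_letter[OF assms(1,3)] assms(6) by simp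
  have r: "Suc N < j \<Longrightarrow> \<xi> (j - 1) = Zero \<or> (\<exists>a. \<xi> (j - 1) = Neg a \<and> 1 \<le> a \<and> a \<le> n)" using tail_letter[OF assms(1,3), of "j - 1"] by auto
  note x = tail_letter[OF assms(1,3,6)]
  have eq: "column_signs n b N i (Psi \<xi>) j = letter_column_signs n i (\<lambda>y. Zero \<le> y \<and> col_gt y (\<xi> (Suc j)))
      (\<lambda>y. Suc N < j \<longrightarrow> col_gt (\<xi> (j - 1)) y) (\<xi> j)"
    unfolding column_signs_active[OF assms(1,2,4,5) act] lo using assms(6)
    by (intro arg_cong2[where f = "\<lambda>p q. letter_column_signs n i p q (\<xi> j)"]) (auto simp: ro)
  show ?thesis
  proof (cases "i < n")
    case True
    have 1: "\<xi> j = Neg i \<Longrightarrow> col_gt (Neg (Suc i)) (\<xi> (Suc j)) \<longleftrightarrow> \<xi> (Suc j) \<noteq> Neg (Suc i)"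
      using L l by (auto simp: col_gt_def)
    have 2: "Suc N < j \<Longrightarrow> \<xi> j = Neg (Suc i) \<Longrightarrow> col_gt (\<xi> (j - 1)) (Neg i) \<longleftrightarrow> \<xi> (j - 1) \<noteq> Neg i"
      using R r by (auto simp: col_gt_def)
    consider "\<xi> j = Neg (Suc i)" | "\<xi> j = Neg i" | "\<xi> j \<notin> {Pos i, Pos (Suc i), Neg (Suc i), Neg i}" using x by (metis empty_iff insert_iff letter.distinct(1,3))
    then show ?thesis unfolding eq
      by cases (use True 1 2 in \<open>auto simp: letter_column_signs_def vec_f_Suc_cases vec_e_Suc_cases\<close>)
  next
    case False
    then have n: "i = n" using assms by simp
    have 1: "\<xi> j = Neg n \<Longrightarrow> col_gt Zero (\<xi> (Suc j))" using L l by (auto simp: col_gt_def)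
    have 2: "Suc N < j \<Longrightarrow> \<xi> j = Zero \<Longrightarrow> col_gt (\<xi> (j - 1)) (Neg n) \<longleftrightarrow> \<xi> (j - 1) \<notin> {Zero, Neg n}"
      using R r by (auto simp: col_gt_def)
    consider "\<xi> j = Neg n" | "\<xi> j = Zero" | "\<xi> j \<notin> {Pos n, Zero, Neg n}" using x by (metis empty_iff insert_iff letter.distinct)
    then show ?thesis unfolding eq
      by cases (use n 1 2 in \<open>auto simp: letter_column_signs_def vec_f_Suc_cases vec_e_Suc_cases\<close>)
  qed
qed

text \<open>If the bars of \<open>i\<close> and of \<open>Suc i\<close> both occur, they are in
  adjacent columns and block each other. For \<open>i = n\<close> only the rightmost ground-state
  column of the tail can receive a block, and not if the bar of \<open>n\<close> stands to its
  right. The range extends to \<open>Suc K\<close> so as to contain a ground-state column.\<close>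

lemma tail_signs_eq:
  assumes "valid \<xi>" "nice \<xi>" b "1 \<le> i" "i \<le> n" "\<forall>j>K. \<xi> j = Zero" "N \<le> K"
  shows "concat (map (\<lambda>j. map (\<lambda>s. (s, j)) (column_signs n b N i (Psi \<xi>) j)) (rev [Suc N..<Suc (Suc K)])) = tail_signs n b N i \<xi>"
proof -
  let ?g = "\<lambda>j. map (\<lambda>s. (s, j)) (column_signs n b N i (Psi \<xi>) j)"
  let ?xs = "rev [Suc N..<Suc (Suc K)]"
  note cs_t = column_signs_tail[OF assms(1-5)]
  have single: "concat (map ?g ?xs) = ?g j"
    if "N < j" "j \<le> Suc K" "\<And>k. N < k \<Longrightarrow> k \<noteq> j \<Longrightarrow> column_signs n b N i (Psi \<xi>) k = []" for j
    by (rule concat_map_single) (use that in auto)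
  have Neg_le: "j \<le> K" if "\<xi> j = Neg a" for j a using assms(6) that by (metis letter.distinct(5) not_le)
  show ?thesis
  proof (cases "i < n")
    case True
    show ?thesis
    proof (cases "in_tail N \<xi> (Neg (Suc i))")
      case p: True
      define j where "j = tail_pos N \<xi> (Neg (Suc i))"
      have j: "N < j" "\<xi> j = Neg (Suc i)" using tail_pos[OF p] by (auto simp: j_def)
      have uj: "\<xi> k \<noteq> Neg (Suc i)" if "N < k" "k \<noteq> j" for k
        using tail_unique[OF assms(2,3) j(1) that(1) j(2)] that(2) by auto
      show ?thesis
      proof (cases "in_tail N \<xi> (Neg i)")
        case q: True
        define k where "k = tail_pos N \<xi> (Neg i)"
        have k: "N < k" "\<xi> k = Neg i" using tail_pos[OF q] by (auto simp: k_def)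
        have uk: "\<xi> l \<noteq> Neg i" if "N < l" "l \<noteq> k" for l
          using tail_unique[OF assms(2,3) k(1) that(1) k(2)] that(2) by auto
        have "k < j" by (rule tail_order[OF assms(2,3) j(1) k(1)]) (simp add: j k)
        \<comment> \<open>No letter lies between the bars of \<open>Suc i\<close> and
          \<open>i\<close>, so by \<open>col_gt\<close> no column fits between theirs.\<close>
        have "j = Suc k"
        proof (rule ccontr)
          assume "j \<noteq> Suc k"
          then have lt: "k < Suc k" "Suc k < j" using \<open>k < j\<close> by auto
          have "col_gt (\<xi> k) (\<xi> (Suc k))" "col_gt (\<xi> (Suc k)) (\<xi> j)"
            using tail_gt[OF assms(2,3)] k j lt by (meson less_SucI)+
          then show False using k j by (cases "\<xi> (Suc k)") (auto simp: col_gt_def)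
        qed
        have "column_signs n b N i (Psi \<xi>) l = []" if "N < l" for l
          unfolding cs_t[OF that] using uj[OF that] uk[OF that] k j \<open>j = Suc k\<close> True
          by (cases "l = j"; cases "l = k") auto
        then have "concat (map ?g ?xs) = []" by (auto simp del: upt_Suc)
        moreover have "tail_signs n b N i \<xi> = []" using p q True by (simp add: tail_signs_def)
        ultimately show ?thesis by (simp only:)
      next
        case q: False
        then have ni: "\<xi> l \<noteq> Neg i" if "N < l" for l using that by (auto simp: in_tail_def)
        have "concat (map ?g ?xs) = ?g j"
          by (rule single) (use j Neg_le[OF j(2)] uj ni True in \<open>auto simp: cs_t\<close>)
        also have "column_signs n b N i (Psi \<xi>) j = [Plus]"
          using j ni[of "j - 1"] True by (auto simp: cs_t)
        finally show ?thesis using p q True assms(3) by (simp add: tail_signs_def j_def)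
      qed
    next
      case p: False
      then have np: "\<xi> l \<noteq> Neg (Suc i)" if "N < l" for l using that by (auto simp: in_tail_def)
      show ?thesis
      proof (cases "in_tail N \<xi> (Neg i)")
        case q: True
        define k where "k = tail_pos N \<xi> (Neg i)"
        have k: "N < k" "\<xi> k = Neg i" using tail_pos[OF q] by (auto simp: k_def)
        have uk: "\<xi> l \<noteq> Neg i" if "N < l" "l \<noteq> k" for l
          using tail_unique[OF assms(2,3) k(1) that(1) k(2)] that(2) by auto
        have "concat (map ?g ?xs) = ?g k"
          by (rule single) (use k Neg_le[OF k(2)] uk np True in \<open>auto simp: cs_t\<close>)
        also have "column_signs n b N i (Psi \<xi>) k = [Minus]"
          using k np[of "Suc k"] True by (auto simp: cs_t)
        finally show ?thesis using p q True assms(3) by (simp add: tail_signs_def k_def)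
      next
        case q: False
        then have ni: "\<xi> l \<noteq> Neg i" if "N < l" for l using that by (auto simp: in_tail_def)
        have "column_signs n b N i (Psi \<xi>) l = []" if "N < l" for l
          using np[OF that] ni[OF that] True by (simp add: cs_t[OF that])
        then have "concat (map ?g ?xs) = []" by (auto simp del: upt_Suc)
        moreover have "tail_signs n b N i \<xi> = []" using p q True by (simp add: tail_signs_def)
        ultimately show ?thesis by (simp only:)
      qed
    qed
  next
    case False
    then have n: "i = n" using assms by simp
    show ?thesis
    proof (cases "in_tail N \<xi> (Neg n)")
      case p: True
      define j where "j = tail_pos N \<xi> (Neg n)"
      have j: "N < j" "\<xi> j = Neg n" using tail_pos[OF p] by (auto simp: j_def)
      have uj: "\<xi> k \<noteq> Neg n" if "N < k" "k \<noteq> j" for k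
        using tail_unique[OF assms(2,3) j(1) that(1) j(2)] that(2) by auto
      have "column_signs n b N i (Psi \<xi>) k = []" if k: "N < k" "k \<noteq> j" for k
      proof (cases "\<xi> k = Zero")
        case True
        have "j < k" by (rule tail_order[OF assms(2,3) k(1) j(1)]) (simp add: j True)
        then have "Suc N < k" "j \<le> k - 1" "N < k - 1" using j by auto
        moreover have "\<xi> (k - 1) = Neg n \<or> \<xi> (k - 1) = Zero"
          using tail_gt[OF assms(2,3) j(1), of "k - 1"] tail_letter[OF assms(1,3), of "k - 1"] calculation j(2)
          by (cases "j = k - 1") (auto simp: col_gt_def)
        ultimately show ?thesis unfolding cs_t[OF k(1)] using uj[OF k] n by auto
      next
        case False
        then show ?thesis unfolding cs_t[OF k(1)] using uj[OF k] n by simp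
      qed
      then have "concat (map ?g ?xs) = ?g j"
        by (intro single) (use j Neg_le[OF j(2)] in auto)
      also have "column_signs n b N i (Psi \<xi>) j = [Minus]" unfolding cs_t[OF j(1)] using j n by simp
      finally show ?thesis using p n assms(3) by (simp add: tail_signs_def j_def)
    next
      case p: False
      then have np: "\<xi> l \<noteq> Neg n" if "N < l" for l using that by (auto simp: in_tail_def)
      define j where "j = tail_pos N \<xi> Zero"
      have zin: "in_tail N \<xi> Zero" using assms(6,7) by (auto simp: in_tail_def intro: exI[of _ "Suc K"])
      have j: "N < j" "\<xi> j = Zero" using tail_pos[OF zin] by (auto simp: j_def)
      have jK: "j \<le> Suc K" unfolding j_def by (rule tail_pos_least) (use assms(6,7) in auto)
      have least: "\<xi> l \<noteq> Zero" if "N < l" "l < j" for l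
        using tail_pos_least[of N l \<xi> Zero] that by (auto simp: j_def)
      have "column_signs n b N i (Psi \<xi>) k = []" if k: "N < k" "k \<noteq> j" for k
      proof (cases "\<xi> k = Zero")
        case True
        then have "j < k" using least[of k] k by (cases "k < j") auto
        then have "\<xi> (k - 1) = Zero" using tail_zero[OF assms(1-3) j(1) _ j(2), of "k - 1"] by simp
        then show ?thesis unfolding cs_t[OF k(1)] using \<open>j < k\<close> j n True by auto
      next
        case False
        then show ?thesis unfolding cs_t[OF k(1)] using np[OF k(1)] n by simp
      qed
      then have "concat (map ?g ?xs) = ?g j"
        by (intro single) (use j jK in auto)
      also have "column_signs n b N i (Psi \<xi>) j = [Plus]"
        unfolding cs_t[OF j(1)] using j n least[of "j - 1"] np[of "j - 1"] by auto
      finally show ?thesis using p n assms(3) by (simp add: tail_signs_def j_def)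
    qed
  qed
qed

lemma remaining_wall_signs:
  assumes "valid \<xi>" "nice \<xi>" "1 \<le> i" "i \<le> n"
  shows "remaining s (wall_signs n b N i (Psi \<xi>)) = remaining s (full_signs n b N i \<xi>)"
proof (cases b)
  case True
  obtain K where K: "\<forall>j>K. \<xi> j = Zero" "N \<le> K" using tail_bound[OF assms(1) True] by blast
  have "column_signs n b N i (Psi \<xi>) j = []" if "Suc (Suc K) \<le> j" for j
  proof -
    have "\<xi> j = Zero" "\<xi> (j - 1) = Zero" "\<xi> (Suc j) = Zero" "N < j" "Suc N < j" using K that by auto
    then show ?thesis using column_signs_tail[OF assms(1,2) True assms(3,4)] by simp
  qed
  then have ws: "wall_signs n b N i (Psi \<xi>) = concat (map (\<lambda>j. map (\<lambda>s. (s, j)) (column_signs n b N i (Psi \<xi>) j)) (rev [1..<Suc (Suc K)]))"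
    by (rule wall_signs_upto)
  have sp: "rev [1..<Suc (Suc K)] = rev [Suc N..<Suc (Suc K)] @ rev [1..<Suc N]"
    using upt_add_eq_append[of 1 "Suc N" "Suc K - N"] K(2) by (simp flip: rev_append)
  show ?thesis
    unfolding ws sp map_append concat_append tail_signs_eq[OF assms(1,2) True assms(3,4) K] full_signs_def
    by (rule row_signs_eq[OF assms])
next
  case False
  have "column_signs n b N i (Psi \<xi>) j = []" if "Suc N \<le> j" for j
    by (rule column_signs_inactive[OF assms(1,3,4)], unfold active_def) (use that False in auto)
  then have ws: "wall_signs n b N i (Psi \<xi>) = concat (map (\<lambda>j. map (\<lambda>s. (s, j)) (column_signs n b N i (Psi \<xi>) j)) (rev [1..<Suc N]))"
    by (rule wall_signs_upto)
  show ?thesis unfolding ws using row_signs_eq[OF assms, of s "[]"] False by (simp add: full_signs_def tail_signs_def)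
qed

end

section \<open>Kashiwara operators on walls and on tableaux\<close>

lemma wall_signs_set: "(s, j) \<in> set (wall_signs n b N i Y) \<Longrightarrow> s \<in> set (column_signs n b N i Y j) \<and> 1 \<le> j"
proof -
  let ?A = "{j. 1 \<le> j \<and> column_signs n b N i Y j \<noteq> []}"
  have "set (sorted_list_of_set ?A) \<subseteq> ?A" by (cases "finite ?A") auto
  then show "(s, j) \<in> set (wall_signs n b N i Y) \<Longrightarrow> s \<in> set (column_signs n b N i Y j) \<and> 1 \<le> j"
    unfolding wall_signs_def by (auto dest: subsetD)
qed

lemma column_signs_Minus: "Minus \<in> set (column_signs n b N i Y j) \<Longrightarrow> removable n b N i j Y"
  by (auto simp: column_signs_def twice_removable_def split: if_splits)

lemma column_signs_Plus: "Plus \<in> set (column_signs n b N i Y j) \<Longrightarrow> admissible n b N i j Y"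
  by (auto simp: column_signs_def twice_admissible_def split: if_splits)

lemma tail_pos_eqI: "N < j \<Longrightarrow> \<xi> j = x \<Longrightarrow> (\<And>k. N < k \<Longrightarrow> k < j \<Longrightarrow> \<xi> k \<noteq> x) \<Longrightarrow> tail_pos N \<xi> x = j"
  unfolding tail_pos_def by (rule Least_equality) (auto simp: not_less[symmetric])

context wall_data
begin

text \<open>The signs computed from the letters include blocked ones, but those cancel. A remaining
  sign therefore also remains in the true signature of the wall, so its column really has a
  removable block.\<close>

lemma wall_e_Psi:
  assumes "valid \<xi>" "nice \<xi>" "1 \<le> i" "i \<le> n" "remaining Minus (full_signs n b N i \<xi>) \<noteq> []"
  defines "j \<equiv> last (remaining Minus (full_signs n b N i \<xi>))"
  obtains y where "active j" "vec_e n i (\<xi> j) = Some y" "N < j \<Longrightarrow> Zero \<le> y" "valid (\<xi>(j := y))" "nice (\<xi>(j := y))"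
    "wall_e n b N i (Psi \<xi>) = Some (Psi (\<xi>(j := y)))"
proof -
  note rm = remaining_wall_signs[OF assms(1-4), of Minus]
  have "j \<in> set (remaining Minus (wall_signs n b N i (Psi \<xi>)))" using assms(5) by (simp add: rm j_def)
  from wall_signs_set[OF set_remaining[OF this]]
  have "Minus \<in> set (column_signs n b N i (Psi \<xi>) j)" and j: "1 \<le> j" by simp_all
  then have "removable n b N i j (Psi \<xi>)" using column_signs_Minus by blast
  then obtain y where y: "active j" "vec_e n i (\<xi> j) = Some y" "N < j \<longrightarrow> Zero \<le> y" "nice (\<xi>(j := y))"
    using removable_iff[OF assms(1,3,4) j] by blast
  have v: "valid (\<xi>(j := y))" by (rule valid_e[OF assms(1) j y(2) assms(3,4)]) (use y in blast)
  have "remove_block i j (Psi \<xi>) = Psi (\<xi>(j := y))"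
    by (rule remove_block_e[OF assms(1) y(1,2) assms(3,4)]) (use y in blast)
  then have "wall_e n b N i (Psi \<xi>) = Some (Psi (\<xi>(j := y)))"
    using assms(5) by (simp add: wall_e_def rm j_def)
  then show thesis using that y v by blast
qed

lemma wall_f_Psi:
  assumes "valid \<xi>" "nice \<xi>" "1 \<le> i" "i \<le> n" "remaining Plus (full_signs n b N i \<xi>) \<noteq> []"
  defines "j \<equiv> hd (remaining Plus (full_signs n b N i \<xi>))"
  obtains y where "active j" "vec_f n i (\<xi> j) = Some y" "valid (\<xi>(j := y))" "nice (\<xi>(j := y))"
    "wall_f n b N i (Psi \<xi>) = Some (Psi (\<xi>(j := y)))"
proof -
  note rm = remaining_wall_signs[OF assms(1-4), of Plus]
  have "j \<in> set (remaining Plus (wall_signs n b N i (Psi \<xi>)))" using assms(5) by (simp add: rm j_def)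
  from wall_signs_set[OF set_remaining[OF this]]
  have "Plus \<in> set (column_signs n b N i (Psi \<xi>) j)" and j: "1 \<le> j" by simp_all
  then have "admissible n b N i j (Psi \<xi>)" using column_signs_Plus by blast
  then obtain y where y: "active j" "vec_f n i (\<xi> j) = Some y" "nice (\<xi>(j := y))"
    using admissible_iff[OF assms(1,3,4) j] by blast
  have v: "valid (\<xi>(j := y))" by (rule valid_f[OF assms(1) j y(2) assms(3,4)])
  have "add_block n i j (Psi \<xi>) = Psi (\<xi>(j := y))"
    by (rule add_block_f(1)[OF assms(1) y(1,2) assms(3,4)])
  then have "wall_f n b N i (Psi \<xi>) = Some (Psi (\<xi>(j := y)))"
    using assms(5) by (simp add: wall_f_def rm j_def)
  then show thesis using that y v by blast
qed

lemma wall_e_None: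
  "valid \<xi> \<Longrightarrow> nice \<xi> \<Longrightarrow> 1 \<le> i \<Longrightarrow> i \<le> n \<Longrightarrow> remaining Minus (full_signs n b N i \<xi>) = [] \<Longrightarrow> wall_e n b N i (Psi \<xi>) = None"
  by (simp add: wall_e_def remaining_wall_signs)

lemma wall_f_None:
  "valid \<xi> \<Longrightarrow> nice \<xi> \<Longrightarrow> 1 \<le> i \<Longrightarrow> i \<le> n \<Longrightarrow> remaining Plus (full_signs n b N i \<xi>) = [] \<Longrightarrow> wall_f n b N i (Psi \<xi>) = None"
  by (simp add: wall_f_def remaining_wall_signs)

lemma tail_signs_tags:
  assumes "valid \<xi>" "(s, j) \<in> set (tail_signs n b N i \<xi>)"
  shows "N < j" "tail_signs n b N i \<xi> = [(s, j)]" b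
proof -
  have b: b using assms(2) by (auto simp: tail_signs_def split: if_splits)
  obtain K where "\<forall>j>K. \<xi> j = Zero" "N \<le> K" using tail_bound[OF assms(1) b] by blast
  then have "in_tail N \<xi> Zero" by (auto simp: in_tail_def intro: exI[of _ "Suc K"])
  then show "N < j" "tail_signs n b N i \<xi> = [(s, j)]" b
    using assms(2) tail_pos by (auto simp: tail_signs_def split: if_splits)
qed

lemma tail_signs_e:
  assumes "valid \<xi>" "nice \<xi>" "1 \<le> i" "i \<le> n" "tail_signs n b N i \<xi> = [(Minus, j)]" "vec_e n i (\<xi> j) = Some y"
  shows "tail_signs n b N i (\<xi>(j := y)) = [(Plus, j)]"
proof -
  have "(Minus, j) \<in> set (tail_signs n b N i \<xi>)" unfolding assms(5) by simp
  note tg = tail_signs_tags[OF assms(1) this]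
  have b: b by (rule tg(3))
  have Nj: "N < j" by (rule tg(1))
  show ?thesis
  proof (cases "i < n")
    case True
    then have t: "in_tail N \<xi> (Neg i)" "\<not> in_tail N \<xi> (Neg (Suc i))" "tail_pos N \<xi> (Neg i) = j"
      using assms(5) b by (auto simp: tail_signs_def split: if_splits)
    then have xj: "\<xi> j = Neg i" using tail_pos by blast
    then have y: "y = Neg (Suc i)" using assms(6) True by (auto simp: vec_e_Suc_cases)
    have "in_tail N (\<xi>(j := y)) (Neg (Suc i))" using y Nj by (auto simp: in_tail_def)
    moreover have "\<not> in_tail N (\<xi>(j := y)) (Neg i)"
      using y tail_unique[OF assms(2) b Nj _ xj] by (auto simp: in_tail_def)
    moreover have "tail_pos N (\<xi>(j := y)) (Neg (Suc i)) = j"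
      by (rule tail_pos_eqI) (use y Nj t(2) in \<open>auto simp: in_tail_def\<close>)
    ultimately show ?thesis using True b by (simp add: tail_signs_def)
  next
    case False
    then have n: "i = n" using assms(4) by simp
    then have t: "in_tail N \<xi> (Neg n)" "tail_pos N \<xi> (Neg n) = j"
      using assms(5) b by (auto simp: tail_signs_def split: if_splits)
    then have xj: "\<xi> j = Neg n" using tail_pos by blast
    then have y: "y = Zero" using assms(6) n by (auto simp: vec_e_Suc_cases)
    have "\<not> in_tail N (\<xi>(j := y)) (Neg n)"
      using y tail_unique[OF assms(2) b Nj _ xj] by (auto simp: in_tail_def)
    moreover have "tail_pos N (\<xi>(j := y)) Zero = j"
    proof (rule tail_pos_eqI)
      fix k assume "N < k" "k < j"
      then show "(\<xi>(j := y)) k \<noteq> Zero" using tail_zero[OF assms(1,2) b, of k j] xj by auto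
    qed (use y Nj in auto)
    ultimately show ?thesis using n b by (simp add: tail_signs_def)
  qed
qed

lemma tail_signs_f:
  assumes "valid \<xi>" "nice \<xi>" "1 \<le> i" "i \<le> n" "tail_signs n b N i \<xi> = [(Plus, j)]" "vec_f n i (\<xi> j) = Some y"
  shows "tail_signs n b N i (\<xi>(j := y)) = [(Minus, j)]"
proof -
  have "(Plus, j) \<in> set (tail_signs n b N i \<xi>)" unfolding assms(5) by simp
  note tg = tail_signs_tags[OF assms(1) this]
  have b: b by (rule tg(3))
  have Nj: "N < j" by (rule tg(1))
  show ?thesis
  proof (cases "i < n")
    case True
    then have t: "in_tail N \<xi> (Neg (Suc i))" "\<not> in_tail N \<xi> (Neg i)" "tail_pos N \<xi> (Neg (Suc i)) = j"
      using assms(5) b by (auto simp: tail_signs_def split: if_splits)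
    then have xj: "\<xi> j = Neg (Suc i)" using tail_pos by blast
    then have y: "y = Neg i" using assms(6) True by (auto simp: vec_f_Suc_cases)
    have "in_tail N (\<xi>(j := y)) (Neg i)" using y Nj by (auto simp: in_tail_def)
    moreover have "\<not> in_tail N (\<xi>(j := y)) (Neg (Suc i))"
      using y tail_unique[OF assms(2) b Nj _ xj] by (auto simp: in_tail_def)
    moreover have "tail_pos N (\<xi>(j := y)) (Neg i) = j"
      by (rule tail_pos_eqI) (use y Nj t(2) in \<open>auto simp: in_tail_def\<close>)
    ultimately show ?thesis using True b by (simp add: tail_signs_def)
  next
    case False
    then have n: "i = n" using assms(4) by simp
    then have t: "\<not> in_tail N \<xi> (Neg n)" "tail_pos N \<xi> Zero = j"
      using assms(5) b by (auto simp: tail_signs_def split: if_splits)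
    obtain K where "\<forall>j>K. \<xi> j = Zero" "N \<le> K" using tail_bound[OF assms(1) b] by blast
    then have "in_tail N \<xi> Zero" by (auto simp: in_tail_def intro: exI[of _ "Suc K"])
    then have xj: "\<xi> j = Zero" using tail_pos t(2) by blast
    then have y: "y = Neg n" using assms(6) n by (auto simp: vec_f_Suc_cases)
    have "in_tail N (\<xi>(j := y)) (Neg n)" using y Nj by (auto simp: in_tail_def)
    moreover have "tail_pos N (\<xi>(j := y)) (Neg n) = j"
      by (rule tail_pos_eqI) (use y Nj t(1) in \<open>auto simp: in_tail_def\<close>)
    ultimately show ?thesis using n b by (simp add: tail_signs_def)
  qed
qed

lemma row_signs_split:
  assumes "1 \<le> j" "j \<le> N"
  obtains A B where "j \<notin> snd ` set A" "j \<notin> snd ` set B"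
    "\<And>x. row_signs n N i (\<xi>(j := x)) = A @ (replicate (letter_eps n i x) (Minus, j) @ replicate (letter_phi n i x) (Plus, j)) @ B"
proof -
  let ?h = "\<lambda>\<xi> j. replicate (letter_eps n i (\<xi> j)) (Minus, j) @ replicate (letter_phi n i (\<xi> j)) (Plus, j)"
  have up: "[1..<Suc N] = [1..<j] @ j # [Suc j..<Suc N]"
    using assms upt_add_eq_append[of 1 j "Suc N - j"] upt_conv_Cons[of j "Suc N"] by simp
  have "row_signs n N i (\<xi>(j := x)) = concat (map (?h \<xi>) (rev [Suc j..<Suc N])) @
      (replicate (letter_eps n i x) (Minus, j) @ replicate (letter_phi n i x) (Plus, j)) @ concat (map (?h \<xi>) (rev [1..<j]))" for x
  proof -
    have e: "map (?h (\<xi>(j := x))) (rev [Suc j..<Suc N]) = map (?h \<xi>) (rev [Suc j..<Suc N])"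
      "map (?h (\<xi>(j := x))) (rev [1..<j]) = map (?h \<xi>) (rev [1..<j])"
      by (rule map_cong; force simp del: upt_Suc)+
    show ?thesis unfolding row_signs_def up
      by (simp only: rev_append rev.simps map_append list.map concat_append concat.simps e append_assoc append_Nil append_Nil2 fun_upd_same)
  qed
  then show thesis by (rule that[rotated 2]) (auto simp del: upt_Suc)
qed

lemma row_signs_tags: "(s, j) \<in> set (row_signs n N i \<xi>) \<Longrightarrow> 1 \<le> j \<and> j \<le> N"
  by (auto simp: row_signs_def simp del: upt_Suc)

lemma tail_signs_update: "j \<le> N \<Longrightarrow> tail_signs n b N i (\<xi>(j := y)) = tail_signs n b N i \<xi>"
proof -
  assume "j \<le> N"
  then have "N < k \<and> (\<xi>(j := y)) k = x \<longleftrightarrow> N < k \<and> \<xi> k = x" for k x by auto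
  then have "in_tail N (\<xi>(j := y)) x = in_tail N \<xi> x" "tail_pos N (\<xi>(j := y)) x = tail_pos N \<xi> x" for x
    unfolding in_tail_def tail_pos_def by simp_all
  then show ?thesis by (simp add: tail_signs_def)
qed

lemma row_signs_update: "N < j \<Longrightarrow> row_signs n N i (\<xi>(j := y)) = row_signs n N i \<xi>"
  unfolding row_signs_def by (intro arg_cong[where f = concat] map_cong refl) auto

text \<open>Carried out on \<open>full_signs\<close>, where a step at \<open>j\<close> affects the
  signs of this column alone; in the true signature of the wall the neighbours may gain or lose
  signs, too.\<close>

lemma full_signs_e:
  assumes "valid \<xi>" "nice \<xi>" "1 \<le> i" "i \<le> n" "remaining Minus (full_signs n b N i \<xi>) \<noteq> []"
    "last (remaining Minus (full_signs n b N i \<xi>)) = j" "1 \<le> j" "vec_e n i (\<xi> j) = Some y"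
  shows "remaining Plus (full_signs n b N i (\<xi>(j := y))) \<noteq> [] \<and> hd (remaining Plus (full_signs n b N i (\<xi>(j := y)))) = j"
proof (cases "j \<le> N")
  case True
  obtain A B where AB: "j \<notin> snd ` set A" "j \<notin> snd ` set B"
    "\<And>x. row_signs n N i (\<xi>(j := x)) = A @ (replicate (letter_eps n i x) (Minus, j) @ replicate (letter_phi n i x) (Plus, j)) @ B"
    using row_signs_split[OF assms(7) True] by blast
  have f: "vec_f n i y = Some (\<xi> j)" using assms(8) by (simp add: vec_e_iff_vec_f)
  note ef = vec_f_eps_phi[OF f]
  let ?u = "tail_signs n b N i \<xi> @ A"
  have u: "j \<notin> snd ` set ?u" using AB(1) tail_signs_tags(1)[OF assms(1)] True by force
  have 1: "full_signs n b N i \<xi> = ?u @ (replicate (Suc (letter_eps n i y)) (Minus, j) @ replicate (letter_phi n i (\<xi> j)) (Plus, j)) @ B"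
    using AB(3)[of "\<xi> j"] ef by (simp add: full_signs_def)
  have 2: "full_signs n b N i (\<xi>(j := y)) = ?u @ (replicate (letter_eps n i y) (Minus, j) @ replicate (Suc (letter_phi n i (\<xi> j))) (Plus, j)) @ B"
    using AB(3)[of y] ef tail_signs_update[OF True] by (simp add: full_signs_def)
  show ?thesis unfolding 2
    by (rule remaining_step_e[OF assms(6)[unfolded 1] assms(5)[unfolded 1] u AB(2)])
next
  case False
  have "(Minus, j) \<in> set (full_signs n b N i \<xi>)" using set_remaining assms(5,6) last_in_set by metis
  then have "(Minus, j) \<in> set (tail_signs n b N i \<xi>)" using row_signs_tags False by (auto simp: full_signs_def)
  then have t: "tail_signs n b N i \<xi> = [(Minus, j)]" using tail_signs_tags[OF assms(1)] by blast
  have r: "j \<notin> snd ` set (row_signs n N i \<xi>)" using row_signs_tags False by force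
  have 1: "full_signs n b N i \<xi> = [] @ (replicate (Suc 0) (Minus, j) @ replicate 0 (Plus, j)) @ row_signs n N i \<xi>"
    using t by (simp add: full_signs_def)
  have 2: "full_signs n b N i (\<xi>(j := y)) = [] @ (replicate 0 (Minus, j) @ replicate (Suc 0) (Plus, j)) @ row_signs n N i \<xi>"
    using tail_signs_e[OF assms(1-4) t assms(8)] row_signs_update[of j i \<xi> y] False by (simp add: full_signs_def)
  show ?thesis unfolding 2
    by (rule remaining_step_e[OF assms(6)[unfolded 1] assms(5)[unfolded 1] _ r]) simp
qed

lemma full_signs_f:
  assumes "valid \<xi>" "nice \<xi>" "1 \<le> i" "i \<le> n" "remaining Plus (full_signs n b N i \<xi>) \<noteq> []"
    "hd (remaining Plus (full_signs n b N i \<xi>)) = j" "1 \<le> j" "vec_f n i (\<xi> j) = Some y"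
  shows "remaining Minus (full_signs n b N i (\<xi>(j := y))) \<noteq> [] \<and> last (remaining Minus (full_signs n b N i (\<xi>(j := y)))) = j"
proof (cases "j \<le> N")
  case True
  obtain A B where AB: "j \<notin> snd ` set A" "j \<notin> snd ` set B"
    "\<And>x. row_signs n N i (\<xi>(j := x)) = A @ (replicate (letter_eps n i x) (Minus, j) @ replicate (letter_phi n i x) (Plus, j)) @ B"
    using row_signs_split[OF assms(7) True] by blast
  note ef = vec_f_eps_phi[OF assms(8)]
  let ?u = "tail_signs n b N i \<xi> @ A"
  have u: "j \<notin> snd ` set ?u" using AB(1) tail_signs_tags(1)[OF assms(1)] True by force
  have 1: "full_signs n b N i \<xi> = ?u @ (replicate (letter_eps n i (\<xi> j)) (Minus, j) @ replicate (Suc (letter_phi n i y)) (Plus, j)) @ B"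
    using AB(3)[of "\<xi> j"] ef by (simp add: full_signs_def)
  have 2: "full_signs n b N i (\<xi>(j := y)) = ?u @ (replicate (Suc (letter_eps n i (\<xi> j))) (Minus, j) @ replicate (letter_phi n i y) (Plus, j)) @ B"
    using AB(3)[of y] ef tail_signs_update[OF True] by (simp add: full_signs_def)
  show ?thesis unfolding 2
    by (rule remaining_step_f[OF assms(6)[unfolded 1] assms(5)[unfolded 1] u AB(2)])
next
  case False
  have "(Plus, j) \<in> set (full_signs n b N i \<xi>)" using set_remaining assms(5,6) hd_in_set by metis
  then have "(Plus, j) \<in> set (tail_signs n b N i \<xi>)" using row_signs_tags False by (auto simp: full_signs_def)
  then have t: "tail_signs n b N i \<xi> = [(Plus, j)]" using tail_signs_tags[OF assms(1)] by blast
  have r: "j \<notin> snd ` set (row_signs n N i \<xi>)" using row_signs_tags False by force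
  have 1: "full_signs n b N i \<xi> = [] @ (replicate 0 (Minus, j) @ replicate (Suc 0) (Plus, j)) @ row_signs n N i \<xi>"
    using t by (simp add: full_signs_def)
  have 2: "full_signs n b N i (\<xi>(j := y)) = [] @ (replicate (Suc 0) (Minus, j) @ replicate 0 (Plus, j)) @ row_signs n N i \<xi>"
    using tail_signs_f[OF assms(1-4) t assms(8)] row_signs_update[of j i \<xi> y] False by (simp add: full_signs_def)
  show ?thesis unfolding 2
    by (rule remaining_step_f[OF assms(6)[unfolded 1] assms(5)[unfolded 1] _ r]) simp
qed

lemma wall_f_wall_e:
  assumes "valid \<xi>" "nice \<xi>" "1 \<le> i" "i \<le> n" "wall_e n b N i (Psi \<xi>) = Some Z"
  shows "wall_f n b N i Z = Some (Psi \<xi>)"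
proof -
  have ne: "remaining Minus (full_signs n b N i \<xi>) \<noteq> []"
    using wall_e_None[OF assms(1-4)] assms(5) by auto
  define j where "j = last (remaining Minus (full_signs n b N i \<xi>))"
  obtain y where y: "active j" "vec_e n i (\<xi> j) = Some y" "valid (\<xi>(j := y))" "nice (\<xi>(j := y))"
    "wall_e n b N i (Psi \<xi>) = Some (Psi (\<xi>(j := y)))"
    using wall_e_Psi[OF assms(1-4) ne] unfolding j_def by metis
  have j1: "1 \<le> j" using y(1) by (simp add: active_def)
  have P: "remaining Plus (full_signs n b N i (\<xi>(j := y))) \<noteq> []" "hd (remaining Plus (full_signs n b N i (\<xi>(j := y)))) = j"
    using full_signs_e[OF assms(1-4) ne j_def[symmetric] j1 y(2)] by auto
  obtain x where x: "vec_f n i ((\<xi>(j := y)) j) = Some x" "wall_f n b N i (Psi (\<xi>(j := y))) = Some (Psi ((\<xi>(j := y))(j := x)))"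
    using wall_f_Psi[OF y(3,4) assms(3,4) P(1)] unfolding P(2) by metis
  have "x = \<xi> j" using x(1) y(2) by (simp add: vec_e_iff_vec_f)
  then show ?thesis using x(2) y(5) assms(5) by simp
qed

lemma wall_e_wall_f:
  assumes "valid \<xi>" "nice \<xi>" "1 \<le> i" "i \<le> n" "wall_f n b N i (Psi \<xi>) = Some Z"
  shows "wall_e n b N i Z = Some (Psi \<xi>)"
proof -
  have ne: "remaining Plus (full_signs n b N i \<xi>) \<noteq> []"
    using wall_f_None[OF assms(1-4)] assms(5) by auto
  define j where "j = hd (remaining Plus (full_signs n b N i \<xi>))"
  obtain y where y: "active j" "vec_f n i (\<xi> j) = Some y" "valid (\<xi>(j := y))" "nice (\<xi>(j := y))"
    "wall_f n b N i (Psi \<xi>) = Some (Psi (\<xi>(j := y)))"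
    using wall_f_Psi[OF assms(1-4) ne] unfolding j_def by metis
  have j1: "1 \<le> j" using y(1) by (simp add: active_def)
  have P: "remaining Minus (full_signs n b N i (\<xi>(j := y))) \<noteq> []" "last (remaining Minus (full_signs n b N i (\<xi>(j := y)))) = j"
    using full_signs_f[OF assms(1-4) ne j_def[symmetric] j1 y(2)] by auto
  obtain x where x: "vec_e n i ((\<xi>(j := y)) j) = Some x" "wall_e n b N i (Psi (\<xi>(j := y))) = Some (Psi ((\<xi>(j := y))(j := x)))"
    using wall_e_Psi[OF y(3,4) assms(3,4) P(1)] unfolding P(2) by metis
  have "x = \<xi> j" using x(1) y(2) by (simp flip: vec_e_iff_vec_f)
  then show ?thesis using x(2) y(5) assms(5) by simp
qed

end

text \<open>The half-column is listed from the bottom, so its barred letters come next to column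
  \<open>N\<close>. The maximum with \<open>Zero\<close> turns its unbarred letters into
  ground-state columns.\<close>

definition letters_of :: "nat \<Rightarrow> nat list \<Rightarrow> bool \<Rightarrow> letter list list \<Rightarrow> nat \<Rightarrow> letter" where
  "letters_of n cs b T j =
     (if j = 0 then Zero
      else if j \<le> sum_list cs then concat (if b then butlast T else T) ! (j - 1)
      else if b \<and> j - sum_list cs \<le> n then max Zero (last T ! (j - sum_list cs - 1))
      else Zero)"

text \<open>The base period changes precisely where the columns of the wall pass from the top entry
  of one tableau column to the bottom entry of the next.\<close>

lemma base_period_adjacent:
  assumes "0 \<notin> set (map length L)" "1 \<le> j" "Suc j \<le> sum_list (map length L)"
  shows "if base_period (map length L) j = base_period (map length L) (Suc j)
    then \<exists>C\<in>set L. \<exists>p. Suc p < length C \<and> concat L ! (j - 1) = C ! p \<and> concat L ! j = C ! Suc p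
    else \<exists>k. Suc k < length L \<and> concat L ! (j - 1) = last (L ! k) \<and> concat L ! j = L ! Suc k ! 0"
  using assms
proof (induction L arbitrary: j)
  case (Cons C L)
  consider "Suc j \<le> length C" | "j = length C" | "length C < j" by linarith
  then show ?case
  proof cases
    case 1
    then have "concat (C # L) ! (j - 1) = C ! (j - 1)" "concat (C # L) ! j = C ! Suc (j - 1)" "Suc (j - 1) < length C"
      using Cons.prems(2) by (auto simp: nth_append)
    then show ?thesis using 1 by auto
  next
    case 2
    have "L \<noteq> []" using 2 Cons.prems(3) by auto
    then obtain D L' where L: "L = D # L'" by (cases L) auto
    have "C \<noteq> []" "D \<noteq> []" using Cons.prems(1) L by auto
    then have "concat (C # L) ! (j - 1) = last C" "concat (C # L) ! j = L ! 0 ! 0"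
      using 2 L by (simp_all add: nth_append last_conv_nth)
    moreover have "base_period (map length (C # L)) (Suc j) \<noteq> base_period (map length (C # L)) j"
      using 2 base_period_1[of "map length L"] Cons.prems(1) by simp
    ultimately show ?thesis using \<open>L \<noteq> []\<close> by (auto intro!: exI[of _ 0])
  next
    case 3
    then have e: "concat (C # L) ! (j - 1) = concat L ! (j - length C - 1)" "concat (C # L) ! j = concat L ! (j - length C)"
      "base_period (map length (C # L)) j = base_period (map length L) (j - length C)"
      "base_period (map length (C # L)) (Suc j) = base_period (map length L) (Suc (j - length C))"
      by (auto simp: nth_append Suc_diff_le intro: arg_cong)
    note IH = Cons.IH[of "j - length C"]
    show ?thesis unfolding e
      using IH Cons.prems 3 by (fastforce simp: Suc_diff_le split: if_splits)
  qed
qed simp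

lemma base_period_column:
  assumes "0 \<notin> set (map length L)" "\<And>C. C \<in> set L \<Longrightarrow> column_ok C" "1 \<le> j" "Suc j \<le> sum_list (map length L)"
    "base_period (map length L) j = base_period (map length L) (Suc j)"
  shows "col_gt (concat L ! (j - 1)) (concat L ! j)"
  using base_period_adjacent[OF assms(1,3,4)] assms(2,5) unfolding column_ok_iff by fastforce

section \<open>The wall of a tableau and its signature\<close>

context wall_data
begin

abbreviation "xi \<equiv> letters_of n cs b"

definition body :: "letter list list \<Rightarrow> letter list" where
  "body T = concat (if b then butlast T else T)"

lemma tabD:
  assumes "tab n cs b T"
  shows "map length (if b then butlast T else T) = cs" "b \<Longrightarrow> last T \<in> half_columns n" "b \<Longrightarrow> T \<noteq> []"
    "\<And>C. C \<in> set T \<Longrightarrow> kn_column n C" "length (body T) = N" "set (body T) \<subseteq> letters n"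
    "reading b T = spin_part b T @ map Vec (rev (body T))"
proof -
  have len: "map length T = cs @ (if b then [n] else [])" using assms by (simp add: tab_def shape_def)
  show 1: "map length (if b then butlast T else T) = cs" using len by (simp add: map_butlast)
  show "b \<Longrightarrow> last T \<in> half_columns n" "\<And>C. C \<in> set T \<Longrightarrow> kn_column n C" using assms by (auto simp: tab_def)
  show "b \<Longrightarrow> T \<noteq> []" using len by auto
  show "length (body T) = N" unfolding body_def length_concat 1 ..
  show "set (body T) \<subseteq> letters n"
    using assms kn_columnD(1) unfolding body_def tab_def by (fastforce dest: in_set_butlastD split: if_splits)
  show "reading b T = spin_part b T @ map Vec (rev (body T))" by (simp add: reading_alt body_def)
qed

lemma xi_body: "1 \<le> j \<Longrightarrow> j \<le> N \<Longrightarrow> xi T j = body T ! (j - 1)"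
  by (simp add: letters_of_def body_def)

lemma xi_tail: "b \<Longrightarrow> k < n \<Longrightarrow> xi T (Suc (N + k)) = max Zero (last T ! k)"
  by (simp add: letters_of_def)

lemma xi_far: "b \<Longrightarrow> N + n < j \<Longrightarrow> xi T j = Zero"
  by (auto simp: letters_of_def)

lemma tail_cases:
  assumes "N < j" obtains k where "k < n" "j = Suc (N + k)" | "N + n < j"
proof (cases "N + n < j")
  case False
  then have "j - Suc N < n" "j = Suc (N + (j - Suc N))" using assms by auto
  then show thesis using that(1) by blast
qed (use that in blast)

lemma max_Zero: "x \<in> letters n \<Longrightarrow> max Zero x \<in> letters n" "x \<noteq> Zero \<Longrightarrow> max Zero x = Neg a \<longleftrightarrow> x = Neg a"
  "x \<noteq> Zero \<Longrightarrow> max Zero x = Zero \<longleftrightarrow> (\<exists>a. x = Pos a)"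
  by (auto simp: max_def; cases x; auto)+

lemma half_nth:
  assumes "tab n cs b T" b "k < n"
  shows "last T ! k \<in> letters n" "last T ! k \<noteq> Zero" "last T ! k \<in> set (last T)"
proof -
  note h = half_columnD[OF tabD(2)[OF assms(1,2)]]
  show s: "last T ! k \<in> set (last T)" using h(1) assms(3) by simp
  then show "last T ! k \<in> letters n" "last T ! k \<noteq> Zero" using h(2,3) by (blast, metis)
qed

lemma xi_tail_Neg_iff:
  assumes "tab n cs b T" b "N < j"
  shows "xi T j = Neg a \<longleftrightarrow> (\<exists>k<n. j = Suc (N + k) \<and> last T ! k = Neg a)"
  using assms(3)
proof (cases rule: tail_cases)
  case (1 k)
  then show ?thesis using xi_tail[OF assms(2) 1(1)] max_Zero(2)[OF half_nth(2)[OF assms(1,2) 1(1)]] by auto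
next
  case 2
  then show ?thesis using xi_far[OF assms(2)] by auto
qed

lemma valid_xi:
  assumes "tab n cs b T" shows "valid (xi T)"
proof -
  have "xi T j \<in> letters n" if "1 \<le> j" for j
  proof (cases "j \<le> N")
    case True
    then have "body T ! (j - 1) \<in> set (body T)" using that tabD(5)[OF assms] by simp
    then show ?thesis using tabD(6)[OF assms] xi_body[OF that True] by auto
  next
    case False
    show ?thesis
    proof (cases b)
      case True
      have "N < j" using False by simp
      then show ?thesis
      proof (cases rule: tail_cases)
        case (1 k)
        then show ?thesis using xi_tail[OF True 1(1)] max_Zero(1)[OF half_nth(1)[OF assms True 1(1)]] by simp
      qed (simp add: xi_far[OF True])
    qed (use False that in \<open>simp add: letters_of_def\<close>)
  qed
  moreover have "Zero \<le> xi T j" if b "N < j" for j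
    using that(2)
  proof (cases rule: tail_cases)
    case (1 k)
    then show ?thesis using xi_tail[OF that(1) 1(1)] by simp
  qed (simp add: xi_far[OF that(1)])
  moreover have "finite {j. N < j \<and> xi T j \<noteq> Zero}" if b
    by (rule finite_subset[OF _ finite_atMost[of "N + n"]]) (use xi_far[OF that] in \<open>auto simp: not_less[symmetric]\<close>)
  ultimately show ?thesis by (simp add: valid_letters_def)
qed

lemma nice_xi:
  assumes "tab n cs b T" shows "nice (xi T)"
  unfolding nice_letters_def
proof (intro allI impI)
  fix j assume j: "1 \<le> j" "Suc j \<le> N \<or> b" "beta j = beta (Suc j)"
  let ?L = "if b then butlast T else T"
  note len = tabD(1)[OF assms]
  show "col_gt (xi T j) (xi T (Suc j))"
  proof (cases "Suc j \<le> N")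
    case True
    have "col_gt (concat ?L ! (j - 1)) (concat ?L ! j)"
    proof (rule base_period_column)
      show "0 \<notin> set (map length ?L)" unfolding len by (rule cs0)
      show "column_ok C" if "C \<in> set ?L" for C
        using that tabD(4)[OF assms] kn_columnD(2) by (auto dest: in_set_butlastD split: if_splits)
    qed (use j True in \<open>simp_all only: len\<close>)
    then show ?thesis using xi_body[OF j(1), of T] xi_body[of "Suc j" T] True by (simp add: body_def)
  next
    case False
    then have b: b using j by simp
    have Nj: "N < j"
    proof (rule ccontr)
      assume "\<not> N < j"
      then have "j = N" using False by simp
      then show False using j base_period_pos[of N cs] base_period_gt[of cs "Suc N"] by simp
    qed
    show ?thesis using Nj
    proof (cases rule: tail_cases)
      case (1 k)
      show ?thesis
      proof (cases "Suc k < n")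
        case True
        have "last T ! Suc k < last T ! k"
          using half_columnD(1,4)[OF tabD(2)[OF assms b]] True unfolding sorted_wrt_iff_nth_less by auto
        then show ?thesis
          using xi_tail[OF b 1(1)] xi_tail[OF b True] 1(2) half_nth(2)[OF assms b 1(1)] half_nth(2)[OF assms b True]
          by (cases "last T ! k"; cases "last T ! Suc k") (auto simp: col_gt_def max_def)
      next
        case False
        then have "xi T (Suc j) = Zero" using xi_far[OF b, of "Suc j"] 1 by simp
        then show ?thesis using xi_tail[OF b 1(1)] 1(2) by (auto simp: col_gt_def max_def)
      qed
    next
      case 2
      then show ?thesis using xi_far[OF b] by (simp add: col_gt_def)
    qed
  qed
qed

lemma row_signs_xi:
  assumes "tab n cs b T"
  shows "row_signs n N i (xi T) = map (\<lambda>(s, p). (s, N - p)) (word_signs n i (map Vec (rev (body T))))"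
proof -
  have len: "length (body T) = N" using tabD(5)[OF assms] .
  have "map (\<lambda>j. replicate (letter_eps n i (xi T j)) (Minus, j) @ replicate (letter_phi n i (xi T j)) (Plus, j)) (rev [1..<Suc N]) =
    map (map (\<lambda>(s, p). (s, N - p))) (map (\<lambda>p. map (\<lambda>s. (s, p)) (factor_signs n i (map Vec (rev (body T)) ! p))) [0..<length (map Vec (rev (body T)))])"
  proof (rule nth_equalityI)
    fix p assume "p < length (map (\<lambda>j. replicate (letter_eps n i (xi T j)) (Minus, j) @ replicate (letter_phi n i (xi T j)) (Plus, j)) (rev [1..<Suc N]))"
    then have p: "p < N" by (simp del: upt_Suc)
    then have r: "rev [1..<Suc N] ! p = N - p" by (simp add: rev_nth del: upt_Suc)
    have x: "xi T (N - p) = rev (body T) ! p" using p len xi_body[of "N - p" T] by (simp add: rev_nth)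
    show "map (\<lambda>j. replicate (letter_eps n i (xi T j)) (Minus, j) @ replicate (letter_phi n i (xi T j)) (Plus, j)) (rev [1..<Suc N]) ! p =
      map (map (\<lambda>(s, p). (s, N - p))) (map (\<lambda>p. map (\<lambda>s. (s, p)) (factor_signs n i (map Vec (rev (body T)) ! p))) [0..<length (map Vec (rev (body T)))]) ! p"
      using p len r x by (simp add: factor_signs_def del: upt_Suc)
  qed (simp add: len del: upt_Suc)
  then show ?thesis unfolding row_signs_def word_signs_alt map_concat by simp
qed

text \<open>A half-column contains a letter precisely when the bar is missing, so the barred
  letters, which are all that the tail shows, decide whether \<open>spin_e\<close> or
  \<open>spin_f\<close> applies. If there is no sign, any \<open>t\<close> will do.\<close>

lemma tail_signs_xi:
  assumes "tab n cs b T" b "1 \<le> i" "i \<le> n"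
  shows "\<exists>t. tail_signs n b N i (xi T) = map (\<lambda>(s, p). (s, t)) (word_signs n i [Spin (last T)])"
proof -
  note h = half_columnD[OF tabD(2)[OF assms(1,2)]]
  have tl: "in_tail N (xi T) (Neg a) \<longleftrightarrow> Neg a \<in> set (last T)" for a
  proof
    assume "in_tail N (xi T) (Neg a)"
    then obtain j where "N < j" "xi T j = Neg a" by (auto simp: in_tail_def)
    then obtain k where "k < n" "last T ! k = Neg a" using xi_tail_Neg_iff[OF assms(1,2)] by blast
    then show "Neg a \<in> set (last T)" using h(1) nth_mem by metis
  next
    assume "Neg a \<in> set (last T)"
    then obtain k where k: "k < n" "last T ! k = Neg a" using h(1) by (metis in_set_conv_nth)
    then have "xi T (Suc (N + k)) = Neg a" using xi_tail_Neg_iff[OF assms(1,2), of "Suc (N + k)" a] by auto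
    then show "in_tail N (xi T) (Neg a)" unfolding in_tail_def by (intro exI[of _ "Suc (N + k)"]) simp
  qed
  show ?thesis
  proof (cases "i < n")
    case True
    then show ?thesis unfolding word_signs_Spin[OF assms(3)] tail_signs_def tl
      using assms(2,3) h(6)[of i] h(6)[of "Suc i"] by (auto simp: spin_e_def spin_f_def)
  next
    case False
    then have "i = n" using assms by simp
    then show ?thesis unfolding word_signs_Spin[OF assms(3)] tail_signs_def tl
      using assms(2,3) h(6)[of n] by (auto simp: spin_e_def spin_f_def)
  qed
qed

lemma full_signs_xi:
  assumes "tab n cs b T" "1 \<le> i" "i \<le> n"
  obtains g where "full_signs n b N i (xi T) = map (\<lambda>(s, p). (s, g p)) (word_signs n i (reading b T))"
    "\<And>p. length (spin_part b T) \<le> p \<Longrightarrow> g p = N + length (spin_part b T) - p"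
proof (cases b)
  case True
  then obtain t where t: "tail_signs n b N i (xi T) = map (\<lambda>(s, p). (s, t)) (word_signs n i [Spin (last T)])"
    using tail_signs_xi[OF assms(1) _ assms(2,3)] by blast
  \<comment> \<open>The spin factor is read at position 0 and belongs to column \<open>t\<close> of
    the tail; the later positions run through the columns from \<open>N\<close> down to 1.\<close>
  define g where "g p = (if p = 0 then t else N + 1 - p)" for p
  have sp: "spin_part b T = [Spin (last T)]" using True by (simp add: spin_part_def)
  have "tail_signs n b N i (xi T) = map (\<lambda>(s, p). (s, g p)) (word_signs n i [Spin (last T)])"
    unfolding t using word_signs_bound[of _ _ n i "[Spin (last T)]"] by (auto simp: g_def)
  then have "full_signs n b N i (xi T) = map (\<lambda>(s, p). (s, g p)) (word_signs n i (reading b T))"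
    unfolding full_signs_def row_signs_xi[OF assms(1)] tabD(7)[OF assms(1)] sp word_signs_append
    by (auto simp: g_def)
  then show thesis by (rule that) (simp add: sp g_def)
next
  case False
  then have "full_signs n b N i (xi T) = map (\<lambda>(s, p). (s, N - p)) (word_signs n i (reading b T))"
    unfolding full_signs_def row_signs_xi[OF assms(1)] tabD(7)[OF assms(1)] by (simp add: tail_signs_def spin_part_def)
  then show thesis by (rule that) (simp add: spin_part_def False)
qed

lemma xi_update_body:
  assumes "tab n cs b T" "tab n cs b T'" "reading b T' = (reading b T)[p := Vec y]" "length (spin_part b T) \<le> p" "p < length (reading b T)"
  defines "j \<equiv> N + length (spin_part b T) - p"
  shows "reading b T ! p = Vec (xi T j)" "xi T' = (xi T)(j := y)"
proof -
  define q where "q = p - length (spin_part b T)"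
  note t = tabD[OF assms(1)] and t' = tabD[OF assms(2)]
  have lsp: "length (spin_part b T') = length (spin_part b T)" by (simp add: spin_part_def)
  have q: "p = length (spin_part b T) + q" "q < N" "j = N - q" using assms(4,5) t(5,7) by (auto simp: q_def j_def)
  have "reading b T ! p = Vec (rev (body T) ! q)" unfolding t(7) q(1) using q(2) t(5) by (simp add: nth_append)
  moreover have "xi T j = rev (body T) ! q" using q t(5) xi_body[of j T] by (simp add: rev_nth)
  ultimately show "reading b T ! p = Vec (xi T j)" by simp
  have "spin_part b T' @ map Vec (rev (body T')) = spin_part b T @ map Vec ((rev (body T))[q := y])"
    using assms(3) unfolding t(7) t'(7) q(1) by (simp add: list_update_append map_update)
  then have sp: "spin_part b T' = spin_part b T" "map Vec (rev (body T')) = map Vec ((rev (body T))[q := y])"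
    using lsp by simp_all
  have "inj (map Vec)" by (simp add: inj_def)
  then have "rev (body T') = (rev (body T))[q := y]" using sp(2) by (meson injD)
  then have "body T' = rev ((rev (body T))[q := y])" by (metis rev_rev_ident)
  then have "body T' = (body T)[N - Suc q := y]" using q t(5) rev_update[of q "rev (body T)" y] by simp
  then have bd: "body T' = (body T)[j - 1 := y]" using q by simp
  have l: "b \<Longrightarrow> last T' = last T" using sp(1) by (simp add: spin_part_def)
  show "xi T' = (xi T)(j := y)"
  proof
    fix k
    consider "k = 0" | "1 \<le> k" "k \<le> N" | "N < k" by linarith
    then show "xi T' k = ((xi T)(j := y)) k"
    proof cases
      case 1
      then show ?thesis using q by (simp add: letters_of_def)
    next
      case 2
      then show ?thesis using xi_body[OF 2] bd q t(5) by (auto simp: nth_list_update)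
    next
      case 3
      then show ?thesis using l q by (auto simp: letters_of_def)
    qed
  qed
qed

lemma xi_update_spin:
  assumes "tab n cs b T" "tab n cs b T'" b "reading b T' = (reading b T)[0 := Spin c']" "N < j"
    and g: "\<And>k. k < n \<Longrightarrow> Suc (N + k) \<noteq> j \<Longrightarrow> max Zero (c' ! k) = max Zero (last T ! k)"
      "\<And>k. k < n \<Longrightarrow> Suc (N + k) = j \<Longrightarrow> max Zero (c' ! k) = y" "j \<le> N + n"
  shows "xi T' = (xi T)(j := y)"
proof -
  note t = tabD[OF assms(1)] and t' = tabD[OF assms(2)]
  have "Spin (last T') # map Vec (rev (body T')) = Spin c' # map Vec (rev (body T))"
    using assms(4) unfolding t(7) t'(7) using assms(3) by (simp add: spin_part_def)
  then have l: "last T' = c'" and bd: "map Vec (rev (body T')) = map Vec (rev (body T))" by simp_all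
  have "inj (map Vec)" by (simp add: inj_def)
  then have bd: "body T' = body T" using bd by (metis injD rev_rev_ident)
  show ?thesis
  proof
    fix k
    consider "k = 0" | "1 \<le> k" "k \<le> N" | "N < k" by linarith
    then show "xi T' k = ((xi T)(j := y)) k"
    proof cases
      case 1
      then show ?thesis using assms(5) by (simp add: letters_of_def)
    next
      case 2
      then show ?thesis using xi_body[OF 2] bd assms(5) by auto
    next
      case 3
      then show ?thesis
      proof (cases rule: tail_cases)
        case (1 m)
        then show ?thesis using xi_tail[OF assms(3) 1(1)] l g(1)[OF 1(1)] g(2)[OF 1(1)] by auto
      next
        case 2
        then show ?thesis using xi_far[OF assms(3) 2] g(3) by simp
      qed
    qed
  qed
qed

text \<open>The same remaining sign selects a factor of the reading and a column of the wall. In a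
  half-column two letters may change, but on the wall only one column does, since an unbarred letter
  is shown as \<open>Zero\<close> before and after.\<close>

lemma wall_e_xi:
  assumes T: "tab n cs b T" and i: "1 \<le> i" "i \<le> n" and a: "acts Minus n i (reading b T) p"
  obtains T' where "tab n cs b T'" "word_e n i (reading b T) = Some (reading b T')" "wall_e n b N i (Psi (xi T)) = Some (Psi (xi T'))"
proof -
  obtain T' z where T': "tab n cs b T'" "factor_e n i (reading b T ! p) = Some z" "reading b T' = (reading b T)[p := z]"
    using tab_e[OF T i a] by blast
  have rm: "remaining Minus (word_signs n i (reading b T)) \<noteq> []" "last (remaining Minus (word_signs n i (reading b T))) = p"
    using a by auto
  have we: "word_e n i (reading b T) = Some (reading b T')"
    using rm T' by (simp add: word_e_def)
  obtain g where g: "full_signs n b N i (xi T) = map (\<lambda>(s, p). (s, g p)) (word_signs n i (reading b T))"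
    "\<And>p. length (spin_part b T) \<le> p \<Longrightarrow> g p = N + length (spin_part b T) - p"
    using full_signs_xi[OF T i] by blast
  define j where "j = g p"
  have rf: "remaining Minus (full_signs n b N i (xi T)) \<noteq> []" "last (remaining Minus (full_signs n b N i (xi T))) = j"
    unfolding g(1) remaining_map using rm by (simp_all add: last_map j_def)
  obtain y where y: "active j" "vec_e n i (xi T j) = Some y" "wall_e n b N i (Psi (xi T)) = Some (Psi ((xi T)(j := y)))"
    using wall_e_Psi[OF valid_xi[OF T] nice_xi[OF T] i rf(1)] unfolding rf(2) by metis
  have pl: "p < length (reading b T)" using acts_bound[OF a] .
  have "xi T' = (xi T)(j := y)"
  proof (cases "length (spin_part b T) \<le> p")
    case True
    have j: "j = N + length (spin_part b T) - p" unfolding j_def by (rule g(2)[OF True])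
    obtain w where w: "reading b T ! p = Vec w"
      using True pl tabD(7)[OF T] by (auto simp: nth_append)
    then obtain y' where z: "z = Vec y'" "vec_e n i w = Some y'" using T'(2) by auto
    note u = xi_update_body[OF T T'(1) T'(3)[unfolded z] True pl]
    have "y' = y" using u(1) w z(2) y(2) j by simp
    then show ?thesis using u(2) j by simp
  next
    case False
    then have b: b and p0: "p = 0" by (auto simp: spin_part_def split: if_splits)
    have "reading b T ! p = Spin (last T)" using b p0 by (simp add: reading_def)
    then obtain c' where c': "z = Spin c'" "spin_e n i (last T) = Some c'" using T'(2) by auto
    note h = half_columnD[OF tabD(2)[OF T b]]
    have "(Minus, j) \<in> set (full_signs n b N i (xi T))" using set_remaining rf last_in_set by metis
    moreover have "(Minus, 0) \<in> set (word_signs n i (reading b T))" using set_remaining rm p0 last_in_set by metis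
    have "tail_signs n b N i (xi T) \<noteq> []"
      using tail_signs_xi[OF T b i] c'(2) word_signs_Spin[OF i(1)] by auto
    then obtain s t where st: "tail_signs n b N i (xi T) = (s, t) # tl (tail_signs n b N i (xi T))" by (metis list.exhaust_sel surj_pair)
    have tt: "N < t" "tail_signs n b N i (xi T) = [(s, t)]"
      using tail_signs_tags[OF valid_xi[OF T], of s t i] st by (metis list.set_intros(1))+
    \<comment> \<open>Both forms of the signature begin with the sign of the spin factor; comparing
      them shows that it sits in column \<open>j\<close>.\<close>
    have "hd (full_signs n b N i (xi T)) = (s, t)" using tt by (simp add: full_signs_def)
    moreover have "hd (full_signs n b N i (xi T)) = (Minus, g 0)"
      unfolding g(1) tabD(7)[OF T] using b c'(2) by (simp add: spin_part_def word_signs_append[of n i "[Spin (last T)]", simplified] word_signs_Spin[OF i(1)])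
    ultimately have tail: "tail_signs n b N i (xi T) = [(Minus, j)]" and Nj: "N < j" using tt p0 by (auto simp: j_def)
    have xj: "xi T j = (if i < n then Neg i else Neg n)"
      using tail tail_pos[of N "xi T"] b by (auto simp: tail_signs_def split: if_splits)
    obtain m where m: "m < n" "j = Suc (N + m)" "last T ! m = xi T j"
      using xi_tail_Neg_iff[OF T b Nj] xj by metis
    have uniq: "last T ! k \<noteq> xi T j" if "k < n" "k \<noteq> m" for k
      using h(1,4) m that unfolding sorted_wrt_iff_nth_less by (metis linorder_neqE_nat order_less_irrefl)
    define gm where "gm = (if i < n then id(Pos (i + 1) := Pos i, Neg i := Neg (i + 1)) else id(Neg n := Pos n))"
    have cm: "c' = map gm (last T)" using c'(2) by (auto simp: spin_e_def gm_def split: if_splits)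
    have y': "y = (if i < n then Neg (Suc i) else Zero)" using y(2) xj i by (auto simp: vec_e_Suc_cases split: if_splits)
    show ?thesis
    proof (rule xi_update_spin[OF T T'(1) b _ Nj])
      show "reading b T' = (reading b T)[0 := Spin c']" using T'(3) p0 c'(1) by simp
      show "max Zero (c' ! k) = max Zero (last T ! k)" if "k < n" "Suc (N + k) \<noteq> j" for k
      proof -
        have "last T ! k \<noteq> (if i < n then Neg i else Neg n)" using uniq[of k] that m(2) xj by auto
        then show ?thesis using that(1) h(1) i unfolding cm by (cases "i = n") (auto simp: gm_def max_def)
      qed
      show "max Zero (c' ! k) = y" if "k < n" "Suc (N + k) = j" for k
        using that m xj h(1) i unfolding cm y' by (cases "i = n") (auto simp: gm_def max_def)
      show "j \<le> N + n" using m by simp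
    qed
  qed
  then show thesis using that T'(1) we y(3) by simp
qed

lemma wall_f_xi:
  assumes T: "tab n cs b T" and i: "1 \<le> i" "i \<le> n" and a: "acts Plus n i (reading b T) p"
  obtains T' where "tab n cs b T'" "word_f n i (reading b T) = Some (reading b T')" "wall_f n b N i (Psi (xi T)) = Some (Psi (xi T'))"
proof -
  obtain T' z where T': "tab n cs b T'" "factor_f n i (reading b T ! p) = Some z" "reading b T' = (reading b T)[p := z]"
    using tab_f[OF T i a] by blast
  have rm: "remaining Plus (word_signs n i (reading b T)) \<noteq> []" "hd (remaining Plus (word_signs n i (reading b T))) = p"
    using a by auto
  have we: "word_f n i (reading b T) = Some (reading b T')"
    using rm T' by (simp add: word_f_def)
  obtain g where g: "full_signs n b N i (xi T) = map (\<lambda>(s, p). (s, g p)) (word_signs n i (reading b T))"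
    "\<And>p. length (spin_part b T) \<le> p \<Longrightarrow> g p = N + length (spin_part b T) - p"
    using full_signs_xi[OF T i] by blast
  define j where "j = g p"
  have rf: "remaining Plus (full_signs n b N i (xi T)) \<noteq> []" "hd (remaining Plus (full_signs n b N i (xi T))) = j"
    unfolding g(1) remaining_map using rm by (simp_all add: hd_map j_def)
  obtain y where y: "active j" "vec_f n i (xi T j) = Some y" "wall_f n b N i (Psi (xi T)) = Some (Psi ((xi T)(j := y)))"
    using wall_f_Psi[OF valid_xi[OF T] nice_xi[OF T] i rf(1)] unfolding rf(2) by metis
  have pl: "p < length (reading b T)" using acts_bound[OF a] .
  have "xi T' = (xi T)(j := y)"
  proof (cases "length (spin_part b T) \<le> p")
    case True
    have j: "j = N + length (spin_part b T) - p" unfolding j_def by (rule g(2)[OF True])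
    obtain w where w: "reading b T ! p = Vec w"
      using True pl tabD(7)[OF T] by (auto simp: nth_append)
    then obtain y' where z: "z = Vec y'" "vec_f n i w = Some y'" using T'(2) by auto
    note u = xi_update_body[OF T T'(1) T'(3)[unfolded z] True pl]
    have "y' = y" using u(1) w z(2) y(2) j by simp
    then show ?thesis using u(2) j by simp
  next
    case False
    then have b: b and p0: "p = 0" by (auto simp: spin_part_def split: if_splits)
    have "reading b T ! p = Spin (last T)" using b p0 by (simp add: reading_def)
    then obtain c' where c': "z = Spin c'" "spin_f n i (last T) = Some c'" using T'(2) by auto
    note half = tabD(2)[OF T b]
    note h = half_columnD[OF half]
    have ne: "spin_e n i (last T) = None" using spin_not_both[OF half i] c'(2) by simp
    have "tail_signs n b N i (xi T) \<noteq> []"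
      using tail_signs_xi[OF T b i] c'(2) word_signs_Spin[OF i(1)] by auto
    then obtain s t where st: "tail_signs n b N i (xi T) = (s, t) # tl (tail_signs n b N i (xi T))" by (metis list.exhaust_sel surj_pair)
    have tt: "N < t" "tail_signs n b N i (xi T) = [(s, t)]"
      using tail_signs_tags[OF valid_xi[OF T], of s t i] st by (metis list.set_intros(1))+
    have "hd (full_signs n b N i (xi T)) = (s, t)" using tt by (simp add: full_signs_def)
    moreover have "hd (full_signs n b N i (xi T)) = (Plus, g 0)"
      unfolding g(1) tabD(7)[OF T] using b c'(2) ne by (simp add: spin_part_def word_signs_append[of n i "[Spin (last T)]", simplified] word_signs_Spin[OF i(1)])
    ultimately have tail: "tail_signs n b N i (xi T) = [(Plus, j)]" and Nj: "N < j" using tt p0 by (auto simp: j_def)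
    define gm where "gm = (if i < n then id(Pos i := Pos (i + 1), Neg (i + 1) := Neg i) else id(Pos n := Neg n))"
    have cm: "c' = map gm (last T)" using c'(2) by (auto simp: spin_f_def gm_def split: if_splits)
    have "\<exists>m<n. j = Suc (N + m) \<and> last T ! m = (if i < n then Neg (Suc i) else Pos n)"
    proof (cases "i < n")
      case True
      then have "xi T j = Neg (Suc i)"
        using tail tail_pos[of N "xi T"] b by (auto simp: tail_signs_def split: if_splits)
      then show ?thesis using xi_tail_Neg_iff[OF T b Nj] True by auto
    next
      case False
      then have jz: "tail_pos N (xi T) Zero = j" using tail b by (auto simp: tail_signs_def split: if_splits)
      have "Pos n \<in> set (last T)" using c'(2) False by (auto simp: spin_f_def split: if_splits)
      then obtain m where m: "m < n" "last T ! m = Pos n" using h(1) by (metis in_set_conv_nth)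
      \<comment> \<open>The entries of the half-column below \<open>n\<close> are all barred, so the
        place of \<open>n\<close> is the first one that the wall shows as a ground-state
        column.\<close>
      have "tail_pos N (xi T) Zero = Suc (N + m)"
      proof (rule tail_pos_eqI)
        show "xi T (Suc (N + m)) = Zero" using xi_tail[OF b m(1)] m(2) by (simp add: max_def)
        fix k assume k: "N < k" "k < Suc (N + m)"
        then have kl: "k - Suc N < m" "Suc (N + (k - Suc N)) = k" by auto
        then have "Pos n < last T ! (k - Suc N)" using h(1,4) m unfolding sorted_wrt_iff_nth_less by metis
        moreover have kn: "k - Suc N < n" using kl m by simp
        ultimately show "xi T k \<noteq> Zero"
          using xi_tail[OF b kn] kl(2) half_nth[OF T b kn] by (cases "last T ! (k - Suc N)") (auto simp: max_def)
      qed simp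
      then show ?thesis using jz m False by auto
    qed
    then obtain m where m: "m < n" "j = Suc (N + m)" "last T ! m = (if i < n then Neg (Suc i) else Pos n)" by blast
    have uniq: "last T ! k \<noteq> last T ! m" if "k < n" "k \<noteq> m" for k
      using h(1,4) m(1) that unfolding sorted_wrt_iff_nth_less by (metis linorder_neqE_nat order_less_irrefl)
    have "xi T j = (if i < n then Neg (Suc i) else Zero)" using xi_tail[OF b m(1)] m(2,3) by (auto simp: max_def)
    then have y': "y = (if i < n then Neg i else Neg n)" using y(2) i by (auto simp: vec_f_Suc_cases split: if_splits)
    show ?thesis
    proof (rule xi_update_spin[OF T T'(1) b _ Nj])
      show "reading b T' = (reading b T)[0 := Spin c']" using T'(3) p0 c'(1) by simp
      show "max Zero (c' ! k) = max Zero (last T ! k)" if "k < n" "Suc (N + k) \<noteq> j" for k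
      proof -
        have "last T ! k \<noteq> (if i < n then Neg (Suc i) else Pos n)" using uniq[of k] that m by auto
        then show ?thesis using that(1) h(1) i unfolding cm by (cases "i = n") (auto simp: gm_def max_def)
      qed
      show "max Zero (c' ! k) = y" if "k < n" "Suc (N + k) = j" for k
        using that m h(1) i unfolding cm y' by (cases "i = n") (auto simp: gm_def max_def)
      show "j \<le> N + n" using m by simp
    qed
  qed
  then show thesis using that T'(1) we y(3) by simp
qed

end

section \<open>Reducedness\<close>

text \<open>Keeps each column from being lowered by a period, because it would then no longer reach
  far enough above its left neighbour. Lowering across a change of base period gives both columns
  the same base, so there the letters themselves are compared. Within one base period only the bar
  of 1 next to 1 could leave room.\<close>

definition tight_letters :: "nat list \<Rightarrow> bool \<Rightarrow> (nat \<Rightarrow> letter) \<Rightarrow> bool" where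
  "tight_letters cs b \<xi> \<longleftrightarrow> (\<forall>j\<ge>1. Suc j \<le> sum_list cs \<or> b \<longrightarrow>
     (if base_period cs j = base_period cs (Suc j) then \<not> (\<xi> j = Neg 1 \<and> \<xi> (Suc j) = Pos 1)
      else \<xi> j \<le> \<xi> (Suc j) \<and> \<not> (\<xi> j = Zero \<and> \<xi> (Suc j) = Zero)))"

lemma letter_layer_mono:
  assumes "x \<in> letters n" "y \<in> letters n" "x \<le> y" shows "letter_layer n x \<le> letter_layer n y"
  using assms by (cases x; cases y) (auto simp: letter_layer_def less_eq_letter_def letters_def)

context wall_rank
begin

lemma letter_layer_le: "x \<in> letters n \<Longrightarrow> letter_layer n x \<le> 2 * n - 1"
  using n3 by (cases x) (auto simp: letter_layer_def letters_def)

lemma letter_layer_max: "x \<in> letters n \<Longrightarrow> 2 * n - 1 \<le> letter_layer n x \<Longrightarrow> x = Neg 1"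
  using n3 by (cases x) (auto simp: letter_layer_def letters_def)

text \<open>In each period the colours 0 and 1 occur in one layer only, every other colour in two
  layers that are symmetric: the offsets \<open>r\<close> and \<open>2 * n - 1 - r\<close> carry the
  same colour.\<close>

lemma colour_window:
  assumes "c \<in> layer_colours n L'" "c \<in> layer_colours n l" "L' < l" "l < L' + (2 * n - 1)"
  shows "2 \<le> c" "l mod (2 * n - 1) = 2 * n - 1 - L' mod (2 * n - 1)"
proof -
  define m where "m = 2 * n - 1"
  have ne: "l mod m \<noteq> L' mod m"
  proof
    assume "l mod m = L' mod m"
    then have "m dvd l - L'" using assms(3) by (meson mod_eq_dvd_iff_nat less_imp_le)
    then show False using assms(3,4) unfolding m_def by (simp add: nat_dvd_not_less)
  qed
  show "2 \<le> c"
  proof (rule ccontr)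
    assume "\<not> 2 \<le> c"
    then show False using layer_colours_small(2)[OF assms(1)] layer_colours_small(2)[OF assms(2)] ne by (simp add: m_def)
  qed
  moreover obtain r r' where r: "r = l mod m" "r' = L' mod m" by blast
  moreover have "r < m" "r' < m" using n3 unfolding r by (simp_all add: m_def)
  ultimately have "r = m - r'"
    using assms(1,2) ne n3 unfolding layer_colours_def Let_def m_def[symmetric] r[symmetric] by (auto split: if_splits simp: m_def)
  then show "l mod (2 * n - 1) = 2 * n - 1 - L' mod (2 * n - 1)" unfolding r m_def .
qed

text \<open>The definition of a reduced wall prescribes only how many blocks of each colour are
  removed. A colour of the new top layer loses blocks only above that layer. Over less than a period
  these are none for the colours 0 and 1 and at most one otherwise, which is too few.\<close>

lemma period_removed:
  assumes t: "proper_top n b L S" and t': "proper_top n b L' S'"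
    and c01: "\<forall>c\<in>{0, 1}. card {l. (l, c) \<in> stack n b L S - stack n b L' S'} = 1"
    and c2: "\<forall>c\<in>{2..n}. card {l. (l, c) \<in> stack n b L S - stack n b L' S'} = 2"
  shows "L' + (2 * n - 1) \<le> L"
proof (rule ccontr)
  assume L: "\<not> L' + (2 * n - 1) \<le> L"
  define m where "m = 2 * n - 1"
  obtain c where c: "c \<in> S'" "c \<in> layer_colours n L'" using t' by (auto simp: proper_top_def)
  define A where "A = {l. (l, c) \<in> stack n b L S - stack n b L' S'}"
  have A: "L' < l \<and> l < L' + m \<and> c \<in> layer_colours n l" if "l \<in> A" for l
  proof -
    have "(l, c) \<in> stack n b L S" "(l, c) \<notin> stack n b L' S'" using that by (auto simp: A_def)
    then have l: "bottom_layer n b \<le> l \<and> l \<le> L \<and> c \<in> layer_colours n l"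
      using t unfolding in_stack proper_top_def by auto
    moreover have "L' < l"
    proof (rule ccontr)
      assume "\<not> L' < l"
      then show False using l c(1) \<open>(l, c) \<notin> stack n b L' S'\<close> by (auto simp: in_stack)
    qed
    ultimately show ?thesis using L by (simp add: m_def)
  qed
  have "card A \<noteq> 0" "card A \<noteq> 1 \<or> c < 2"
    using c01 c2 layer_colours_le[OF c(2)] unfolding A_def
    by (cases "c < 2"; force simp: less_2_cases_iff)+
  then obtain l where "l \<in> A" by fastforce
  then have c2: "2 \<le> c" using colour_window(1)[OF c(2), of l] A by (simp add: m_def)
  have "l = l'" if "l \<in> A" "l' \<in> A" for l l'
  proof -
    have "l mod m = l' mod m" using colour_window(2)[OF c(2)] A[OF that(1)] A[OF that(2)] unfolding m_def by metis
    then have "m dvd l - l'" "m dvd l' - l" by (metis mod_eq_dvd_iff_nat diff_is_0_eq dvd_0_right nle_le)+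
    moreover have "l - l' < m" "l' - l < m" using A[OF that(1)] A[OF that(2)] by auto
    ultimately have "l - l' = 0" "l' - l = 0" using nat_dvd_not_less by blast+
    then show ?thesis by simp
  qed
  then have "card A \<le> 1" by (metis is_singletonI' \<open>l \<in> A\<close> empty_iff is_singleton_altdef order_refl)
  then show False using \<open>card A \<noteq> 0\<close> \<open>card A \<noteq> 1 \<or> c < 2\<close> c2 by linarith
qed

text \<open>Between tops exactly one period apart the colours 0 and 1 do not recur. So if the new
  top has such a colour and the old top lacks it, no block of this colour is removed, against the
  prescribed number.\<close>

lemma colour_kept:
  assumes "c \<in> S'" "c \<notin> S" "c < 2" "c \<in> layer_colours n L'"
  shows "{l. (l, c) \<in> stack n b (L' + (2 * n - 1)) S - stack n b L' S'} = {}"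
proof -
  have False if "(l, c) \<in> stack n b (L' + (2 * n - 1)) S" "(l, c) \<notin> stack n b L' S'" for l
  proof -
    have "l < L' + (2 * n - 1)" "c \<in> layer_colours n l" "bottom_layer n b \<le> l" using that(1) assms(2) by (auto simp: in_stack)
    moreover then have "L' < l" using that(2) assms(1) unfolding in_stack by (metis linorder_neqE_nat)
    ultimately show False using colour_window(1)[OF assms(4)] assms(3) by fastforce
  qed
  then show ?thesis by blast
qed

end

context wall_data
begin

lemma beta_N: "1 \<le> N \<Longrightarrow> beta N = 1"
  using base_period_Suc[OF cs0, of N] base_period_gt[of cs "Suc N"] base_period_pos[of N cs] by auto

text \<open>A lowered column must still support its left neighbour. For active neighbours
  \<open>period_removed\<close> and tightness leave only equal tops: then either two full columns
  have the same height, or one of the colours 0 and 1 loses no block.\<close>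

lemma reduced_Psi:
  assumes v: "valid \<xi>" and nice: "nice \<xi>" and tight: "tight_letters cs b \<xi>"
  shows "reduced_wall n b N (Psi \<xi>)"
  unfolding reduced_wall_def
proof (intro conjI notI)
  show "proper_wall n b N (Psi \<xi>)" using proper_Psi_iff[OF v] nice by simp
  define m where "m = 2 * n - 1"
  assume "\<exists>j\<ge>1. \<exists>C\<subseteq>Psi \<xi> j. proper_wall n b N ((Psi \<xi>)(j := C)) \<and>
         (\<forall>c\<in>{0, 1}. card {L. (L, c) \<in> Psi \<xi> j - C} = 1) \<and>
         (\<forall>c\<in>{2..n}. card {L. (L, c) \<in> Psi \<xi> j - C} = 2)"
  then obtain j C where j: "1 \<le> j" and C: "C \<subseteq> Psi \<xi> j" and pw: "proper_wall n b N ((Psi \<xi>)(j := C))"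
    and c01: "\<forall>c\<in>{0, 1}. card {L. (L, c) \<in> Psi \<xi> j - C} = 1"
    and c2: "\<forall>c\<in>{2..n}. card {L. (L, c) \<in> Psi \<xi> j - C} = 2" by blast
  define L where "L = top_at n cs b \<xi> j"
  define S where "S = colours_at n cs b \<xi> j"
  have YS: "Psi \<xi> j = stack n b L S" and t: "proper_top n b L S"
    using Psi_stack[OF j] proper_top_at[OF v j] by (simp_all add: L_def S_def)
  define L' where "L' = top_layer C"
  define S' where "S' = {c. (L', c) \<in> C}"
  have gr: "ground n b N j \<subseteq> C" and ic: "is_column n b C" and rs: "right_supported N ((Psi \<xi>)(j := C))"
    using proper_wallD[OF pw j] by simp_all
  have ne: "C \<noteq> {}" using gr j by (auto simp: ground_def split: if_splits)
  have fin: "finite C" using C finite_stack[OF t] YS finite_subset by metis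
  have CS: "C = stack n b L' S'" and t': "proper_top n b L' S'"
    using column_form[OF ic fin ne] by (simp_all add: L'_def S'_def)
  have bl: "bottom_layer n b \<le> L'" using t' by (simp add: proper_top_def)
  have LL: "L' + m \<le> L" using period_removed[OF t t'] c01 c2 unfolding YS CS m_def by blast
  have m1: "5 \<le> m" using n3 by (simp add: m_def)
  have kept: False if "c \<in> S'" "c \<notin> S" "c < 2" "L = L' + m" for c
  proof -
    have "{l. (l, c) \<in> Psi \<xi> j - C} = {}"
      using colour_kept[OF that(1,2,3), of L' b] that(1,4) t' unfolding YS CS m_def proper_top_def by blast
    moreover have "c \<in> {0, 1}" using that(3) by auto
    then have "card {l. (l, c) \<in> Psi \<xi> j - C} = 1" using c01 by blast
    ultimately show False by (metis card.empty zero_neq_one)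
  qed
  have act: "j \<le> N \<or> b"
  proof (rule ccontr)
    assume "\<not> (j \<le> N \<or> b)"
    then have "L = bottom_layer n b" by (simp add: L_def top_at_def)
    then show False using LL bl m1 by simp
  qed
  define x where "x = \<xi> j"
  have x: "x \<in> letters n" using validD(1)[OF v j] by (simp add: x_def)
  have Lx: "L = beta j * m + letter_layer n x" and Sx: "S = tops n x"
    using act by (simp_all add: L_def S_def top_at_def colours_at_def lay_eq x_def m_def)
  show False
  proof (cases "Suc j \<le> N \<or> b")
    case False
    then have nb: "\<not> b" and jN: "j = N" using act by auto
    have b1: "beta j = 1" using beta_N j jN by simp
    have bm: "bottom_layer n b = m" unfolding bottom_layer_def using nb by (simp add: m_def)
    \<comment> \<open>In column \<open>N\<close>, with no active column to its left, only the bar of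
      1 is high enough. The column would be cut down to its bottom layer, where the 0-block of the
      ground-state wall stays, so that no 0-block is removed.\<close>
    have "2 * n - 1 \<le> letter_layer n x" using LL bl bm Lx b1 by (simp add: m_def)
    then have xn: "x = Neg 1" using letter_layer_max[OF x] by simp
    then have "L = m + m" using Lx b1 n3 by (simp add: letter_layer_def m_def)
    then have e: "L' = m" "L = L' + m" using LL bl bm by auto
    have "front_colour N j = 0" using jN by (simp add: front_colour_def)
    then have "ground n b N j = {(m, 0)}" unfolding ground_def bm using nb j by simp
    then have "(m, 0) \<in> C" using gr by blast
    then have "0 \<in> S'" using e(1) by (simp add: S'_def)
    then show False using kept[of 0] e(2) Sx xn by simp
  next
    case True
    define y where "y = \<xi> (Suc j)"
    define L1 where "L1 = top_at n cs b \<xi> (Suc j)"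
    have y: "y \<in> letters n" using validD(1)[OF v, of "Suc j"] by (simp add: y_def)
    have Ly: "L1 = beta (Suc j) * m + letter_layer n y"
      using True by (simp add: L1_def top_at_def lay_eq y_def m_def)
    have Y1: "Psi \<xi> (Suc j) = stack n b L1 (tops n y)" and t1: "proper_top n b L1 (tops n y)"
      using Psi_stack[of "Suc j"] proper_top_at[OF v, of "Suc j"] True by (simp_all add: L1_def colours_at_def y_def)
    have z: "((Psi \<xi>)(j := C)) j = stack n b L' S'" "((Psi \<xi>)(j := C)) (j + 1) = stack n b L1 (tops n y)"
      using CS Y1 by simp_all
    have "\<forall>(l, c)\<in>stack n b L1 (tops n y). if c \<ge> 2 then (l, c) \<in> stack n b L' S'
      else \<exists>c'\<in>{0, 1}. (l, c') \<in> stack n b L' S' \<and> (c' = front_colour N j \<longleftrightarrow> c = front_colour N (j + 1))"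
      using spec[OF rs[unfolded right_supported_def], of j] j unfolding z by blast
    then have sup: "supports L' S' L1 (tops n y)" using supports_iff[OF t1 t'] by blast
    \<comment> \<open>A full left neighbour with the same top forces the lowered column to be full
      at the same height.\<close>
    have not_equal: False if e: "L' = L1" and yy: "y \<notin> {Pos 1, Neg 1, Zero}"
    proof -
      have tc: "tops n y = layer_colours n L1" using tops_complete[OF y, of "beta (Suc j)"] yy Ly by (simp add: lay_eq m_def)
      have "tops n y \<subseteq> S'"
      proof
        fix c assume c: "c \<in> tops n y"
        show "c \<in> S'"
        proof (cases "2 \<le> c")
          case True
          then show ?thesis using sup e c by (auto simp: supports_def)
        next
          case False
          then have "layer_colours n L1 = {0, 1}" using layer_colours_small(1)[of c L1] c tc by auto
          then have t01: "tops n y = {0, 1}" using tc by simp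
          then have "\<forall>c\<in>{0, 1}. if c \<ge> 2 then c \<in> S' else 1 - c \<in> S'" using sup e by (simp add: supports_def)
          then have "0 \<in> S'" "1 \<in> S'" by simp_all
          then show ?thesis using c unfolding t01 by auto
        qed
      qed
      then have S': "S' = layer_colours n L'" using t' tc e by (auto simp: proper_top_def)
      have f1: "full n (Psi \<xi> (Suc j))" using full_Psi[OF v, of "Suc j"] True yy by (simp add: y_def)
      then have "L1 mod (2 * n - 1) \<noteq> n - 1" using full_stack[OF t1] by (simp add: Y1)
      then have f2: "full n C" using full_stack[OF t'] S' e CS by simp
      have "column_height n C = column_height n (Psi \<xi> (Suc j))"
        using column_height_stack[OF t'] column_height_stack[OF t1] e CS Y1 by metis
      moreover have "full n (((Psi \<xi>)(j := C)) j)" "full n (((Psi \<xi>)(j := C)) (Suc j))" using f1 f2 by simp_all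
      then have "column_height n (((Psi \<xi>)(j := C)) j) \<noteq> column_height n (((Psi \<xi>)(j := C)) (Suc j))"
        using pw j unfolding proper_wall_def by (metis Suc_leI le_SucI n_not_Suc_n)
      ultimately show False by simp
    qed
    have L1': "L1 \<le> L'" using sup by (auto simp: supports_def)
    show False
    proof (cases "beta j = beta (Suc j)")
      case True
      have lx: "letter_layer n x \<le> m" using letter_layer_le[OF x] by (simp add: m_def)
      have "beta (Suc j) * m + letter_layer n y + m \<le> beta (Suc j) * m + letter_layer n x"
        using L1' LL Lx Ly True by simp
      then have "m \<le> letter_layer n x" "letter_layer n y = 0" using lx by linarith+
      then have xn: "x = Neg 1" using letter_layer_max[OF x] by (simp add: m_def)
      have "y \<noteq> Pos 1" using tight \<open>Suc j \<le> N \<or> b\<close> True j xn unfolding tight_letters_def x_def y_def by metis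
      moreover have "y = Pos 1 \<or> y = Pos 2"
        using \<open>letter_layer n y = 0\<close> y n3 by (cases y) (auto simp: letter_layer_def letters_def)
      moreover have "L' = L1" using LL Lx Ly True lx L1' by simp
      ultimately show False using not_equal by auto
    next
      case False
      then have s: "beta j = Suc (beta (Suc j))" using base_period_Suc[OF cs0 j] by auto
      have le: "x \<le> y" "\<not> (x = Zero \<and> y = Zero)"
        using tight \<open>Suc j \<le> N \<or> b\<close> False j unfolding tight_letters_def x_def y_def by metis+
      have "letter_layer n x \<le> letter_layer n y" using letter_layer_mono[OF x y le(1)] .
      moreover have "L = beta (Suc j) * m + m + letter_layer n x" using Lx s by simp
      ultimately have e: "L' = L1" "L = L' + m" "letter_layer n x = letter_layer n y" using LL Ly L1' by linarith+
      have "y = Pos 1 \<or> y = Neg 1 \<or> y = Zero" using not_equal e(1) by auto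
      then have "x = y" using e(3) x y le(1) n3
        by (cases x) (auto simp: letter_layer_def letters_def less_eq_letter_def split: if_splits)
      then have "x = Pos 1 \<and> y = Pos 1 \<or> x = Neg 1 \<and> y = Neg 1"
        using \<open>y = Pos 1 \<or> y = Neg 1 \<or> y = Zero\<close> le(2) by auto
      then show False
      proof
        assume xy: "x = Pos 1 \<and> y = Pos 1"
        then have "1 \<in> S'" using sup e(1) by (simp add: supports_def)
        then show False using kept[of 1] e(2) Sx xy by simp
      next
        assume xy: "x = Neg 1 \<and> y = Neg 1"
        then have "0 \<in> S'" using sup e(1) by (simp add: supports_def)
        then show False using kept[of 0] e(2) Sx xy by simp
      qed
    qed
  qed
qed

text \<open>The top entry of a column is at most its bottom entry, hence at most the bottom entry of
  the next column. The letter 1 and its bar cannot lie in one column, because the total at 1 is at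
  most 1.\<close>

lemma tight_xi:
  assumes T: "tab n cs b T" shows "tight_letters cs b (xi T)"
  unfolding tight_letters_def
proof (intro allI impI)
  fix j assume j: "1 \<le> j" and act: "Suc j \<le> N \<or> b"
  have lk: "linked n (T ! k) (T ! Suc k)" if "Suc k < length T" for k
    using T that successively_conv_nth unfolding tab_def by blast
  have rl: "row_le (T ! k) (T ! Suc k)" if "Suc k < length T" for k
  proof -
    have "kn_column n (T ! k)" "kn_column n (T ! Suc k)" using tabD(4)[OF T] that by simp_all
    moreover have "length (T ! k) \<le> length (T ! Suc k)" using lk[OF that] by (simp add: linked_def)
    ultimately show ?thesis using lk[OF that] linked_iff by blast
  qed
  have first: "last (T ! k) \<le> T ! Suc k ! 0 \<and> \<not> (last (T ! k) = Zero \<and> T ! Suc k ! 0 = Zero)"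
    if k: "Suc k < length T" "T ! k \<noteq> []" for k
  proof -
    have r: "T ! k ! 0 \<le> T ! Suc k ! 0" "\<not> (T ! k ! 0 = Zero \<and> T ! Suc k ! 0 = Zero)"
      using rl[OF k(1)] k(2) unfolding row_le_def by auto
    have "column_ok (T ! k)" using kn_columnD(2)[OF tabD(4)[OF T, of "T ! k"]] k(1) by simp
    then have h: "T ! k ! p > T ! k ! q \<or> (T ! k ! p = Zero \<and> T ! k ! q = Zero)" if "p < q" "q < length (T ! k)" for p q
      using that unfolding column_ok_def sorted_wrt_iff_nth_less by blast
    have "last (T ! k) \<le> T ! k ! 0"
      unfolding last_conv_nth[OF k(2)] using h[of 0 "length (T ! k) - 1"] k(2)
      by (cases "length (T ! k) = 1") (auto simp: less_imp_le)
    then show ?thesis using r by auto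
  qed
  show "if beta j = beta (Suc j) then \<not> (xi T j = Neg 1 \<and> xi T (Suc j) = Pos 1)
      else xi T j \<le> xi T (Suc j) \<and> \<not> (xi T j = Zero \<and> xi T (Suc j) = Zero)"
  proof (cases "Suc j \<le> N")
    case True
    define L where "L = (if b then butlast T else T)"
    have cs': "map length L = cs" and sL: "set L \<subseteq> set T"
      using tabD(1)[OF T] by (auto simp: L_def dest: in_set_butlastD)
    have e: "xi T j = concat L ! (j - 1)" "xi T (Suc j) = concat L ! j"
      using True j by (simp_all add: xi_body body_def L_def)
    have nL: "L ! k = T ! k" if "k < length L" for k using that by (auto simp: L_def nth_butlast)
    have lL: "length L \<le> length T" by (simp add: L_def)
    note a = base_period_adjacent[of L j, unfolded cs', OF cs0 j True]
    show ?thesis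
    proof (cases "beta j = beta (Suc j)")
      case eq: True
      then obtain C p where C: "C \<in> set L" "Suc p < length C" "xi T j = C ! p" "xi T (Suc j) = C ! Suc p"
        using a unfolding e by auto
      have "\<not> (C ! p = Neg 1 \<and> C ! Suc p = Pos 1)"
      proof
        assume pn: "C ! p = Neg 1 \<and> C ! Suc p = Pos 1"
        then have "Neg 1 \<in> set C" "Pos 1 \<in> set C" using C(2) by (metis Suc_lessD nth_mem)+
        have kn: "kn_column n C" using tabD(4)[OF T] C(1) sL by blast
        have "0 < pos_count C 1" "0 < neg_count C 1"
          using \<open>Neg 1 \<in> set C\<close> \<open>Pos 1 \<in> set C\<close> unfolding pos_count_def neg_count_def by (force simp: filter_empty_conv)+
        then show False using kn_columnD(4)[OF kn, of 1] n3 by simp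
      qed
      then show ?thesis using eq C by simp
    next
      case neq: False
      then obtain k where k: "Suc k < length L" "xi T j = last (L ! k)" "xi T (Suc j) = L ! Suc k ! 0"
        using a unfolding e by auto
      have "length (L ! k) \<in> set cs" using k(1) unfolding cs'[symmetric] by simp
      then have "L ! k \<noteq> []" using cs0 by auto
      then show ?thesis using first[of k] k nL lL neq by simp
    qed
  next
    case False
    then have b: b using act by simp
    show ?thesis
    proof (cases "j = N")
      case True
      have T0: "T \<noteq> []" using tabD(3)[OF T b] .
      define L where "L = butlast T"
      have TL: "T = L @ [last T]" using T0 by (simp add: L_def)
      have cs': "map length L = cs" using tabD(1)[OF T] b by (simp add: L_def)
      have L0: "L \<noteq> []" using cs' True j by auto
      have "length (last L) \<in> set cs" using L0 unfolding cs'[symmetric] by simp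
      then have l0: "last L \<noteq> []" using cs0 by auto
      have "body T \<noteq> []" using True j tabD(5)[OF T] by (metis list.size(3) not_one_le_zero)
      then have "xi T j = last (body T)" using xi_body[of j T] True j tabD(5)[OF T] last_conv_nth[of "body T"] by simp
      also have "body T = concat L" unfolding body_def L_def if_P[OF b] ..
      also have "last (concat L) = last (last L)"
        using L0 l0 by (metis append_butlast_last_id concat.simps(1,2) concat_append append_Nil2 last_appendR)
      finally have x: "xi T j = last (last L)" .
      have y: "xi T (Suc j) = max Zero (last T ! 0)" using xi_tail[OF b, of 0 T] True n3 by simp
      have lT: "length T = Suc (length L)" using arg_cong[OF TL, of length] by simp
      have k: "Suc (length L - 1) < length T" using lT L0 by (simp add: Suc_le_eq)
      have "length L - 1 < length (butlast T)" using L0 by (simp add: L_def[symmetric])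
      then have k1: "T ! (length L - 1) = last L" using last_conv_nth[OF L0] nth_butlast by (metis L_def)
      have k2: "T ! Suc (length L - 1) = last T" unfolding last_conv_nth[OF T0] using lT L0 by simp
      have "last (last L) \<le> last T ! 0 \<and> \<not> (last (last L) = Zero \<and> last T ! 0 = Zero)"
        using first[of "length L - 1"] k k1 k2 l0 by simp
      moreover have "last T ! 0 \<noteq> Zero" using half_nth(2)[OF T b, of 0] n3 by simp
      moreover have "beta j \<noteq> beta (Suc j)" using beta_N j base_period_gt[of cs "Suc j"] True by simp
      ultimately show ?thesis unfolding x y by (auto simp: max_def split: if_splits)
    next
      case False
      then have "N < j" using \<open>\<not> Suc j \<le> N\<close> by simp
      then have "beta j = beta (Suc j)" by (simp add: base_period_gt)
      moreover have "Zero \<le> xi T (Suc j)" using validD(2)[OF valid_xi[OF T] b, of "Suc j"] \<open>N < j\<close> by simp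
      then have "xi T (Suc j) \<noteq> Pos 1" by (auto simp: less_eq_letter_def)
      ultimately show ?thesis by simp
    qed
  qed
qed

lemma reduced_xi: "tab n cs b T \<Longrightarrow> reduced_wall n b N (Psi (xi T))"
  using reduced_Psi valid_xi nice_xi tight_xi by blast

end

section \<open>Tableaux of walls and the highest weight wall\<close>

lemma sum_list_take_nth: "k < length cs \<Longrightarrow> sum_list (take k cs) + cs ! k \<le> sum_list (cs :: nat list)"
  by (induction cs arbitrary: k) (auto simp: take_Cons nth_Cons split: nat.splits)

lemma column_number_le: "k < length cs \<Longrightarrow> a \<le> cs ! k \<Longrightarrow> column_number cs k a \<le> sum_list cs"
  using sum_list_take_nth[of k cs] by (simp add: column_number_def)

lemma column_number_ge: "1 \<le> a \<Longrightarrow> 1 \<le> column_number cs k a"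
  by (simp add: column_number_def)

lemma concat_column_number:
  "k < length L \<Longrightarrow> 1 \<le> a \<Longrightarrow> a \<le> length (L ! k) \<Longrightarrow> concat L ! (column_number (map length L) k a - 1) = L ! k ! (a - 1)"
proof (induction L arbitrary: k)
  case (Cons C L)
  show ?case
  proof (cases k)
    case 0
    moreover have "a - 1 < length C" using Cons.prems(2,3) 0 by simp
    ultimately show ?thesis by (simp add: column_number_def nth_append)
  next
    case (Suc k')
    have "column_number (map length (C # L)) k a - 1 = length C + (column_number (map length L) k' a - 1)"
      using Cons.prems(2) Suc by (simp add: column_number_def)
    then show ?thesis using Cons Suc by (simp add: nth_append)
  qed
qed simp

lemma base_period_column_number:
  "k < length cs \<Longrightarrow> 1 \<le> a \<Longrightarrow> a \<le> cs ! k \<Longrightarrow> base_period cs (column_number cs k a) = length cs - k"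
proof (induction cs arbitrary: k)
  case (Cons c cs)
  show ?case
  proof (cases k)
    case 0
    then show ?thesis using Cons.prems by (simp add: column_number_def)
  next
    case (Suc k')
    have "column_number (c # cs) k a = c + column_number cs k' a" using Suc by (simp add: column_number_def)
    moreover have "1 \<le> column_number cs k' a" using Cons.prems(2) by (rule column_number_ge)
    ultimately show ?thesis using Cons Suc by simp
  qed
qed simp

lemma column_number_ex:
  "1 \<le> j \<Longrightarrow> j \<le> sum_list cs \<Longrightarrow> \<exists>k<length cs. \<exists>a\<in>{1..cs ! k}. j = column_number cs k a"
proof (induction cs arbitrary: j)
  case (Cons c cs)
  show ?case
  proof (cases "j \<le> c")
    case True
    then show ?thesis using Cons.prems by (auto intro!: exI[of _ 0] bexI[of _ j] simp: column_number_def)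
  next
    case False
    then have "1 \<le> j - c" "j - c \<le> sum_list cs" using Cons.prems by auto
    then obtain k a where ka: "k < length cs" "a \<in> {1..cs ! k}" "j - c = column_number cs k a"
      using Cons.IH[of "j - c"] by blast
    then have "j = column_number (c # cs) (Suc k) a" using False by (auto simp: column_number_def)
    then show ?thesis using ka by (intro exI[of _ "Suc k"]) auto
  qed
qed simp

context wall_rank
begin

lemma column_letter_stack:
  assumes x: "x \<in> letters n" and "bottom_layer n b \<le> lay n p x"
  shows "column_letter n (stack n b (lay n p x) (tops n x)) = x"
proof -
  have t: "proper_top n b (lay n p x) (tops n x)" using proper_top_lay[OF assms] .
  have i: "(lay n p x, c) \<in> stack n b (lay n p x) (tops n x) \<longleftrightarrow> c \<in> tops n x" for c by (simp add: in_stack)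
  show ?thesis
    unfolding column_letter_def top_layer_stack[OF t] Let_def i lay_mod[OF x]
    using x n3 by (cases x) (auto simp: letters_def)
qed

lemma column_letter_Pos:
  assumes t: "proper_top n b L S" and l: "column_letter n (stack n b L S) = Pos x" and x: "1 \<le> x" "x \<le> n"
  shows "L = lay n (L div (2 * n - 1)) (Pos x)" "S = tops n (Pos x)"
proof -
  define m where "m = 2 * n - 1"
  have S: "S \<noteq> {}" "S \<subseteq> layer_colours n L" using t by (auto simp: proper_top_def)
  have i: "(L, c) \<in> stack n b L S \<longleftrightarrow> c \<in> S" for c by (simp add: in_stack)
  note c = l[unfolded column_letter_def top_layer_stack[OF t] Let_def i]
  have lc: "L mod m = 0 \<Longrightarrow> layer_colours n L = {0, 1}"
    "0 < L mod m \<Longrightarrow> L mod m < n \<Longrightarrow> layer_colours n L = {L mod m + 1}"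
    by (auto simp: layer_colours_def m_def Let_def)
  have *: "L mod m = x - 2 \<and> S = tops n (Pos x)"
  proof (cases "L mod m = 0")
    case True
    then show ?thesis using c lc(1)[OF True] S by (auto simp: m_def split: if_splits)
  next
    case False
    then have r: "L mod m < n - 1" "x = L mod m + 2" using c by (auto simp: m_def split: if_splits)
    then have "S = {L mod m + 1}" using S lc(2) False by auto
    then show ?thesis using r False by auto
  qed
  have "L = L div m * m + L mod m" by simp
  then show "L = lay n (L div (2 * n - 1)) (Pos x)" using * by (simp add: m_def)
  show "S = tops n (Pos x)" using * by blast
qed

end

context wall_data
begin

lemma column_letter_Psi: "valid \<xi> \<Longrightarrow> active j \<Longrightarrow> column_letter n (Psi \<xi> j) = \<xi> j"
  using active_lay column_letter_stack by simp

lemma xi_column_number: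
  assumes T: "tab n cs b T" and k: "k < length cs" "1 \<le> a" "a \<le> cs ! k"
  shows "xi T (column_number cs k a) = T ! k ! (a - 1)"
proof -
  define L where "L = (if b then butlast T else T)"
  have L: "map length L = cs" using tabD(1)[OF T] by (simp add: L_def)
  then have kL: "k < length L" "length (L ! k) = cs ! k" using k(1) by auto
  have "xi T (column_number cs k a) = concat L ! (column_number (map length L) k a - 1)"
    using xi_body[of "column_number cs k a" T] column_number_le[OF k(1,3)] column_number_ge[OF k(2)] L by (simp add: body_def L_def)
  also have "\<dots> = L ! k ! (a - 1)" using concat_column_number[OF kL(1) k(2)] k(3) kL(2) by simp
  also have "L ! k = T ! k" using kL(1) by (auto simp: L_def nth_butlast)
  finally show ?thesis .
qed

lemma half_column_of_xi:
  assumes T: "tab n cs b T" and b: b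
  shows "half_column_of n b N (Psi (xi T)) = last T"
proof -
  define c where "c = last T"
  note h = half_columnD[OF tabD(2)[OF T b], folded c_def]
  have g: "Psi (xi T) j \<noteq> ground n b N j \<longleftrightarrow> xi T j \<noteq> Zero" "column_letter n (Psi (xi T) j) = xi T j" if j: "N < j" for j
  proof -
    have act: "active j" unfolding active_def using j b by linarith
    show l: "column_letter n (Psi (xi T) j) = xi T j" using column_letter_Psi[OF valid_xi[OF T] act] .
    \<comment> \<open>Resetting column \<open>j\<close> to \<open>Zero\<close> exhibits the
      ground-state column as the column of a letter. So \<open>column_letter_Psi\<close> computes
      its letter, too, and added blocks can be detected by letters.\<close>
    have "valid ((xi T)(j := Zero))" using valid_update[OF valid_xi[OF T]] by (simp add: letters_def)
    then have "column_letter n (Psi ((xi T)(j := Zero)) j) = Zero" using column_letter_Psi[OF _ act] by fastforce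
    then have "column_letter n (ground n b N j) = Zero" using Psi_ground_tail[OF b j, of "(xi T)(j := Zero)"] by simp
    then show "Psi (xi T) j \<noteq> ground n b N j \<longleftrightarrow> xi T j \<noteq> Zero" using l Psi_ground_tail[OF b j] by metis
  qed
  define xs where "xs = map (\<lambda>j. column_letter n (Psi (xi T) j)) (filter (\<lambda>j. Psi (xi T) j \<noteq> ground n b N j) [N + 1..<N + n + 1])"
  have "filter (\<lambda>j. Psi (xi T) j \<noteq> ground n b N j) [N + 1..<N + n + 1] = filter (\<lambda>j. xi T j \<noteq> Zero) [N + 1..<N + n + 1]"
    by (rule filter_cong[OF refl]) (metis g(1) atLeastLessThan_iff set_upt Suc_eq_plus1 Suc_le_eq)
  then have "xs = map (xi T) (filter (\<lambda>j. xi T j \<noteq> Zero) [N + 1..<N + n + 1])"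
    unfolding xs_def using g(2) by (auto simp del: upt_Suc)
  also have "\<dots> = filter (\<lambda>x. x \<noteq> Zero) (map (xi T) [N + 1..<N + n + 1])" by (simp add: filter_map comp_def del: upt_Suc)
  also have "map (xi T) [N + 1..<N + n + 1] = map (max Zero) c"
  proof (rule nth_equalityI)
    fix k assume "k < length (map (xi T) [N + 1..<N + n + 1])"
    then have "k < n" by (simp del: upt_Suc)
    then show "map (xi T) [N + 1..<N + n + 1] ! k = map (max Zero) c ! k"
      using xi_tail[OF b, of k T] h(1) by (simp add: c_def del: upt_Suc)
  qed (simp add: h(1) del: upt_Suc)
  also have "filter (\<lambda>x. x \<noteq> Zero) (map (max Zero) c) = filter (\<lambda>x. Zero < x) c"
    by (induction c) (auto simp: max_def)
  finally have xs: "xs = filter (\<lambda>x. Zero < x) c" .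
  have dist: "distinct c" using h(4) by (auto simp: distinct_conv_nth sorted_wrt_iff_nth_less) (metis linorder_neqE_nat order_less_irrefl)
  define ys where "ys = map Pos (filter (\<lambda>j. Neg j \<notin> set xs) [1..<n + 1])"
  have NegS: "Neg j \<in> set xs \<longleftrightarrow> Neg j \<in> set c" for j by (simp add: xs)
  have "sort (xs @ ys) = rev c"
  proof (rule sorted_distinct_set_unique)
    show "sorted (sort (xs @ ys))" by simp
    show "sorted (rev c)" using h(4) unfolding sorted_wrt_rev by (rule sorted_wrt_mono_rel[rotated]) simp
    show "distinct (rev c)" using dist by simp
    show "distinct (sort (xs @ ys))" using dist by (auto simp: xs ys_def distinct_map inj_on_def)
    have "x \<in> set (xs @ ys) \<longleftrightarrow> x \<in> set c" for x
    proof (cases x)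
      case (Pos j)
      have "Pos j \<in> set c \<Longrightarrow> 1 \<le> j \<and> j \<le> n" using h(2) by (auto simp: letters_def)
      then show ?thesis using Pos h(6)[of j] by (auto simp: xs ys_def)
    next
      case Zero
      then show ?thesis using h(3) by (auto simp: xs ys_def)
    next
      case (Neg j)
      then show ?thesis using NegS by (auto simp: ys_def)
    qed
    then show "set (sort (xs @ ys)) = set (rev c)" by auto
  qed
  then show ?thesis unfolding half_column_of_def Let_def xs_def[symmetric] ys_def[symmetric] c_def by simp
qed

lemma wall_tableau:
  assumes T: "tab n cs b T"
  shows "map (\<lambda>k. map (\<lambda>a. column_letter n (Psi (xi T) (column_number cs k a))) [1..<cs ! k + 1]) [0..<length cs] @
     (if b then [half_column_of n b N (Psi (xi T))] else []) = T"
proof -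
  define L where "L = (if b then butlast T else T)"
  have L: "map length L = cs" using tabD(1)[OF T] by (simp add: L_def)
  have "map (\<lambda>k. map (\<lambda>a. column_letter n (Psi (xi T) (column_number cs k a))) [1..<cs ! k + 1]) [0..<length cs] = L"
  proof (rule nth_equalityI)
    show "length (map (\<lambda>k. map (\<lambda>a. column_letter n (Psi (xi T) (column_number cs k a))) [1..<cs ! k + 1]) [0..<length cs]) = length L"
      using arg_cong[OF L, of length] by simp
    fix k assume "k < length (map (\<lambda>k. map (\<lambda>a. column_letter n (Psi (xi T) (column_number cs k a))) [1..<cs ! k + 1]) [0..<length cs])"
    then have k: "k < length cs" by simp
    have len: "length (L ! k) = cs ! k" "L ! k = T ! k"
      using k L by (auto simp: L_def nth_butlast)
    have "map (\<lambda>a. column_letter n (Psi (xi T) (column_number cs k a))) [1..<cs ! k + 1] = L ! k"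
    proof (rule nth_equalityI)
      fix q assume "q < length (map (\<lambda>a. column_letter n (Psi (xi T) (column_number cs k a))) [1..<cs ! k + 1])"
      then have q: "q < cs ! k" by (simp del: upt_Suc)
      have "active (column_number cs k (q + 1))"
        using column_number_le[OF k, of "q + 1"] column_number_ge[of "q + 1"] q by (simp add: active_def)
      then show "map (\<lambda>a. column_letter n (Psi (xi T) (column_number cs k a))) [1..<cs ! k + 1] ! q = L ! k ! q"
        using q column_letter_Psi[OF valid_xi[OF T]] xi_column_number[OF T k, of "q + 1"] len by (simp del: upt_Suc)
    qed (simp add: len(1) del: upt_Suc)
    then show "map (\<lambda>k. map (\<lambda>a. column_letter n (Psi (xi T) (column_number cs k a))) [1..<cs ! k + 1]) [0..<length cs] ! k = L ! k"
      using k by (simp del: upt_Suc)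
  qed
  moreover have "L @ (if b then [half_column_of n b N (Psi (xi T))] else []) = T"
    unfolding L_def using half_column_of_xi[OF T] tabD(3)[OF T] by (cases b) simp_all
  ultimately show ?thesis by simp
qed

lemma young_column:
  assumes "young_wall n b N Y" "1 \<le> j"
  shows "proper_top n b (top_layer (Y j)) {c. (top_layer (Y j), c) \<in> Y j}"
    "Y j = stack n b (top_layer (Y j)) {c. (top_layer (Y j), c) \<in> Y j}" "finite (Y j)" "Y j \<noteq> {}"
proof -
  have ic: "is_column n b (Y j)" "ground n b N j \<subseteq> Y j" and "finite {(j, x). x \<in> Y j - ground n b N j}"
    using assms unfolding young_wall_def by blast+
  then have "finite (snd ` {(j, x). x \<in> Y j - ground n b N j})" by blast
  then have "finite (Y j - ground n b N j)" by (rule rev_finite_subset) force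
  then show fin: "finite (Y j)" by (simp add: ground_def)
  show ne: "Y j \<noteq> {}" using ic(2) assms(2) by (auto simp: ground_def split: if_splits)
  show "proper_top n b (top_layer (Y j)) {c. (top_layer (Y j), c) \<in> Y j}"
    "Y j = stack n b (top_layer (Y j)) {c. (top_layer (Y j), c) \<in> Y j}"
    using column_form[OF ic(1) fin ne] .
qed

text \<open>The description is unique because an unbarred letter together with the period of the top
  fixes the top of a column, and the top fixes the whole column.\<close>

lemma highest_weight_wall_eq:
  assumes "sorted cs"
  shows "highest_weight_wall n cs b = Psi (xi (std_tab n cs b))"
proof -
  define T where "T = std_tab n cs b"
  have T: "tab n cs b T" unfolding T_def by (rule tab_std[OF assms cs])
  have letter: "xi T (column_number cs k a) = Pos (cs ! k + 1 - a)" if "k < length cs" "a \<in> {1..cs ! k}" for k a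
  proof -
    have "T ! k = std_column (cs ! k)" using that(1) by (simp add: T_def std_tab_def shape_def nth_append)
    then show ?thesis using xi_column_number[OF T that(1)] that(2) std_column_nth[of "a - 1" "cs ! k"]
      by (auto intro: arg_cong[of _ _ Pos])
  qed
  have act: "active (column_number cs k a)" if "k < length cs" "a \<in> {1..cs ! k}" for k a
    using that column_number_le[OF that(1)] column_number_ge[of a] by (auto simp: active_def)
  have far: "Psi (xi T) j = ground n b N j" if j: "N < j" for j
  proof (cases b)
    case False
    then show ?thesis using Psi_ground[of j] j by fastforce
  next
    case True
    have "last T = std_column n" using True by (simp add: T_def std_tab_def shape_def)
    then have "xi T (Suc (N + k)) = Zero" if "k < n" for k
      using xi_tail[OF True that] std_column_nth[OF that] by (simp add: max_def)
    then have "xi T j = Zero" using xi_far[OF True] tail_cases[OF j] by metis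
    then show ?thesis by (rule Psi_ground_tail[OF True j])
  qed
  define Q where "Q Y \<longleftrightarrow> young_wall n b N Y \<and>
     (\<forall>k<length cs. \<forall>a\<in>{1..cs ! k}.
        column_letter n (Y (column_number cs k a)) = Pos (cs ! k + 1 - a) \<and>
        top_period n (Y (column_number cs k a)) = length cs - k) \<and>
     (\<forall>j>N. Y j = ground n b N j)" for Y
  have hw: "top_layer (Psi (xi T) (column_number cs k a)) = lay n (length cs - k) (Pos (cs ! k + 1 - a))"
    if "k < length cs" "a \<in> {1..cs ! k}" for k a
  proof -
    note al = active_lay[OF valid_xi[OF T] act[OF that]]
    have "beta (column_number cs k a) = length cs - k" using base_period_column_number[of k cs a] that by simp
    then show ?thesis using top_layer_stack[OF proper_top_lay[OF al(3,2)]] unfolding al(1) letter[OF that] by simp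
  qed
  have "Q (Psi (xi T))"
    unfolding Q_def
  proof (intro conjI allI impI ballI)
    have "proper_wall n b N (Psi (xi T))" using proper_Psi_iff[OF valid_xi[OF T]] nice_xi[OF T] by simp
    then show "young_wall n b N (Psi (xi T))" by (simp add: proper_wall_def)
    fix k a assume ka: "k < length cs" "a \<in> {1..cs ! k}"
    show "column_letter n (Psi (xi T) (column_number cs k a)) = Pos (cs ! k + 1 - a)"
      using column_letter_Psi[OF valid_xi[OF T] act[OF ka]] letter[OF ka] by simp
    have "cs ! k \<le> n" using ka(1) cs by (meson atLeastAtMost_iff nth_mem subsetD)
    then have "cs ! k + 1 - a - 2 < 2 * n - 1" using ka(2) n3 by auto
    then show "top_period n (Psi (xi T) (column_number cs k a)) = length cs - k"
      unfolding top_period_def hw[OF ka] by (simp add: div_mult_self3)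
  qed (use far in auto)
  moreover have "Y = Psi (xi T)" if Q: "Q Y" for Y
  proof
    fix j
    have yw: "young_wall n b N Y" using Q by (simp add: Q_def)
    consider "j = 0" | "N < j" | "1 \<le> j" "j \<le> N" by linarith
    then show "Y j = Psi (xi T) j"
    proof cases
      case 1
      then show ?thesis using yw by (simp add: young_wall_def Psi_0)
    next
      case 2
      then show ?thesis using Q far by (simp add: Q_def)
    next
      case 3
      obtain k a where ka: "k < length cs" "a \<in> {1..cs ! k}" "j = column_number cs k a"
        using column_number_ex[OF 3] by blast
      define S where "S = {c. (top_layer (Y j), c) \<in> Y j}"
      note form = young_column(1,2)[OF yw 3(1), folded S_def]
      have l: "column_letter n (stack n b (top_layer (Y j)) S) = Pos (cs ! k + 1 - a)" "top_layer (Y j) div (2 * n - 1) = length cs - k"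
        using Q ka form(2) by (auto simp: Q_def top_period_def)
      have kn: "cs ! k \<le> n" using ka(1) cs by (meson atLeastAtMost_iff nth_mem subsetD)
      have "top_layer (Y j) = lay n (length cs - k) (Pos (cs ! k + 1 - a))" "S = tops n (Pos (cs ! k + 1 - a))"
        using column_letter_Pos[OF form(1) l(1)] l(2) ka(2) kn by auto
      then have "Y j = stack n b (lay n (length cs - k) (Pos (cs ! k + 1 - a))) (tops n (Pos (cs ! k + 1 - a)))"
        using form(2) by metis
      then show ?thesis
        using active_lay(1)[OF valid_xi[OF T] act[OF ka(1,2)]] letter[OF ka(1,2)] base_period_column_number[of k cs a] ka by simp
    qed
  qed
  ultimately show ?thesis
    unfolding highest_weight_wall_def T_def[symmetric] Q_def[symmetric] by (rule the_equality)
qed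

end

section \<open>Weights\<close>

lemma coroot_value_add: "coroot_value n (\<lambda>m. f m + g m) j = coroot_value n f j + coroot_value n g j"
  by (simp add: coroot_value_def)

lemma coroot_value_sum_list: "coroot_value n (\<lambda>m. \<Sum>x\<leftarrow>xs. f x m) j = (\<Sum>x\<leftarrow>xs. coroot_value n (f x) j)"
  by (induction xs) (simp_all add: coroot_value_add, simp add: coroot_value_def)

text \<open>The letter that a column with complete top layer \<open>L\<close> carries.\<close>

definition layer_letter :: "nat \<Rightarrow> nat \<Rightarrow> letter" where
  "layer_letter n L = (let r = L mod (2 * n - 1) in if r < n - 1 then Pos (r + 2) else if r = n - 1 then Zero else Neg (2 * n - r))"

definition letter_value :: "nat \<Rightarrow> nat \<Rightarrow> letter \<Rightarrow> rat" where
  "letter_value n j x = coroot_value n (letter_weight x) j"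

definition block_value :: "nat \<Rightarrow> nat \<Rightarrow> block \<Rightarrow> rat" where
  "block_value n j x = of_int (affine_cartan n j (snd x))"

text \<open>Both sides are values of the simple root of index \<open>i\<close>, by which the weights
  of consecutive letters of the vector crystal differ.\<close>

lemma letter_value_f:
  assumes "vec_f n i x = Some y" "1 \<le> i" "i \<le> n" "1 \<le> j" "j \<le> n"
  shows "letter_value n j x - letter_value n j y = block_value n j (l, i)"
  using assms unfolding vec_f_Suc_cases letter_value_def block_value_def coroot_value_def affine_cartan_def
  by (auto simp: doubleton_eq_iff)

text \<open>A whole (0|1) layer separates the bar of 2 from the letter 2 of the next period. On the
  coroots 1, ..., n the sum of the simple roots of index 0 and 1 takes the values of -2 times the
  second basis vector \<epsilon>.\<close>

lemma letter_value_affine: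
  assumes "3 \<le> n" "1 \<le> j" "j \<le> n"
  shows "letter_value n j (Neg 2) - letter_value n j (Pos 2) = block_value n j (l, 0) + block_value n j (l, 1)"
  using assms unfolding letter_value_def block_value_def coroot_value_def affine_cartan_def
  by (auto simp: doubleton_eq_iff)

context wall_rank
begin

lemma layer_letter_step:
  assumes "1 \<le> j" "j \<le> n"
  shows "(\<Sum>x\<in>{Suc L} \<times> layer_colours n (Suc L). block_value n j x) =
    letter_value n j (layer_letter n L) - letter_value n j (layer_letter n (Suc L))"
proof -
  define m where "m = 2 * n - 1"
  define r where "r = L mod m"
  have r: "r < m" using n3 by (simp add: r_def m_def)
  have Sr: "Suc L mod m = (if Suc r = m then 0 else Suc r)" by (simp add: mod_Suc r_def)
  show ?thesis
  proof (cases "Suc r = m")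
    case True
    then have "L mod m = 2 * n - 2" "Suc L mod m = 0" using Sr by (auto simp: r_def m_def)
    then have "layer_letter n L = Neg 2" "layer_letter n (Suc L) = Pos 2" "layer_colours n (Suc L) = {0, 1}"
      unfolding layer_letter_def layer_colours_def m_def[symmetric] Let_def using n3 by auto
    then show ?thesis using letter_value_affine[OF n3 assms] by simp
  next
    case False
    define i where "i = (if Suc r < n then r + 2 else 2 * n - Suc r)"
    have i: "1 \<le> i" "i \<le> n" using r n3 by (auto simp: i_def m_def)
    have c: "layer_colours n (Suc L) = {i}"
      unfolding layer_colours_def Let_def m_def[symmetric] i_def using False Sr by auto
    have "layer_letter n L = (if r < n - 1 then Pos (r + 2) else if r = n - 1 then Zero else Neg (2 * n - r))"
      "layer_letter n (Suc L) = (if Suc r < n - 1 then Pos (Suc r + 2) else if Suc r = n - 1 then Zero else Neg (2 * n - Suc r))"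
      unfolding layer_letter_def Let_def m_def[symmetric] using False Sr by (simp_all add: r_def)
    then have "vec_f n i (layer_letter n L) = Some (layer_letter n (Suc L))"
      using r n3 False unfolding vec_f_Suc_cases by (auto simp: i_def m_def)
    then show ?thesis using letter_value_f[OF _ i assms] c by simp
  qed
qed

text \<open>By \<open>layer_letter_step\<close> the sum telescopes; only the bottom layer has no
  predecessor and is kept apart. As \<open>block_value\<close> does not depend on the layer, 0
  stands for it there.\<close>

lemma stack_complete_value:
  assumes j: "1 \<le> j" "j \<le> n" and "bottom_layer n b \<le> L"
  shows "(\<Sum>x\<in>stack n b L (layer_colours n L). block_value n j x) =
    letter_value n j (layer_letter n (bottom_layer n b)) - letter_value n j (layer_letter n L) +
    (\<Sum>c\<in>layer_colours n (bottom_layer n b). block_value n j (0, c))"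
  using assms(3)
proof (induction L rule: dec_induct)
  case base
  have "(\<Sum>x\<in>{bottom_layer n b} \<times> S. block_value n j x) = (\<Sum>c\<in>S. block_value n j (0, c))" for S
    by (simp add: sum.cartesian_product' block_value_def)
  moreover have "stack n b (bottom_layer n b) S = {bottom_layer n b} \<times> S" for S by (auto simp: stack_def)
  ultimately show ?case by simp
next
  case (step L)
  have "stack n b (Suc L) (layer_colours n (Suc L)) = stack n b L (layer_colours n L) \<union> {Suc L} \<times> layer_colours n (Suc L)"
    using step.hyps by (auto simp: in_stack less_Suc_eq)
  moreover have "stack n b L (layer_colours n L) \<inter> {Suc L} \<times> layer_colours n (Suc L) = {}" by (auto simp: in_stack)
  moreover have "finite (stack n b L (layer_colours n L))"
    using step.hyps finite_stack layer_colours_nonempty by (simp add: proper_top_def)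
  ultimately have "(\<Sum>x\<in>stack n b (Suc L) (layer_colours n (Suc L)). block_value n j x) =
      (\<Sum>x\<in>stack n b L (layer_colours n L). block_value n j x) + (\<Sum>x\<in>{Suc L} \<times> layer_colours n (Suc L). block_value n j x)"
    by (simp add: sum.union_disjoint)
  then show ?case using step.IH layer_letter_step[OF j, of L] by simp
qed

lemma layer_letter_lay:
  "x \<in> letters n \<Longrightarrow> layer_letter n (lay n p x) = (if x = Pos 1 \<or> x = Neg 1 then Pos 2 else x)"
  using n3 unfolding layer_letter_def lay_mod Let_def by (cases x) (auto simp: letters_def)

text \<open>For the letter 1 or its bar, the (0|1) layer at the top is first completed, which gives
  the letter 2, and the value of the missing block is taken off again.\<close>

lemma stack_value:
  assumes j: "1 \<le> j" "j \<le> n" and x: "x \<in> letters n" and bot: "bottom_layer n b \<le> lay n p x"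
  shows "(\<Sum>x\<in>stack n b (lay n p x) (tops n x). block_value n j x) =
    letter_value n j (layer_letter n (bottom_layer n b)) - letter_value n j x +
    (\<Sum>c\<in>layer_colours n (bottom_layer n b). block_value n j (0, c))"
proof -
  define L where "L = lay n p x"
  define K where "K = letter_value n j (layer_letter n (bottom_layer n b)) +
    (\<Sum>c\<in>layer_colours n (bottom_layer n b). block_value n j (0, c))"
  have full: "(\<Sum>x\<in>stack n b L (layer_colours n L). block_value n j x) = K - letter_value n j (layer_letter n L)"
    using stack_complete_value[OF j bot] by (simp add: L_def K_def)
  have "(\<Sum>x\<in>stack n b L (tops n x). block_value n j x) = K - letter_value n j x"
  proof (cases "x = Pos 1 \<or> x = Neg 1")
    case False
    then have "tops n x = layer_colours n L" using tops_complete[OF x, of p] by (simp add: L_def)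
    then show ?thesis using full layer_letter_lay[OF x, of p] False by (simp add: L_def)
  next
    case True
    define d :: nat where "d = (if x = Pos 1 then 0 else 1)"
    have d: "tops n x = {d}" "d < 2" using True by (auto simp: d_def)
    have lc: "layer_colours n L = {0, 1}" unfolding L_def colours_lay[OF x] using True by auto
    have "stack n b L (layer_colours n L) = insert (L, 1 - d) (stack n b L (tops n x))"
    proof -
      have "d = 0 \<or> d = 1" using d(2) by auto
      then show ?thesis unfolding lc d(1) stack_def by auto
    qed
    moreover have "1 - d \<noteq> d" by arith
    then have "(L, 1 - d) \<notin> stack n b L (tops n x)" using d(1) by (simp add: in_stack)
    moreover have "finite (stack n b L (tops n x))" using finite_stack[OF proper_top_lay[OF x bot]] by (simp add: L_def)
    ultimately have e: "K - letter_value n j (Pos 2) = block_value n j (L, 1 - d) + (\<Sum>x\<in>stack n b L (tops n x). block_value n j x)"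
      using full layer_letter_lay[OF x, of p] True by (simp add: L_def)
    have f: "letter_value n j (Pos 1) - letter_value n j (Pos 2) = block_value n j (L, 1)"
      by (rule letter_value_f) (use n3 j in \<open>auto simp: vec_f_def\<close>)
    have f': "letter_value n j (Neg 2) - letter_value n j (Neg 1) = block_value n j (L, 1)"
      by (rule letter_value_f) (use n3 j in \<open>auto simp: vec_f_def\<close>)
    have a: "letter_value n j (Neg 2) - letter_value n j (Pos 2) = block_value n j (L, 0) + block_value n j (L, 1)"
      by (rule letter_value_affine[OF n3 j])
    show ?thesis using True
    proof
      assume "x = Pos 1"
      then show ?thesis using e f d by simp
    next
      assume "x = Neg 1"
      then show ?thesis using e f' a d by simp
    qed
  qed
  then show ?thesis by (simp add: L_def K_def)
qed

end

text \<open>Exactly one of \<open>m\<close> and its bar occurs. Its contribution, 1/2 or -1/2, is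
  1/2 plus 0 or -1, and the latter is what the tail of the wall shows.\<close>

lemma half_column_weight:
  assumes c: "c \<in> half_columns n" and m: "1 \<le> m" "m \<le> n"
  shows "factor_weight (Spin c) m = 1 / 2 + (\<Sum>x\<leftarrow>c. letter_weight (max Zero x) m)"
proof -
  note h = half_columnD[OF c]
  define y where "y = (if Pos m \<in> set c then Pos m else Neg m)"
  have y: "y \<in> set c" using h(6)[OF m] by (auto simp: y_def)
  have dist: "distinct c" using h(4) by (auto simp: distinct_conv_nth sorted_wrt_iff_nth_less) (metis linorder_neqE_nat order_less_irrefl)
  have "(\<Sum>x\<leftarrow>c. letter_weight x m) - 2 * (\<Sum>x\<leftarrow>c. letter_weight (max Zero x) m) =
      (\<Sum>x\<leftarrow>c. letter_weight x m - 2 * letter_weight (max Zero x) m)"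
    by (simp add: sum_list_subtractf sum_list_const_mult)
  also have "\<dots> = (\<Sum>x\<in>set c. letter_weight x m - 2 * letter_weight (max Zero x) m)"
    using dist by (rule sum_list_distinct_conv_sum_set)
  also have "\<dots> = (\<Sum>x\<in>set c. if x = y then 1 else 0)"
  proof (rule sum.cong[OF refl])
    fix x assume x: "x \<in> set c"
    have "x \<noteq> y \<Longrightarrow> x \<noteq> Pos m \<and> x \<noteq> Neg m" using x h(6)[OF m] by (auto simp: y_def split: if_splits)
    then show "letter_weight x m - 2 * letter_weight (max Zero x) m = (if x = y then 1 else 0)"
      by (cases x) (auto simp: max_def less_eq_letter_def y_def split: if_splits)
  qed
  also have "\<dots> = 1" using y by (simp add: sum.delta)
  finally show ?thesis by simp
qed

lemma half_column_value:
  assumes c: "c \<in> half_columns n" and j: "1 \<le> j" "j \<le> n"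
  shows "coroot_value n (factor_weight (Spin c)) j = (if j = n then 1 else 0) + (\<Sum>x\<leftarrow>c. letter_value n j (max Zero x))"
proof -
  have "coroot_value n (factor_weight (Spin c)) j = coroot_value n (\<lambda>m. 1 / 2 + (\<Sum>x\<leftarrow>c. letter_weight (max Zero x) m)) j - (if j < n then 0 else 0)"
    using half_column_weight[OF c] j unfolding coroot_value_def by (auto simp del: factor_weight.simps)
  then show ?thesis
    using j unfolding coroot_value_add coroot_value_sum_list letter_value_def by (simp add: coroot_value_def)
qed

section \<open>The weight of the wall of a tableau\<close>

context wall_data
begin

text \<open>\<open>wall_weight\<close> counts the added blocks colour by colour; regrouping them by
  columns makes \<open>stack_value\<close> applicable.\<close>

lemma added_value:
  assumes "\<And>k. 1 \<le> k \<Longrightarrow> finite (Y k - ground n b N k) \<and> snd ` (Y k - ground n b N k) \<subseteq> {0..n}"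
    and "Y 0 = {}" "\<And>k. M < k \<Longrightarrow> Y k = ground n b N k"
  shows "(\<Sum>i\<in>{0..n}. of_nat (card {(k, L). (L, i) \<in> Y k - ground n b N k}) * of_int (affine_cartan n j i)) =
    (\<Sum>k\<in>{1..M}. \<Sum>x\<in>Y k - ground n b N k. block_value n j x)"
proof -
  define D where "D = Sigma {1..M} (\<lambda>k. Y k - ground n b N k)"
  have fD: "finite D" using assms(1) unfolding D_def by auto
  have D: "x \<in> D \<longleftrightarrow> snd x \<in> Y (fst x) - ground n b N (fst x)" for x
  proof -
    have "1 \<le> fst x \<and> fst x \<le> M" if "snd x \<in> Y (fst x) - ground n b N (fst x)"
      using that assms(2) assms(3)[of "fst x"] by (cases "fst x = 0") (auto simp: not_less[symmetric])
    then show ?thesis unfolding D_def by (cases x) auto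
  qed
  have "(\<Sum>k\<in>{1..M}. \<Sum>x\<in>Y k - ground n b N k. block_value n j x) = (\<Sum>x\<in>D. block_value n j (snd x))"
    unfolding D_def using assms(1) by (subst sum.Sigma) (auto simp: case_prod_beta)
  also have "\<dots> = (\<Sum>i\<in>{0..n}. \<Sum>x\<in>{x \<in> D. snd (snd x) = i}. block_value n j (snd x))"
    by (rule sum.group[symmetric, OF fD]) (use assms(1) in \<open>force simp: D_def\<close>)+
  also have "\<dots> = (\<Sum>i\<in>{0..n}. of_nat (card {(k, L). (L, i) \<in> Y k - ground n b N k}) * of_int (affine_cartan n j i))"
  proof (rule sum.cong[OF refl])
    fix i
    have img: "(\<lambda>(k, L). (k, (L, i))) ` {(k, L). (L, i) \<in> Y k - ground n b N k} = {x \<in> D. snd (snd x) = i}"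
      using D by (force simp: image_iff)
    have inj: "inj_on (\<lambda>(k, L). (k, (L, i))) {(k, L). (L, i) \<in> Y k - ground n b N k}"
      by (auto simp: inj_on_def)
    have "card {x \<in> D. snd (snd x) = i} = card {(k, L). (L, i) \<in> Y k - ground n b N k}"
      unfolding img[symmetric] by (rule card_image[OF inj])
    then show "(\<Sum>x\<in>{x \<in> D. snd (snd x) = i}. block_value n j (snd x)) =
      of_nat (card {(k, L). (L, i) \<in> Y k - ground n b N k}) * of_int (affine_cartan n j i)"
      by (simp add: block_value_def)
  qed
  finally show ?thesis by simp
qed

text \<open>
  The ground-state column contributes like the letter \<open>Zero\<close> if \<open>b\<close> holds, and otherwise like \<open>Pos 1\<close>
  or \<open>Neg 1\<close>, according to its front colour.
\<close>

definition ground_letter :: "nat \<Rightarrow> letter" where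
  "ground_letter k = (if b then Zero else if front_colour N k = 0 then Pos 1 else Neg 1)"

lemma column_value:
  assumes v: "valid \<xi>" "nice \<xi>" "active k" and j: "1 \<le> j" "j \<le> n"
  shows "(\<Sum>x\<in>Psi \<xi> k - ground n b N k. block_value n j x) = letter_value n j (ground_letter k) - letter_value n j (\<xi> k)"
proof -
  note al = active_lay[OF v(1,3)]
  have k: "1 \<le> k" using v(3) by (simp add: active_def)
  have fin: "finite (Psi \<xi> k)" using finite_stack[OF proper_top_lay[OF al(3,2)]] al(1) by simp
  have g: "ground n b N k \<subseteq> Psi \<xi> k" using ground_subset[OF v(1,2) k] .
  have "(\<Sum>x\<in>Psi \<xi> k - ground n b N k. block_value n j x) = (\<Sum>x\<in>Psi \<xi> k. block_value n j x) - (\<Sum>x\<in>ground n b N k. block_value n j x)"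
    by (rule sum_diff[OF fin g])
  also have "(\<Sum>x\<in>Psi \<xi> k. block_value n j x) = letter_value n j (layer_letter n (bottom_layer n b)) - letter_value n j (\<xi> k) +
      (\<Sum>c\<in>layer_colours n (bottom_layer n b). block_value n j (0, c))"
    unfolding al(1) by (rule stack_value[OF j al(3,2)])
  finally have e: "(\<Sum>x\<in>Psi \<xi> k - ground n b N k. block_value n j x) =
      letter_value n j (layer_letter n (bottom_layer n b)) - letter_value n j (\<xi> k) +
      (\<Sum>c\<in>layer_colours n (bottom_layer n b). block_value n j (0, c)) - (\<Sum>x\<in>ground n b N k. block_value n j x)" .
  have "letter_value n j (layer_letter n (bottom_layer n b)) + (\<Sum>c\<in>layer_colours n (bottom_layer n b). block_value n j (0, c)) -
      (\<Sum>x\<in>ground n b N k. block_value n j x) = letter_value n j (ground_letter k)"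
  proof (cases b)
    case True
    have "layer_letter n (bottom_layer n b) = Zero" using n3 True by (simp add: layer_letter_def bottom_layer_def Let_def)
    moreover have "ground n b N k = {(bottom_layer n b, n)}" using True k by (simp add: ground_def)
    ultimately show ?thesis using True bottom_ground(2) unfolding ground_letter_def block_value_def by simp
  next
    case False
    have l: "layer_letter n (bottom_layer n b) = Pos 2" using n3 False by (simp add: layer_letter_def bottom_layer_def Let_def)
    have gr: "ground n b N k = {(bottom_layer n b, front_colour N k)}" using False k by (simp add: ground_def)
    have f: "letter_value n j (Pos 1) - letter_value n j (Pos 2) = block_value n j (0, 1)"
      by (rule letter_value_f) (use n3 j in \<open>auto simp: vec_f_def\<close>)
    have f': "letter_value n j (Neg 2) - letter_value n j (Neg 1) = block_value n j (0, 1)"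
      by (rule letter_value_f) (use n3 j in \<open>auto simp: vec_f_def\<close>)
    have a: "letter_value n j (Neg 2) - letter_value n j (Pos 2) = block_value n j (0, 0) + block_value n j (0, 1)"
      by (rule letter_value_affine[OF n3 j])
    have bv: "block_value n j (l, c) = block_value n j (0, c)" for l c by (simp add: block_value_def)
    have sg: "(\<Sum>x\<in>ground n b N k. block_value n j x) = block_value n j (0, front_colour N k)"
      unfolding gr using bv by simp
    have sl: "(\<Sum>c\<in>layer_colours n (bottom_layer n b). block_value n j (0, c)) = block_value n j (0, 0) + block_value n j (0, 1)"
      unfolding bottom_ground(1)[OF False] by simp
    have gl: "ground_letter k = (if front_colour N k = 0 then Pos 1 else Neg 1)" unfolding ground_letter_def if_not_P[OF False] ..
    show ?thesis
      unfolding l sg sl gl using f f' a front_colour_cases[of N k] by auto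
  qed
  then show ?thesis using e by linarith
qed

text \<open>The contributions alternate in sign, and column \<open>N\<close> counts like the letter
  1. What is left over for odd \<open>N\<close> equals the value of the ground-state weight in that
  case.\<close>

lemma ground_letter_sum:
  assumes "\<not> b" "1 \<le> j" "j \<le> n"
  shows "(\<Sum>k\<in>{1..N}. letter_value n j (ground_letter k)) = (if odd N \<and> j = 1 then 1 else 0)"
proof -
  have g: "letter_value n j (ground_letter k) = (if j = 1 then if even (N + k) then 1 else -1 else 0)" for k
    unfolding ground_letter_def if_not_P[OF assms(1)] using assms(2,3) n3
    by (auto simp: letter_value_def coroot_value_def front_colour_def even_iff_mod_2_eq_zero)
  have "(\<Sum>k\<in>{1..M}. if even (N + k) then 1 else - 1 :: rat) = (if odd M then if odd N then 1 else -1 else 0)" for M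
    by (induction M) auto
  then show ?thesis unfolding g by (cases "j = 1") (simp_all only: if_True if_False sum.neutral_const simp_thms split: if_split, auto)
qed

lemma sum_xi_body: "tab n cs b T \<Longrightarrow> (\<Sum>k\<in>{1..N}. f (xi T k)) = (\<Sum>x\<leftarrow>body T. f x :: rat)"
proof -
  assume T: "tab n cs b T"
  have "(\<Sum>k\<in>{1..N}. f (xi T k)) = (\<Sum>p\<in>{0..<N}. f (body T ! p))"
    by (rule sum.reindex_bij_witness[of _ Suc "\<lambda>k. k - 1"]) (auto simp: xi_body)
  also have "\<dots> = (\<Sum>x\<leftarrow>body T. f x)" using tabD(5)[OF T] by (simp add: sum_list_sum_nth)
  finally show ?thesis .
qed

lemma sum_xi_tail:
  assumes T: "tab n cs b T" and b: b
  shows "(\<Sum>k\<in>{Suc N..N + n}. f (xi T k)) = (\<Sum>x\<leftarrow>last T. f (max Zero x) :: rat)"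
proof -
  have l: "length (last T) = n" using half_columnD(1)[OF tabD(2)[OF T b]] .
  have "(\<Sum>k\<in>{Suc N..N + n}. f (xi T k)) = (\<Sum>p\<in>{0..<n}. f (max Zero (last T ! p)))"
    by (rule sum.reindex_bij_witness[of _ "\<lambda>p. Suc (N + p)" "\<lambda>k. k - Suc N"]) (auto simp: xi_tail[OF b, symmetric])
  also have "\<dots> = (\<Sum>x\<leftarrow>map (\<lambda>x. f (max Zero x)) (last T). x)" using l unfolding sum_list_sum_nth by simp
  finally show ?thesis by simp
qed

text \<open>The weight of the ground-state wall matches the constant in
  \<open>half_column_value\<close> if \<open>b\<close> holds and is offset by
  \<open>ground_letter_sum\<close> otherwise; the contributions of the letters agree.\<close>

lemma wall_weight_xi:
  assumes T: "tab n cs b T" and j: "1 \<le> j" "j \<le> n"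
  shows "wall_weight n b N (Psi (xi T)) j = coroot_value n (\<lambda>m. \<Sum>x\<leftarrow>reading b T. factor_weight x m) j"
proof -
  note v = valid_xi[OF T] and nc = nice_xi[OF T]
  define M where "M = (if b then N + n else N)"
  have fin: "finite (Psi (xi T) k - ground n b N k) \<and> snd ` (Psi (xi T) k - ground n b N k) \<subseteq> {0..n}" if k: "1 \<le> k" for k
  proof -
    have "finite (Psi (xi T) k)" using finite_stack[OF proper_top_at[OF v k]] Psi_stack[OF k] by simp
    moreover have "is_column n b (Psi (xi T) k)" using is_column_stack[OF proper_top_at[OF v k]] Psi_stack[OF k] by simp
    then have "snd x \<le> n" if "x \<in> Psi (xi T) k" for x using that layer_colours_le unfolding is_column_def by fastforce
    ultimately show ?thesis by auto
  qed
  have far: "Psi (xi T) k = ground n b N k" if "M < k" for k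
  proof (cases b)
    case True
    then have "N + n < k" "N < k" using that by (simp_all add: M_def)
    then show ?thesis using Psi_ground_tail[OF True] xi_far[OF True] by blast
  next
    case False
    then have "\<not> (k \<le> N \<or> b)" using that unfolding M_def by (simp add: not_le)
    then show ?thesis by (rule Psi_ground)
  qed
  have "(\<Sum>i\<in>{0..n}. of_nat (card {(k, L). (L, i) \<in> Psi (xi T) k - ground n b N k}) * of_int (affine_cartan n j i)) =
      (\<Sum>k\<in>{1..M}. \<Sum>x\<in>Psi (xi T) k - ground n b N k. block_value n j x)"
    by (rule added_value[OF fin Psi_0 far])
  also have "\<dots> = (\<Sum>k\<in>{1..M}. letter_value n j (ground_letter k) - letter_value n j (xi T k))"
  proof (rule sum.cong[OF refl])
    fix k assume "k \<in> {1..M}"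
    then have "active k" unfolding active_def M_def by (auto split: if_splits)
    then show "(\<Sum>x\<in>Psi (xi T) k - ground n b N k. block_value n j x) = letter_value n j (ground_letter k) - letter_value n j (xi T k)"
      by (rule column_value[OF v nc _ j])
  qed
  also have "\<dots> = (\<Sum>k\<in>{1..M}. letter_value n j (ground_letter k)) - (\<Sum>k\<in>{1..M}. letter_value n j (xi T k))"
    by (rule sum_subtractf)
  finally have ww: "wall_weight n b N (Psi (xi T)) j = (if j = ground_index n b N then 1 else 0) -
      (\<Sum>k\<in>{1..M}. letter_value n j (ground_letter k)) + (\<Sum>k\<in>{1..M}. letter_value n j (xi T k))"
    by (simp add: wall_weight_def)
  have fw: "factor_weight (Vec x) = letter_weight x" for x by (rule ext) simp
  have body: "(\<Sum>x\<leftarrow>map Vec (rev (body T)). coroot_value n (factor_weight x) j) = (\<Sum>k\<in>{1..N}. letter_value n j (xi T k))"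
    using sum_xi_body[OF T, of "letter_value n j"] fw by (simp add: comp_def rev_map[symmetric] letter_value_def del: factor_weight.simps)
  show ?thesis
  proof (cases b)
    case True
    have "(\<Sum>k\<in>{1..M}. letter_value n j (xi T k)) = (\<Sum>k\<in>{1..N}. letter_value n j (xi T k)) + (\<Sum>k\<in>{Suc N..N + n}. letter_value n j (xi T k))"
      using sum.ub_add_nat[of 1 N "\<lambda>k. letter_value n j (xi T k)" n] True by (simp add: M_def)
    moreover have "letter_value n j (ground_letter k) = 0" for k
      unfolding ground_letter_def if_P[OF True] letter_value_def coroot_value_def by simp
    moreover have "ground_index n b N = n" using True by (simp add: ground_index_def)
    ultimately have "wall_weight n b N (Psi (xi T)) j = coroot_value n (factor_weight (Spin (last T))) j +
        (\<Sum>x\<leftarrow>map Vec (rev (body T)). coroot_value n (factor_weight x) j)"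
      unfolding ww body half_column_value[OF tabD(2)[OF T True] j] sum_xi_tail[OF T True] by simp
    then show ?thesis
      unfolding coroot_value_sum_list tabD(7)[OF T] spin_part_def if_P[OF True] by simp
  next
    case False
    have M: "M = N" using False by (simp add: M_def)
    have "ground_index n b N = (if even N then 0 else 1)" using False by (simp add: ground_index_def)
    then show ?thesis
      unfolding coroot_value_sum_list tabD(7)[OF T] spin_part_def if_not_P[OF False] append_Nil body ww M
        ground_letter_sum[OF False j] using j by auto
  qed
qed

end

section \<open>The isomorphism\<close>

context wall_data
begin

lemma wall_e_cases:
  assumes T: "tab n cs b T" and i: "1 \<le> i" "i \<le> n"
  obtains "wall_e n b N i (Psi (xi T)) = None" "word_e n i (reading b T) = None"
  | T' where "tab n cs b T'" "wall_e n b N i (Psi (xi T)) = Some (Psi (xi T'))" "word_e n i (reading b T) = Some (reading b T')"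
proof (cases "remaining Minus (word_signs n i (reading b T)) = []")
  case True
  obtain g where g: "full_signs n b N i (xi T) = map (\<lambda>(s, p). (s, g p)) (word_signs n i (reading b T))"
    using full_signs_xi[OF T i] by blast
  have "remaining Minus (full_signs n b N i (xi T)) = []" unfolding g remaining_map using True by simp
  then have "wall_e n b N i (Psi (xi T)) = None" by (rule wall_e_None[OF valid_xi[OF T] nice_xi[OF T] i])
  then show ?thesis using that(1) True by (simp add: word_e_def)
next
  case False
  then have "acts Minus n i (reading b T) (last (remaining Minus (word_signs n i (reading b T))))" by simp
  then show ?thesis using wall_e_xi[OF T i] that(2) by metis
qed

lemma wall_f_cases:
  assumes T: "tab n cs b T" and i: "1 \<le> i" "i \<le> n"
  obtains "wall_f n b N i (Psi (xi T)) = None" "word_f n i (reading b T) = None"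
  | T' where "tab n cs b T'" "wall_f n b N i (Psi (xi T)) = Some (Psi (xi T'))" "word_f n i (reading b T) = Some (reading b T')"
proof (cases "remaining Plus (word_signs n i (reading b T)) = []")
  case True
  obtain g where g: "full_signs n b N i (xi T) = map (\<lambda>(s, p). (s, g p)) (word_signs n i (reading b T))"
    using full_signs_xi[OF T i] by blast
  have "remaining Plus (full_signs n b N i (xi T)) = []" unfolding g remaining_map using True by simp
  then have "wall_f n b N i (Psi (xi T)) = None" by (rule wall_f_None[OF valid_xi[OF T] nice_xi[OF T] i])
  then show ?thesis using that(1) True by (simp add: word_f_def)
next
  case False
  then have "acts Plus n i (reading b T) (hd (remaining Plus (word_signs n i (reading b T))))" by simp
  then show ?thesis using wall_f_xi[OF T i] that(2) by metis
qed

lemma length_remaining_xi: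
  assumes T: "tab n cs b T" and i: "1 \<le> i" "i \<le> n"
  shows "length (remaining s (wall_signs n b N i (Psi (xi T)))) = length (remaining s (word_signs n i (reading b T)))"
proof -
  obtain g where g: "full_signs n b N i (xi T) = map (\<lambda>(s, p). (s, g p)) (word_signs n i (reading b T))"
    using full_signs_xi[OF T i] by blast
  show ?thesis using remaining_wall_signs[OF valid_xi[OF T] nice_xi[OF T] i] unfolding g remaining_map by simp
qed

lemma slot_after_removal:
  assumes t: "proper_top n b L S" and i: "i \<in> S" and ne: "stack n b L S - {(L, i)} \<noteq> {}"
  shows "slot_layer n (stack n b L S - {(L, i)}) = L"
proof (cases "S = {i}")
  case True
  have "bottom_layer n b < L"
  proof (rule ccontr)
    assume "\<not> bottom_layer n b < L"
    then have "stack n b L S - {(L, i)} = {}" using True by (auto simp: stack_def)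
    then show False using ne by blast
  qed
  then obtain L0 where L0: "L = Suc L0" "bottom_layer n b \<le> L0" by (metis less_Suc_eq_le not0_implies_Suc not_less0)
  have "stack n b L S - {(L, i)} = stack n b L0 (layer_colours n L0)"
    using L0(2) unfolding True L0(1) stack_def by (auto simp: less_Suc_eq)
  moreover have "proper_top n b L0 (layer_colours n L0)"
    using L0(2) layer_colours_nonempty by (auto simp: proper_top_def)
  ultimately show ?thesis using slot_stack[of b L0 "layer_colours n L0"] L0(1) by simp
next
  case False
  then have "stack n b L S - {(L, i)} = stack n b L (S - {i})" by (auto simp: in_stack)
  moreover have "proper_top n b L (S - {i})" using t False i by (auto simp: proper_top_def)
  moreover have "S - {i} \<noteq> layer_colours n L" using t i by (auto simp: proper_top_def)
  ultimately show ?thesis using slot_stack[of b L "S - {i}"] by simp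
qed

text \<open>The component is formed with arrows in both directions, so a proper wall
  \<open>Z\<close> with an arrow into a known wall must be recognised. Putting the removed block
  back is admissible for the known wall; hence \<open>Z\<close> is described by letters as well, and
  \<open>f\<close> undoes \<open>e\<close>.\<close>

lemma predecessor_e:
  assumes v: "valid \<xi>" "nice \<xi>" and i: "1 \<le> i" "i \<le> n" and Z: "proper_wall n b N Z" and e: "wall_e n b N i Z = Some (Psi \<xi>)"
  shows "wall_f n b N i (Psi \<xi>) = Some Z"
proof -
  define js where "js = remaining Minus (wall_signs n b N i Z)"
  define j where "j = last js"
  have js: "js \<noteq> []" and Y: "Psi \<xi> = remove_block i j Z" using e by (auto simp: wall_e_def js_def j_def Let_def split: if_splits)
  have "j \<in> set js" using js by (simp add: j_def)
  then have "(Minus, j) \<in> set (wall_signs n b N i Z)" using set_remaining unfolding js_def by metis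
  then have j: "1 \<le> j" and rm: "removable n b N i j Z" using wall_signs_set column_signs_Minus by metis+
  have yw: "young_wall n b N Z" using Z by (simp add: proper_wall_def)
  define L where "L = top_layer (Z j)"
  define S where "S = {c. (L, c) \<in> Z j}"
  note form = young_column[OF yw j, folded L_def, folded S_def]
  have iS: "i \<in> S" using rm by (simp add: removable_def S_def L_def)
  have Yj: "Psi \<xi> j = stack n b L S - {(L, i)}" unfolding Y remove_block_def L_def[symmetric] using form(2) by simp
  have "ground n b N j \<noteq> {}" using j by (simp add: ground_def)
  then have "Psi \<xi> j \<noteq> {}" using ground_subset[OF v j] by blast
  then have slot: "slot_layer n (Psi \<xi> j) = L" using slot_after_removal[OF form(1) iS] unfolding Yj by blast
  have "insert (L, i) (Psi \<xi> j) = Z j" using rm unfolding Y remove_block_def L_def removable_def by auto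
  then have add: "add_block n i j (Psi \<xi>) = Z" unfolding add_block_def slot unfolding Y remove_block_def by simp
  have "(L, i) \<notin> Psi \<xi> j" unfolding Yj by simp
  then have "admissible n b N i j (Psi \<xi>)" unfolding admissible_def add slot using Z by simp
  then obtain y where y: "active j" "vec_f n i (\<xi> j) = Some y" "nice (\<xi>(j := y))" using admissible_iff[OF v(1) i j] by blast
  have Z': "Z = Psi (\<xi>(j := y))" using add_block_f(1)[OF v(1) y(1,2) i] add by simp
  show ?thesis using wall_f_wall_e[OF valid_f[OF v(1) j y(2) i] y(3) i, of "Psi \<xi>"] e Z' by simp
qed

lemma predecessor_f:
  assumes v: "valid \<xi>" "nice \<xi>" and i: "1 \<le> i" "i \<le> n" and Z: "proper_wall n b N Z" and f: "wall_f n b N i Z = Some (Psi \<xi>)"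
  shows "wall_e n b N i (Psi \<xi>) = Some Z"
proof -
  define js where "js = remaining Plus (wall_signs n b N i Z)"
  define j where "j = hd js"
  have js: "js \<noteq> []" and Y: "Psi \<xi> = add_block n i j Z" using f by (auto simp: wall_f_def js_def j_def Let_def split: if_splits)
  have "j \<in> set js" using js by (simp add: j_def)
  then have "(Plus, j) \<in> set (wall_signs n b N i Z)" using set_remaining unfolding js_def by metis
  then have j: "1 \<le> j" and ad: "admissible n b N i j Z" using wall_signs_set column_signs_Plus by metis+
  have yw: "young_wall n b N Z" using Z by (simp add: proper_wall_def)
  define L where "L = slot_layer n (Z j)"
  note form = young_column(3,4)[OF yw j]
  have Yj: "Psi \<xi> j = insert (L, i) (Z j)" unfolding Y add_block_def L_def by simp
  have "top_layer (Z j) \<le> L" by (simp add: L_def slot_layer_def)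
  moreover have "top_layer (insert (L, i) (Z j)) = max L (top_layer (Z j))" using form by (simp add: top_layer_def)
  ultimately have top: "top_layer (Psi \<xi> j) = L" unfolding Yj by simp
  have "(L, i) \<notin> Z j" using ad by (simp add: admissible_def L_def)
  then have "Psi \<xi> j - {(L, i)} = Z j" unfolding Yj by simp
  then have rem: "remove_block i j (Psi \<xi>) = Z" unfolding remove_block_def top unfolding Y add_block_def by simp
  have "removable n b N i j (Psi \<xi>)" unfolding removable_def rem top using Z Yj by simp
  then obtain y where y: "active j" "vec_e n i (\<xi> j) = Some y" "N < j \<Longrightarrow> Zero \<le> y" "nice (\<xi>(j := y))"
    using removable_iff[OF v(1) i j] by blast
  have Z': "Z = Psi (\<xi>(j := y))" using remove_block_e[OF v(1) y(1,2) i y(3)] rem by simp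
  show ?thesis using wall_e_wall_f[OF valid_e[OF v(1) j y(2) i y(3)] y(4) i, of "Psi \<xi>"] f Z' by simp
qed

lemma arrow_tab:
  assumes "(Y, Z) \<in> wall_arrow n b N \<union> (wall_arrow n b N)\<inverse>" "tab n cs b T" "Y = Psi (xi T)"
  shows "\<exists>T'. tab n cs b T' \<and> Z = Psi (xi T')"
proof -
  note v = valid_xi[OF assms(2)] nice_xi[OF assms(2)]
  have pZ: "proper_wall n b N Z" using assms(1) by (auto simp: wall_arrow_def reduced_wall_def)
  have "\<exists>i. 1 \<le> i \<and> i \<le> n \<and> (wall_e n b N i (Psi (xi T)) = Some Z \<or> wall_f n b N i (Psi (xi T)) = Some Z)"
    using assms(1) predecessor_e[OF v _ _ pZ] predecessor_f[OF v _ _ pZ]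
    unfolding wall_arrow_def assms(3) by (auto; metis)
  then obtain i where i: "1 \<le> i" "i \<le> n" "wall_e n b N i (Psi (xi T)) = Some Z \<or> wall_f n b N i (Psi (xi T)) = Some Z"
    by blast
  from i(3) show ?thesis
  proof
    assume "wall_e n b N i (Psi (xi T)) = Some Z"
    then show ?thesis by (cases rule: wall_e_cases[OF assms(2) i(1,2)]) auto
  next
    assume "wall_f n b N i (Psi (xi T)) = Some Z"
    then show ?thesis by (cases rule: wall_f_cases[OF assms(2) i(1,2)]) auto
  qed
qed

lemma reading_eqD: "tab n cs b T \<Longrightarrow> tab n cs b T' \<Longrightarrow> reading b T = reading b T' \<Longrightarrow> T = T'"
  using unreading_reading by metis

text \<open>The walls of all tableaux are reached from the highest weight wall by following the
  \<open>e\<close>-steps of \<open>tab_induct\<close> backwards; \<open>reduced_xi\<close> makes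
  each of them an arrow.\<close>

lemma walls_eq:
  assumes "sorted cs"
  shows "walls n cs b = (\<lambda>T. Psi (xi T)) ` {T. tab n cs b T}"
proof (intro set_eqI iffI)
  fix Y assume "Y \<in> walls n cs b"
  then have "(Psi (xi (std_tab n cs b)), Y) \<in> (wall_arrow n b N \<union> (wall_arrow n b N)\<inverse>)\<^sup>*"
    by (simp add: walls_def highest_weight_wall_eq[OF assms])
  then have "\<exists>T. tab n cs b T \<and> Y = Psi (xi T)"
  proof (induction rule: rtrancl_induct)
    case base
    show ?case using tab_std[OF assms cs] by blast
  next
    case (step Y Z)
    then show ?case using arrow_tab by metis
  qed
  then show "Y \<in> (\<lambda>T. Psi (xi T)) ` {T. tab n cs b T}" by blast
next
  fix Y assume "Y \<in> (\<lambda>T. Psi (xi T)) ` {T. tab n cs b T}"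
  then obtain T where T: "tab n cs b T" and Y: "Y = Psi (xi T)" by blast
  have n1: "1 \<le> n" using n3 by simp
  have "Psi (xi T) \<in> walls n cs b" using n1 T
  proof (induction rule: tab_induct)
    case std
    show ?case by (simp add: walls_def highest_weight_wall_eq[OF assms])
  next
    case (step T T' i p z)
    obtain T'' where T'': "tab n cs b T''" "word_e n i (reading b T) = Some (reading b T'')"
      "wall_e n b N i (Psi (xi T)) = Some (Psi (xi T''))"
      using wall_e_xi[OF step.hyps(1,3,4,5)] by blast
    have "word_e n i (reading b T) = Some (reading b T')"
      using step.hyps(5,6,7) by (simp add: word_e_def)
    then have "T'' = T'" using reading_eqD[OF T''(1) step.hyps(2)] T''(2) by simp
    then have "(Psi (xi T), Psi (xi T')) \<in> wall_arrow n b N"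
      using T''(3) reduced_xi[OF step.hyps(1)] reduced_xi[OF step.hyps(2)] step.hyps(3,4) unfolding wall_arrow_def by auto
    then show ?case using step.IH unfolding walls_def by (auto elim: rtrancl_into_rtrancl)
  qed
  then show "Y \<in> walls n cs b" by (simp add: Y)
qed

end

theorem theorem3p10:
  fixes n :: nat and lam :: "nat \<Rightarrow> rat"
  assumes "n \<ge> 3" and "dominant_integral n lam"
  shows "crystal_iso n (wall_crystal n lam) (tableau_crystal n lam) (tableau_of_wall n lam)"
proof -
  obtain cs b where d: "decomposition n lam = (cs, b)" by fastforce
  have "decomposes n lam (fst (decomposition n lam)) (snd (decomposition n lam))"
    unfolding decomposition_def by (rule theI'[OF decomposition_ex1]) (use assms in auto)
  then have dec: "sorted cs" "set cs \<subseteq> {1..n}" unfolding d by (simp_all add: decomposes_def)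
  interpret wall_data n cs b by unfold_locales (use assms(1) dec(2) in auto)
  define \<Phi> where "\<Phi> = (\<lambda>T. Psi (xi T))"
  define \<psi> where "\<psi> = tableau_of_wall n lam"
  define W where "W = wall_crystal n lam"
  define B where "B = tableau_crystal n lam"
  have W: "elems W = \<Phi> ` {T. tab n cs b T}" "weight W = wall_weight n b N" "op_e W = wall_e n b N" "op_f W = wall_f n b N"
    "eps W = (\<lambda>i Y. length (remaining Minus (wall_signs n b N i Y)))"
    "phi W = (\<lambda>i Y. length (remaining Plus (wall_signs n b N i Y)))"
    by (simp_all add: W_def wall_crystal_def d walls_eq[OF dec(1)] \<Phi>_def Let_def)
  have B: "elems B = {T. tab n cs b T}" "weight B = (\<lambda>T. coroot_value n (\<lambda>m. \<Sum>x\<leftarrow>reading b T. factor_weight x m))"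
    "op_e B = (\<lambda>i T. map_option (unreading n cs b) (word_e n i (reading b T)))"
    "op_f B = (\<lambda>i T. map_option (unreading n cs b) (word_f n i (reading b T)))"
    "eps B = (\<lambda>i T. length (remaining Minus (word_signs n i (reading b T))))"
    "phi B = (\<lambda>i T. length (remaining Plus (word_signs n i (reading b T))))"
    using tableaux_iff_tab[OF dec] by (auto simp: B_def tableau_crystal_def d)
  have \<psi>: "\<psi> (\<Phi> T) = T" if "tab n cs b T" for T
    using wall_tableau[OF that] unfolding \<psi>_def tableau_of_wall_def d \<Phi>_def by simp
  have e: "op_e W i (\<Phi> T) = None \<and> op_e B i T = None \<or>
      (\<exists>T'. tab n cs b T' \<and> op_e W i (\<Phi> T) = Some (\<Phi> T') \<and> op_e B i T = Some T')"
    if T: "tab n cs b T" and i: "i \<in> {1..n}" for i T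
  proof -
    have "1 \<le> i" "i \<le> n" using i by auto
    from T this show ?thesis
      by (cases rule: wall_e_cases) (auto simp: W B \<Phi>_def unreading_reading)
  qed
  have f: "op_f W i (\<Phi> T) = None \<and> op_f B i T = None \<or>
      (\<exists>T'. tab n cs b T' \<and> op_f W i (\<Phi> T) = Some (\<Phi> T') \<and> op_f B i T = Some T')"
    if T: "tab n cs b T" and i: "i \<in> {1..n}" for i T
  proof -
    have "1 \<le> i" "i \<le> n" using i by auto
    from T this show ?thesis
      by (cases rule: wall_f_cases) (auto simp: W B \<Phi>_def unreading_reading)
  qed
  have "crystal_iso n W B \<psi>"
    unfolding crystal_iso_def
  proof (intro conjI ballI)
    show "closed_under_ops n W" "closed_under_ops n B"
      unfolding closed_under_ops_def W(1) B(1) using e f by (fastforce)+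
    show "bij_betw \<psi> (elems W) (elems B)"
      by (rule bij_betw_byWitness[where f' = \<Phi>]) (auto simp: W(1) B(1) \<psi>)
    fix Y i assume "Y \<in> elems W" and i: "i \<in> {1..n}"
    then obtain T where T: "tab n cs b T" and Y: "Y = \<Phi> T" by (auto simp: W(1))
    have i': "1 \<le> i" "i \<le> n" using i by auto
    show "op_e B i (\<psi> Y) = map_option \<psi> (op_e W i Y)" using e[OF T i] \<psi> T Y by auto
    show "op_f B i (\<psi> Y) = map_option \<psi> (op_f W i Y)" using f[OF T i] \<psi> T Y by auto
    show "weight B (\<psi> Y) i = weight W Y i"
      using wall_weight_xi[OF T i'] \<psi>[OF T] by (simp add: W B Y \<Phi>_def)
    show "eps B i (\<psi> Y) = eps W i Y" "phi B i (\<psi> Y) = phi W i Y"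
      using length_remaining_xi[OF T i'] \<psi>[OF T] by (simp_all add: W B Y \<Phi>_def)
  qed
  then show ?thesis by (simp add: W_def B_def \<psi>_def)
qed

end
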